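(* Fix $T>0$ and a small $\tau>0$ (with $\tau<T$), and let $\mu_*$, $\varrho_t$, $s_t$, $\widehat\varrho_t$ be as in the context. Assume: (1) The data distribution (a probability measure on $\mathbb R^d$) $\mu_*$ is positive and compactly supported on a compact set $K_*\subset\mathbb R^d$; put $D:=1+\max_{x\in K_*}\|x\|_\infty$. (2) ($L^2$ score error) There exists a small $\delta>0$ such that $$\int_0^{T-\tau}\mathbb E_{x\sim\varrho_t}\big[\|\nabla\log\varrho_t(x)-s_t(x)\|_2^2\big]\,dt\le\delta^2 .$$ (3) For every $0\le t\le T-\tau$ the score estimate $s_t=(s_t^{(1)},\dots,s_t^{(d)})$ is $C^2$ in $x$, and there is a function $L_t>0$ of $t$ such that $$\max_{1\le j\le d}|s_t^{(j)}(0)|\le L_t,\qquad \sup_{x\in\mathbb R^d}\max_{1\le|\alpha|\le2}\max_{1\le j\le d}|\partial_x^\alpha s_t^{(j)}(x)|\le L_t ;$$ put $\mathcal L:=\int_0^{T-\tau}L_t\,dt$. Then there is a universal constant $C_u>0$ (independent of the dimension $d$ and of all other parameters) such that $$\mathrm{TV}(\varrho_{T-\tau},\widehat\varrho_{T-\tau})\le C_u\, d^{3/4}\,T^{1/4}\,\big(\mathcal L+T\,\tau^{-2}D^3\big)^{1/2}\,\delta^{1/2}+\mathrm{TV}(\varrho_0,\widehat\varrho_0).$$ If the initialization is taken to be the standard normal distribution, $\widehat\varrho_0=\mathcal N(0,\mathbb I_d)$, then $\mathrm{TV}(\varrho_0,\widehat\varrho_0)\le C_u e^{-T}\sqrt d\,D$,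 which is exponentially small in $T$.
   Context: Convention: for densities $f,g$ on $\mathbb R^d$, $\mathrm{TV}(f,g)=\int_{\mathbb R^d}|f(x)-g(x)|\,dx$ (no factor $1/2$). $C_u$ denotes a universal constant that may differ from one occurrence to the next. Forward process: $X_0\sim\mu_*$ and $q_t$ ($t>0$) is the density of $\lambda_tX_0+\sigma_tW$, where $W\sim\mathcal N(0,\mathbb I_d)$ is independent of $X_0$, $\lambda_t=e^{-t}$, $\sigma_t=\sqrt{1-e^{-2t}}$ (the law at time $t$ of the Ornstein–Uhlenbeck process $dX_t=-X_tdt+\sqrt2\,dB_t$). It satisfies $\partial_tq_t=\nabla\cdot((x+\nabla\log q_t)q_t)$. The measure $\mu_*$ need not have a density. Reverse process: $\varrho_t:=q_{T-t}$, so that $\partial_t\varrho_t=-\nabla\cdot(V_t\varrho_t)$ with $V_t(x)=x+\nabla\log\varrho_t(x)$. Approximate reverse process: $s_t:\mathbb R^d\to\mathbb R^d$, $0\le t\le T-\tau$, is a given (learned) estimate of the score $\nabla\log\varrho_t=\nabla\log q_{T-t}$. $\widehat\varrho_t$ is the density of the solution $\widehat Y_t$ of the probability flow ODE $\partial_t\widehat Y_t=\widehat Y_t+s_t(\widehat Y_t)$ with random initial condition $\widehat Y_0\sim\widehat\varrho_0$, where $\widehat\varrho_0$ is a given probability density; equivalently $\partial_t\widehat\varrho_t=-\nabla\cdot(\widehat V_t\widehat\varrho_t)$ with $\widehat V_t(x)=x+s_t(x)$. Multi-indices: $\alpha=(\alpha_1,\dots,\alpha_d)$, $|\alpha|=\sum_i\alpha_i$,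 $\partial_x^\alpha=\partial_{x_1}^{\alpha_1}\cdots\partial_{x_d}^{\alpha_d}$; $\|x\|_\infty=\max_i|x_i|$. *)

theory Defs
  imports "HOL-Probability.Probability"
begin

text \<open>
  The constant of the theorem must not depend on the dimension, so the dimension has to be an
  ordinary natural number. A vector of \<open>\<real>\<^sup>d\<close> is therefore a function \<open>nat \<Rightarrow> real\<close> with coordinates
  \<open>x 0, \<dots>, x (d - 1)\<close> that is \<open>undefined\<close> outside \<open>{..<d}\<close>. On \<open>Rd d\<close> the product topology of
  \<open>nat \<Rightarrow> real\<close> is the usual topology of \<open>\<real>\<^sup>d\<close>.
\<close>

abbreviation Rd :: "nat \<Rightarrow> (nat \<Rightarrow> real) set" where
  "Rd d \<equiv> PiE {..<d} (\<lambda>_. UNIV)"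

abbreviation leb :: "nat \<Rightarrow> (nat \<Rightarrow> real) measure" where
  "leb d \<equiv> PiM {..<d} (\<lambda>_. lborel)"

definition std_gaussian :: "nat \<Rightarrow> (nat \<Rightarrow> real) measure" where
  "std_gaussian d = PiM {..<d} (\<lambda>_. density lborel (\<lambda>u. ennreal (std_normal_density u)))"

definition sup_norm :: "nat \<Rightarrow> (nat \<Rightarrow> real) \<Rightarrow> real" where
  "sup_norm d x = Max ((\<lambda>i. \<bar>x i\<bar>) ` {..<d})"

text \<open>No factor \<open>1/2\<close>.\<close>

definition TV :: "nat \<Rightarrow> ((nat \<Rightarrow> real) \<Rightarrow> real) \<Rightarrow> ((nat \<Rightarrow> real) \<Rightarrow> real) \<Rightarrow> real" where
  "TV d f g = (\<integral>x. \<bar>f x - g x\<bar> \<partial>leb d)"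

definition partial_deriv :: "nat \<Rightarrow> ((nat \<Rightarrow> real) \<Rightarrow> real) \<Rightarrow> (nat \<Rightarrow> real) \<Rightarrow> real" where
  "partial_deriv i f x = deriv (\<lambda>h. f (x(i := h))) (x i)"

text \<open>
  \<open>multi_deriv \<alpha> d\<close> is the derivative of multi-index \<open>(\<alpha> 0, \<dots>, \<alpha> (d - 1))\<close>; the other values of
  \<open>\<alpha>\<close> play no role.
\<close>

primrec multi_deriv ::
    "(nat \<Rightarrow> nat) \<Rightarrow> nat \<Rightarrow> ((nat \<Rightarrow> real) \<Rightarrow> real) \<Rightarrow> (nat \<Rightarrow> real) \<Rightarrow> real" where
  "multi_deriv \<alpha> 0 f = f"
| "multi_deriv \<alpha> (Suc n) f = multi_deriv \<alpha> n ((partial_deriv n ^^ \<alpha> n) f)"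

primrec C_k :: "nat \<Rightarrow> nat \<Rightarrow> ((nat \<Rightarrow> real) \<Rightarrow> real) \<Rightarrow> bool" where
  "C_k d 0 f \<longleftrightarrow> continuous_on (Rd d) f"
| "C_k d (Suc k) f \<longleftrightarrow> continuous_on (Rd d) f \<and>
     (\<forall>i<d. (\<forall>x\<in>Rd d. (\<lambda>h. f (x(i := h))) differentiable (at (x i))) \<and> C_k d k (partial_deriv i f))"

text \<open>
  \<open>q t\<close> is the density of \<open>exp (-t) X\<^sub>0 + sqrt (1 - exp (-2t)) W\<close> with \<open>X\<^sub>0 \<sim> \<mu>\<close> and an independent
  standard normal \<open>W\<close>. A density is determined only almost everywhere; continuity selects the
  version whose logarithm is differentiated in the score.
\<close>

definition forward_density ::
    "nat \<Rightarrow> (nat \<Rightarrow> real) measure \<Rightarrow> (real \<Rightarrow> (nat \<Rightarrow> real) \<Rightarrow> real) \<Rightarrow> bool" where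
  "forward_density d \<mu> q \<longleftrightarrow> (\<forall>t>0.
     continuous_on (Rd d) (q t) \<and> (\<forall>x\<in>Rd d. 0 \<le> q t x) \<and>
     distributed (\<mu> \<Otimes>\<^sub>M std_gaussian d) (leb d)
       (\<lambda>(x, w). \<lambda>i\<in>{..<d}. exp (- t) * x i + sqrt (1 - exp (- 2 * t)) * w i)
       (\<lambda>x. ennreal (q t x)))"

definition score :: "((nat \<Rightarrow> real) \<Rightarrow> real) \<Rightarrow> (nat \<Rightarrow> real) \<Rightarrow> nat \<Rightarrow> real" where
  "score f x j = partial_deriv j (\<lambda>y. ln (f y)) x"

text \<open>
  Extended nonnegative integrals: the error is infinite, and not \<open>0\<close>, if the score error is not
  square integrable.
\<close>

definition score_error ::
    "nat \<Rightarrow> real \<Rightarrow> (real \<Rightarrow> (nat \<Rightarrow> real) \<Rightarrow> real) \<Rightarrow> (real \<Rightarrow> (nat \<Rightarrow> real) \<Rightarrow> nat \<Rightarrow> real) \<Rightarrow> ennreal" where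
  "score_error d S \<rho> s =
     (\<integral>\<^sup>+t\<in>{0..S}. (\<integral>\<^sup>+x. ennreal (\<Sum>j<d. (score (\<rho> t) x j - s t x j)\<^sup>2)
        \<partial>density (leb d) (\<lambda>x. ennreal (\<rho> t x))) \<partial>lborel)"

text \<open>
  \<open>Y t x\<close> is the value at time \<open>t\<close> of the solution of \<open>y' = y + s t y\<close> started at \<open>x\<close>. As \<open>s\<close> need
  only be measurable in time, the equation is imposed in integrated form (Caratheodory); under
  the growth bound on \<open>s\<close> in the theorem, a classical solution satisfies it.
\<close>

definition ode_flow ::
    "nat \<Rightarrow> real \<Rightarrow> (real \<Rightarrow> (nat \<Rightarrow> real) \<Rightarrow> nat \<Rightarrow> real) \<Rightarrow> (real \<Rightarrow> (nat \<Rightarrow> real) \<Rightarrow> nat \<Rightarrow> real) \<Rightarrow> bool" where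
  "ode_flow d S s Y \<longleftrightarrow> (\<forall>x\<in>Rd d. Y 0 x = x \<and> (\<forall>t\<in>{0..S}. Y t x \<in> Rd d) \<and>
     (\<forall>i<d. set_integrable lborel {0..S} (\<lambda>r. Y r x i + s r (Y r x) i) \<and>
       (\<forall>t\<in>{0..S}. Y t x i = x i + (LINT r:{0..t}|lborel. Y r x i + s r (Y r x) i))))"

text \<open>
  \<open>\<rho>' t\<close> is a density of the solution at time \<open>t\<close> with random initial value of density \<open>\<rho>' 0\<close>. Since
  the solution is a function of its initial value, \<open>\<real>\<^sup>d\<close> with the initial law is used as the
  underlying probability space.
\<close>

definition approx_reverse_density ::
    "nat \<Rightarrow> real \<Rightarrow> (real \<Rightarrow> (nat \<Rightarrow> real) \<Rightarrow> nat \<Rightarrow> real) \<Rightarrow> (real \<Rightarrow> (nat \<Rightarrow> real) \<Rightarrow> real) \<Rightarrow> bool" where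
  "approx_reverse_density d S s \<rho>' \<longleftrightarrow>
     prob_space (density (leb d) (\<lambda>x. ennreal (\<rho>' 0 x))) \<and>
     (\<exists>Y. ode_flow d S s Y \<and>
       (\<forall>t\<in>{0..S}. (\<forall>x\<in>Rd d. 0 \<le> \<rho>' t x) \<and>
          distributed (density (leb d) (\<lambda>x. ennreal (\<rho>' 0 x))) (leb d) (Y t) (\<lambda>x. ennreal (\<rho>' t x))))"

text \<open>
  The support of \<open>\<mu>\<close> may be smaller than \<open>K\<close>. Positivity of \<open>\<mu>\<close> is built into the type of measures;
  reading it as full support on \<open>K\<close> gives an equivalent theorem, since shrinking \<open>K\<close> to the support
  only decreases \<open>radius d K\<close>.
\<close>

definition data_distribution :: "nat \<Rightarrow> (nat \<Rightarrow> real) set \<Rightarrow> (nat \<Rightarrow> real) measure \<Rightarrow> bool" where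
  "data_distribution d K \<mu> \<longleftrightarrow> prob_space \<mu> \<and> sets \<mu> = sets (leb d) \<and>
     K \<subseteq> Rd d \<and> compact K \<and> (AE x in \<mu>. x \<in> K)"

definition radius :: "nat \<Rightarrow> (nat \<Rightarrow> real) set \<Rightarrow> real" where
  "radius d K = 1 + (SUP x\<in>K. sup_norm d x)"

text \<open>
  Measurability in time and integrability of \<open>L\<close> give a meaning to the time integrals of the
  theorem; for a non-integrable \<open>L\<close> the asserted bound would be infinite.
\<close>

definition regular_score ::
    "nat \<Rightarrow> real \<Rightarrow> (real \<Rightarrow> (nat \<Rightarrow> real) \<Rightarrow> nat \<Rightarrow> real) \<Rightarrow> (real \<Rightarrow> real) \<Rightarrow> bool" where
  "regular_score d S s L \<longleftrightarrow>
     (\<forall>x\<in>Rd d. \<forall>j<d. set_borel_measurable lborel {0..S} (\<lambda>t. s t x j)) \<and>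
     set_integrable lborel {0..S} L \<and>
     (\<forall>t\<in>{0..S}. 0 < L t \<and>
        (\<forall>j<d. C_k d 2 (\<lambda>x. s t x j) \<and> \<bar>s t (\<lambda>i\<in>{..<d}. 0) j\<bar> \<le> L t \<and>
           (\<forall>\<alpha>. (\<Sum>i<d. \<alpha> i) \<in> {1..2} \<longrightarrow>
              (\<forall>x\<in>Rd d. \<bar>multi_deriv \<alpha> d (\<lambda>x. s t x j) x\<bar> \<le> L t))))"

text \<open>
  In the theorem, ``small \<open>\<tau>\<close>'' is the condition \<open>\<tau> \<le> 1\<close>. A bound on \<open>\<tau>\<close> cannot be omitted: for
  \<open>d = 1\<close>, \<open>\<mu>\<close> the Dirac measure at \<open>0\<close>, \<open>K = {0}\<close>, \<open>s = 0\<close>, \<open>\<rho>' 0 = \<rho> 0\<close>, \<open>T = \<tau> + 1\<close>, \<open>\<delta> = 2\<close> and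
  \<open>L = 1 / \<tau>\<close>, the right-hand side tends to \<open>0\<close> as \<open>\<tau>\<close> grows and the left-hand side does not.
  No smallness of \<open>\<delta>\<close> is required.
\<close>

end

theory Submission imports Defs begin

text \<open>
  The exact reverse process has the same marginal laws as the random path
  \<open>X\<^sub>r = e\<^sup>-\<^sup>(\<^sup>T\<^sup>-\<^sup>r\<^sup>) y + \<sigma> w\<close> with data point \<open>y\<close> and noise \<open>w\<close> fixed in time, whose velocity is \<open>X\<^sub>r - w / \<sigma>\<close>; given
  \<open>X\<^sub>r\<close>, the mean of \<open>- w / \<sigma>\<close> is the score. A test function transported backwards along the
  approximate flow therefore changes in expectation at the rate \<open>E (\<nabla>u \<bullet> (score - s)) (X\<^sub>r)\<close>. Its gradient
  is not controlled, so one integrates by parts, coordinate by coordinate, and needs the derivative of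
  the score error in \<open>L\<^sup>1\<close>. That derivative is interpolated: a difference quotient of step \<open>h\<close> is bounded by
  the \<open>L\<^sup>2\<close> score error, and the variation of the derivative over a distance \<open>h\<close> by the second
  derivatives of \<open>s\<close> and of the score, where the latter is at most \<open>O(D / \<sigma>\<^sup>4)\<close> in mean because the data
  are bounded. Optimising \<open>h\<close> gives the exponent \<open>1/2\<close> of \<open>\<delta>\<close>.

  Since \<open>s\<close> is only measurable in time, the approximate flow is replaced by its Euler scheme, for which
  no smoothness of the flow map is required; the error of the scheme vanishes in the limit. Test
  functions with quadratic Taylor remainder are stable under the Euler maps and determine the total
  variation. Closeness of \<open>q\<^sub>T\<close> to the Gaussian follows from the relative entropy of each mixture component.
\<close>

section \<open>One-dimensional Gaussian mixtures\<close>

text \<open>The bounds \<Lambda> and H of a transported test function can grow exponentially along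
  the flow, so they must not reach the result. They occur only in the local errors of the Euler
  steps: n steps of size 1/n leave an error C/n, and what survives depends on the test function only
  through its sup norm. The class of test functions can therefore be chosen for convenience, with
  constants that merely have to be finite.

  The derivative of the score error is treated in L^1 because the second derivatives of the score
  are controlled only in mean against the density. Comparing the derivative at z with its values
  nearby must then move the density weight as well. A normal density permits this, up to a factor 2,
  towards its centre and within distance \<sigma>; hence the constraint h \<le> \<sigma>. For
  \<delta> above 2/3 the chosen h may violate it, but then the asserted bound exceeds 2, the largest
  possible distance.

  For smaller \<delta> the accumulated bound consists of d S \<alpha> / h, d h (\<L> + S D /
  \<tau>^2) and \<delta>^2 / (h \<alpha>), up to constants. Two parameters, the window h and the
  AM-GM weight \<alpha>, balance the three terms.\<close>

lemma has_derivative_of_quadratic_error: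
  fixes f :: "real \<Rightarrow> real"
  assumes "\<And>t. \<bar>f (z + t) - f z - t * c\<bar> \<le> B * t\<^sup>2"
  shows "(f has_real_derivative c) (at z)"
  unfolding DERIV_def
proof (rule LIM_zero_cancel, rule Lim_null_comparison)
  have "\<bar>(f (z + t) - f z) / t - c\<bar> \<le> B * \<bar>t\<bar>" if "t \<noteq> 0" for t
  proof -
    have "\<bar>(f (z + t) - f z) / t - c\<bar> = \<bar>f (z + t) - f z - t * c\<bar> / \<bar>t\<bar>"
      using that by (simp add: field_simps flip: abs_divide)
    also have "\<dots> \<le> B * t\<^sup>2 / \<bar>t\<bar>"
      using assms[of t] by (intro divide_right_mono) auto
    also have "\<dots> = B * \<bar>t\<bar>"
      using that by (simp add: power2_eq_square abs_if field_simps)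
    finally show ?thesis .
  qed
  then show "\<forall>\<^sub>F t in at 0. norm ((f (z + t) - f z) / t - c) \<le> B * \<bar>t\<bar>"
    by (auto simp: eventually_at_filter)
  show "((\<lambda>t. B * \<bar>t\<bar>) \<longlongrightarrow> 0) (at 0)"
    by (auto intro!: tendsto_eq_intros)
qed

lemma quadratic_error_of_Lipschitz_derivative:
  fixes f :: "real \<Rightarrow> real"
  assumes D: "\<And>x. (f has_real_derivative f' x) (at x)"
    and L: "\<And>x y. \<bar>f' x - f' y\<bar> \<le> B * \<bar>x - y\<bar>"
  shows "\<bar>f (z + t) - f z - t * f' z\<bar> \<le> B * t\<^sup>2"
proof -
  have "\<exists>\<xi>. \<bar>\<xi> - z\<bar> \<le> \<bar>t\<bar> \<and> f (z + t) - f z = t * f' \<xi>"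
  proof (cases t "0::real" rule: linorder_cases)
    case less
    then obtain \<xi> where "z + t < \<xi>" "\<xi> < z" "f z - f (z + t) = (z - (z + t)) * f' \<xi>"
      using MVT2[of "z + t" z f f'] D by auto
    then show ?thesis by (intro exI[of _ \<xi>]) (auto simp: algebra_simps)
  next
    case greater
    then obtain \<xi> where "z < \<xi>" "\<xi> < z + t" "f (z + t) - f z = (z + t - z) * f' \<xi>"
      using MVT2[of z "z + t" f f'] D by auto
    then show ?thesis by (intro exI[of _ \<xi>]) auto
  qed (auto intro!: exI[of _ z])
  then obtain \<xi> where xi: "\<bar>\<xi> - z\<bar> \<le> \<bar>t\<bar>" "f (z + t) - f z = t * f' \<xi>" by auto
  have B: "0 \<le> B" using L[of 1 0] by (simp add: order_trans[OF abs_ge_zero])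
  have "\<bar>f (z + t) - f z - t * f' z\<bar> = \<bar>t\<bar> * \<bar>f' \<xi> - f' z\<bar>"
    unfolding xi(2) by (simp add: right_diff_distrib[symmetric] abs_mult)
  also have "\<dots> \<le> \<bar>t\<bar> * (B * \<bar>t\<bar>)"
    using L[of \<xi> z] xi(1) B by (intro mult_left_mono) (auto intro: order_trans mult_left_mono)
  finally show ?thesis by (simp add: power2_eq_square mult_ac)
qed

lemma Lipschitz_of_bounded_derivative:
  fixes f :: "real \<Rightarrow> real"
  assumes D: "\<And>x. (f has_real_derivative f' x) (at x)" and B: "\<And>x. \<bar>f' x\<bar> \<le> B"
  shows "\<bar>f x - f y\<bar> \<le> B * \<bar>x - y\<bar>"
  using field_differentiable_bound[of UNIV f f' B x y] D B
  by (auto simp: has_field_derivative_at_within)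

text \<open>No limits at infinity are taken: F' averaged over a unit interval is F (x + 1) - F x,
  and Lebesgue measure is translation invariant. Integration over x therefore gives the integral of
  F' on one side and 0 on the other.\<close>

lemma lborel_integral_deriv_eq_0:
  fixes F F' :: "real \<Rightarrow> real"
  assumes D: "\<And>x. (F has_real_derivative F' x) (at x)"
    and cont: "continuous_on UNIV F'"
    and F: "integrable lborel F" and F': "integrable lborel F'"
  shows "(\<integral>x. F' x \<partial>lborel) = 0"
proof -
  have [measurable]: "F' \<in> borel_measurable borel"
    using cont by (rule borel_measurable_continuous_onI)
  have tr: "(\<integral>x. F' (x + r) \<partial>lborel) = (\<integral>x. F' x \<partial>lborel)" "integrable lborel (\<lambda>x. F' (x + r))" for r
    using lborel_integral_real_affine[of 1 F' r] lborel_integrable_real_affine[OF F', of 1 r]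
    by (auto simp: add.commute)
  have tra: "(\<integral>x. \<bar>F' (x + r)\<bar> \<partial>lborel) = (\<integral>x. \<bar>F' x\<bar> \<partial>lborel)" for r
    using lborel_integral_real_affine[of 1 "\<lambda>x. \<bar>F' x\<bar>" r] by (auto simp: add.commute)
  have tF: "(\<integral>x. F (x + 1) \<partial>lborel) = (\<integral>x. F x \<partial>lborel)" "integrable lborel (\<lambda>x. F (x + 1))"
    using lborel_integral_real_affine[of 1 F 1] lborel_integrable_real_affine[OF F, of 1 1]
    by (auto simp: add.commute)
  have inner: "(\<integral>r. indicator {0..1} r * F' (x + r) \<partial>lborel) = F (x + 1) - F x" for x
  proof -
    have "((\<lambda>r. F (x + r)) has_real_derivative F' (x + r)) (at r)" for r
      using D[of "r + x"] DERIV_shift[of F "F' (x + r)" r x] by (simp only: add.commute)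
    moreover have "isCont (\<lambda>r. F' (x + r)) r" for r
      by (rule isCont_o2[where g = F'])
        (use cont in \<open>auto simp: continuous_on_eq_continuous_at intro: continuous_intros\<close>)
    ultimately have "has_bochner_integral lborel (\<lambda>r. F' (x + r) * indicator {0..1} r) (F (x + 1) - F (x + 0))"
      by (intro has_bochner_integral_FTC_Icc_real) auto
    then show ?thesis by (simp add: has_bochner_integral_iff mult.commute)
  qed
  have "integrable (lborel \<Otimes>\<^sub>M lborel) (\<lambda>(r, x). indicator {0..1} r * F' (x + r))"
  proof (rule lborel_pair.Fubini_integrable)
    show "integrable lborel (\<lambda>x. \<integral>y. norm (case (x, y) of (r, x) \<Rightarrow> indicator {0..1} r * F' (x + r)) \<partial>lborel)"
      by (simp add: abs_mult tra)
    show "AE x in lborel. integrable lborel (\<lambda>y. case (x, y) of (r, x) \<Rightarrow> indicator {0..1} r * F' (x + r))"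
      using tr by auto
  qed measurable
  from lborel_pair.Fubini_integral[OF this]
  have "(\<integral>x. \<integral>r. indicator {0..1} r * F' (x + r) \<partial>lborel \<partial>lborel)
      = (\<integral>r. \<integral>x. indicator {0..1} r * F' (x + r) \<partial>lborel \<partial>lborel)"
    by simp
  then show ?thesis
    using F tF by (simp add: inner tr)
qed

text \<open>The second hypothesis places x on the side of z that faces the centre m. The cross term
  in (x - m)^2 then has a favourable sign, even if x overshoots m, so the exponent loses at most
  1/2, and exp (1/2) \<le> 2.\<close>

lemma normal_density_le_twice:
  assumes "0 < \<sigma>" "m \<le> z \<and> x \<le> z \<or> z \<le> m \<and> z \<le> x" "\<bar>z - x\<bar> \<le> \<sigma>"
  shows "normal_density m \<sigma> z \<le> 2 * normal_density m \<sigma> x"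
proof -
  have "(x - m)\<^sup>2 \<le> (z - m)\<^sup>2 + (z - x)\<^sup>2"
  proof -
    have "(z - m) * (z - x) \<ge> 0"
      using assms(2) by (auto intro: mult_nonneg_nonneg mult_nonpos_nonpos)
    then show ?thesis by (simp add: power2_eq_square algebra_simps)
  qed
  moreover have "(z - x)\<^sup>2 \<le> \<sigma>\<^sup>2"
    using assms by (metis abs_le_square_iff abs_of_pos)
  ultimately have "(x - m)\<^sup>2 \<le> (z - m)\<^sup>2 + \<sigma>\<^sup>2" by linarith
  then have "- (z - m)\<^sup>2 / (2 * \<sigma>\<^sup>2) \<le> 1/2 + - (x - m)\<^sup>2 / (2 * \<sigma>\<^sup>2)"
    using assms(1) by (simp add: field_simps)
  then have "exp (- (z - m)\<^sup>2 / (2 * \<sigma>\<^sup>2)) \<le> exp (1/2) * exp (- (x - m)\<^sup>2 / (2 * \<sigma>\<^sup>2))"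
    by (simp flip: exp_add)
  also have "\<dots> \<le> 2 * exp (- (x - m)\<^sup>2 / (2 * \<sigma>\<^sup>2))"
    using exp_bound_half[of "1/2::real"] by (intro mult_right_mono) auto
  finally show ?thesis
    unfolding normal_density_def by (simp add: divide_right_mono field_simps)
qed

lemma has_real_derivative_normal_density:
  "0 < \<sigma> \<Longrightarrow> (normal_density m \<sigma> has_real_derivative (m - z) / \<sigma>\<^sup>2 * normal_density m \<sigma> z) (at z)"
  unfolding normal_density_def
  by (rule derivative_eq_intros refl | simp)+ (simp add: field_simps power2_eq_square power4_eq_xxxx)

lemma normal_density_le: "0 < \<sigma> \<Longrightarrow> normal_density m \<sigma> z \<le> 1 / sqrt (2 * pi * \<sigma>\<^sup>2)"
  unfolding normal_density_def by (simp add: divide_right_mono)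

lemma normal_density_square_le:
  assumes "0 < \<sigma>"
  shows "(m - z)\<^sup>2 * normal_density m \<sigma> z \<le> 2 * \<sigma>\<^sup>2 / sqrt (2 * pi * \<sigma>\<^sup>2)"
proof -
  define t where "t = (z - m)\<^sup>2 / (2 * \<sigma>\<^sup>2)"
  have "t \<le> exp t" using exp_ge_add_one_self[of t] by linarith
  then have "t * exp (- t) \<le> 1" by (simp add: exp_minus field_simps)
  moreover have "(m - z)\<^sup>2 * normal_density m \<sigma> z = 2 * \<sigma>\<^sup>2 / sqrt (2 * pi * \<sigma>\<^sup>2) * (t * exp (- t))"
    using assms by (simp add: normal_density_def t_def power2_commute[of m z])
  ultimately show ?thesis
    using assms by (metis mult.right_neutral mult_left_mono divide_nonneg_nonneg real_sqrt_ge_zero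
      mult_nonneg_nonneg pi_ge_zero zero_le_numeral zero_le_power2)
qed

text \<open>Uniformity in the centre m is the point: the remainder can be integrated over any finite
  mixing measure. The 3 is 2 + 1, for the two terms of the second derivative.\<close>

lemma normal_density_quadratic_error:
  assumes "0 < \<sigma>"
  shows "\<bar>normal_density m \<sigma> (z + t) - normal_density m \<sigma> z - t * ((m - z) / \<sigma>\<^sup>2 * normal_density m \<sigma> z)\<bar>
    \<le> 3 / (\<sigma>\<^sup>2 * sqrt (2 * pi * \<sigma>\<^sup>2)) * t\<^sup>2"
proof (rule quadratic_error_of_Lipschitz_derivative)
  fix x y
  show "\<bar>(m - x) / \<sigma>\<^sup>2 * normal_density m \<sigma> x - (m - y) / \<sigma>\<^sup>2 * normal_density m \<sigma> y\<bar>
      \<le> 3 / (\<sigma>\<^sup>2 * sqrt (2 * pi * \<sigma>\<^sup>2)) * \<bar>x - y\<bar>"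
  proof (rule Lipschitz_of_bounded_derivative)
    fix z
    show "((\<lambda>z. (m - z) / \<sigma>\<^sup>2 * normal_density m \<sigma> z) has_real_derivative
        ((m - z)\<^sup>2 * normal_density m \<sigma> z / \<sigma>\<^sup>2 - normal_density m \<sigma> z) / \<sigma>\<^sup>2) (at z)"
      using assms
      by (auto intro!: derivative_eq_intros has_real_derivative_normal_density simp: field_simps power2_eq_square)
    have "\<bar>(m - z)\<^sup>2 * normal_density m \<sigma> z / \<sigma>\<^sup>2 - normal_density m \<sigma> z\<bar> \<le>
        (m - z)\<^sup>2 * normal_density m \<sigma> z / \<sigma>\<^sup>2 + normal_density m \<sigma> z"
      using abs_triangle_ineq4 by (simp add: order_trans[OF abs_triangle_ineq4] abs_mult)
    also have "\<dots> \<le> 2 * \<sigma>\<^sup>2 / sqrt (2 * pi * \<sigma>\<^sup>2) / \<sigma>\<^sup>2 + 1 / sqrt (2 * pi * \<sigma>\<^sup>2)"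
      using assms by (intro add_mono divide_right_mono normal_density_square_le normal_density_le) auto
    also have "\<dots> = 3 / sqrt (2 * pi * \<sigma>\<^sup>2)"
      using assms by (simp add: field_simps)
    finally have "\<bar>(m - z)\<^sup>2 * normal_density m \<sigma> z / \<sigma>\<^sup>2 - normal_density m \<sigma> z\<bar> / \<sigma>\<^sup>2
        \<le> 3 / sqrt (2 * pi * \<sigma>\<^sup>2) / \<sigma>\<^sup>2"
      by (intro divide_right_mono) auto
    then show "\<bar>((m - z)\<^sup>2 * normal_density m \<sigma> z / \<sigma>\<^sup>2 - normal_density m \<sigma> z) / \<sigma>\<^sup>2\<bar>
        \<le> 3 / (\<sigma>\<^sup>2 * sqrt (2 * pi * \<sigma>\<^sup>2))"
      by (simp add: abs_divide mult.commute)
  qed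
qed (use assms has_real_derivative_normal_density in auto)

text \<open>The mass of \<open>M\<close> is left free because slices of a d-dimensional mixture are
  not normalised. Logarithmic derivatives do not see the mass.\<close>

locale gaussian_mixture = finite_measure M
  for M :: "'a measure" and m :: "'a \<Rightarrow> real" and D \<sigma> :: real +
  assumes m_measurable [measurable]: "m \<in> borel_measurable M"
    and m_bounded: "AE w in M. \<bar>m w\<bar> \<le> D"
    and \<sigma>_pos: "0 < \<sigma>"
    and nonzero: "emeasure M (space M) \<noteq> 0"
begin

lemma D_nonneg: "0 \<le> D"
proof (rule ccontr)
  assume "\<not> 0 \<le> D"
  then have "AE w in M. False" using m_bounded by (auto elim: eventually_mono)
  then have "emeasure M (space M) = 0" by (subst (asm) AE_iff_measurable[OF sets.top]) auto
  then show False using nonzero by simp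
qed

abbreviation nd :: "'a \<Rightarrow> real \<Rightarrow> real" where "nd w z \<equiv> normal_density (m w) \<sigma> z"

lemma nd_measurable [measurable]:
  "(\<lambda>w. nd w z) \<in> borel_measurable M" "(\<lambda>(w, z). nd w z) \<in> borel_measurable (M \<Otimes>\<^sub>M borel)"
  "(\<lambda>(z, w). nd w z) \<in> borel_measurable (borel \<Otimes>\<^sub>M M)"
  unfolding normal_density_def by measurable

lemma integrable_nd:
  assumes [measurable]: "f \<in> borel_measurable M" and "AE w in M. \<bar>f w\<bar> \<le> B"
  shows "integrable M (\<lambda>w. f w * nd w z)"
proof (rule integrable_const_bound[where B = "\<bar>B\<bar> * (1 / sqrt (2 * pi * \<sigma>\<^sup>2))"])
  show "AE w in M. norm (f w * nd w z) \<le> \<bar>B\<bar> * (1 / sqrt (2 * pi * \<sigma>\<^sup>2))"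
    using assms(2)
  proof eventually_elim
    fix w assume "\<bar>f w\<bar> \<le> B"
    then show "norm (f w * nd w z) \<le> \<bar>B\<bar> * (1 / sqrt (2 * pi * \<sigma>\<^sup>2))"
      using normal_density_le[OF \<sigma>_pos, of "m w" z] unfolding real_norm_def abs_mult
      by (intro mult_mono[of "\<bar>f w\<bar>" "\<bar>B\<bar>" "\<bar>nd w z\<bar>"]) auto
  qed
qed measurable

text \<open>\<open>mom 0\<close> is the density of the mixture; \<open>l0\<close>, \<open>l1\<close>, \<open>l2\<close> are the first three derivatives of its
  logarithm.\<close>

definition mom :: "nat \<Rightarrow> real \<Rightarrow> real" where
  "mom k z = (\<integral>w. m w ^ k * nd w z \<partial>M)"

lemma m_power_bounded: "AE w in M. \<bar>m w ^ k\<bar> \<le> D ^ k"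
  using m_bounded by eventually_elim (auto simp: power_abs intro: power_mono)

lemma integrable_mom: "integrable M (\<lambda>w. m w ^ k * nd w z)"
  by (rule integrable_nd[OF _ m_power_bounded]) simp

text \<open>Differentiating a normal density in z multiplies it by (m - z) / \<sigma>^2, which
  raises the order of the moment by one. The quadratic remainder is uniform in the centre and is
  simply integrated; this takes the place of a theorem on derivatives of parameter
  integrals.\<close>

lemma has_real_derivative_mom:
  "(mom k has_real_derivative (mom (Suc k) z - z * mom k z) / \<sigma>\<^sup>2) (at z)"
proof (rule has_derivative_of_quadratic_error)
  fix t
  define C where "C = 3 / (\<sigma>\<^sup>2 * sqrt (2 * pi * \<sigma>\<^sup>2)) * t\<^sup>2"
  have eq: "mom k (z + t) - mom k z - t * ((mom (Suc k) z - z * mom k z) / \<sigma>\<^sup>2)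
      = (\<integral>w. m w ^ k * (nd w (z + t) - nd w z - t * ((m w - z) / \<sigma>\<^sup>2 * nd w z)) \<partial>M)"
  proof -
    have "(\<integral>w. m w ^ k * (nd w (z + t) - nd w z - t * ((m w - z) / \<sigma>\<^sup>2 * nd w z)) \<partial>M)
      = (\<integral>w. m w ^ k * nd w (z + t) - m w ^ k * nd w z
           - t / \<sigma>\<^sup>2 * (m w ^ Suc k * nd w z - z * (m w ^ k * nd w z)) \<partial>M)"
      by (intro Bochner_Integration.integral_cong) (auto simp: field_simps)
    also have "\<dots> = mom k (z + t) - mom k z - t / \<sigma>\<^sup>2 * (mom (Suc k) z - z * mom k z)"
      unfolding mom_def using integrable_mom[of k] integrable_mom[of "Suc k" z] by simp
    finally show ?thesis by simp
  qed
  have "\<bar>mom k (z + t) - mom k z - t * ((mom (Suc k) z - z * mom k z) / \<sigma>\<^sup>2)\<bar>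
      \<le> (\<integral>w. D ^ k * C \<partial>M)"
    unfolding eq
  proof (rule integral_abs_bound[THEN order_trans], rule integral_mono_AE)
    show "AE w in M. \<bar>m w ^ k * (nd w (z + t) - nd w z - t * ((m w - z) / \<sigma>\<^sup>2 * nd w z))\<bar> \<le> D ^ k * C"
      using m_power_bounded[of k]
    proof eventually_elim
      fix w assume "\<bar>m w ^ k\<bar> \<le> D ^ k"
      then show "\<bar>m w ^ k * (nd w (z + t) - nd w z - t * ((m w - z) / \<sigma>\<^sup>2 * nd w z))\<bar> \<le> D ^ k * C"
        unfolding abs_mult C_def
        using normal_density_quadratic_error[OF \<sigma>_pos, of "m w" z t] D_nonneg by (intro mult_mono) auto
    qed
    then show "integrable M (\<lambda>w. \<bar>m w ^ k * (nd w (z + t) - nd w z - t * ((m w - z) / \<sigma>\<^sup>2 * nd w z))\<bar>)"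
      by (intro integrable_const_bound[where B = "D ^ k * C"]) auto
  qed auto
  then show "\<bar>mom k (z + t) - mom k z - t * ((mom (Suc k) z - z * mom k z) / \<sigma>\<^sup>2)\<bar>
      \<le> measure M (space M) * D ^ k * (3 / (\<sigma>\<^sup>2 * sqrt (2 * pi * \<sigma>\<^sup>2))) * t\<^sup>2"
    by (simp add: C_def mult_ac)
qed

lemma continuous_mom: "continuous_on S (mom k)"
  by (rule DERIV_continuous_on, rule has_field_derivative_at_within, rule has_real_derivative_mom)

lemma mom_measurable [measurable]: "mom k \<in> borel_measurable borel"
  using continuous_mom[of UNIV] by (rule borel_measurable_continuous_onI)

lemma mom_0_pos: "0 < mom 0 z"
proof -
  have "0 \<le> mom 0 z" unfolding mom_def by simp
  moreover have "mom 0 z \<noteq> 0"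
  proof
    assume "mom 0 z = 0"
    then have "AE w in M. nd w z = 0"
      using integral_nonneg_eq_0_iff_AE[of M "\<lambda>w. nd w z"] integrable_mom[of 0 z] by (simp add: mom_def)
    then have "AE w in M. False"
      by (rule eventually_mono) (use normal_density_pos[OF \<sigma>_pos] in \<open>metis less_irrefl\<close>)
    then have "emeasure M (space M) = 0" by (subst (asm) AE_iff_measurable[OF sets.top]) auto
    then show False using nonzero by simp
  qed
  ultimately show ?thesis by simp
qed

text \<open>The conditional mean of the centre given the value z. With it, \<open>l0\<close> is
  Tweedie's formula.\<close>

definition cm :: "real \<Rightarrow> real" where "cm z = mom 1 z / mom 0 z"
definition l0 :: "real \<Rightarrow> real" where "l0 z = (cm z - z) / \<sigma>\<^sup>2"
definition l1 :: "real \<Rightarrow> real" where "l1 z = ((mom 2 z / mom 0 z - (cm z)\<^sup>2) / \<sigma>\<^sup>2 - 1) / \<sigma>\<^sup>2"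
definition l2 :: "real \<Rightarrow> real" where
  "l2 z = (mom 3 z / mom 0 z - 3 * cm z * (mom 2 z / mom 0 z) + 2 * cm z ^ 3) / \<sigma>^6"
text \<open>The unnormalised conditional second moment of the distance from centre to z. Up to
  powers of \<sigma> and a factor D it dominates both \<open>l0\<close> squared and
  \<open>l2\<close> against the density, and its Lebesgue integral is known exactly.\<close>

definition sq :: "real \<Rightarrow> real" where "sq z = (\<integral>w. (m w - z)\<^sup>2 * nd w z \<partial>M)"

lemma mom_0_ne [simp]: "mom 0 z \<noteq> 0"
  using mom_0_pos[of z] by simp

lemma has_real_derivative_mom_0: "(mom 0 has_real_derivative l0 z * mom 0 z) (at z)"
proof -
  have "cm z * mom 0 z = mom (Suc 0) z" by (simp add: cm_def)
  then have "l0 z * mom 0 z = (mom (Suc 0) z - z * mom 0 z) / \<sigma>\<^sup>2"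
    by (simp add: l0_def left_diff_distrib)
  then show ?thesis using has_real_derivative_mom[of 0 z] by simp
qed

lemma has_real_derivative_mom_ratio:
  "((\<lambda>z. mom k z / mom 0 z) has_real_derivative
    (mom (Suc k) z / mom 0 z - mom k z / mom 0 z * cm z) / \<sigma>\<^sup>2) (at z)"
  apply (rule derivative_eq_intros has_real_derivative_mom mom_0_ne)+
  using \<sigma>_pos by (simp add: cm_def field_simps)

lemma has_real_derivative_cm:
  "(cm has_real_derivative (mom 2 z / mom 0 z - (cm z)\<^sup>2) / \<sigma>\<^sup>2) (at z)"
  using has_real_derivative_mom_ratio[of 1 z]
  by (simp add: cm_def [abs_def] power2_eq_square numeral_2_eq_2)

lemma has_real_derivative_l0: "(l0 has_real_derivative l1 z) (at z)"
  unfolding l0_def [abs_def] l1_def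
  by (rule derivative_eq_intros has_real_derivative_cm refl)+
    (use \<sigma>_pos in \<open>simp_all add: power2_eq_square power4_eq_xxxx\<close>)

lemma has_real_derivative_l1: "(l1 has_real_derivative l2 z) (at z)"
proof -
  define r where "r k z = mom k z / mom 0 z" for k z
  have r: "(r 2 has_real_derivative (r 3 z - r 2 z * cm z) / \<sigma>\<^sup>2) (at z)"
    using has_real_derivative_mom_ratio[of 2 z] by (simp add: r_def [abs_def])
  have l1: "l1 = (\<lambda>z. ((r 2 z - (cm z)\<^sup>2) * inverse (\<sigma>\<^sup>2) - 1) * inverse (\<sigma>\<^sup>2))"
    by (simp add: l1_def [abs_def] r_def divide_inverse)
  have l2: "l2 z = (((r 3 z - r 2 z * cm z) / \<sigma>\<^sup>2 - 2 * cm z * ((r 2 z - (cm z)\<^sup>2) / \<sigma>\<^sup>2)) * inverse (\<sigma>\<^sup>2)) * inverse (\<sigma>\<^sup>2)"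
    using \<sigma>_pos unfolding l2_def r_def[symmetric] by (simp add: field_simps eval_nat_numeral)
  have cm: "(cm has_real_derivative (r 2 z - (cm z)\<^sup>2) / \<sigma>\<^sup>2) (at z)"
    using has_real_derivative_cm[of z] by (simp add: r_def)
  show ?thesis
    unfolding l1 l2 by (auto intro!: derivative_eq_intros r cm)
qed

lemma mom_binomial:
  "(\<integral>w. (m w - c)\<^sup>2 * nd w z \<partial>M) = mom 2 z - 2 * c * mom 1 z + c\<^sup>2 * mom 0 z"
  "(\<integral>w. (m w - c) ^ 3 * nd w z \<partial>M) = mom 3 z - 3 * c * mom 2 z + 3 * c\<^sup>2 * mom 1 z - c ^ 3 * mom 0 z"
proof -
  have "(\<integral>w. (m w - c)\<^sup>2 * nd w z \<partial>M)
    = (\<integral>w. m w ^ 2 * nd w z - 2 * c * (m w ^ 1 * nd w z) + c\<^sup>2 * (m w ^ 0 * nd w z) \<partial>M)"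
    by (intro Bochner_Integration.integral_cong) (auto simp: power2_eq_square algebra_simps)
  then show "(\<integral>w. (m w - c)\<^sup>2 * nd w z \<partial>M) = mom 2 z - 2 * c * mom 1 z + c\<^sup>2 * mom 0 z"
    unfolding mom_def
    by (simp add: integrable_mom del: power_one_right power_0 power_Suc One_nat_def)
  have "(\<integral>w. (m w - c) ^ 3 * nd w z \<partial>M)
    = (\<integral>w. m w ^ 3 * nd w z - 3 * c * (m w ^ 2 * nd w z) + 3 * c\<^sup>2 * (m w ^ 1 * nd w z)
          - c ^ 3 * (m w ^ 0 * nd w z) \<partial>M)"
    by (intro Bochner_Integration.integral_cong) (auto simp: power2_eq_square power3_eq_cube algebra_simps)
  then show "(\<integral>w. (m w - c) ^ 3 * nd w z \<partial>M)
      = mom 3 z - 3 * c * mom 2 z + 3 * c\<^sup>2 * mom 1 z - c ^ 3 * mom 0 z"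
    unfolding mom_def
    by (simp add: integrable_mom del: power_one_right power_0 power_Suc One_nat_def)
qed

lemma abs_cm_le: "\<bar>cm z\<bar> \<le> D"
proof -
  have "\<bar>mom 1 z\<bar> \<le> (\<integral>w. D * nd w z \<partial>M)"
    unfolding mom_def
  proof (rule integral_abs_bound[THEN order_trans], rule integral_mono_AE)
    show "AE w in M. \<bar>m w ^ 1 * nd w z\<bar> \<le> D * nd w z"
      using m_bounded by eventually_elim (auto simp: abs_mult intro: mult_right_mono)
  qed (use integrable_mom[of 1 z] integrable_mom[of 0 z] in auto)
  also have "\<dots> = D * mom 0 z" by (simp add: mom_def)
  finally show ?thesis using mom_0_pos[of z] by (simp add: cm_def field_simps)
qed

lemma sq_measurable [measurable]: "sq \<in> borel_measurable borel"
  unfolding sq_def [abs_def] by measurable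

lemma sq_nonneg: "0 \<le> sq z"
  unfolding sq_def by simp

text \<open>Bias-variance decomposition: conditional variance of the centre plus squared distance of
  its conditional mean from z. Both summands are nonnegative, hence each is at most
  \<open>sq\<close>.\<close>

lemma sq_eq: "sq z = (\<integral>w. (m w - cm z)\<^sup>2 * nd w z \<partial>M) + (cm z - z)\<^sup>2 * mom 0 z"
proof -
  have "mom 1 z = cm z * mom 0 z" by (simp add: cm_def)
  then show ?thesis
    unfolding sq_def mom_binomial by (simp add: power2_eq_square algebra_simps)
qed

lemma l0_square_le: "(l0 z)\<^sup>2 * mom 0 z \<le> sq z / \<sigma> ^ 4"
proof -
  have "(cm z - z)\<^sup>2 * mom 0 z \<le> sq z" unfolding sq_eq by simp
  then have "(cm z - z)\<^sup>2 * mom 0 z / \<sigma> ^ 4 \<le> sq z / \<sigma> ^ 4" by (rule divide_right_mono) simp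
  then show ?thesis unfolding l0_def by (simp add: power_divide)
qed

text \<open>Up to an affine rescaling \<open>l1\<close> is the conditional variance of the centre,
  which lies between 0 and D^2. Only finiteness of the bound matters: it makes the derivative of the
  score error integrable, and its value does not enter the final estimate.\<close>

lemma l1_bound: "\<bar>l1 z\<bar> \<le> (D\<^sup>2 / \<sigma>\<^sup>2 + 1) / \<sigma>\<^sup>2"
proof -
  have "(\<integral>w. (m w - cm z)\<^sup>2 * nd w z \<partial>M) = mom 2 z - (cm z)\<^sup>2 * mom 0 z"
    unfolding mom_binomial by (simp add: cm_def power2_eq_square)
  moreover have "0 \<le> (\<integral>w. (m w - cm z)\<^sup>2 * nd w z \<partial>M)" by simp
  ultimately have "0 \<le> mom 2 z - (cm z)\<^sup>2 * mom 0 z" by simp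
  then have *: "0 \<le> mom 2 z / mom 0 z - (cm z)\<^sup>2"
    using mom_0_pos[of z] by (simp add: field_simps)
  have "mom 2 z \<le> (\<integral>w. D\<^sup>2 * nd w z \<partial>M)"
    unfolding mom_def
  proof (rule integral_mono_AE)
    show "AE w in M. (m w)\<^sup>2 * nd w z \<le> D\<^sup>2 * nd w z"
      using m_power_bounded[of 2] by eventually_elim (auto intro: mult_right_mono)
  qed (use integrable_mom[of 2 z] integrable_mom[of 0 z] in auto)
  also have "\<dots> = D\<^sup>2 * mom 0 z" by (simp add: mom_def)
  finally have "mom 2 z / mom 0 z \<le> D\<^sup>2" using mom_0_pos[of z] by (simp add: field_simps)
  then have **: "mom 2 z / mom 0 z - (cm z)\<^sup>2 \<le> D\<^sup>2" using zero_le_power2[of "cm z"] by linarith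
  have "(mom 2 z / mom 0 z - (cm z)\<^sup>2) / \<sigma>\<^sup>2 \<le> D\<^sup>2 / \<sigma>\<^sup>2" using ** by (rule divide_right_mono) simp
  moreover have "0 \<le> (mom 2 z / mom 0 z - (cm z)\<^sup>2) / \<sigma>\<^sup>2" using * by simp
  ultimately have "\<bar>(mom 2 z / mom 0 z - (cm z)\<^sup>2) / \<sigma>\<^sup>2 - 1\<bar> \<le> D\<^sup>2 / \<sigma>\<^sup>2 + 1" by linarith
  then show ?thesis unfolding l1_def abs_divide by (simp add: divide_right_mono)
qed

text \<open>\<open>l2\<close> is the conditional third central moment of the centre, divided by
  \<sigma>^6. One factor is at most 2 D in modulus; the other two form the conditional variance, at
  most \<open>sq\<close> by the decomposition. Since \<open>sq\<close> integrates to \<sigma>^2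
  times the mass, only D / \<sigma>^4 remains in mean, with a single power of D.\<close>

lemma l2_bound: "\<bar>l2 z\<bar> * mom 0 z \<le> 2 * D / \<sigma> ^ 6 * sq z"
proof -
  let ?c = "cm z"
  have 1: "mom 1 z = ?c * mom 0 z" by (simp add: cm_def)
  have "(mom 3 z / mom 0 z - 3 * ?c * (mom 2 z / mom 0 z) + 2 * ?c ^ 3) * mom 0 z
      = mom 3 z - 3 * ?c * mom 2 z + 2 * ?c ^ 3 * mom 0 z"
    by (simp add: distrib_right left_diff_distrib)
  then have "l2 z * mom 0 z = (\<integral>w. (m w - ?c) ^ 3 * nd w z \<partial>M) / \<sigma> ^ 6"
    unfolding l2_def mom_binomial 1 times_divide_eq_left
    by (simp add: power2_eq_square power3_eq_cube algebra_simps)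
  moreover have "\<bar>l2 z\<bar> * mom 0 z = \<bar>l2 z * mom 0 z\<bar>"
    using mom_0_pos[of z] by (simp add: abs_mult)
  ultimately have "\<bar>l2 z\<bar> * mom 0 z = \<bar>\<integral>w. (m w - ?c) ^ 3 * nd w z \<partial>M\<bar> / \<sigma> ^ 6"
    using \<sigma>_pos by (simp add: abs_divide)
  also have "\<bar>\<integral>w. (m w - ?c) ^ 3 * nd w z \<partial>M\<bar> \<le> (\<integral>w. 2 * D * ((m w - ?c)\<^sup>2 * nd w z) \<partial>M)"
  proof (rule integral_abs_bound[THEN order_trans], rule integral_mono_AE)
    have bd: "AE w in M. \<bar>m w - ?c\<bar> \<le> 2 * D"
      using m_bounded by (rule eventually_mono) (use abs_cm_le[of z] in linarith)
    then show "AE w in M. \<bar>(m w - ?c) ^ 3 * nd w z\<bar> \<le> 2 * D * ((m w - ?c)\<^sup>2 * nd w z)"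
    proof eventually_elim
      fix w assume "\<bar>m w - ?c\<bar> \<le> 2 * D"
      then have "\<bar>m w - ?c\<bar> * ((m w - ?c)\<^sup>2 * nd w z) \<le> 2 * D * ((m w - ?c)\<^sup>2 * nd w z)"
        by (rule mult_right_mono) simp
      then show "\<bar>(m w - ?c) ^ 3 * nd w z\<bar> \<le> 2 * D * ((m w - ?c)\<^sup>2 * nd w z)"
        by (simp add: abs_mult power3_eq_cube power2_eq_square mult_ac)
    qed
    have pw: "AE w in M. \<bar>(m w - ?c) ^ k\<bar> \<le> (2 * D) ^ k" for k
      using bd by eventually_elim (simp only: power_abs, rule power_mono, auto)
    show "integrable M (\<lambda>w. \<bar>(m w - ?c) ^ 3 * nd w z\<bar>)"
      by (intro integrable_abs integrable_nd[OF _ pw]) simp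
    show "integrable M (\<lambda>w. 2 * D * ((m w - ?c)\<^sup>2 * nd w z))"
      by (intro integrable_mult_right integrable_nd[OF _ pw]) simp
  qed
  also have "\<dots> = 2 * D * (\<integral>w. (m w - ?c)\<^sup>2 * nd w z \<partial>M)" by simp
  also have "\<dots> \<le> 2 * D * sq z"
    using D_nonneg mom_0_pos[of z] unfolding sq_eq by (intro mult_left_mono) auto
  finally show ?thesis using \<sigma>_pos by (simp add: divide_right_mono)
qed

lemma nn_integral_mixture:
  assumes f: "\<And>w. (\<integral>\<^sup>+z. ennreal (f w z * nd w z) \<partial>lborel) = ennreal c"
    and [measurable]: "(\<lambda>(w, z). f w z) \<in> borel_measurable (M \<Otimes>\<^sub>M borel)"
    and f0: "\<And>w z. 0 \<le> f w z" and int: "\<And>z. integrable M (\<lambda>w. f w z * nd w z)" and c: "0 \<le> c"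
  shows "(\<integral>\<^sup>+z. ennreal (\<integral>w. f w z * nd w z \<partial>M) \<partial>lborel) = ennreal (c * measure M (space M))"
proof -
  interpret pair_sigma_finite M lborel ..
  have "(\<integral>\<^sup>+z. ennreal (\<integral>w. f w z * nd w z \<partial>M) \<partial>lborel) = (\<integral>\<^sup>+z. \<integral>\<^sup>+w. ennreal (f w z * nd w z) \<partial>M \<partial>lborel)"
    by (intro nn_integral_cong) (simp add: nn_integral_eq_integral[OF int] f0)
  also have "\<dots> = (\<integral>\<^sup>+w. \<integral>\<^sup>+z. ennreal (f w z * nd w z) \<partial>lborel \<partial>M)"
    by (rule Fubini') measurable
  also have "\<dots> = ennreal (c * measure M (space M))"
    using c by (simp add: f emeasure_eq_measure ennreal_mult)
  finally show ?thesis .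
qed

lemma lborel_mom_0:
  "integrable lborel (mom 0)" "(\<integral>z. mom 0 z \<partial>lborel) = measure M (space M)"
proof -
  have "(\<integral>\<^sup>+z. ennreal (mom 0 z) \<partial>lborel) = ennreal (1 * measure M (space M))"
    unfolding mom_def using integrable_mom[of 0] \<sigma>_pos
    by (intro nn_integral_mixture) (auto simp: nn_integral_eq_integral)
  then show "integrable lborel (mom 0)" "(\<integral>z. mom 0 z \<partial>lborel) = measure M (space M)"
    using mom_0_pos by (auto intro!: integrableI_nonneg integral_eq_nn_integral[THEN trans] simp: less_imp_le)
qed

text \<open>Each component contributes its own variance \<sigma>^2, wherever its centre lies, so the
  size of the data does not enter.\<close>

lemma lborel_sq:
  "integrable lborel sq" "(\<integral>z. sq z \<partial>lborel) = \<sigma>\<^sup>2 * (\<integral>z. mom 0 z \<partial>lborel)"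
proof -
  have "(\<integral>\<^sup>+z. ennreal (sq z) \<partial>lborel) = ennreal (\<sigma>\<^sup>2 * measure M (space M))"
    unfolding sq_def
  proof (intro nn_integral_mixture)
    fix w z
    have "has_bochner_integral lborel (\<lambda>z. (m w - z)\<^sup>2 * nd w z) (\<sigma>\<^sup>2)"
      using normal_moment_even[OF \<sigma>_pos, of "m w" 1]
      by (simp add: power2_commute[of "m w"] mult.commute power_divide)
    then show "(\<integral>\<^sup>+z. ennreal ((m w - z)\<^sup>2 * nd w z) \<partial>lborel) = ennreal (\<sigma>\<^sup>2)"
      by (simp add: has_bochner_integral_iff nn_integral_eq_integral)
    have "AE w in M. \<bar>(m w - z)\<^sup>2\<bar> \<le> (D + \<bar>z\<bar>)\<^sup>2"
      using m_bounded by eventually_elim (auto intro!: abs_le_square_iff[THEN iffD1])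
    then show "integrable M (\<lambda>w. (m w - z)\<^sup>2 * nd w z)"
      by (intro integrable_nd) auto
  qed auto
  then show "integrable lborel sq" "(\<integral>z. sq z \<partial>lborel) = \<sigma>\<^sup>2 * (\<integral>z. mom 0 z \<partial>lborel)"
    using sq_nonneg
    by (auto intro!: integrableI_nonneg integral_eq_nn_integral[THEN trans] simp: lborel_mom_0)
qed

end

text \<open>By the mean value theorem the derivative somewhere in the window is the difference
  quotient, and E pays for moving from there to z. Only the endpoint values of f appear; integrated
  over the position of the window they become translates of one function.\<close>

lemma abs_deriv_le_of_difference:
  fixes f :: "real \<Rightarrow> real"
  assumes h: "a < b"
    and D: "\<And>x. (f has_real_derivative f' x) (at x)"
    and E: "\<And>x. x \<in> {a..b} \<Longrightarrow> \<bar>f' z - f' x\<bar> \<le> E"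
  shows "\<bar>f' z\<bar> \<le> (\<bar>f a\<bar> + \<bar>f b\<bar>) / (b - a) + E"
proof -
  obtain \<xi> where xi: "a < \<xi>" "\<xi> < b" "f b - f a = (b - a) * f' \<xi>"
    using MVT2[OF h, of f f'] D by auto
  have "\<bar>f' \<xi>\<bar> = \<bar>f b - f a\<bar> / (b - a)"
    using xi(3) h by (simp add: abs_mult)
  also have "\<dots> \<le> (\<bar>f a\<bar> + \<bar>f b\<bar>) / (b - a)"
    using h by (intro divide_right_mono) auto
  finally show ?thesis using E[of \<xi>] xi by auto
qed

section \<open>Score error of a mixture: interpolation over a window and integration by
  parts\<close>

context gaussian_mixture
begin

lemma l2_continuous: "continuous_on S l2"
  unfolding l2_def [abs_def] cm_def
  by (intro continuous_intros continuous_mom) (use \<sigma>_pos in auto)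

lemma l1_continuous: "continuous_on S l1"
  by (rule DERIV_continuous_on, rule has_field_derivative_at_within, rule has_real_derivative_l1)

lemma l0_continuous: "continuous_on S l0"
  by (rule DERIV_continuous_on, rule has_field_derivative_at_within, rule has_real_derivative_l0)

lemma l0_measurable [measurable]: "l0 \<in> borel_measurable borel"
  by (rule borel_measurable_continuous_onI) (rule l0_continuous)

lemma l1_measurable [measurable]: "l1 \<in> borel_measurable borel"
  by (rule borel_measurable_continuous_onI) (rule l1_continuous)

lemma l1_difference:
  assumes "z \<in> {a..b}" "x \<in> {a..b}"
  shows "\<bar>l1 z - l1 x\<bar> \<le> (LINT y:{a..b}|lborel. \<bar>l2 y\<bar>)"
proof -
  have int: "set_integrable lborel {u..v} (\<lambda>y. \<bar>l2 y\<bar>)" "set_integrable lborel {u..v} l2" for u v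
    by (auto intro!: borel_integrable_atLeastAtMost' continuous_intros l2_continuous)
  have main: "\<bar>l1 v - l1 u\<bar> \<le> (LINT y:{a..b}|lborel. \<bar>l2 y\<bar>)" if "a \<le> u" "u \<le> v" "v \<le> b" for u v
  proof -
    have "(LINT y:{u..v}|lborel. l2 y) = l1 v - l1 u"
      unfolding set_lebesgue_integral_def
      using integral_FTC_Icc_real[of u v l1 l2] has_real_derivative_l1 l2_continuous[of UNIV] that
      by (simp add: continuous_on_eq_continuous_at mult.commute)
    then have "\<bar>l1 v - l1 u\<bar> \<le> (LINT y:{u..v}|lborel. \<bar>l2 y\<bar>)"
      using set_integral_norm_bound[OF int(2)[of u v]] by simp
    also have "\<dots> \<le> (LINT y:{a..b}|lborel. \<bar>l2 y\<bar>)"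
      using that int unfolding set_lebesgue_integral_def set_integrable_def
      by (intro integral_mono) (auto simp: indicator_def)
    finally show ?thesis .
  qed
  show ?thesis
    using main[of z x] main[of x z] assms by (cases "x \<le> z") (auto simp: abs_minus_commute)
qed

text \<open>On the side of \<open>z\<close> that faces its centre, a normal density is within distance \<open>\<sigma>\<close> at least half
  of its value at \<open>z\<close>. So the components centred below \<open>z\<close> use the window \<open>{z - h..z}\<close>, the others
  \<open>{z..z + h}\<close>.\<close>

definition lower :: "real \<Rightarrow> real" where "lower z = (\<integral>w. indicator {w. m w \<le> z} w * nd w z \<partial>M)"
definition upper :: "real \<Rightarrow> real" where "upper z = (\<integral>w. indicator {w. z < m w} w * nd w z \<partial>M)"

lemma integrable_half:
  "integrable M (\<lambda>w. indicator {w. m w \<le> z} w * nd w x)"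
  "integrable M (\<lambda>w. indicator {w. z < m w} w * nd w x)"
  by (rule integrable_nd[where B = 1]; measurable; simp add: indicator_def)+

lemma lower_upper: "lower z + upper z = mom 0 z"
proof -
  have "lower z + upper z = (\<integral>w. indicator {w. m w \<le> z} w * nd w z + indicator {w. z < m w} w * nd w z \<partial>M)"
    unfolding lower_def upper_def using integrable_half by simp
  also have "\<dots> = mom 0 z"
    unfolding mom_def by (intro Bochner_Integration.integral_cong) (auto simp: indicator_def)
  finally show ?thesis .
qed

lemma lower_nonneg: "0 \<le> lower z" and upper_nonneg: "0 \<le> upper z"
  unfolding lower_def upper_def by auto

lemma lower_le:
  assumes "x \<le> z" "z - x \<le> \<sigma>"
  shows "lower z \<le> 2 * mom 0 x"
proof -
  have "lower z \<le> (\<integral>w. 2 * (m w ^ 0 * nd w x) \<partial>M)"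
    unfolding lower_def
  proof (rule integral_mono_AE)
    show "AE w in M. indicator {w. m w \<le> z} w * nd w z \<le> 2 * (m w ^ 0 * nd w x)"
    proof (rule AE_I2)
      fix w show "indicator {w. m w \<le> z} w * nd w z \<le> 2 * (m w ^ 0 * nd w x)"
        using normal_density_le_twice[OF \<sigma>_pos, of "m w" z x] assms
        by (auto simp: indicator_def)
    qed
  qed (use integrable_half integrable_mom[of 0] in auto)
  also have "\<dots> = 2 * mom 0 x" by (simp add: mom_def)
  finally show ?thesis .
qed

lemma upper_le:
  assumes "z \<le> x" "x - z \<le> \<sigma>"
  shows "upper z \<le> 2 * mom 0 x"
proof -
  have "upper z \<le> (\<integral>w. 2 * (m w ^ 0 * nd w x) \<partial>M)"
    unfolding upper_def
  proof (rule integral_mono_AE)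
    show "AE w in M. indicator {w. z < m w} w * nd w z \<le> 2 * (m w ^ 0 * nd w x)"
    proof (rule AE_I2)
      fix w show "indicator {w. z < m w} w * nd w z \<le> 2 * (m w ^ 0 * nd w x)"
        using normal_density_le_twice[OF \<sigma>_pos, of "m w" z x] assms
        by (auto simp: indicator_def)
    qed
  qed (use integrable_half integrable_mom[of 0] in auto)
  also have "\<dots> = 2 * mom 0 x" by (simp add: mom_def)
  finally show ?thesis .
qed

lemma set_integrable_sq: "set_integrable lborel {a..b} sq"
  unfolding set_integrable_def using lborel_sq(1) by (intro integrable_mult_indicator) auto

text \<open>Here v will be the part of the density at z carried by one half of the components. As it
  is at most twice the density throughout the window, it can be moved to the point y at which
  \<open>l2\<close> is evaluated, where \<open>l2_bound\<close> applies.\<close>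

lemma half_times_l2:
  assumes v: "0 \<le> v" "\<And>x. x \<in> {a..b} \<Longrightarrow> v \<le> 2 * mom 0 x"
  shows "v * (LINT y:{a..b}|lborel. \<bar>l2 y\<bar>) \<le> 4 * D / \<sigma> ^ 6 * (LINT y:{a..b}|lborel. sq y)"
proof -
  have "v * (LINT y:{a..b}|lborel. \<bar>l2 y\<bar>) = (LINT y:{a..b}|lborel. v * \<bar>l2 y\<bar>)" by simp
  also have "\<dots> \<le> (LINT y:{a..b}|lborel. 4 * D / \<sigma> ^ 6 * sq y)"
  proof (rule set_integral_mono)
    show "set_integrable lborel {a..b} (\<lambda>y. v * \<bar>l2 y\<bar>)"
      by (intro set_integrable_mult_right borel_integrable_atLeastAtMost' continuous_intros l2_continuous)
    show "set_integrable lborel {a..b} (\<lambda>y. 4 * D / \<sigma> ^ 6 * sq y)"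
      by (intro set_integrable_mult_right set_integrable_sq)
    fix y assume "y \<in> {a..b}"
    then have "v * \<bar>l2 y\<bar> \<le> 2 * mom 0 y * \<bar>l2 y\<bar>" using v(2) by (intro mult_right_mono) auto
    also have "\<dots> \<le> 4 * D / \<sigma> ^ 6 * sq y"
      using mult_left_mono[OF l2_bound[of y], of 2] by (simp add: mult_ac)
    finally show "v * \<bar>l2 y\<bar> \<le> 4 * D / \<sigma> ^ 6 * sq y" .
  qed
  finally show ?thesis by simp
qed

text \<open>Tonelli: a point y lies in the windows of a set of z of length h. The offset c is 0 or -
  h, for the windows on the two sides of z.\<close>

lemma lborel_window_sq:
  assumes "0 \<le> h"
  shows "integrable lborel (\<lambda>z. LINT y:{z + c..z + c + h}|lborel. sq y)"
    and "(\<integral>z. (LINT y:{z + c..z + c + h}|lborel. sq y) \<partial>lborel) = h * (\<sigma>\<^sup>2 * (\<integral>z. mom 0 z \<partial>lborel))"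
proof -
  have [measurable]: "(\<lambda>z. LINT y:{z + c..z + c + h}|lborel. sq y) \<in> borel_measurable borel"
    unfolding set_lebesgue_integral_def atLeastAtMost_def atLeast_def atMost_def Int_def
    by simp
  have nn: "0 \<le> (LINT y:{z + c..z + c + h}|lborel. sq y)" for z
    unfolding set_lebesgue_integral_def by (auto intro!: integral_nonneg simp: sq_nonneg)
  have "(\<integral>\<^sup>+z. ennreal (LINT y:{z + c..z + c + h}|lborel. sq y) \<partial>lborel)
      = (\<integral>\<^sup>+z. \<integral>\<^sup>+y. ennreal (sq y) * indicator {z + c..z + c + h} y \<partial>lborel \<partial>lborel)"
  proof (rule nn_integral_cong)
    fix z
    have "(\<integral>\<^sup>+y. ennreal (sq y) * indicator {z + c..z + c + h} y \<partial>lborel)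
      = (\<integral>\<^sup>+y. ennreal (indicator {z + c..z + c + h} y * sq y) \<partial>lborel)"
      by (intro nn_integral_cong) (auto simp: indicator_def)
    also have "\<dots> = ennreal (LINT y:{z + c..z + c + h}|lborel. sq y)"
      unfolding set_lebesgue_integral_def real_scaleR_def
      using set_integrable_sq[of "z + c" "z + c + h"] sq_nonneg
      by (intro nn_integral_eq_integral) (auto simp: set_integrable_def)
    finally show "ennreal (LINT y:{z + c..z + c + h}|lborel. sq y) =
      (\<integral>\<^sup>+y. ennreal (sq y) * indicator {z + c..z + c + h} y \<partial>lborel)" by simp
  qed
  also have "\<dots> = (\<integral>\<^sup>+z. \<integral>\<^sup>+y. ennreal (sq y) * indicator {(z, y). z + c \<le> y \<and> y \<le> z + c + h} (z, y) \<partial>lborel \<partial>lborel)"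
    by (intro nn_integral_cong) (auto simp: indicator_def)
  also have "\<dots> = (\<integral>\<^sup>+y. \<integral>\<^sup>+z. ennreal (sq y) * indicator {(z, y). z + c \<le> y \<and> y \<le> z + c + h} (z, y) \<partial>lborel \<partial>lborel)"
    by (rule lborel_pair.Fubini') measurable
  also have "\<dots> = (\<integral>\<^sup>+y. ennreal (sq y) * ennreal h \<partial>lborel)"
  proof (rule nn_integral_cong)
    fix y
    have "(\<integral>\<^sup>+z. ennreal (sq y) * indicator {(z, y). z + c \<le> y \<and> y \<le> z + c + h} (z, y) \<partial>lborel)
      = (\<integral>\<^sup>+z. ennreal (sq y) * indicator {y - c - h..y - c} z \<partial>lborel)"
      by (intro nn_integral_cong) (auto simp: indicator_def)
    also have "\<dots> = ennreal (sq y) * ennreal h"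
      using assms by (subst nn_integral_cmult_indicator) auto
    finally show "(\<integral>\<^sup>+z. ennreal (sq y) * indicator {(z, y). z + c \<le> y \<and> y \<le> z + c + h} (z, y) \<partial>lborel)
      = ennreal (sq y) * ennreal h" .
  qed
  also have "\<dots> = ennreal (h * (\<sigma>\<^sup>2 * (\<integral>z. mom 0 z \<partial>lborel)))"
    using assms lborel_sq sq_nonneg mom_0_pos
    by (simp add: nn_integral_multc nn_integral_eq_integral ennreal_mult[symmetric] mult.commute less_imp_le)
  finally have *: "(\<integral>\<^sup>+z. ennreal (LINT y:{z + c..z + c + h}|lborel. sq y) \<partial>lborel)
      = ennreal (h * (\<sigma>\<^sup>2 * (\<integral>z. mom 0 z \<partial>lborel)))" .
  show "integrable lborel (\<lambda>z. LINT y:{z + c..z + c + h}|lborel. sq y)"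
    using * nn by (intro integrableI_nonneg) auto
  show "(\<integral>z. (LINT y:{z + c..z + c + h}|lborel. sq y) \<partial>lborel) = h * (\<sigma>\<^sup>2 * (\<integral>z. mom 0 z \<partial>lborel))"
    using * nn assms by (subst integral_eq_nn_integral) (auto simp: lborel_mom_0)
qed

text \<open>The tails of the mixture are not examined. Instead z is split at the conditional mean:
  \<open>cm z\<close> is at most D in modulus, and the square of the remaining distance is part of
  the integrable \<open>sq\<close>.\<close>

lemma integrable_quadratic_growth:
  assumes [measurable]: "f \<in> borel_measurable borel" and f: "\<And>z. \<bar>f z\<bar> \<le> A + B * z\<^sup>2" and B: "0 \<le> A" "0 \<le> B"
  shows "integrable lborel (\<lambda>z. f z * mom 0 z)"
proof (rule Bochner_Integration.integrable_bound)
  show "integrable lborel (\<lambda>z. (A + B * (2 * D\<^sup>2)) * mom 0 z + 2 * B * sq z)"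
    using lborel_mom_0 lborel_sq by simp
  show "AE z in lborel. norm (f z * mom 0 z) \<le> norm ((A + B * (2 * D\<^sup>2)) * mom 0 z + 2 * B * sq z)"
  proof (rule AE_I2)
    fix z
    have "z\<^sup>2 \<le> 2 * (cm z)\<^sup>2 + 2 * (cm z - z)\<^sup>2"
      using zero_le_power2[of "2 * cm z - z"] by (simp add: power2_eq_square algebra_simps)
    moreover have "(cm z)\<^sup>2 \<le> D\<^sup>2" using abs_cm_le[of z] by (metis abs_le_square_iff abs_of_nonneg D_nonneg)
    ultimately have "z\<^sup>2 * mom 0 z \<le> (2 * D\<^sup>2 + 2 * (cm z - z)\<^sup>2) * mom 0 z"
      using mom_0_pos[of z] by (intro mult_right_mono) auto
    also have "\<dots> \<le> 2 * D\<^sup>2 * mom 0 z + 2 * sq z"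
      unfolding sq_eq[of z] by (simp add: distrib_right)
    finally have "B * (z\<^sup>2 * mom 0 z) \<le> B * (2 * D\<^sup>2 * mom 0 z + 2 * sq z)"
      using B by (intro mult_left_mono)
    moreover have "\<bar>f z\<bar> * mom 0 z \<le> (A + B * z\<^sup>2) * mom 0 z"
      using f mom_0_pos[of z] by (intro mult_right_mono) auto
    ultimately have "\<bar>f z\<bar> * mom 0 z \<le> (A + B * (2 * D\<^sup>2)) * mom 0 z + 2 * B * sq z"
      by (simp add: algebra_simps)
    then show "norm (f z * mom 0 z) \<le> norm ((A + B * (2 * D\<^sup>2)) * mom 0 z + 2 * B * sq z)"
      using mom_0_pos[of z] by (simp add: abs_mult)
  qed
qed measurable

text \<open>After integration by parts only \<open>u\<close> occurs, which is bounded, and the derivative of \<open>del * mom 0\<close>.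
  The derivative of \<open>del\<close> at \<open>z\<close> is compared with its mean over a window of length \<open>h\<close> next to \<open>z\<close>.
  The parameter \<open>a\<close> comes from AM-GM for \<open>\<bar>del\<bar>\<close>.\<close>

lemma one_dimensional_bound:
  fixes s s1 u p :: "real \<Rightarrow> real" and L \<Lambda> h a :: real
  defines "del \<equiv> \<lambda>z. l0 z - s z"
  assumes s: "\<And>z. (s has_real_derivative s1 z) (at z)" "\<And>z. \<bar>s1 z\<bar> \<le> L"
      "\<And>x y. \<bar>s1 x - s1 y\<bar> \<le> L * \<bar>x - y\<bar>"
    and u: "\<And>z. (u has_real_derivative p z) (at z)" "\<And>z. \<bar>u z\<bar> \<le> 1" "\<And>z. \<bar>p z\<bar> \<le> \<Lambda>"
      "continuous_on UNIV p"
    and h: "0 < h" "h \<le> \<sigma>" and a: "0 < a"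
  shows "integrable lborel (\<lambda>z. p z * (del z * mom 0 z))"
    and "integrable lborel (\<lambda>z. (4 / h * (a + (del z)\<^sup>2 / a) + 8 * h * (L + D / \<sigma> ^ 4)) * mom 0 z)"
    and "\<bar>\<integral>z. p z * (del z * mom 0 z) \<partial>lborel\<bar>
      \<le> (\<integral>z. (4 / h * (a + (del z)\<^sup>2 / a) + 8 * h * (L + D / \<sigma> ^ 4)) * mom 0 z \<partial>lborel)"
proof -
  define del1 where "del1 z = l1 z - s1 z" for z
  have L0: "0 \<le> L" using s(2)[of 0] by (simp add: order_trans[OF abs_ge_zero])
  have s_cont: "continuous_on UNIV s" "continuous_on UNIV u"
    by (rule DERIV_continuous_on, rule has_field_derivative_at_within, rule s u)+
  have "L-lipschitz_on UNIV s1"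
    using s(3) L0 by (intro lipschitz_onI) (auto simp: dist_real_def)
  then have s1_cont: "continuous_on UNIV s1" by (rule lipschitz_on_continuous_on)
  note [measurable] = s_cont[THEN borel_measurable_continuous_onI]
    s1_cont[THEN borel_measurable_continuous_onI] u(4)[THEN borel_measurable_continuous_onI]
  have [measurable]: "del \<in> borel_measurable borel" "del1 \<in> borel_measurable borel"
    unfolding del_def del1_def [abs_def] by measurable
  have del_deriv: "(del has_real_derivative del1 z) (at z)" for z
    unfolding del_def del1_def by (intro derivative_intros has_real_derivative_l0 s)
  have l0_growth: "\<bar>l0 z\<bar> \<le> D / \<sigma>\<^sup>2 + 1 / \<sigma>\<^sup>2 * \<bar>z\<bar>" for z
  proof -
    have "\<bar>cm z - z\<bar> / \<sigma>\<^sup>2 \<le> (D + \<bar>z\<bar>) / \<sigma>\<^sup>2"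
      using abs_cm_le[of z] by (intro divide_right_mono) auto
    then show ?thesis by (simp add: l0_def add_divide_distrib)
  qed
  define A B where "A = D / \<sigma>\<^sup>2 + \<bar>s 0\<bar>" and "B = 1 / \<sigma>\<^sup>2 + L"
  have AB: "0 \<le> A" "0 \<le> B" using D_nonneg L0 by (auto simp: A_def B_def)
  have s_growth: "\<bar>s z\<bar> \<le> \<bar>s 0\<bar> + L * \<bar>z\<bar>" for z
    using Lipschitz_of_bounded_derivative[of s s1 L z 0] s by auto
  have del_growth: "\<bar>del z\<bar> \<le> A + B * \<bar>z\<bar>" for z
    using l0_growth[of z] s_growth[of z] by (simp add: del_def A_def B_def distrib_right)
  have square: "x\<^sup>2 \<le> 2 * c\<^sup>2 + 2 * b\<^sup>2 * z\<^sup>2" if "\<bar>x\<bar> \<le> c + b * \<bar>z\<bar>" for x c b z :: real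
  proof -
    have "x\<^sup>2 \<le> (c + b * \<bar>z\<bar>)\<^sup>2" using that by (metis abs_ge_zero order_trans abs_le_square_iff abs_of_nonneg)
    also have "\<dots> \<le> 2 * c\<^sup>2 + 2 * (b * \<bar>z\<bar>)\<^sup>2"
      using zero_le_power2[of "c - b * \<bar>z\<bar>"] by (simp add: power2_eq_square algebra_simps)
    finally show ?thesis by (simp add: power_mult_distrib)
  qed
  have i_del2: "integrable lborel (\<lambda>z. (del z)\<^sup>2 * mom 0 z)"
    using square[OF del_growth]
    by (intro integrable_quadratic_growth[where A = "2 * A\<^sup>2" and B = "2 * B\<^sup>2"]) auto
  have i_l02: "integrable lborel (\<lambda>z. (l0 z)\<^sup>2 * mom 0 z)"
    using square[OF l0_growth]
    by (intro integrable_quadratic_growth[where A = "2 * (D / \<sigma>\<^sup>2)\<^sup>2" and B = "2 * (1 / \<sigma>\<^sup>2)\<^sup>2"]) auto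
  have i_q: "integrable lborel (mom 0)" by (rule lborel_mom_0)
  have le_square: "\<bar>x\<bar> \<le> 1 + x\<^sup>2" for x :: real
    using zero_le_power2[of "\<bar>x\<bar> - 1"] by (simp add: power2_eq_square algebra_simps)
  have i_del: "integrable lborel (\<lambda>z. \<bar>del z\<bar> * mom 0 z)"
  proof (rule Bochner_Integration.integrable_bound)
    show "integrable lborel (\<lambda>z. mom 0 z + (del z)\<^sup>2 * mom 0 z)" using i_del2 i_q by simp
    show "AE z in lborel. norm (\<bar>del z\<bar> * mom 0 z) \<le> norm (mom 0 z + (del z)\<^sup>2 * mom 0 z)"
      using mult_right_mono[OF le_square mom_0_pos[THEN less_imp_le]] mom_0_pos
      by (auto simp: abs_mult distrib_right less_imp_le)
  qed measurable
  \<comment> \<open>The weight a \<sigma>^2 anticipates that \<open>l0\<close> squared integrates to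
    at most 1 / \<sigma>^2 times the mass; the two terms then take the form a and del^2 / a of the
    claim.\<close>
  have AM: "\<bar>del z * l0 z\<bar> \<le> 1 / (2 * \<sigma>) * ((del z)\<^sup>2 / a + a * \<sigma>\<^sup>2 * (l0 z)\<^sup>2)" for z
  proof -
    have "0 \<le> (\<bar>del z\<bar> - a * \<sigma> * \<bar>l0 z\<bar>)\<^sup>2 / (2 * \<sigma> * a)" using a \<sigma>_pos by simp
    also have "\<dots> = 1 / (2 * \<sigma>) * ((del z)\<^sup>2 / a + a * \<sigma>\<^sup>2 * (l0 z)\<^sup>2) - \<bar>del z * l0 z\<bar>"
      using a \<sigma>_pos by (simp add: field_simps power2_eq_square abs_mult)
    finally show ?thesis by simp
  qed
  have i_AM: "integrable lborel (\<lambda>z. 1 / (2 * \<sigma>) * ((del z)\<^sup>2 / a + a * \<sigma>\<^sup>2 * (l0 z)\<^sup>2) * mom 0 z)"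
  proof -
    have "integrable lborel (\<lambda>z. 1 / (2 * \<sigma>) * (1 / a * ((del z)\<^sup>2 * mom 0 z) + a * \<sigma>\<^sup>2 * ((l0 z)\<^sup>2 * mom 0 z)))"
      using i_del2 i_l02 by auto
    then show ?thesis by (simp add: algebra_simps)
  qed
  have i_dell: "integrable lborel (\<lambda>z. \<bar>del z * l0 z\<bar> * mom 0 z)"
  proof (rule Bochner_Integration.integrable_bound[OF i_AM])
    show "AE z in lborel. norm (\<bar>del z * l0 z\<bar> * mom 0 z)
        \<le> norm (1 / (2 * \<sigma>) * ((del z)\<^sup>2 / a + a * \<sigma>\<^sup>2 * (l0 z)\<^sup>2) * mom 0 z)"
    proof (rule AE_I2)
      fix z
      have "\<bar>del z * l0 z\<bar> * mom 0 z \<le> 1 / (2 * \<sigma>) * ((del z)\<^sup>2 / a + a * \<sigma>\<^sup>2 * (l0 z)\<^sup>2) * mom 0 z"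
        using AM[of z] mom_0_pos[of z] by (intro mult_right_mono) auto
      then show "norm (\<bar>del z * l0 z\<bar> * mom 0 z)
          \<le> norm (1 / (2 * \<sigma>) * ((del z)\<^sup>2 / a + a * \<sigma>\<^sup>2 * (l0 z)\<^sup>2) * mom 0 z)"
        using mom_0_pos[of z] unfolding real_norm_def
        by (intro order_trans[OF _ abs_ge_self]) (simp add: abs_mult)
    qed
  qed measurable
  have del1_bound: "\<bar>del1 z\<bar> \<le> (D\<^sup>2 / \<sigma>\<^sup>2 + 1) / \<sigma>\<^sup>2 + L" for z
    using l1_bound[of z] s(2)[of z] by (simp add: del1_def)
  have C0: "0 \<le> (D\<^sup>2 / \<sigma>\<^sup>2 + 1) / \<sigma>\<^sup>2 + L" using L0 by simp
  have i_del1: "integrable lborel (\<lambda>z. \<bar>del1 z\<bar> * mom 0 z)"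
    using del1_bound C0
    by (intro integrable_quadratic_growth[where A = "(D\<^sup>2 / \<sigma>\<^sup>2 + 1) / \<sigma>\<^sup>2 + L" and B = 0]) auto
  have bounded: "integrable lborel (\<lambda>z. f z * g z)"
    if "integrable lborel (\<lambda>z. \<bar>g z\<bar>)" "\<And>z. \<bar>f z\<bar> \<le> C"
      "f \<in> borel_measurable borel" "g \<in> borel_measurable borel" for f g :: "real \<Rightarrow> real" and C
  proof (rule Bochner_Integration.integrable_bound)
    show "integrable lborel (\<lambda>z. C * \<bar>g z\<bar>)" using that by simp
    show "AE z in lborel. norm (f z * g z) \<le> norm (C * \<bar>g z\<bar>)"
      using that(2) by (auto simp: abs_mult intro!: mult_right_mono order_trans[OF that(2) abs_ge_self])
  qed (use that in measurable)
  have q0: "0 \<le> mom 0 z" for z using mom_0_pos[of z] by simp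
  show pint: "integrable lborel (\<lambda>z. p z * (del z * mom 0 z))"
    by (rule bounded[OF _ u(3)]) (use i_del q0 in \<open>auto simp: abs_mult\<close>)
  \<comment> \<open>\<open>R\<close> collects the terms of the derivative of
    \<open>u * del * mom 0\<close> in which u is not differentiated. The whole derivative has
    integral 0, so \<open>R\<close> can replace the term with p.\<close>
  define R where "R z = u z * (del1 z * mom 0 z + (del z * l0 z) * mom 0 z)" for z
  have [measurable]: "R \<in> borel_measurable borel" unfolding R_def [abs_def] by measurable
  have "integrable lborel (\<lambda>z. \<bar>del1 z * mom 0 z + (del z * l0 z) * mom 0 z\<bar>)"
    by (rule Bochner_Integration.integrable_bound[OF Bochner_Integration.integrable_add[OF i_del1 i_dell]])
      (auto simp: abs_mult q0 intro!: order_trans[OF abs_triangle_ineq])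
  then have Rint: "integrable lborel R"
    unfolding R_def [abs_def] by (rule bounded[OF _ u(2)]) measurable
  have "(\<integral>z. p z * (del z * mom 0 z) + R z \<partial>lborel) = 0"
  proof (rule lborel_integral_deriv_eq_0)
    fix z
    show "((\<lambda>z. u z * (del z * mom 0 z)) has_real_derivative p z * (del z * mom 0 z) + R z) (at z)"
      by (auto intro!: derivative_eq_intros u del_deriv has_real_derivative_mom_0 simp: R_def algebra_simps)
  next
    show "continuous_on UNIV (\<lambda>z. p z * (del z * mom 0 z) + R z)"
      unfolding R_def del_def del1_def
      by (intro continuous_intros u s_cont s1_cont l0_continuous l1_continuous continuous_mom)
    show "integrable lborel (\<lambda>z. u z * (del z * mom 0 z))"
      by (rule bounded[OF _ u(2)]) (use i_del q0 in \<open>auto simp: abs_mult\<close>)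
    show "integrable lborel (\<lambda>z. p z * (del z * mom 0 z) + R z)"
      using pint Rint by simp
  qed
  then have eq: "(\<integral>z. p z * (del z * mom 0 z) \<partial>lborel) = - (\<integral>z. R z \<partial>lborel)"
    using pint Rint by simp
  define Q E1 E2 where "Q = (\<integral>z. mom 0 z \<partial>lborel)" and "E1 = (\<integral>z. \<bar>del z\<bar> * mom 0 z \<partial>lborel)"
    and "E2 = (\<integral>z. (del z)\<^sup>2 * mom 0 z \<partial>lborel)"
  have Q0: "0 \<le> Q" unfolding Q_def using q0 by simp
  have E20: "0 \<le> E2" unfolding E2_def using q0 by simp
  define W where "W c z = (LINT y:{z + c..z + c + h}|lborel. sq y)" for c z
  have W: "integrable lborel (W c)" "(\<integral>z. W c z \<partial>lborel) = h * (\<sigma>\<^sup>2 * Q)" for c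
    using lborel_window_sq[of h c] h unfolding W_def Q_def by auto
  define G where "G z = \<bar>del z\<bar> * mom 0 z" for z
  have G: "integrable lborel (\<lambda>z. G (z + c))" "(\<integral>z. G (z + c) \<partial>lborel) = E1" for c
    using lborel_integral_real_affine[of 1 G c] lborel_integrable_real_affine[of G 1 c] i_del
    by (auto simp: add.commute G_def [abs_def] E1_def)
  \<comment> \<open>A majorant of \<open>\<bar>del1 z\<bar> * mom 0 z\<close>. The two windows share
    the endpoint z; the others are z - h and z + h. Writing \<open>z + 0\<close> keeps all three
    values of G in the form of translates.\<close>
  define H where "H z = (2 * G (z + - h) + 2 * G (z + h) + 2 * G (z + 0)) / h
      + 4 * D / \<sigma> ^ 6 * (W (- h) z + W 0 z) + 2 * L * h * mom 0 z" for z
  have Hint: "integrable lborel H" unfolding H_def [abs_def] using G[of "- h"] G[of h] G[of 0] W i_q by simp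
  have HI: "(\<integral>z. H z \<partial>lborel) = 6 / h * E1 + 8 * D / \<sigma> ^ 4 * h * Q + 2 * L * h * Q"
  proof -
    have "(\<integral>z. H z \<partial>lborel) = (2 * E1 + 2 * E1 + 2 * E1) / h + 4 * D / \<sigma> ^ 6 * (h * (\<sigma>\<^sup>2 * Q) + h * (\<sigma>\<^sup>2 * Q)) + 2 * L * h * Q"
      unfolding H_def using G[of "- h"] G[of h] G[of 0] W i_q by (simp add: Q_def)
    also have "\<dots> = 6 / h * E1 + 8 * D / \<sigma> ^ 4 * h * Q + 2 * L * h * Q"
      using \<sigma>_pos by (simp add: field_simps eval_nat_numeral)
    finally show ?thesis .
  qed
  \<comment> \<open>One window at a time: v is the share of \<open>mom 0 z\<close> from the
    components centred on the side of this window, and x1 is its far endpoint. At x1 the share is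
    compared with twice the density there, at z with the density itself.\<close>
  have half: "v * \<bar>del1 z\<bar> \<le> (2 * G x1 + G z) / h
      + 4 * D / \<sigma> ^ 6 * (LINT y:{b..b + h}|lborel. sq y) + L * h * mom 0 z"
    if v: "0 \<le> v" "v \<le> mom 0 z" "\<And>x. x \<in> {b..b + h} \<Longrightarrow> v \<le> 2 * mom 0 x"
      and b: "b = z \<and> x1 = z + h \<or> b = z - h \<and> x1 = z - h" for v b z x1
  proof -
    define E where "E = (LINT y:{b..b + h}|lborel. \<bar>l2 y\<bar>) + L * h"
    have z: "z \<in> {b..b + h}" "x1 \<in> {b..b+h}" using b h by auto
    have "\<bar>del1 z\<bar> \<le> (\<bar>del b\<bar> + \<bar>del (b + h)\<bar>) / (b + h - b) + E"
    proof (rule abs_deriv_le_of_difference[where f = del and f' = del1])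
      fix x assume x: "x \<in> {b..b + h}"
      have "\<bar>s1 z - s1 x\<bar> \<le> L * \<bar>z - x\<bar>" by (rule s)
      also have "\<dots> \<le> L * h" using L0 x z by (intro mult_left_mono) auto
      finally show "\<bar>del1 z - del1 x\<bar> \<le> E"
        using l1_difference[OF z(1) x] unfolding E_def del1_def by linarith
    qed (use h del_deriv in auto)
    also have "\<bar>del b\<bar> + \<bar>del (b + h)\<bar> = \<bar>del x1\<bar> + \<bar>del z\<bar>" using b by auto
    finally have "v * \<bar>del1 z\<bar> \<le> v * ((\<bar>del x1\<bar> + \<bar>del z\<bar>) / h + E)"
      using v by (intro mult_left_mono) auto
    also have "\<dots> = (v * \<bar>del x1\<bar> + v * \<bar>del z\<bar>) / h + v * (LINT y:{b..b + h}|lborel. \<bar>l2 y\<bar>) + v * (L * h)"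
      by (simp add: E_def algebra_simps add_divide_distrib)
    also have "\<dots> \<le> (2 * G x1 + G z) / h + 4 * D / \<sigma> ^ 6 * (LINT y:{b..b + h}|lborel. sq y) + mom 0 z * (L * h)"
    proof (intro add_mono divide_right_mono half_times_l2 mult_right_mono v(1,2))
      show "v * \<bar>del x1\<bar> \<le> 2 * G x1"
        using mult_right_mono[OF v(3)[OF z(2)], of "\<bar>del x1\<bar>"] by (simp add: G_def mult_ac)
      show "v * \<bar>del z\<bar> \<le> G z"
        using mult_right_mono[OF v(2), of "\<bar>del z\<bar>"] by (simp add: G_def mult_ac)
    qed (use v h L0 in auto)
    finally show ?thesis by (simp add: mult_ac)
  qed
  have del1_le: "\<bar>del1 z\<bar> * mom 0 z \<le> H z" for z
  proof -
    have "lower z * \<bar>del1 z\<bar> \<le> (2 * G (z - h) + G z) / h + 4 * D / \<sigma> ^ 6 * (LINT y:{z - h..z - h + h}|lborel. sq y) + L * h * mom 0 z"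
      using lower_upper[of z] upper_nonneg[of z] lower_nonneg[of z] h by (intro half lower_le) auto
    moreover have "upper z * \<bar>del1 z\<bar> \<le> (2 * G (z + h) + G z) / h + 4 * D / \<sigma> ^ 6 * (LINT y:{z..z + h}|lborel. sq y) + L * h * mom 0 z"
      using lower_upper[of z] upper_nonneg[of z] lower_nonneg[of z] h by (intro half upper_le) auto
    ultimately have "(lower z + upper z) * \<bar>del1 z\<bar> \<le> H z"
      by (simp add: H_def W_def distrib_right distrib_left add_divide_distrib)
    then show ?thesis by (simp add: lower_upper mult.commute)
  qed
  have "\<bar>\<integral>z. R z \<partial>lborel\<bar> \<le> (\<integral>z. H z + 1 / (2 * \<sigma>) * ((del z)\<^sup>2 / a + a * \<sigma>\<^sup>2 * (l0 z)\<^sup>2) * mom 0 z \<partial>lborel)"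
  proof (rule integral_abs_bound[THEN order_trans], rule integral_mono)
    fix z
    have "\<bar>R z\<bar> \<le> 1 * \<bar>del1 z * mom 0 z + (del z * l0 z) * mom 0 z\<bar>"
      unfolding R_def abs_mult[of "u z"] by (rule mult_right_mono[OF u(2)]) simp
    also have "\<dots> \<le> \<bar>del1 z\<bar> * mom 0 z + \<bar>del z * l0 z\<bar> * mom 0 z"
      using q0[of z] by (auto intro!: order_trans[OF abs_triangle_ineq] simp: abs_mult)
    also have "\<dots> \<le> H z + 1 / (2 * \<sigma>) * ((del z)\<^sup>2 / a + a * \<sigma>\<^sup>2 * (l0 z)\<^sup>2) * mom 0 z"
      by (intro add_mono del1_le mult_right_mono AM q0)
    finally show "\<bar>R z\<bar> \<le> H z + 1 / (2 * \<sigma>) * ((del z)\<^sup>2 / a + a * \<sigma>\<^sup>2 * (l0 z)\<^sup>2) * mom 0 z" .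
  qed (use Rint Hint i_AM in auto)
  also have "\<dots> = 6 / h * E1 + 8 * D / \<sigma> ^ 4 * h * Q + 2 * L * h * Q
      + (\<integral>z. 1 / (2 * \<sigma>) * (1 / a * ((del z)\<^sup>2 * mom 0 z) + a * \<sigma>\<^sup>2 * ((l0 z)\<^sup>2 * mom 0 z)) \<partial>lborel)"
    using Hint i_AM by (simp add: HI algebra_simps)
  also have "(\<integral>z. 1 / (2 * \<sigma>) * (1 / a * ((del z)\<^sup>2 * mom 0 z) + a * \<sigma>\<^sup>2 * ((l0 z)\<^sup>2 * mom 0 z)) \<partial>lborel)
      = 1 / (2 * \<sigma>) * (1 / a * E2 + a * \<sigma>\<^sup>2 * (\<integral>z. (l0 z)\<^sup>2 * mom 0 z \<partial>lborel))"
    unfolding E2_def using i_del2 i_l02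
    by (simp only: integral_mult_right_zero Bochner_Integration.integral_add integrable_mult_right)
  also have "\<dots> \<le> 1 / (2 * \<sigma>) * (1 / a * E2 + a * Q)"
  proof -
    have "(\<integral>z. (l0 z)\<^sup>2 * mom 0 z \<partial>lborel) \<le> (\<integral>z. sq z / \<sigma> ^ 4 \<partial>lborel)"
      using i_l02 lborel_sq l0_square_le by (intro integral_mono) auto
    also have "\<dots> = Q / \<sigma>\<^sup>2"
      using \<sigma>_pos by (simp add: lborel_sq Q_def field_simps eval_nat_numeral)
    finally have "a * \<sigma>\<^sup>2 * (\<integral>z. (l0 z)\<^sup>2 * mom 0 z \<partial>lborel) \<le> a * \<sigma>\<^sup>2 * (Q / \<sigma>\<^sup>2)"
      using a by (intro mult_left_mono) auto
    then show ?thesis using \<sigma>_pos by (intro mult_left_mono) auto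
  qed
  \<comment> \<open>h \<le> \<sigma> merges this term with those of order 1 / h.\<close>
  also have "\<dots> \<le> 1 / (2 * h) * (1 / a * E2 + a * Q)"
    using h a E20 Q0 by (intro mult_right_mono divide_left_mono) auto
  also have "6 / h * E1 \<le> 6 / h * (a / 2 * Q + 1 / (2 * a) * E2)"
  proof (intro mult_left_mono)
    have "E1 \<le> (\<integral>z. a / 2 * mom 0 z + 1 / (2 * a) * ((del z)\<^sup>2 * mom 0 z) \<partial>lborel)"
      unfolding E1_def
    proof (rule integral_mono)
      fix z
      have "0 \<le> (\<bar>del z\<bar> - a)\<^sup>2 / (2 * a)" using a by simp
      then have "\<bar>del z\<bar> \<le> a / 2 + 1 / (2 * a) * (del z)\<^sup>2"
        using a by (simp add: field_simps power2_eq_square)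
      then have "\<bar>del z\<bar> * mom 0 z \<le> (a / 2 + 1 / (2 * a) * (del z)\<^sup>2) * mom 0 z"
        using q0 by (intro mult_right_mono)
      then show "\<bar>del z\<bar> * mom 0 z \<le> a / 2 * mom 0 z + 1 / (2 * a) * ((del z)\<^sup>2 * mom 0 z)"
        by (simp add: distrib_right mult.assoc)
    qed (use i_del i_del2 i_q in auto)
    also have "\<dots> = a / 2 * Q + 1 / (2 * a) * E2"
      unfolding Q_def E2_def using i_del2 i_q by simp
    finally show "E1 \<le> a / 2 * Q + 1 / (2 * a) * E2" .
  qed (use h in auto)
  finally have fin: "\<bar>\<integral>z. R z \<partial>lborel\<bar> \<le> 6 / h * (a / 2 * Q + 1 / (2 * a) * E2) + 8 * D / \<sigma> ^ 4 * h * Q + 2 * L * h * Q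
      + 1 / (2 * h) * (1 / a * E2 + a * Q)" by simp
  have rhs: "(\<lambda>z. (4 / h * (a + (del z)\<^sup>2 / a) + 8 * h * (L + D / \<sigma> ^ 4)) * mom 0 z)
    = (\<lambda>z. (4 / h * a + 8 * h * (L + D / \<sigma> ^ 4)) * mom 0 z + 4 / h / a * ((del z)\<^sup>2 * mom 0 z))"
    by (simp add: algebra_simps fun_eq_iff)
  show "integrable lborel (\<lambda>z. (4 / h * (a + (del z)\<^sup>2 / a) + 8 * h * (L + D / \<sigma> ^ 4)) * mom 0 z)"
    unfolding rhs using i_q i_del2 by simp
  have X: "(\<integral>z. (4 / h * (a + (del z)\<^sup>2 / a) + 8 * h * (L + D / \<sigma> ^ 4)) * mom 0 z \<partial>lborel)
    = (4 / h * a + 8 * h * (L + D / \<sigma> ^ 4)) * Q + 4 / h / a * E2"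
    unfolding rhs Q_def E2_def using i_q i_del2 by simp
  \<comment> \<open>The last bracket on the left is slack. It rounds the coefficients 7/2 of a and
    of del^2 / a up to 4, and 2 L up to 8 L, which gives the claim its compact form.\<close>
  have Y: "6 / h * (a / 2 * Q + 1 / (2 * a) * E2) + 8 * D / \<sigma> ^ 4 * h * Q + 2 * L * h * Q
      + 1 / (2 * h) * (1 / a * E2 + a * Q) + (1 / (2 * h) * (1 / a * E2 + a * Q) + 6 * L * h * Q)
    = (4 / h * a + 8 * h * (L + D / \<sigma> ^ 4)) * Q + 4 / h / a * E2"
    using h a by (simp add: field_simps)
  have P: "0 \<le> 1 / (2 * h) * (1 / a * E2 + a * Q) + 6 * L * h * Q"
    using h a E20 Q0 L0 by simp
  have final: "R \<le> X" if "X = Y" "Z + P = Y" "0 \<le> P" "R \<le> Z" for R X Y Z P :: real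
    using that by linarith
  show "\<bar>\<integral>z. p z * (del z * mom 0 z) \<partial>lborel\<bar>
      \<le> (\<integral>z. (4 / h * (a + (del z)\<^sup>2 / a) + 8 * h * (L + D / \<sigma> ^ 4)) * mom 0 z \<partial>lborel)"
    unfolding eq abs_minus by (rule final[OF X Y P fin])
qed

end

section \<open>Gaussian kernels and measurability in product spaces\<close>

lemma tendsto_coordinatewise:
  fixes f :: "'b \<Rightarrow> 'a \<Rightarrow> 'c::topological_space"
  assumes "\<And>i. ((\<lambda>n. f n i) \<longlongrightarrow> x i) F"
  shows "(f \<longlongrightarrow> x) F"
  using limitin_componentwise[of "\<lambda>_. euclidean" UNIV f x F] assms
  by (simp add: euclidean_product_topology)

lemma space_leb [simp]: "space (leb d) = Rd d"
  by (simp add: space_PiM)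

lemma product_sigma_finite_lborel: "product_sigma_finite (\<lambda>_::nat. lborel :: real measure)"
  by standard

lemma sigma_finite_leb: "sigma_finite_measure (leb d)"
  using product_sigma_finite_lborel by (rule product_sigma_finite.sigma_finite) simp

lemma prob_space_std_gaussian: "prob_space (std_gaussian d)"
  unfolding std_gaussian_def by (intro prob_space_PiM prob_space_normal_density) simp

lemma sets_std_gaussian [measurable_cong]: "sets (std_gaussian d) = sets (leb d)"
  unfolding std_gaussian_def by (intro sets_PiM_cong) auto

lemma space_std_gaussian [simp]: "space (std_gaussian d) = Rd d"
  using sets_eq_imp_space_eq[OF sets_std_gaussian, of d] by simp

definition gauss_kernel :: "nat \<Rightarrow> real \<Rightarrow> (nat \<Rightarrow> real) \<Rightarrow> (nat \<Rightarrow> real) \<Rightarrow> real" where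
  "gauss_kernel d \<sigma> c x = (\<Prod>i<d. normal_density (c i) \<sigma> (x i))"

lemma gauss_kernel_nonneg: "0 \<le> gauss_kernel d \<sigma> c x"
  unfolding gauss_kernel_def by (intro prod_nonneg) auto

lemma gauss_kernel_pos: "0 < \<sigma> \<Longrightarrow> 0 < gauss_kernel d \<sigma> c x"
  unfolding gauss_kernel_def by (intro prod_pos) (auto intro: normal_density_pos)

lemma gauss_kernel_le: "0 < \<sigma> \<Longrightarrow> gauss_kernel d \<sigma> c x \<le> (1 / sqrt (2 * pi * \<sigma>\<^sup>2)) ^ d"
  unfolding gauss_kernel_def
  using prod_mono[of "{..<d}" "\<lambda>i. normal_density (c i) \<sigma> (x i)" "\<lambda>_. 1 / sqrt (2 * pi * \<sigma>\<^sup>2)"]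
  by (auto simp: normal_density_le)

lemma measurable_gauss_kernel [measurable (raw)]:
  assumes [measurable]: "f \<in> measurable M (leb d)" "\<And>i. i < d \<Longrightarrow> (\<lambda>w. c w i) \<in> borel_measurable M"
  shows "(\<lambda>w. gauss_kernel d \<sigma> (c w) (f w)) \<in> borel_measurable M"
proof -
  have [measurable]: "(\<lambda>w. f w i) \<in> borel_measurable M" if "i < d" for i
    using measurable_compose[OF assms(1) measurable_component_singleton[of i]] that by simp
  show ?thesis
    unfolding gauss_kernel_def normal_density_def by (intro borel_measurable_prod) simp
qed

lemma density_gauss_kernel:
  assumes "0 < \<sigma>"
  shows "density (leb d) (\<lambda>x. ennreal (gauss_kernel d \<sigma> c x))
    = PiM {..<d} (\<lambda>i. density lborel (\<lambda>u. ennreal (normal_density (c i) \<sigma> u)))"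
proof (rule product_sigma_finite.PiM_eqI)
  interpret prob_space "density lborel (\<lambda>u. ennreal (normal_density (c i) \<sigma> u))" for i
    using assms by (rule prob_space_normal_density)
  show "product_sigma_finite (\<lambda>i. density lborel (\<lambda>u. ennreal (normal_density (c i) \<sigma> u)))"
    by standard
  show "sets (density (leb d) (\<lambda>x. ennreal (gauss_kernel d \<sigma> c x)))
    = sets (PiM {..<d} (\<lambda>i. density lborel (\<lambda>u. ennreal (normal_density (c i) \<sigma> u))))"
    by (simp, intro sets_PiM_cong) auto
  fix A assume "\<And>i. i \<in> {..<d} \<Longrightarrow> A i \<in> sets (density lborel (\<lambda>u. ennreal (normal_density (c i) \<sigma> u)))"
  then have A [measurable]: "\<And>i. i < d \<Longrightarrow> A i \<in> sets borel" by auto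
  have "emeasure (density (leb d) (\<lambda>x. ennreal (gauss_kernel d \<sigma> c x))) (Pi\<^sub>E {..<d} A)
    = (\<integral>\<^sup>+x. ennreal (gauss_kernel d \<sigma> c x) * indicator (Pi\<^sub>E {..<d} A) x \<partial>leb d)"
    by (subst emeasure_density) (auto intro!: sets_PiM_I_finite)
  also have "\<dots> = (\<integral>\<^sup>+x. (\<Prod>i<d. ennreal (normal_density (c i) \<sigma> (x i)) * indicator (A i) (x i)) \<partial>leb d)"
  proof (rule nn_integral_cong)
    fix x assume "x \<in> space (leb d)"
    then have "indicator (Pi\<^sub>E {..<d} A) x = (\<Prod>i<d. indicator (A i) (x i) :: ennreal)"
      by (auto simp: indicator_def PiE_iff prod_zero_iff split: if_splits)
    then show "ennreal (gauss_kernel d \<sigma> c x) * indicator (Pi\<^sub>E {..<d} A) x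
      = (\<Prod>i<d. ennreal (normal_density (c i) \<sigma> (x i)) * indicator (A i) (x i))"
      by (simp add: gauss_kernel_def prod.distrib prod_ennreal)
  qed
  also have "\<dots> = (\<Prod>i<d. \<integral>\<^sup>+u. ennreal (normal_density (c i) \<sigma> u) * indicator (A i) u \<partial>lborel)"
    by (rule product_sigma_finite.product_nn_integral_prod[OF product_sigma_finite_lborel]) auto
  also have "\<dots> = (\<Prod>i<d. emeasure (density lborel (\<lambda>u. ennreal (normal_density (c i) \<sigma> u))) (A i))"
    by (intro prod.cong refl, subst emeasure_density) auto
  finally show "emeasure (density (leb d) (\<lambda>x. ennreal (gauss_kernel d \<sigma> c x))) (Pi\<^sub>E {..<d} A)
    = (\<Prod>i\<in>{..<d}. emeasure (density lborel (\<lambda>u. ennreal (normal_density (c i) \<sigma> u))) (A i))" .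
qed simp

lemma distr_normal_density_affine:
  assumes "0 < \<sigma>"
  shows "distr (density lborel (\<lambda>u. ennreal (std_normal_density u))) lborel (\<lambda>w. c + \<sigma> * w)
    = density lborel (\<lambda>u. ennreal (normal_density c \<sigma> u))"
proof -
  let ?N = "density lborel (\<lambda>u. ennreal (std_normal_density u))"
  interpret prob_space ?N by (rule prob_space_normal_density) simp
  have "distr ?N lborel (\<lambda>x. x) = distr ?N ?N (\<lambda>x. x)" by (rule distr_cong) auto
  then have "distributed ?N lborel (\<lambda>x. x) std_normal_density"
    unfolding distributed_def by simp
  from normal_density_affine[OF this, of \<sigma> c] assms show ?thesis
    by (simp add: distributed_def)
qed

lemma distr_std_gaussian_affine:
  assumes "0 < \<sigma>"
  shows "distr (std_gaussian d) (leb d) (\<lambda>w. \<lambda>i\<in>{..<d}. c i + \<sigma> * w i)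
    = density (leb d) (\<lambda>x. ennreal (gauss_kernel d \<sigma> c x))"
  unfolding density_gauss_kernel[OF assms]
proof (rule product_sigma_finite.PiM_eqI)
  interpret prob_space "density lborel (\<lambda>u. ennreal (normal_density (c i) \<sigma> u))" for i
    using assms by (rule prob_space_normal_density)
  show "product_sigma_finite (\<lambda>i. density lborel (\<lambda>u. ennreal (normal_density (c i) \<sigma> u)))"
    by standard
  let ?N = "density lborel (\<lambda>u. ennreal (std_normal_density u))"
  interpret N: prob_space ?N by (rule prob_space_normal_density) simp
  interpret P: product_sigma_finite "\<lambda>_::nat. ?N" by standard
  show "sets (distr (std_gaussian d) (leb d) (\<lambda>w. \<lambda>i\<in>{..<d}. c i + \<sigma> * w i))
    = sets (PiM {..<d} (\<lambda>i. density lborel (\<lambda>u. ennreal (normal_density (c i) \<sigma> u))))"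
    by (simp, intro sets_PiM_cong) auto
  fix A assume "\<And>i. i \<in> {..<d} \<Longrightarrow> A i \<in> sets (density lborel (\<lambda>u. ennreal (normal_density (c i) \<sigma> u)))"
  then have A [measurable]: "\<And>i. i < d \<Longrightarrow> A i \<in> sets borel" by auto
  have pre: "(\<lambda>u. c i + \<sigma> * u) -` A i \<in> sets borel" if "i < d" for i
    using measurable_sets[of "\<lambda>u. c i + \<sigma> * u" borel borel "A i"] that by simp
  have "emeasure (distr (std_gaussian d) (leb d) (\<lambda>w. \<lambda>i\<in>{..<d}. c i + \<sigma> * w i)) (Pi\<^sub>E {..<d} A)
    = emeasure (std_gaussian d) ((\<lambda>w. \<lambda>i\<in>{..<d}. c i + \<sigma> * w i) -` Pi\<^sub>E {..<d} A \<inter> space (std_gaussian d))"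
    by (rule emeasure_distr) (auto intro!: sets_PiM_I_finite)
  also have "(\<lambda>w. \<lambda>i\<in>{..<d}. c i + \<sigma> * w i) -` Pi\<^sub>E {..<d} A \<inter> space (std_gaussian d)
    = Pi\<^sub>E {..<d} (\<lambda>i. (\<lambda>u. c i + \<sigma> * u) -` A i)"
    by (auto simp: PiE_iff extensional_def)
  also have "emeasure (std_gaussian d) \<dots> = (\<Prod>i<d. emeasure ?N ((\<lambda>u. c i + \<sigma> * u) -` A i))"
    unfolding std_gaussian_def using pre by (intro P.emeasure_PiM) auto
  also have "\<dots> = (\<Prod>i<d. emeasure (density lborel (\<lambda>u. ennreal (normal_density (c i) \<sigma> u))) (A i))"
    unfolding distr_normal_density_affine[OF assms, symmetric]
    by (intro prod.cong refl, subst emeasure_distr) auto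
  finally show "emeasure (distr (std_gaussian d) (leb d) (\<lambda>w. \<lambda>i\<in>{..<d}. c i + \<sigma> * w i)) (Pi\<^sub>E {..<d} A)
    = (\<Prod>i\<in>{..<d}. emeasure (density lborel (\<lambda>u. ennreal (normal_density (c i) \<sigma> u))) (A i))" .
qed simp

text \<open>The set where f and g differ is relatively open in \<open>Rd d\<close> as a subspace of
  \<open>nat \<Rightarrow> real\<close>. A basic box around x restricts to a d-dimensional box
  inside this set, because all points of \<open>Rd d\<close> agree in the coordinates from d on. A
  product of nonempty open sets has positive Lebesgue measure.\<close>

lemma AE_eq_continuous_imp_eq:
  fixes f g :: "(nat \<Rightarrow> real) \<Rightarrow> real"
  assumes f: "continuous_on (Rd d) f" and g: "continuous_on (Rd d) g"
    and eq: "AE x in leb d. f x = g x" and x: "x \<in> Rd d"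
  shows "f x = g x"
proof (rule ccontr)
  assume ne: "f x \<noteq> g x"
  have "continuous_on (Rd d) (\<lambda>x. f x - g x)" using f g by (rule continuous_on_diff)
  from continuous_on_open_invariant[THEN iffD1, OF this, rule_format, of "- {0}"]
  obtain V where V: "open V" "V \<inter> Rd d = (\<lambda>x. f x - g x) -` (- {0}) \<inter> Rd d" by auto
  have "x \<in> V" using V(2) x ne by auto
  moreover have "openin (product_topology (\<lambda>_. euclidean) UNIV) V"
    using V(1) by (simp add: open_fun_def)
  ultimately obtain X where X: "x \<in> Pi\<^sub>E UNIV X" "\<And>i. open (X i)" "Pi\<^sub>E UNIV X \<subseteq> V"
    using product_topology_open_contains_basis[of "\<lambda>_. euclidean" UNIV V x]
    by (metis open_openin)
  have sub: "Pi\<^sub>E {..<d} X \<subseteq> {x \<in> space (leb d). f x \<noteq> g x}"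
  proof
    fix y assume y: "y \<in> Pi\<^sub>E {..<d} X"
    have "y i \<in> X i" for i
    proof (cases "i < d")
      case False
      then have "y i = x i" using y x by (auto simp: PiE_iff extensional_def)
      then show ?thesis using X(1) by auto
    qed (use y in auto)
    then have "y \<in> V" using X(3) by auto
    moreover have "y \<in> Rd d" using y by (auto simp: PiE_iff)
    ultimately show "y \<in> {x \<in> space (leb d). f x \<noteq> g x}" using V(2) by auto
  qed
  from eq obtain N where N: "N \<in> null_sets (leb d)" "{x \<in> space (leb d). f x \<noteq> g x} \<subseteq> N"
    by (auto simp: eventually_ae_filter)
  interpret product_sigma_finite "\<lambda>_::nat. lborel :: real measure" by (rule product_sigma_finite_lborel)
  have "emeasure (leb d) (Pi\<^sub>E {..<d} X) = (\<Prod>i<d. emeasure lborel (X i))"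
    using X(2) by (intro emeasure_PiM) auto
  moreover have "emeasure lborel (X i) \<noteq> 0" for i
  proof
    assume "emeasure lborel (X i) = 0"
    then have "X i \<in> null_sets lborel" using X(2) by (auto intro!: null_setsI)
    then have "negligible (X i)"
      by (simp add: negligible_iff_null_sets null_sets_completionI)
    then show False using open_not_negligible[of "X i"] X(1,2) by (auto simp: PiE_iff)
  qed
  ultimately have "emeasure (leb d) (Pi\<^sub>E {..<d} X) \<noteq> 0" by (simp add: prod_zero_iff)
  moreover have "emeasure (leb d) (Pi\<^sub>E {..<d} X) \<le> emeasure (leb d) N"
    using sub N by (intro emeasure_mono) auto
  ultimately show False using N(1) by auto
qed

text \<open>A function measurable in \<open>t\<close> and continuous in \<open>x\<close> is a pointwise limit of functions of \<open>t\<close> and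
  of \<open>x\<close> rounded to a grid, which are jointly measurable because the grid is countable.\<close>

lemma measurable_Caratheodory:
  fixes f :: "'a \<Rightarrow> (nat \<Rightarrow> real) \<Rightarrow> real"
  assumes meas: "\<And>x. x \<in> Rd d \<Longrightarrow> (\<lambda>t. f t x) \<in> borel_measurable M"
    and cont: "\<And>t. t \<in> space M \<Longrightarrow> continuous_on (Rd d) (f t)"
  shows "(\<lambda>(t, x). f t x) \<in> borel_measurable (M \<Otimes>\<^sub>M leb d)"
proof -
  define r where "r n x = (\<lambda>i\<in>{..<d}. real_of_int \<lfloor>real (Suc n) * x i\<rfloor> / real (Suc n))" for n x
  have r: "r n x \<in> Rd d" for n x by (auto simp: r_def)
  define I where "I = PiE {..<d} (\<lambda>_. UNIV :: int set)"
  have "countable I" unfolding I_def by (intro countable_PiE) auto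
  define g where "g x = (\<lambda>i\<in>{..<d}. \<lfloor>x i\<rfloor>)" for x :: "nat \<Rightarrow> real"
  define rr where "rr n k = (\<lambda>i\<in>{..<d}. real_of_int (k i) / real (Suc n))" for n and k :: "nat \<Rightarrow> int"
  have meas_n: "(\<lambda>(t, x). f t (r n x)) \<in> borel_measurable (M \<Otimes>\<^sub>M leb d)" for n
  proof -
    define k where "k = (\<lambda>p :: 'a \<times> (nat \<Rightarrow> real). \<lambda>i\<in>{..<d}. \<lfloor>real (Suc n) * snd p i\<rfloor>)"
    have k: "k \<in> measurable (M \<Otimes>\<^sub>M leb d) (count_space I)"
    proof (subst measurable_count_space_eq_countable[OF \<open>countable I\<close>], intro conjI ballI)
      fix a assume "a \<in> I"
      then have "k -` {a} \<inter> space (M \<Otimes>\<^sub>M leb d)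
          = {p \<in> space (M \<Otimes>\<^sub>M leb d). \<forall>i\<in>{..<d}. \<lfloor>real (Suc n) * snd p i\<rfloor> = a i}"
        by (auto simp: k_def I_def PiE_iff extensional_def fun_eq_iff)
      also have "\<dots> \<in> sets (M \<Otimes>\<^sub>M leb d)" by measurable
      finally show "k -` {a} \<inter> space (M \<Otimes>\<^sub>M leb d) \<in> sets (M \<Otimes>\<^sub>M leb d)" .
    qed (auto simp: k_def I_def)
    have "(\<lambda>p. (\<lambda>j p. f (fst p) (rr n j)) (k p) p) \<in> borel_measurable (M \<Otimes>\<^sub>M leb d)"
    proof (rule measurable_compose_countable'[OF _ k \<open>countable I\<close>])
      fix j
      have "rr n j \<in> Rd d" by (auto simp: rr_def)
      from meas[OF this] show "(\<lambda>p. f (fst p) (rr n j)) \<in> borel_measurable (M \<Otimes>\<^sub>M leb d)"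
        by (rule measurable_compose[OF measurable_fst])
    qed
    also have "(\<lambda>p. (\<lambda>j p. f (fst p) (rr n j)) (k p) p) = (\<lambda>(t, x). f t (r n x))"
      by (auto simp: fun_eq_iff k_def rr_def r_def intro!: arg_cong[where f = "f _"])
    finally show ?thesis .
  qed
  show ?thesis
  proof (rule borel_measurable_LIMSEQ_real[OF _ meas_n])
    fix p assume p: "p \<in> space (M \<Otimes>\<^sub>M leb d)"
    then obtain t x where tx: "p = (t, x)" "t \<in> space M" "x \<in> Rd d" by (auto simp: space_pair_measure)
    have "(\<lambda>n. r n x) \<longlonglongrightarrow> x"
    proof (rule tendsto_coordinatewise)
      fix i
      show "(\<lambda>n. r n x i) \<longlonglongrightarrow> x i"
      proof (cases "i < d")
        case True
        have "\<bar>r n x i - x i\<bar> \<le> 1 / real (Suc n)" for n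
        proof -
          have "\<bar>real_of_int \<lfloor>real (Suc n) * x i\<rfloor> - real (Suc n) * x i\<bar> \<le> 1" by linarith
          then have "\<bar>real_of_int \<lfloor>real (Suc n) * x i\<rfloor> - real (Suc n) * x i\<bar> / real (Suc n) \<le> 1 / real (Suc n)"
            by (rule divide_right_mono) simp
          then show ?thesis
            using True by (simp add: r_def field_simps flip: abs_divide)
        qed
        then show ?thesis
          by (intro LIM_zero_cancel[OF Lim_null_comparison[OF _ LIMSEQ_inverse_real_of_nat]])
            (auto simp: inverse_eq_divide)
      qed (use tx(3) in \<open>simp add: r_def PiE_iff extensional_def\<close>)
    qed
    then have "((f t) \<circ> (\<lambda>n. r n x)) \<longlonglongrightarrow> f t x"
      using cont[OF tx(2)] tx(3) r[of _ x] unfolding continuous_on_sequentially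
      by (elim allE[of _ x] allE[of _ "\<lambda>n. r n x"]) simp
    then have "(\<lambda>n. f t (r n x)) \<longlonglongrightarrow> f t x" by (simp add: comp_def)
    then show "(\<lambda>n. case p of (t, x) \<Rightarrow> f t (r n x)) \<longlonglongrightarrow> (case p of (t, x) \<Rightarrow> f t x)"
      by (simp add: tx)
  qed
qed

text \<open>Continuity refers to the subspace topology of \<open>nat \<Rightarrow> real\<close>,
  measurability to a finite product of Borel algebras. The previous lemma, with a one-point
  parameter space, connects the two.\<close>

lemma borel_measurable_continuous_Rd:
  fixes f :: "(nat \<Rightarrow> real) \<Rightarrow> real"
  assumes "continuous_on (Rd d) f"
  shows "f \<in> borel_measurable (leb d)"
proof -
  have "(\<lambda>(t::unit, x). f x) \<in> borel_measurable (count_space UNIV \<Otimes>\<^sub>M leb d)"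
    using assms by (intro measurable_Caratheodory) auto
  from measurable_compose[OF _ this, of "\<lambda>x. ((), x)" "leb d"] show ?thesis by simp
qed

section \<open>The forward density and its score\<close>

lemma tendsto_coordinate:
  fixes f :: "'b \<Rightarrow> 'a \<Rightarrow> 'c::topological_space"
  assumes "(f \<longlongrightarrow> x) F"
  shows "((\<lambda>n. f n i) \<longlongrightarrow> x i) F"
  using limitin_componentwise[of "\<lambda>_. euclidean" UNIV f x F] assms
  by (simp add: euclidean_product_topology)

definition sig :: "real \<Rightarrow> real" where "sig t = sqrt (1 - exp (- 2 * t))"

lemma sig_pos: "0 < t \<Longrightarrow> 0 < sig t"
  unfolding sig_def by simp

lemma sig_le_1: "sig t \<le> 1"
  unfolding sig_def by simp

lemma sig_square: "0 \<le> t \<Longrightarrow> (sig t)\<^sup>2 = 1 - exp (- 2 * t)"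
  unfolding sig_def by simp

definition ou :: "nat \<Rightarrow> real \<Rightarrow> (nat \<Rightarrow> real) \<Rightarrow> (nat \<Rightarrow> real) \<Rightarrow> nat \<Rightarrow> real" where
  "ou d t y w = (\<lambda>i\<in>{..<d}. exp (- t) * y i + sig t * w i)"

definition ou_kernel :: "nat \<Rightarrow> real \<Rightarrow> (nat \<Rightarrow> real) \<Rightarrow> (nat \<Rightarrow> real) \<Rightarrow> real" where
  "ou_kernel d t y x = gauss_kernel d (sig t) (\<lambda>i. exp (- t) * y i) x"

lemma ou_Rd [simp]: "ou d t y w \<in> Rd d"
  by (auto simp: ou_def)

lemma ou_kernel_nonneg: "0 \<le> ou_kernel d t y x"
  unfolding ou_kernel_def by (rule gauss_kernel_nonneg)

text \<open>Of the compact support only a bound for each coordinate is kept. It bounds the centres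
  of every one-dimensional slice.\<close>

locale bounded_data =
  fixes d :: nat and \<mu> :: "(nat \<Rightarrow> real) measure" and D :: real
  assumes prob_mu: "prob_space \<mu>" and sets_mu [measurable_cong]: "sets \<mu> = sets (leb d)"
    and bounded_mu: "\<And>i. i < d \<Longrightarrow> AE y in \<mu>. \<bar>y i\<bar> \<le> D"
begin

sublocale mu: prob_space \<mu> by (rule prob_mu)
sublocale gam: prob_space "std_gaussian d" by (rule prob_space_std_gaussian)
sublocale lebd: sigma_finite_measure "leb d" by (rule sigma_finite_leb)
sublocale mg: pair_prob_space \<mu> "std_gaussian d" ..
sublocale ml: pair_sigma_finite \<mu> "leb d" ..

abbreviation P where "P \<equiv> \<mu> \<Otimes>\<^sub>M std_gaussian d"

lemma space_mu [simp]: "space \<mu> = Rd d"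
  using sets_eq_imp_space_eq[OF sets_mu] by simp

lemma mu_component [measurable]: "i < d \<Longrightarrow> (\<lambda>y. y i) \<in> borel_measurable \<mu>"
  by (subst measurable_cong_sets[OF sets_mu refl]) simp

lemma ou_measurable [measurable]: "(\<lambda>(y, w). ou d t y w) \<in> measurable P (leb d)"
  unfolding ou_def split_beta by measurable

lemma ou_kernel_measurable [measurable]:
  "(\<lambda>(y, x). ou_kernel d t y x) \<in> borel_measurable (\<mu> \<Otimes>\<^sub>M leb d)"
  "x \<in> Rd d \<Longrightarrow> (\<lambda>y. ou_kernel d t y x) \<in> borel_measurable \<mu>"
  "(\<lambda>x. ou_kernel d t y x) \<in> borel_measurable (leb d)"
  unfolding ou_kernel_def split_beta by measurable

lemma distr_ou_given:
  assumes "0 < t"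
  shows "distr (std_gaussian d) (leb d) (ou d t y) = density (leb d) (\<lambda>x. ennreal (ou_kernel d t y x))"
  using distr_std_gaussian_affine[OF sig_pos[OF assms], of d "\<lambda>i. exp (- t) * y i"]
  by (simp add: ou_def [abs_def] ou_kernel_def)

text \<open>With the data point kept beside the position, the noise is a function of the pair.
  Expectations that contain the noise thus become integrals against the kernel, and integrating out
  the data point afterwards produces the score.\<close>

lemma joint_law:
  assumes "0 < t"
  shows "distr P (\<mu> \<Otimes>\<^sub>M leb d) (\<lambda>(y, w). (y, ou d t y w))
    = density (\<mu> \<Otimes>\<^sub>M leb d) (\<lambda>(y, x). ennreal (ou_kernel d t y x))"
proof (rule measure_eqI)
  fix A assume "A \<in> sets (distr P (\<mu> \<Otimes>\<^sub>M leb d) (\<lambda>(y, w). (y, ou d t y w)))"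
  then have A [measurable]: "A \<in> sets (\<mu> \<Otimes>\<^sub>M leb d)" by simp
  have "emeasure (distr P (\<mu> \<Otimes>\<^sub>M leb d) (\<lambda>(y, w). (y, ou d t y w))) A
    = (\<integral>\<^sup>+p. indicator A p \<partial>distr P (\<mu> \<Otimes>\<^sub>M leb d) (\<lambda>(y, w). (y, ou d t y w)))"
    by simp
  also have "\<dots> = (\<integral>\<^sup>+p. indicator A (fst p, ou d t (fst p) (snd p)) \<partial>P)"
    by (subst nn_integral_distr) (auto simp: split_beta')
  also have "\<dots> = (\<integral>\<^sup>+y. \<integral>\<^sup>+w. indicator A (y, ou d t y w) \<partial>std_gaussian d \<partial>\<mu>)"
    by (subst gam.nn_integral_fst[symmetric]) (auto simp: split_beta')
  also have "\<dots> = (\<integral>\<^sup>+y. \<integral>\<^sup>+x. ennreal (ou_kernel d t y x) * indicator A (y, x) \<partial>leb d \<partial>\<mu>)"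
  proof (rule nn_integral_cong)
    fix y assume y [measurable]: "y \<in> space \<mu>"
    have "(\<integral>\<^sup>+w. indicator A (y, ou d t y w) \<partial>std_gaussian d)
      = (\<integral>\<^sup>+x. indicator A (y, x) \<partial>distr (std_gaussian d) (leb d) (ou d t y))"
      using y by (subst nn_integral_distr) auto
    also have "\<dots> = (\<integral>\<^sup>+x. ennreal (ou_kernel d t y x) * indicator A (y, x) \<partial>leb d)"
      unfolding distr_ou_given[OF assms] using y by (subst nn_integral_density) auto
    finally show "(\<integral>\<^sup>+w. indicator A (y, ou d t y w) \<partial>std_gaussian d)
      = (\<integral>\<^sup>+x. ennreal (ou_kernel d t y x) * indicator A (y, x) \<partial>leb d)" .
  qed
  also have "\<dots> = (\<integral>\<^sup>+p. ennreal (ou_kernel d t (fst p) (snd p)) * indicator A p \<partial>(\<mu> \<Otimes>\<^sub>M leb d))"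
    by (subst lebd.nn_integral_fst[symmetric]) (auto simp: split_beta')
  also have "\<dots> = emeasure (density (\<mu> \<Otimes>\<^sub>M leb d) (\<lambda>(y, x). ennreal (ou_kernel d t y x))) A"
    by (subst emeasure_density) (auto simp: split_beta')
  finally show "emeasure (distr P (\<mu> \<Otimes>\<^sub>M leb d) (\<lambda>(y, w). (y, ou d t y w))) A
    = emeasure (density (\<mu> \<Otimes>\<^sub>M leb d) (\<lambda>(y, x). ennreal (ou_kernel d t y x))) A" .
qed simp

lemma integrable_joint:
  fixes f :: "(nat \<Rightarrow> real) \<Rightarrow> (nat \<Rightarrow> real) \<Rightarrow> real"
  assumes "0 < t" and [measurable]: "(\<lambda>(y, x). f y x) \<in> borel_measurable (\<mu> \<Otimes>\<^sub>M leb d)"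
  shows "integrable (\<mu> \<Otimes>\<^sub>M leb d) (\<lambda>(y, x). ou_kernel d t y x * f y x)
    \<longleftrightarrow> integrable P (\<lambda>(y, w). f y (ou d t y w))"
    and "(\<integral>p. (case p of (y, x) \<Rightarrow> ou_kernel d t y x * f y x) \<partial>(\<mu> \<Otimes>\<^sub>M leb d))
      = (\<integral>p. (case p of (y, w) \<Rightarrow> f y (ou d t y w)) \<partial>P)"
proof -
  have m: "(\<lambda>(y, w). (y, ou d t y w)) \<in> measurable P (\<mu> \<Otimes>\<^sub>M leb d)"
    by (simp add: split_beta')
  have d: "density (\<mu> \<Otimes>\<^sub>M leb d) (\<lambda>(y, x). ennreal (ou_kernel d t y x))
    = density (\<mu> \<Otimes>\<^sub>M leb d) (\<lambda>p. ennreal (ou_kernel d t (fst p) (snd p)))"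
    by (simp add: split_beta')
  have km: "(\<lambda>p. ou_kernel d t (fst p) (snd p)) \<in> borel_measurable (\<mu> \<Otimes>\<^sub>M leb d)"
    using ou_kernel_measurable(1) by (simp add: split_beta')
  have fm: "(\<lambda>p. f (fst p) (snd p)) \<in> borel_measurable (\<mu> \<Otimes>\<^sub>M leb d)"
    using assms(2) by (simp add: split_beta')
  show "integrable (\<mu> \<Otimes>\<^sub>M leb d) (\<lambda>(y, x). ou_kernel d t y x * f y x)
    \<longleftrightarrow> integrable P (\<lambda>(y, w). f y (ou d t y w))"
    using integrable_distr_eq[OF m fm] integrable_density[OF fm km]
    unfolding joint_law[OF assms(1)] d by (simp add: split_beta' ou_kernel_nonneg)
  show "(\<integral>p. (case p of (y, x) \<Rightarrow> ou_kernel d t y x * f y x) \<partial>(\<mu> \<Otimes>\<^sub>M leb d))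
      = (\<integral>p. (case p of (y, w) \<Rightarrow> f y (ou d t y w)) \<partial>P)"
    using integral_distr[OF m fm] integral_density[OF fm km]
    unfolding joint_law[OF assms(1)] d by (simp add: split_beta' ou_kernel_nonneg)
qed

definition mix :: "real \<Rightarrow> (nat \<Rightarrow> real) \<Rightarrow> real" where
  "mix t x = (\<integral>y. ou_kernel d t y x \<partial>\<mu>)"

lemma mix_nonneg: "0 \<le> mix t x"
  unfolding mix_def by (simp add: ou_kernel_nonneg)

lemma ou_kernel_le: "0 < t \<Longrightarrow> ou_kernel d t y x \<le> (1 / sqrt (2 * pi * (sig t)\<^sup>2)) ^ d"
  unfolding ou_kernel_def by (intro gauss_kernel_le sig_pos)

lemma integrable_ou_kernel:
  assumes "0 < t" "x \<in> Rd d" shows "integrable \<mu> (\<lambda>y. ou_kernel d t y x)"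
  using assms ou_kernel_le ou_kernel_nonneg
  by (intro mu.integrable_const_bound[where B = "(1 / sqrt (2 * pi * (sig t)\<^sup>2)) ^ d"]) auto

lemma mix_measurable [measurable]: "mix t \<in> borel_measurable (leb d)"
  unfolding mix_def [abs_def] by (rule mu.borel_measurable_lebesgue_integral) (simp add: split_beta)

lemma mix_continuous:
  assumes t: "0 < t"
  shows "continuous_on (Rd d) (mix t)"
  unfolding continuous_on_sequentially comp_def
proof (intro allI ballI impI, elim conjE)
  fix f x assume x: "x \<in> Rd d" and f: "\<forall>n. f n \<in> Rd d" "f \<longlonglongrightarrow> x"
  have fi: "(\<lambda>n. f n i) \<longlonglongrightarrow> x i" for i
    using f(2) by (rule tendsto_coordinate)
  show "(\<lambda>n. mix t (f n)) \<longlonglongrightarrow> mix t x"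
    unfolding mix_def
  proof (rule integral_dominated_convergence[where w = "\<lambda>_. (1 / sqrt (2 * pi * (sig t)\<^sup>2)) ^ d"])
    show "AE y in \<mu>. (\<lambda>n. ou_kernel d t y (f n)) \<longlonglongrightarrow> ou_kernel d t y x"
      unfolding ou_kernel_def gauss_kernel_def normal_density_def using sig_pos[OF t]
      by (intro AE_I2 tendsto_intros fi) auto
  qed (use x f t ou_kernel_le ou_kernel_nonneg in auto)
qed

lemma ou_law:
  assumes t: "0 < t"
  shows "distr P (leb d) (\<lambda>(y, w). ou d t y w) = density (leb d) (\<lambda>x. ennreal (mix t x))"
proof (rule measure_eqI)
  fix A assume "A \<in> sets (distr P (leb d) (\<lambda>(y, w). ou d t y w))"
  then have A [measurable]: "A \<in> sets (leb d)" by simp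
  have "emeasure (distr P (leb d) (\<lambda>(y, w). ou d t y w)) A
    = emeasure (distr P (\<mu> \<Otimes>\<^sub>M leb d) (\<lambda>(y, w). (y, ou d t y w))) (space \<mu> \<times> A)"
    by (subst (1 2) emeasure_distr)
      (auto simp: split_beta space_pair_measure intro!: arg_cong[where f = "emeasure P"])
  also have "\<dots> = (\<integral>\<^sup>+p. ennreal (ou_kernel d t (fst p) (snd p)) * indicator (space \<mu> \<times> A) p \<partial>(\<mu> \<Otimes>\<^sub>M leb d))"
    unfolding joint_law[OF t] by (subst emeasure_density) (auto simp: split_beta')
  also have "\<dots> = (\<integral>\<^sup>+x. \<integral>\<^sup>+y. ennreal (ou_kernel d t y x) * indicator (space \<mu> \<times> A) (y, x) \<partial>\<mu> \<partial>leb d)"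
    by (subst ml.nn_integral_snd[symmetric]) (auto simp: split_beta')
  also have "\<dots> = (\<integral>\<^sup>+x. ennreal (mix t x) * indicator A x \<partial>leb d)"
  proof (rule nn_integral_cong)
    fix x assume x: "x \<in> space (leb d)"
    have "(\<integral>\<^sup>+y. ennreal (ou_kernel d t y x) * indicator (space \<mu> \<times> A) (y, x) \<partial>\<mu>)
      = (\<integral>\<^sup>+y. ennreal (ou_kernel d t y x) * indicator A x \<partial>\<mu>)"
      by (intro nn_integral_cong) (auto simp: indicator_def)
    also have "\<dots> = (\<integral>\<^sup>+y. ennreal (ou_kernel d t y x) \<partial>\<mu>) * indicator A x"
      using x by (intro nn_integral_multc) auto
    also have "(\<integral>\<^sup>+y. ennreal (ou_kernel d t y x) \<partial>\<mu>) = ennreal (mix t x)"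
      unfolding mix_def using x t by (intro nn_integral_eq_integral integrable_ou_kernel) (auto simp: ou_kernel_nonneg)
    finally show "(\<integral>\<^sup>+y. ennreal (ou_kernel d t y x) * indicator (space \<mu> \<times> A) (y, x) \<partial>\<mu>)
      = ennreal (mix t x) * indicator A x" .
  qed
  also have "\<dots> = emeasure (density (leb d) (\<lambda>x. ennreal (mix t x))) A"
    by (subst emeasure_density) auto
  finally show "emeasure (distr P (leb d) (\<lambda>(y, w). ou d t y w)) A
    = emeasure (density (leb d) (\<lambda>x. ennreal (mix t x))) A" .
qed simp

text \<open>Replaces a density known only through its law and continuity by an explicit mixture, the
  form in which every estimate is made.\<close>

lemma forward_density_eq_mix:
  assumes q: "forward_density d \<mu> q" and t: "0 < t" and x: "x \<in> Rd d"
  shows "q t x = mix t x"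
proof (rule AE_eq_continuous_imp_eq[OF _ mix_continuous[OF t] _ x])
  have q': "continuous_on (Rd d) (q t)" "\<And>x. x \<in> Rd d \<Longrightarrow> 0 \<le> q t x"
    "distributed P (leb d) (\<lambda>(y, w). ou d t y w) (\<lambda>x. ennreal (q t x))"
    using q t unfolding forward_density_def ou_def sig_def by auto
  show "continuous_on (Rd d) (q t)" by fact
  have "density (leb d) (\<lambda>x. ennreal (q t x)) = density (leb d) (\<lambda>x. ennreal (mix t x))"
    using q'(3) ou_law[OF t] by (simp add: distributed_def)
  then have "AE x in leb d. ennreal (q t x) = ennreal (mix t x)"
    using q'(3) by (intro lebd.density_unique) (auto simp: distributed_def)
  with AE_space[of "leb d"] show "AE x in leb d. q t x = mix t x"
    by eventually_elim (auto simp: q'(2) mix_nonneg)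
qed

end

section \<open>Slices of the forward density along a coordinate axis\<close>

context bounded_data
begin

text \<open>As a function of the coordinate \<open>x i\<close> alone, the forward density is a one-dimensional Gaussian
  mixture with mixing measure \<open>slice i t x\<close>.\<close>

definition slice_weight :: "nat \<Rightarrow> real \<Rightarrow> (nat \<Rightarrow> real) \<Rightarrow> (nat \<Rightarrow> real) \<Rightarrow> real" where
  "slice_weight i t x y = (\<Prod>j\<in>{..<d} - {i}. normal_density (exp (- t) * y j) (sig t) (x j))"

definition slice :: "nat \<Rightarrow> real \<Rightarrow> (nat \<Rightarrow> real) \<Rightarrow> (nat \<Rightarrow> real) measure" where
  "slice i t x = density \<mu> (\<lambda>y. ennreal (slice_weight i t x y))"

lemma slice_weight_measurable [measurable]: "slice_weight i t x \<in> borel_measurable \<mu>"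
  unfolding slice_weight_def [abs_def] normal_density_def by (intro borel_measurable_prod) simp

lemma slice_weight_pos: "0 < t \<Longrightarrow> 0 < slice_weight i t x y"
  unfolding slice_weight_def by (intro prod_pos) (auto intro: normal_density_pos sig_pos)

lemma slice_weight_le:
  "0 < t \<Longrightarrow> slice_weight i t x y \<le> (1 / sqrt (2 * pi * (sig t)\<^sup>2)) ^ card ({..<d} - {i})"
  unfolding slice_weight_def
  using prod_mono[of "{..<d} - {i}" "\<lambda>j. normal_density (exp (- t) * y j) (sig t) (x j)"
    "\<lambda>_. 1 / sqrt (2 * pi * (sig t)\<^sup>2)"]
  by (auto simp: normal_density_le sig_pos)

lemma slice_weight_upd: "slice_weight i t (x(i := z)) = slice_weight i t x"
  unfolding slice_weight_def fun_eq_iff by (auto intro!: prod.cong)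

lemma emeasure_slice_space:
  "emeasure (slice i t x) (space (slice i t x)) = (\<integral>\<^sup>+y. ennreal (slice_weight i t x y) \<partial>\<mu>)"
proof -
  have "emeasure (slice i t x) (space (slice i t x))
    = (\<integral>\<^sup>+y. ennreal (slice_weight i t x y) * indicator (space \<mu>) y \<partial>\<mu>)"
    unfolding slice_def by (subst emeasure_density) (auto simp del: space_mu)
  also have "\<dots> = (\<integral>\<^sup>+y. ennreal (slice_weight i t x y) \<partial>\<mu>)"
    by (rule nn_integral_cong) simp
  finally show ?thesis .
qed

lemma gaussian_mixture_slice:
  assumes t: "0 < t" and i: "i < d"
  shows "gaussian_mixture (slice i t x) (\<lambda>y. exp (- t) * y i) D (sig t)"
proof (intro gaussian_mixture.intro gaussian_mixture_axioms.intro finite_measureI)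
  let ?C = "(1 / sqrt (2 * pi * (sig t)\<^sup>2)) ^ card ({..<d} - {i})"
  have "emeasure (slice i t x) (space (slice i t x)) \<le> (\<integral>\<^sup>+y. ennreal ?C \<partial>\<mu>)"
    unfolding emeasure_slice_space using slice_weight_le[OF t]
    by (intro nn_integral_mono ennreal_leI)
  also have "\<dots> < \<infinity>" using mu.emeasure_space_1 by (simp add: ennreal_mult_less_top)
  finally show "emeasure (slice i t x) (space (slice i t x)) \<noteq> \<infinity>" by simp
  show "(\<lambda>y. exp (- t) * y i) \<in> borel_measurable (slice i t x)"
    using i unfolding slice_def by simp
  have "AE y in \<mu>. \<bar>exp (- t) * y i\<bar> \<le> D"
    using bounded_mu[OF i]
  proof eventually_elim
    fix y :: "nat \<Rightarrow> real" assume y: "\<bar>y i\<bar> \<le> D"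
    have "exp (- t) * \<bar>y i\<bar> \<le> 1 * \<bar>y i\<bar>" using t by (intro mult_right_mono) auto
    then show "\<bar>exp (- t) * y i\<bar> \<le> D" using y by (simp add: abs_mult)
  qed
  then show "AE y in slice i t x. \<bar>exp (- t) * y i\<bar> \<le> D"
    unfolding slice_def by (subst AE_density) (auto elim: eventually_mono)
  show "0 < sig t" using t by (rule sig_pos)
  show "emeasure (slice i t x) (space (slice i t x)) \<noteq> 0"
  proof
    assume "emeasure (slice i t x) (space (slice i t x)) = 0"
    then have "(\<integral>\<^sup>+y. ennreal (slice_weight i t x y) \<partial>\<mu>) = 0"
      unfolding emeasure_slice_space .
    then have "AE y in \<mu>. ennreal (slice_weight i t x y) = 0"
      by (subst (asm) nn_integral_0_iff_AE) auto
    then have "AE y in \<mu>. False"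
      by (rule eventually_mono) (use slice_weight_pos[OF t] in \<open>metis ennreal_eq_0_iff not_le\<close>)
    then show False using mu.AE_False by simp
  qed
qed

lemma ou_kernel_upd:
  assumes i: "i < d"
  shows "ou_kernel d t y (x(i := z)) = slice_weight i t x y * normal_density (exp (- t) * y i) (sig t) z"
proof -
  have "ou_kernel d t y (x(i := z)) = (\<Prod>j\<in>insert i ({..<d} - {i}). normal_density (exp (- t) * y j) (sig t) ((x(i := z)) j))"
    unfolding ou_kernel_def gauss_kernel_def using i by (intro prod.cong) auto
  also have "\<dots> = slice_weight i t x y * normal_density (exp (- t) * y i) (sig t) z"
    unfolding slice_weight_def by (subst prod.insert) (auto simp: mult.commute intro!: prod.cong)
  finally show ?thesis .
qed

lemma slice_mom:
  assumes t: "0 < t" and i: "i < d"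
  shows "gaussian_mixture.mom (slice i t x) (\<lambda>y. exp (- t) * y i) (sig t) k z
    = (\<integral>y. ou_kernel d t y (x(i := z)) * (exp (- t) * y i) ^ k \<partial>\<mu>)"
proof -
  interpret gaussian_mixture "slice i t x" "\<lambda>y. exp (- t) * y i" D "sig t"
    by (rule gaussian_mixture_slice[OF t i])
  have [measurable]: "(\<lambda>y. normal_density (exp (- t) * y i) (sig t) z) \<in> borel_measurable \<mu>"
    using i unfolding normal_density_def by simp
  have "mom k z = (\<integral>y. slice_weight i t x y * ((exp (- t) * y i) ^ k * normal_density (exp (- t) * y i) (sig t) z) \<partial>\<mu>)"
  proof -
    have "mom k z = (\<integral>y. (exp (- t) * y i) ^ k * normal_density (exp (- t) * y i) (sig t) z
        \<partial>density \<mu> (\<lambda>y. ennreal (slice_weight i t x y)))"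
      unfolding mom_def unfolding slice_def ..
    also have "\<dots> = (\<integral>y. slice_weight i t x y * ((exp (- t) * y i) ^ k * normal_density (exp (- t) * y i) (sig t) z) \<partial>\<mu>)"
      using i slice_weight_pos[OF t] by (subst integral_density) (auto simp: less_imp_le)
    finally show ?thesis .
  qed
  then show ?thesis by (simp add: ou_kernel_upd[OF i] mult_ac)
qed

lemma slice_mom_0:
  assumes t: "0 < t" and i: "i < d"
  shows "gaussian_mixture.mom (slice i t x) (\<lambda>y. exp (- t) * y i) (sig t) 0 = (\<lambda>z. mix t (x(i := z)))"
  by (simp add: fun_eq_iff slice_mom[OF t i] mix_def)

text \<open>The i-th partial derivative of \<open>mix t\<close> as an integral that is visibly
  measurable, also jointly in time and space. At the position reached from y with noise w, the
  factor beside the kernel is - w i / sig t.\<close>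

definition mix_deriv :: "nat \<Rightarrow> real \<Rightarrow> (nat \<Rightarrow> real) \<Rightarrow> real" where
  "mix_deriv i t x = (\<integral>y. ou_kernel d t y x * ((exp (- t) * y i - x i) / (sig t)\<^sup>2) \<partial>\<mu>)"

lemma slice_l0:
  assumes t: "0 < t" and i: "i < d" and x: "x(i := z) \<in> Rd d"
  shows "gaussian_mixture.l0 (slice i t x) (\<lambda>y. exp (- t) * y i) (sig t) z * mix t (x(i := z))
    = mix_deriv i t (x(i := z))"
proof -
  interpret gaussian_mixture "slice i t x" "\<lambda>y. exp (- t) * y i" D "sig t"
    by (rule gaussian_mixture_slice[OF t i])
  have [measurable]: "(\<lambda>y. ou_kernel d t y (x(i := z))) \<in> borel_measurable \<mu>"
    using x by simp
  have int: "integrable \<mu> (\<lambda>y. ou_kernel d t y (x(i := z)) * (exp (- t) * y i) ^ k)" for k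
  proof -
    have "integrable \<mu> (\<lambda>y. slice_weight i t x y *\<^sub>R ((exp (- t) * y i) ^ k * normal_density (exp (- t) * y i) (sig t) z))"
    proof (subst integrable_density[symmetric])
      show "(\<lambda>y. (exp (- t) * y i) ^ k * normal_density (exp (- t) * y i) (sig t) z) \<in> borel_measurable \<mu>"
        using i unfolding normal_density_def by simp
      show "integrable (density \<mu> (\<lambda>y. ennreal (slice_weight i t x y)))
          (\<lambda>y. (exp (- t) * y i) ^ k * normal_density (exp (- t) * y i) (sig t) z)"
        using integrable_mom[of k z] unfolding slice_def .
    qed (use slice_weight_pos[OF t] in \<open>auto simp: less_imp_le\<close>)
    then show ?thesis by (simp add: ou_kernel_upd[OF i] mult_ac)
  qed
  have "mix_deriv i t (x(i := z)) = (\<integral>y. (ou_kernel d t y (x(i := z)) * (exp (- t) * y i) ^ 1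
      - z * (ou_kernel d t y (x(i := z)) * (exp (- t) * y i) ^ 0)) / (sig t)\<^sup>2 \<partial>\<mu>)"
    unfolding mix_deriv_def by (intro Bochner_Integration.integral_cong) (auto simp: algebra_simps diff_divide_distrib)
  also have "\<dots> = (mom 1 z - z * mom 0 z) / (sig t)\<^sup>2"
    unfolding slice_mom[OF t i] integral_divide_zero using int[of 1] int[of 0]
    by (subst Bochner_Integration.integral_diff) auto
  also have "\<dots> = l0 z * mom 0 z"
  proof -
    have "cm z * mom 0 z = mom 1 z" by (simp add: cm_def)
    then show ?thesis by (simp add: l0_def left_diff_distrib)
  qed
  finally show ?thesis by (simp add: slice_mom_0[OF t i])
qed

lemma mix_pos:
  assumes t: "0 < t" and x: "x \<in> Rd d" and d: "0 < d"
  shows "0 < mix t x"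
proof -
  interpret gaussian_mixture "slice 0 t x" "\<lambda>y. exp (- t) * y 0" D "sig t"
    by (rule gaussian_mixture_slice[OF t d])
  show ?thesis using mom_0_pos[of "x 0"] by (simp add: slice_mom_0[OF t d])
qed

lemma score_mix:
  assumes t: "0 < t" and i: "i < d" and x: "x \<in> Rd d"
  shows "score (mix t) x i = mix_deriv i t x / mix t x"
    and "gaussian_mixture.l0 (slice i t x) (\<lambda>y. exp (- t) * y i) (sig t) (x i) = score (mix t) x i"
proof -
  interpret gaussian_mixture "slice i t x" "\<lambda>y. exp (- t) * y i" D "sig t"
    by (rule gaussian_mixture_slice[OF t i])
  have "((\<lambda>h. ln (mom 0 h)) has_real_derivative l0 (x i)) (at (x i))"
    using DERIV_ln_divide[OF mom_0_pos[of "x i"]] has_real_derivative_mom_0[of "x i"]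
    by (auto intro!: derivative_eq_intros mom_0_pos)
  then have "deriv (\<lambda>h. ln (mom 0 h)) (x i) = l0 (x i)" by (rule DERIV_imp_deriv)
  then show *: "l0 (x i) = score (mix t) x i"
    by (simp add: score_def partial_deriv_def slice_mom_0[OF t i])
  show "score (mix t) x i = mix_deriv i t x / mix t x"
    using slice_l0[OF t i, of x "x i"] x mix_pos[OF t x] i unfolding * by (simp add: field_simps)
qed

lemma mix_deriv_measurable [measurable]: "i < d \<Longrightarrow> mix_deriv i t \<in> borel_measurable (leb d)"
  unfolding mix_deriv_def [abs_def]
  by (rule mu.borel_measurable_lebesgue_integral) (simp add: split_beta')

lemma score_mix_measurable [measurable]:
  assumes "0 < t" "i < d" shows "(\<lambda>x. score (mix t) x i) \<in> borel_measurable (leb d)"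
proof (subst measurable_cong)
  show "(\<lambda>x. mix_deriv i t x / mix t x) \<in> borel_measurable (leb d)" using assms by simp
qed (use score_mix(1)[OF assms] in auto)

text \<open>Integrating the data point out of the joint law replaces - w i / sig t by its
  conditional mean, the score. On each line parallel to axis i the density is a one-dimensional
  mixture; the bound for mixtures applies there and is integrated over the other coordinates.
  Derivatives of u and s in other directions do not appear.\<close>

lemma velocity_gap_coordinate:
  fixes u p s s1 :: "(nat \<Rightarrow> real) \<Rightarrow> real" and L \<Lambda> h a :: real
  assumes t: "0 < t" and i: "i < d"
    and s: "continuous_on (Rd d) s"
      "\<And>x z. x \<in> Rd d \<Longrightarrow> ((\<lambda>z. s (x(i := z))) has_real_derivative s1 (x(i := z))) (at z)"
      "\<And>x. x \<in> Rd d \<Longrightarrow> \<bar>s1 x\<bar> \<le> L"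
      "\<And>x z z'. x \<in> Rd d \<Longrightarrow> \<bar>s1 (x(i := z)) - s1 (x(i := z'))\<bar> \<le> L * \<bar>z - z'\<bar>"
    and u: "\<And>x. x \<in> Rd d \<Longrightarrow> \<bar>u x\<bar> \<le> 1"
      "\<And>x z. x \<in> Rd d \<Longrightarrow> ((\<lambda>z. u (x(i := z))) has_real_derivative p (x(i := z))) (at z)"
      "\<And>x. x \<in> Rd d \<Longrightarrow> \<bar>p x\<bar> \<le> \<Lambda>" "continuous_on (Rd d) p"
    and h: "0 < h" "h \<le> sig t" and a: "0 < a"
    and int: "integrable P (\<lambda>(y, w). p (ou d t y w) * (- w i / sig t - s (ou d t y w)))"
  shows "ennreal \<bar>\<integral>v. (case v of (y, w) \<Rightarrow> p (ou d t y w) * (- w i / sig t - s (ou d t y w))) \<partial>P\<bar>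
    \<le> (\<integral>\<^sup>+x. ennreal ((4 / h * (a + (score (mix t) x i - s x)\<^sup>2 / a) + 8 * h * (L + D / sig t ^ 4)) * mix t x) \<partial>leb d)"
proof -
  define f where "f y x = p x * ((exp (- t) * y i - x i) / (sig t)\<^sup>2 - s x)" for y x
  define g where "g x = (\<integral>y. ou_kernel d t y x * f y x \<partial>\<mu>)" for x
  define B where "B x = (4 / h * (a + (score (mix t) x i - s x)\<^sup>2 / a) + 8 * h * (L + D / sig t ^ 4)) * mix t x" for x
  note [measurable] = borel_measurable_continuous_Rd[OF s(1)] borel_measurable_continuous_Rd[OF u(4)]
  have f_eq: "f y (ou d t y w) = p (ou d t y w) * (- w i / sig t - s (ou d t y w))" for y w
    using i sig_pos[OF t] by (simp add: f_def ou_def field_simps power2_eq_square)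
  have [measurable]: "(\<lambda>(y, x). f y x) \<in> borel_measurable (\<mu> \<Otimes>\<^sub>M leb d)"
    using i unfolding f_def split_beta' by measurable
  have int': "integrable (\<mu> \<Otimes>\<^sub>M leb d) (\<lambda>(y, x). ou_kernel d t y x * f y x)"
    using int by (subst integrable_joint[OF t]) (simp_all add: f_eq)
  have eq: "(\<integral>v. (case v of (y, w) \<Rightarrow> p (ou d t y w) * (- w i / sig t - s (ou d t y w))) \<partial>P) = (\<integral>x. g x \<partial>leb d)"
    using integrable_joint(2)[OF t, of f] ml.integral_snd[OF int'] by (simp add: f_eq g_def)
  have g_int: "integrable (leb d) g"
    using ml.integrable_snd[OF int'] by (simp add: g_def [abs_def])
  let ?J = "{..<d} - {i}"
  have ins: "insert i ?J = {..<d}" using i by auto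
  interpret L: product_sigma_finite "\<lambda>_::nat. lborel :: real measure" by (rule product_sigma_finite_lborel)
  have key: "integrable lborel (\<lambda>z. B (x(i := z)))"
      "\<bar>\<integral>z. g (x(i := z)) \<partial>lborel\<bar> \<le> (\<integral>z. B (x(i := z)) \<partial>lborel)"
    if x: "x \<in> space (PiM ?J (\<lambda>_. lborel))" for x
  proof -
    have xz: "x(i := z) \<in> Rd d" for z
      using x i by (auto simp: space_PiM PiE_iff extensional_def)
    interpret gaussian_mixture "slice i t x" "\<lambda>y. exp (- t) * y i" D "sig t"
      by (rule gaussian_mixture_slice[OF t i])
    have sc: "score (mix t) (x(i := z)) i = l0 z" for z
    proof -
      have "slice i t (x(i := z)) = slice i t x"
        unfolding slice_def slice_weight_upd ..
      then show ?thesis using score_mix(2)[OF t i xz[of z]] by simp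
    qed
    have geq: "g (x(i := z)) = p (x(i := z)) * ((l0 z - s (x(i := z))) * mom 0 z)" for z
    proof -
      have "g (x(i := z)) = (\<integral>y. p (x(i := z)) * (ou_kernel d t y (x(i := z)) * ((exp (- t) * y i - z) / (sig t)\<^sup>2)
          - s (x(i := z)) * ou_kernel d t y (x(i := z))) \<partial>\<mu>)"
        unfolding g_def f_def by (intro Bochner_Integration.integral_cong) (auto simp: algebra_simps)
      also have "\<dots> = p (x(i := z)) * ((\<integral>y. ou_kernel d t y (x(i := z)) * ((exp (- t) * y i - z) / (sig t)\<^sup>2)
          - s (x(i := z)) * ou_kernel d t y (x(i := z)) \<partial>\<mu>))"
        by simp
      also have "\<dots> = p (x(i := z)) * (mix_deriv i t (x(i := z)) - s (x(i := z)) * mix t (x(i := z)))"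
      proof -
        have "integrable \<mu> (\<lambda>y. ou_kernel d t y (x(i := z)) * ((exp (- t) * y i - z) / (sig t)\<^sup>2))"
        proof (rule Bochner_Integration.integrable_bound)
          show "integrable \<mu> (\<lambda>y. ou_kernel d t y (x(i := z)) * ((D + \<bar>z\<bar>) / (sig t)\<^sup>2))"
            using integrable_ou_kernel[OF t xz[of z]] by simp
          show "AE y in \<mu>. norm (ou_kernel d t y (x(i := z)) * ((exp (- t) * y i - z) / (sig t)\<^sup>2))
              \<le> norm (ou_kernel d t y (x(i := z)) * ((D + \<bar>z\<bar>) / (sig t)\<^sup>2))"
            using bounded_mu[OF i]
          proof eventually_elim
            fix y :: "nat \<Rightarrow> real" assume y: "\<bar>y i\<bar> \<le> D"
            have "exp (- t) * \<bar>y i\<bar> \<le> 1 * \<bar>y i\<bar>" using t by (intro mult_right_mono) auto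
            then have "\<bar>exp (- t) * y i - z\<bar> \<le> D + \<bar>z\<bar>" using y abs_triangle_ineq4[of "exp (- t) * y i" z] by (simp add: abs_mult)
            then show "norm (ou_kernel d t y (x(i := z)) * ((exp (- t) * y i - z) / (sig t)\<^sup>2))
              \<le> norm (ou_kernel d t y (x(i := z)) * ((D + \<bar>z\<bar>) / (sig t)\<^sup>2))"
              unfolding real_norm_def abs_mult abs_divide using D_nonneg
              by (intro mult_left_mono divide_right_mono) auto
          qed
          show "(\<lambda>y. ou_kernel d t y (x(i := z)) * ((exp (- t) * y i - z) / (sig t)\<^sup>2)) \<in> borel_measurable \<mu>"
            using xz[of z] i by measurable
        qed
        then show ?thesis
          using integrable_ou_kernel[OF t xz[of z]] by (simp add: mix_deriv_def mix_def)
      qed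
      also have "\<dots> = p (x(i := z)) * ((l0 z - s (x(i := z))) * mom 0 z)"
        using slice_l0[OF t i xz[of z]] by (simp add: slice_mom_0[OF t i] left_diff_distrib)
      finally show ?thesis .
    qed
    have Beq: "B (x(i := z)) = (4 / h * (a + (l0 z - s (x(i := z)))\<^sup>2 / a) + 8 * h * (L + D / sig t ^ 4)) * mom 0 z" for z
      by (simp add: B_def sc slice_mom_0[OF t i])
    have upd: "((\<lambda>z. s (x(i := z))) has_real_derivative s1 (x(i := z))) (at z)"
      "((\<lambda>z. u (x(i := z))) has_real_derivative p (x(i := z))) (at z)"
      "\<bar>s1 (x(i := z)) - s1 (x(i := z'))\<bar> \<le> L * \<bar>z - z'\<bar>" for z z'
      using s(2)[OF xz[of 0], of z] u(2)[OF xz[of 0], of z] s(4)[OF xz[of 0], of z z'] by simp_all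
    have pc: "continuous_on UNIV (\<lambda>z. p (x(i := z)))"
    proof (rule continuous_on_compose2[OF u(4)])
      show "continuous_on UNIV (\<lambda>z. x(i := z))"
      proof (rule continuous_on_coordinatewise_then_product)
        fix j show "continuous_on UNIV (\<lambda>z. (x(i := z)) j)" by (cases "j = i") auto
      qed
    qed (use xz in auto)
    note odb = one_dimensional_bound[OF upd(1) s(3)[OF xz] upd(3) upd(2) u(1)[OF xz] u(3)[OF xz] pc h a]
    show "integrable lborel (\<lambda>z. B (x(i := z)))"
      using odb(2) unfolding Beq .
    show "\<bar>\<integral>z. g (x(i := z)) \<partial>lborel\<bar> \<le> (\<integral>z. B (x(i := z)) \<partial>lborel)"
      using odb(3) unfolding Beq geq .
  qed
  have B0: "0 \<le> B x" if "x \<in> Rd d" for x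
  proof -
    interpret gaussian_mixture "slice i t x" "\<lambda>y. exp (- t) * y i" D "sig t"
      by (rule gaussian_mixture_slice[OF t i])
    have "0 \<le> L" using s(3)[OF that] by (simp add: order_trans[OF abs_ge_zero])
    then show ?thesis using h a D_nonneg mix_nonneg by (simp add: B_def)
  qed
  have [measurable]: "B \<in> borel_measurable (leb d)"
    unfolding B_def [abs_def] using t i by measurable
  have "(\<integral>x. g x \<partial>leb d) = (\<integral>x. (\<integral>z. g (x(i := z)) \<partial>lborel) \<partial>PiM ?J (\<lambda>_. lborel))"
    using L.product_integral_insert[of ?J i g] g_int by (simp add: ins del: insert_Diff_single)
  \<comment> \<open>If the inner integral were not integrable over the remaining coordinates, its
    Bochner integral would be 0 and the inequality trivial, so both cases are covered.\<close>
  then have "ennreal \<bar>\<integral>x. g x \<partial>leb d\<bar>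
    \<le> (\<integral>\<^sup>+x. ennreal \<bar>\<integral>z. g (x(i := z)) \<partial>lborel\<bar> \<partial>PiM ?J (\<lambda>_. lborel))"
    using integral_norm_bound_ennreal[of "PiM ?J (\<lambda>_. lborel)" "\<lambda>x. \<integral>z. g (x(i := z)) \<partial>lborel"]
    by (cases "integrable (PiM ?J (\<lambda>_. lborel)) (\<lambda>x. \<integral>z. g (x(i := z)) \<partial>lborel)")
      (auto simp: not_integrable_integral_eq)
  also have "\<dots> \<le> (\<integral>\<^sup>+x. (\<integral>\<^sup>+z. ennreal (B (x(i := z))) \<partial>lborel) \<partial>PiM ?J (\<lambda>_. lborel))"
  proof (rule nn_integral_mono)
    fix x assume x: "x \<in> space (PiM ?J (\<lambda>_. lborel :: real measure))"
    then have xz: "x(i := z) \<in> Rd d" for z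
      using i by (auto simp: space_PiM PiE_iff extensional_def)
    have "(\<integral>\<^sup>+z. ennreal (B (x(i := z))) \<partial>lborel) = ennreal (\<integral>z. B (x(i := z)) \<partial>lborel)"
      using key(1)[OF x] B0[OF xz] by (intro nn_integral_eq_integral) auto
    then show "ennreal \<bar>\<integral>z. g (x(i := z)) \<partial>lborel\<bar> \<le> (\<integral>\<^sup>+z. ennreal (B (x(i := z))) \<partial>lborel)"
      using key(2)[OF x] by (simp add: ennreal_leI)
  qed
  also have "\<dots> = (\<integral>\<^sup>+x. ennreal (B x) \<partial>leb d)"
    using L.product_nn_integral_insert[of ?J i "\<lambda>x. ennreal (B x)"] by (simp add: ins del: insert_Diff_single)
  finally show ?thesis unfolding eq B_def .
qed

end

section \<open>Test functions with quadratic remainder\<close>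

text \<open>The l1 distance is the one that pairs with bounds on the individual partial derivatives.
  The powers of d it costs enter only constants of the Euler error, which vanishes in the
  limit.\<close>

definition l1_dist :: "nat \<Rightarrow> (nat \<Rightarrow> real) \<Rightarrow> (nat \<Rightarrow> real) \<Rightarrow> real" where
  "l1_dist d x y = (\<Sum>i<d. \<bar>y i - x i\<bar>)"

lemma l1_dist_nonneg [simp]: "0 \<le> l1_dist d x y"
  unfolding l1_dist_def by (intro sum_nonneg) auto

lemma l1_dist_triangle: "l1_dist d x z \<le> l1_dist d x y + l1_dist d y z"
  unfolding l1_dist_def sum.distrib[symmetric] by (intro sum_mono) linarith

lemma abs_le_l1_dist: "i < d \<Longrightarrow> \<bar>y i - x i\<bar> \<le> l1_dist d x y"
  unfolding l1_dist_def by (rule member_le_sum[of i "{..<d}" "\<lambda>i. \<bar>y i - x i\<bar>"]) auto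

lemma l1_dist_upd: "i < d \<Longrightarrow> l1_dist d (x(i := z)) (x(i := z')) = \<bar>z' - z\<bar>"
  unfolding l1_dist_def by (subst sum.remove[of _ i]) (auto intro!: sum.neutral)

lemma upd_Rd [intro]: "x \<in> Rd d \<Longrightarrow> i < d \<Longrightarrow> x(i := z) \<in> Rd d"
  by (auto simp: PiE_iff extensional_def)

lemma sum_mult_abs_le:
  assumes "\<And>i. i < d \<Longrightarrow> \<bar>p i\<bar> \<le> c"
  shows "\<bar>\<Sum>i<d. p i * (y i - x i)\<bar> \<le> c * l1_dist d x y"
  unfolding l1_dist_def sum_distrib_left
  by (rule order_trans[OF sum_abs]) (auto intro!: sum_mono mult_right_mono assms simp: abs_mult)

lemma continuous_on_Rd_of_l1_modulus:
  fixes f :: "(nat \<Rightarrow> real) \<Rightarrow> real"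
  assumes "\<And>x y. x \<in> Rd d \<Longrightarrow> y \<in> Rd d \<Longrightarrow> \<bar>f y - f x\<bar> \<le> a * l1_dist d x y + b * (l1_dist d x y)\<^sup>2"
  shows "continuous_on (Rd d) f"
  unfolding continuous_on_sequentially comp_def
proof (intro allI ballI impI, elim conjE)
  fix g x assume x: "x \<in> Rd d" and g: "\<forall>n. g n \<in> Rd d" "g \<longlonglongrightarrow> x"
  have "(\<lambda>n. l1_dist d x (g n)) \<longlonglongrightarrow> (\<Sum>i<d. \<bar>x i - x i\<bar>)"
    unfolding l1_dist_def by (intro tendsto_sum tendsto_rabs tendsto_diff tendsto_const tendsto_coordinate[OF g(2)])
  then have N: "(\<lambda>n. l1_dist d x (g n)) \<longlonglongrightarrow> 0" by simp
  have "(\<lambda>n. a * l1_dist d x (g n) + b * (l1_dist d x (g n))\<^sup>2) \<longlonglongrightarrow> a * 0 + b * 0\<^sup>2"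
    by (intro tendsto_intros N)
  then have lim: "(\<lambda>n. a * l1_dist d x (g n) + b * (l1_dist d x (g n))\<^sup>2) \<longlonglongrightarrow> 0" by simp
  have "norm (f (g n) - f x) \<le> a * l1_dist d x (g n) + b * (l1_dist d x (g n))\<^sup>2" for n
    using assms[OF x g(1)[rule_format]] by simp
  then have "(\<lambda>n. f (g n) - f x) \<longlonglongrightarrow> 0"
    by (intro Lim_null_comparison[OF always_eventually lim]) blast
  then show "(\<lambda>n. f (g n)) \<longlonglongrightarrow> f x" by (rule LIM_zero_cancel)
qed

text \<open>Test functions: \<open>p\<close> is the gradient of \<open>u\<close>, and the remainder of the first-order expansion is
  quadratic. The constants compose under maps that are close to the identity.\<close>

definition quad_approx ::
    "nat \<Rightarrow> ((nat \<Rightarrow> real) \<Rightarrow> real) \<Rightarrow> ((nat \<Rightarrow> real) \<Rightarrow> nat \<Rightarrow> real) \<Rightarrow> real \<Rightarrow> real \<Rightarrow> bool" where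
  "quad_approx d u p \<Lambda> H \<longleftrightarrow> (\<forall>x\<in>Rd d. (\<forall>i<d. \<bar>p x i\<bar> \<le> \<Lambda>) \<and>
     (\<forall>y\<in>Rd d. \<bar>u y - u x - (\<Sum>i<d. p x i * (y i - x i))\<bar> \<le> H * (l1_dist d x y)\<^sup>2))"

lemma quad_approxD:
  assumes "quad_approx d u p \<Lambda> H" "x \<in> Rd d"
  shows "i < d \<Longrightarrow> \<bar>p x i\<bar> \<le> \<Lambda>"
    and "y \<in> Rd d \<Longrightarrow> \<bar>u y - u x - (\<Sum>i<d. p x i * (y i - x i))\<bar> \<le> H * (l1_dist d x y)\<^sup>2"
  using assms unfolding quad_approx_def by auto

lemma quad_approx_mono:
  assumes "quad_approx d u p \<Lambda> H" "\<Lambda> \<le> \<Lambda>'" "H \<le> H'"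
  shows "quad_approx d u p \<Lambda>' H'"
  unfolding quad_approx_def
proof (intro ballI conjI allI impI)
  fix x y assume x: "x \<in> Rd d" and y: "y \<in> Rd d"
  have "H * (l1_dist d x y)\<^sup>2 \<le> H' * (l1_dist d x y)\<^sup>2" using assms(3) by (intro mult_right_mono) auto
  then show "\<bar>u y - u x - (\<Sum>i<d. p x i * (y i - x i))\<bar> \<le> H' * (l1_dist d x y)\<^sup>2"
    using quad_approxD(2)[OF assms(1) x y] by linarith
next
  fix x i assume "x \<in> Rd d" "i < d"
  then show "\<bar>p x i\<bar> \<le> \<Lambda>'" using quad_approxD(1)[OF assms(1), of x i] assms(2) by linarith
qed

lemma quad_approx_partial:
  assumes Q: "quad_approx d u p \<Lambda> H" and x: "x \<in> Rd d" and i: "i < d"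
  shows "((\<lambda>z. u (x(i := z))) has_real_derivative p (x(i := z)) i) (at z)"
proof (rule has_derivative_of_quadratic_error)
  fix t
  have "(\<Sum>j<d. p (x(i := z)) j * ((x(i := z + t)) j - (x(i := z)) j)) = t * p (x(i := z)) i"
    using i by (subst sum.remove[of _ i]) (auto intro!: sum.neutral)
  then show "\<bar>u (x(i := z + t)) - u (x(i := z)) - t * p (x(i := z)) i\<bar> \<le> H * t\<^sup>2"
    using quad_approxD(2)[OF Q, of "x(i := z)" "x(i := z + t)"] x i by (simp add: l1_dist_upd upd_Rd)
qed

text \<open>The expansions at x and at y are compared at a third point z, which is y moved along
  axis i by the distance t of x and y. All other gradient terms cancel and (p y i - p x i) * t is a
  sum of three remainders, over distances at most 2 t, t and t; hence 6 = 4 + 1 + 1.\<close>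

lemma quad_approx_gradient_Lipschitz:
  assumes Q: "quad_approx d u p \<Lambda> H" and x: "x \<in> Rd d" and y: "y \<in> Rd d" and i: "i < d"
  shows "\<bar>p y i - p x i\<bar> \<le> 6 * H * l1_dist d x y"
proof (cases "l1_dist d x y = 0")
  case True
  have "x = y"
  proof (rule PiE_ext[OF x y])
    fix j assume "j \<in> {..<d}"
    then show "x j = y j" using abs_le_l1_dist[of j d y x] True by auto
  qed
  then show ?thesis using True by simp
next
  case False
  define t where "t = l1_dist d x y"
  have t: "0 < t" using False l1_dist_nonneg[of d x y] unfolding t_def by linarith
  define z where "z = y(i := y i + t)"
  have z: "z \<in> Rd d" unfolding z_def using y i by (rule upd_Rd)
  have yz: "l1_dist d y z = t"
    using l1_dist_upd[OF i, of y "y i" "y i + t"] t by (simp add: z_def)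
  have xz: "l1_dist d x z \<le> 2 * t" using l1_dist_triangle[of d x z y] yz by (simp add: t_def)
  have H0: "0 \<le> H * t\<^sup>2" using quad_approxD(2)[OF Q x y] unfolding t_def by (meson abs_ge_zero order_trans)
  then have H: "0 \<le> H" using t by (simp add: zero_le_mult_iff)
  have 1: "\<bar>u z - u x - (\<Sum>j<d. p x j * (z j - x j))\<bar> \<le> H * (2 * t)\<^sup>2"
    using quad_approxD(2)[OF Q x z] mult_left_mono[OF power_mono[OF xz l1_dist_nonneg, of 2] H] by linarith
  have 2: "\<bar>u z - u y - (\<Sum>j<d. p y j * (z j - y j))\<bar> \<le> H * t\<^sup>2"
    using quad_approxD(2)[OF Q y z] yz by simp
  have 3: "\<bar>u y - u x - (\<Sum>j<d. p x j * (y j - x j))\<bar> \<le> H * t\<^sup>2"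
    using quad_approxD(2)[OF Q x y] by (simp add: t_def)
  have s: "(\<Sum>j<d. r j * (z j - y j)) = r i * t" for r
    unfolding z_def using i by (subst sum.remove[of _ i]) (auto intro!: sum.neutral)
  have "(\<Sum>j<d. p x j * (z j - x j)) = (\<Sum>j<d. p x j * (y j - x j)) + (\<Sum>j<d. p x j * (z j - y j))"
    by (simp add: sum.distrib[symmetric] algebra_simps)
  then have "(p y i - p x i) * t = (u z - u x - (\<Sum>j<d. p x j * (z j - x j)))
      - (u z - u y - (\<Sum>j<d. p y j * (z j - y j))) - (u y - u x - (\<Sum>j<d. p x j * (y j - x j)))"
    by (simp add: s left_diff_distrib)
  then have "\<bar>(p y i - p x i) * t\<bar> \<le> H * (2 * t)\<^sup>2 + H * t\<^sup>2 + H * t\<^sup>2"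
    using 1 2 3 by linarith
  moreover have "\<bar>(p y i - p x i) * t\<bar> = \<bar>p y i - p x i\<bar> * t" using t by (simp add: abs_mult)
  ultimately have "\<bar>p y i - p x i\<bar> * t \<le> (6 * H * t) * t"
    by (simp add: power2_eq_square)
  then show ?thesis using t unfolding t_def[symmetric] by (rule mult_right_le_imp_le)
qed

lemma quad_approx_continuous:
  assumes Q: "quad_approx d u p \<Lambda> H"
  shows "continuous_on (Rd d) u" and "i < d \<Longrightarrow> continuous_on (Rd d) (\<lambda>x. p x i)"
proof -
  show "continuous_on (Rd d) u"
  proof (rule continuous_on_Rd_of_l1_modulus)
    fix x y assume xy: "x \<in> Rd d" "y \<in> Rd d"
    show "\<bar>u y - u x\<bar> \<le> \<Lambda> * l1_dist d x y + H * (l1_dist d x y)\<^sup>2"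
      using quad_approxD(2)[OF Q xy] sum_mult_abs_le[of d "p x" \<Lambda> y x, OF quad_approxD(1)[OF Q xy(1)]] by linarith
  qed
  show "continuous_on (Rd d) (\<lambda>x. p x i)" if "i < d"
    using quad_approx_gradient_Lipschitz[OF Q _ _ that]
    by (intro continuous_on_Rd_of_l1_modulus[where a = "6 * H" and b = 0]) auto
qed

text \<open>Chain rule with remainder, for maps that are not assumed differentiable:
  \<open>J\<close> is any matrix with quadratic error. In the l1 distance the operator norm of a
  matrix is its largest column sum, so one \<kappa> serves both for the gradient and for the
  Lipschitz constant. The remainder of each of the d components of \<Psi> is paid for with
  \<Lambda>.\<close>

lemma quad_approx_comp:
  assumes Q: "quad_approx d u p \<Lambda> H"
    and \<Psi>: "\<And>x. x \<in> Rd d \<Longrightarrow> \<Psi> x \<in> Rd d"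
    and E: "\<And>x y i. x \<in> Rd d \<Longrightarrow> y \<in> Rd d \<Longrightarrow> i < d \<Longrightarrow>
      \<bar>\<Psi> y i - \<Psi> x i - (\<Sum>j<d. J x i j * (y j - x j))\<bar> \<le> e * (l1_dist d x y)\<^sup>2"
    and J: "\<And>x j. x \<in> Rd d \<Longrightarrow> j < d \<Longrightarrow> (\<Sum>i<d. \<bar>J x i j\<bar>) \<le> \<kappa>"
    and Lip: "\<And>x y. x \<in> Rd d \<Longrightarrow> y \<in> Rd d \<Longrightarrow> l1_dist d (\<Psi> x) (\<Psi> y) \<le> \<kappa> * l1_dist d x y"
    and nn: "0 \<le> \<Lambda>" "0 \<le> H"
  shows "quad_approx d (\<lambda>x. u (\<Psi> x)) (\<lambda>x j. \<Sum>i<d. p (\<Psi> x) i * J x i j) (\<Lambda> * \<kappa>) (H * \<kappa>\<^sup>2 + d * \<Lambda> * e)"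
  unfolding quad_approx_def
proof (intro ballI conjI allI impI)
  fix x j assume x: "x \<in> Rd d" and j: "j < d"
  have "\<bar>\<Sum>i<d. p (\<Psi> x) i * J x i j\<bar> \<le> (\<Sum>i<d. \<Lambda> * \<bar>J x i j\<bar>)"
    by (rule order_trans[OF sum_abs])
      (auto intro!: sum_mono mult_right_mono quad_approxD(1)[OF Q \<Psi>[OF x]] simp: abs_mult)
  also have "\<dots> \<le> \<Lambda> * \<kappa>"
    unfolding sum_distrib_left[symmetric] using nn J[OF x j] by (intro mult_left_mono)
  finally show "\<bar>\<Sum>i<d. p (\<Psi> x) i * J x i j\<bar> \<le> \<Lambda> * \<kappa>" .
next
  fix x y assume x: "x \<in> Rd d" and y: "y \<in> Rd d"
  let ?r = "\<lambda>i. \<Psi> y i - \<Psi> x i - (\<Sum>j<d. J x i j * (y j - x j))"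
  have "(\<Sum>j<d. (\<Sum>i<d. p (\<Psi> x) i * J x i j) * (y j - x j)) = (\<Sum>i<d. p (\<Psi> x) i * (\<Sum>j<d. J x i j * (y j - x j)))"
    unfolding sum_distrib_left sum_distrib_right by (subst sum.swap) (simp add: mult.assoc)
  then have eq: "u (\<Psi> y) - u (\<Psi> x) - (\<Sum>j<d. (\<Sum>i<d. p (\<Psi> x) i * J x i j) * (y j - x j))
    = (u (\<Psi> y) - u (\<Psi> x) - (\<Sum>i<d. p (\<Psi> x) i * (\<Psi> y i - \<Psi> x i))) + (\<Sum>i<d. p (\<Psi> x) i * ?r i)"
    by (simp add: right_diff_distrib sum_subtractf)
  have "\<bar>u (\<Psi> y) - u (\<Psi> x) - (\<Sum>j<d. (\<Sum>i<d. p (\<Psi> x) i * J x i j) * (y j - x j))\<bar>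
      \<le> H * (l1_dist d (\<Psi> x) (\<Psi> y))\<^sup>2 + (\<Sum>i<d. \<Lambda> * (e * (l1_dist d x y)\<^sup>2))"
    unfolding eq
  proof (rule order_trans[OF abs_triangle_ineq], rule add_mono)
    show "\<bar>\<Sum>i<d. p (\<Psi> x) i * ?r i\<bar> \<le> (\<Sum>i<d. \<Lambda> * (e * (l1_dist d x y)\<^sup>2))"
    proof (rule order_trans[OF sum_abs], rule sum_mono)
      fix i assume "i \<in> {..<d}"
      then show "\<bar>p (\<Psi> x) i * ?r i\<bar> \<le> \<Lambda> * (e * (l1_dist d x y)\<^sup>2)"
        unfolding abs_mult using quad_approxD(1)[OF Q \<Psi>[OF x]] E[OF x y] nn by (intro mult_mono) auto
    qed
  qed (rule quad_approxD(2)[OF Q \<Psi>[OF x] \<Psi>[OF y]])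
  also have "H * (l1_dist d (\<Psi> x) (\<Psi> y))\<^sup>2 \<le> H * (\<kappa> * l1_dist d x y)\<^sup>2"
    using Lip[OF x y] nn by (intro mult_left_mono power_mono) auto
  finally show "\<bar>u (\<Psi> y) - u (\<Psi> x) - (\<Sum>j<d. (\<Sum>i<d. p (\<Psi> x) i * J x i j) * (y j - x j))\<bar>
      \<le> (H * \<kappa>\<^sup>2 + d * \<Lambda> * e) * (l1_dist d x y)\<^sup>2"
    by (simp add: power_mult_distrib algebra_simps)
qed

section \<open>First and second order bounds from multi-index derivatives\<close>

lemma multi_deriv_single:
  "multi_deriv (\<lambda>k. if k = i then 1 else 0) n f = (if i < n then partial_deriv i f else f)"
  by (induction n arbitrary: f) (auto simp: less_Suc_eq)

lemma multi_deriv_pair: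
  assumes "l < i"
  shows "multi_deriv (\<lambda>k. if k = i \<or> k = l then 1 else 0) n f =
    (if i < n then partial_deriv l (partial_deriv i f) else if l < n then partial_deriv l f else f)"
  using assms by (induction n arbitrary: f) (auto simp: less_Suc_eq)

lemma multi_deriv_double:
  "multi_deriv (\<lambda>k. if k = i then 2 else 0) n f =
    (if i < n then partial_deriv i (partial_deriv i f) else f)"
  by (induction n arbitrary: f) (auto simp: less_Suc_eq numeral_2_eq_2)

lemma partial_deriv_bounds:
  assumes B: "\<And>\<alpha> x. (\<Sum>i<d. \<alpha> i) \<in> {1..2} \<Longrightarrow> x \<in> Rd d \<Longrightarrow> \<bar>multi_deriv \<alpha> d f x\<bar> \<le> L" and x: "x \<in> Rd d"
  shows "i < d \<Longrightarrow> \<bar>partial_deriv i f x\<bar> \<le> L"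
    and "l \<le> i \<Longrightarrow> i < d \<Longrightarrow> \<bar>partial_deriv l (partial_deriv i f) x\<bar> \<le> L"
proof -
  have single: "(\<Sum>k<d. if k = i then c else 0) = c" if "i < d" for i and c :: nat
    using that by (subst sum.delta) auto
  show "\<bar>partial_deriv i f x\<bar> \<le> L" if "i < d"
    using B[of "\<lambda>k. if k = i then 1 else 0", OF _ x] that by (simp add: multi_deriv_single single)
  show "\<bar>partial_deriv l (partial_deriv i f) x\<bar> \<le> L" if "l \<le> i" "i < d"
  proof (cases "l = i")
    case True
    then show ?thesis
      using B[of "\<lambda>k. if k = i then 2 else 0", OF _ x] that by (simp add: multi_deriv_double single)
  next
    case False
    have "(\<Sum>k<d. if k = i \<or> k = l then 1 else 0 :: nat) = (\<Sum>k<d. (if k = i then 1 else 0) + (if k = l then 1 else 0))"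
      using False by (intro sum.cong) auto
    also have "\<dots> = 2" using that by (simp add: sum.distrib)
    finally show ?thesis
      using B[of "\<lambda>k. if k = i \<or> k = l then 1 else 0", OF _ x] that False by (simp add: multi_deriv_pair)
  qed
qed

lemma C_k_partial:
  assumes "C_k d (Suc k) f" "x \<in> Rd d" "i < d"
  shows "((\<lambda>z. f (x(i := z))) has_real_derivative partial_deriv i f (x(i := z))) (at z)"
proof -
  have "\<forall>x\<in>Rd d. (\<lambda>h. f (x(i := h))) differentiable (at (x i))"
    using assms by simp
  then have "(\<lambda>h. f ((x(i := z))(i := h))) differentiable (at ((x(i := z)) i))"
    using upd_Rd[OF assms(2,3)] by (rule bspec)
  then have "(\<lambda>h. f (x(i := h))) differentiable (at z)" by simp
  then have "((\<lambda>z. f (x(i := z))) has_real_derivative deriv (\<lambda>z. f (x(i := z))) z) (at z)"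
    by (simp add: DERIV_deriv_iff_real_differentiable)
  then show ?thesis by (simp add: partial_deriv_def)
qed

lemma MVT_interval:
  fixes f :: "real \<Rightarrow> real"
  assumes D: "\<And>x. (f has_real_derivative f' x) (at x)"
  shows "\<exists>\<xi>. \<bar>\<xi> - a\<bar> \<le> \<bar>b - a\<bar> \<and> f b - f a = f' \<xi> * (b - a)"
proof (cases a b rule: linorder_cases)
  case less
  then obtain \<xi> where "a < \<xi>" "\<xi> < b" "f b - f a = (b - a) * f' \<xi>" using MVT2[of a b f f'] D by auto
  then show ?thesis by (intro exI[of _ \<xi>]) auto
next
  case greater
  then obtain \<xi> where "b < \<xi>" "\<xi> < a" "f a - f b = (a - b) * f' \<xi>" using MVT2[of b a f f'] D by auto
  then show ?thesis by (intro exI[of _ \<xi>]) (auto simp: algebra_simps)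
qed auto

text \<open>One moves from \<open>x\<close> to \<open>y\<close> one coordinate at a time, in increasing order. With this order, a
  second-order expansion needs \<open>\<partial>\<^sub>l \<partial>\<^sub>k\<close> only for \<open>l \<le> k\<close>, which are the mixed derivatives that
  \<open>multi_deriv\<close> provides, and no symmetry of second derivatives.\<close>

lemma abs_diff_le_of_partials:
  fixes f :: "(nat \<Rightarrow> real) \<Rightarrow> real"
  assumes D: "\<And>k x z. k < n \<Longrightarrow> x \<in> Rd d \<Longrightarrow> ((\<lambda>z. f (x(k := z))) has_real_derivative f' k (x(k := z))) (at z)"
    and B: "\<And>k x. k < n \<Longrightarrow> x \<in> Rd d \<Longrightarrow> \<bar>f' k x\<bar> \<le> L"
    and n: "n \<le> d" and x: "x \<in> Rd d" and m: "m \<le> n" and y: "y \<in> Rd d" "\<forall>k\<ge>m. y k = x k"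
  shows "\<bar>f y - f x\<bar> \<le> L * (\<Sum>k<m. \<bar>y k - x k\<bar>)"
  using m y
proof (induction m arbitrary: y)
  case 0
  then have "y = x" by (intro ext) simp
  then show ?case by simp
next
  case (Suc m)
  have mn: "m < n" "m < d" using Suc.prems(1) n by auto
  define y' where "y' = y(m := x m)"
  have y': "y' \<in> Rd d" unfolding y'_def by (rule upd_Rd[OF Suc.prems(2) mn(2)])
  have eq: "\<forall>k\<ge>m. y' k = x k"
  proof (intro allI impI)
    fix k assume "m \<le> k"
    then show "y' k = x k" using Suc.prems(3) by (cases "k = m") (auto simp: y'_def)
  qed
  have "\<bar>f y' - f x\<bar> \<le> L * (\<Sum>k<m. \<bar>y' k - x k\<bar>)"
    using mn(1) by (intro Suc.IH y' eq) simp
  also have "(\<Sum>k<m. \<bar>y' k - x k\<bar>) = (\<Sum>k<m. \<bar>y k - x k\<bar>)" by (rule sum.cong) (auto simp: y'_def)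
  finally have 1: "\<bar>f y' - f x\<bar> \<le> L * (\<Sum>k<m. \<bar>y k - x k\<bar>)" .
  have "\<bar>f (y(m := y m)) - f (y(m := x m))\<bar> \<le> L * \<bar>y m - x m\<bar>"
    by (rule Lipschitz_of_bounded_derivative[where f = "\<lambda>z. f (y(m := z))", OF D[OF mn(1) Suc.prems(2)]])
      (rule B[OF mn(1) upd_Rd[OF Suc.prems(2) mn(2)]])
  then have "\<bar>f y - f y'\<bar> \<le> L * \<bar>y m - x m\<bar>" by (simp add: y'_def)
  with 1 show ?case by (simp add: distrib_left)
qed

text \<open>Induction on the number m of coordinates in which y may differ from x. Moving the last
  one costs a partial derivative at an intermediate point; this point differs from x in the
  coordinates up to m only, so the derivative varies by at most L (A + b) with A the earlier and b
  the last displacement. The step closes because A^2 + (A + b) b \<le> (A + b)^2.\<close>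

lemma first_order_expansion:
  fixes f :: "(nat \<Rightarrow> real) \<Rightarrow> real"
  assumes D: "\<And>k x z. k < d \<Longrightarrow> x \<in> Rd d \<Longrightarrow> ((\<lambda>z. f (x(k := z))) has_real_derivative f' k (x(k := z))) (at z)"
    and D2: "\<And>l k x z. l \<le> k \<Longrightarrow> k < d \<Longrightarrow> x \<in> Rd d \<Longrightarrow>
      ((\<lambda>z. f' k (x(l := z))) has_real_derivative f'' l k (x(l := z))) (at z)"
    and B: "\<And>l k x. l \<le> k \<Longrightarrow> k < d \<Longrightarrow> x \<in> Rd d \<Longrightarrow> \<bar>f'' l k x\<bar> \<le> L"
    and m: "m \<le> d" and x: "x \<in> Rd d" and y: "y \<in> Rd d" "\<forall>k\<ge>m. y k = x k"
  shows "\<bar>f y - f x - (\<Sum>k<m. f' k x * (y k - x k))\<bar> \<le> L * (\<Sum>k<m. \<bar>y k - x k\<bar>)\<^sup>2"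
  using m y
proof (induction m arbitrary: y)
  case 0
  then have "y = x" by (intro ext) simp
  then show ?case by simp
next
  case (Suc m)
  have md: "m < d" using Suc.prems(1) by simp
  define y' where "y' = y(m := x m)"
  have y': "y' \<in> Rd d" unfolding y'_def by (rule upd_Rd[OF Suc.prems(2) md])
  have eq: "\<forall>k\<ge>m. y' k = x k"
  proof (intro allI impI)
    fix k assume "m \<le> k"
    then show "y' k = x k" using Suc.prems(3) by (cases "k = m") (auto simp: y'_def)
  qed
  define A where "A = (\<Sum>k<m. \<bar>y k - x k\<bar>)"
  define b where "b = \<bar>y m - x m\<bar>"
  have A: "0 \<le> A" "0 \<le> b" unfolding A_def b_def by (auto intro: sum_nonneg)
  have L: "0 \<le> L" by (rule order_trans[OF abs_ge_zero B[OF order_refl md x]])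
  have "\<bar>f y' - f x - (\<Sum>k<m. f' k x * (y' k - x k))\<bar> \<le> L * (\<Sum>k<m. \<bar>y' k - x k\<bar>)\<^sup>2"
    using md by (intro Suc.IH y' eq) simp
  then have 1: "\<bar>f y' - f x - (\<Sum>k<m. f' k x * (y k - x k))\<bar> \<le> L * A\<^sup>2"
    unfolding A_def by (simp add: y'_def)
  obtain \<xi> where xi: "\<bar>\<xi> - x m\<bar> \<le> \<bar>y m - x m\<bar>" "f y - f y' = f' m (y(m := \<xi>)) * (y m - x m)"
    using MVT_interval[of "\<lambda>z. f (y(m := z))" "\<lambda>z. f' m (y(m := z))" "x m" "y m", OF D[OF md Suc.prems(2)]]
    unfolding y'_def by auto
  have "\<bar>f' m (y(m := \<xi>)) - f' m x\<bar> \<le> L * (\<Sum>k<Suc m. \<bar>(y(m := \<xi>)) k - x k\<bar>)"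
  proof (rule abs_diff_le_of_partials[where n = "Suc m" and f' = "\<lambda>l. f'' l m" and d = d])
    fix l x z assume l: "l < Suc m" and x: "x \<in> Rd d"
    show "((\<lambda>z. f' m (x(l := z))) has_real_derivative f'' l m (x(l := z))) (at z)"
      using l md x by (intro D2) auto
    show "\<bar>f'' l m x\<bar> \<le> L" using l md x by (intro B) auto
  next
    show "y(m := \<xi>) \<in> Rd d" by (rule upd_Rd[OF Suc.prems(2) md])
    show "\<forall>k\<ge>Suc m. (y(m := \<xi>)) k = x k" using Suc.prems(3) by auto
  qed (use md x in auto)
  also have "\<dots> \<le> L * (A + b)"
    using L xi(1) unfolding A_def b_def by (intro mult_left_mono) auto
  finally have "\<bar>(f' m (y(m := \<xi>)) - f' m x) * (y m - x m)\<bar> \<le> L * (A + b) * b"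
    unfolding abs_mult b_def by (rule mult_right_mono) simp
  moreover have "f y - f x - (\<Sum>k<Suc m. f' k x * (y k - x k))
      = (f y' - f x - (\<Sum>k<m. f' k x * (y k - x k))) + (f' m (y(m := \<xi>)) - f' m x) * (y m - x m)"
    using xi(2) by (simp add: algebra_simps)
  ultimately have "\<bar>f y - f x - (\<Sum>k<Suc m. f' k x * (y k - x k))\<bar> \<le> L * A\<^sup>2 + L * (A + b) * b"
    using 1 by linarith
  also have "\<dots> \<le> L * (A + b)\<^sup>2"
    using L A by (simp add: power2_eq_square algebra_simps)
  finally show ?case by (simp add: A_def b_def)
qed

lemma first_order_expansion_C2:
  assumes C: "C_k d 2 f"
    and B: "\<And>\<alpha> x. (\<Sum>i<d. \<alpha> i) \<in> {1..2} \<Longrightarrow> x \<in> Rd d \<Longrightarrow> \<bar>multi_deriv \<alpha> d f x\<bar> \<le> L"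
    and x: "x \<in> Rd d" and y: "y \<in> Rd d"
  shows "\<bar>f y - f x - (\<Sum>k<d. partial_deriv k f x * (y k - x k))\<bar> \<le> L * (l1_dist d x y)\<^sup>2"
    and "\<bar>f y - f x\<bar> \<le> L * l1_dist d x y"
    and "i < d \<Longrightarrow> \<bar>partial_deriv i f (x(i := z)) - partial_deriv i f (x(i := z'))\<bar> \<le> L * \<bar>z - z'\<bar>"
proof -
  have C1: "C_k d (Suc (Suc 0)) f" using C by (simp add: numeral_2_eq_2)
  have C2: "C_k d (Suc 0) (partial_deriv k f)" if "k < d" for k using C1 that by simp
  have out: "\<forall>k\<ge>d. y k = x k" using x y by (auto simp: PiE_iff extensional_def)
  note B1 = partial_deriv_bounds(1)[of d f L, OF B] and B2 = partial_deriv_bounds(2)[of d f L, OF B]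
  show "\<bar>f y - f x - (\<Sum>k<d. partial_deriv k f x * (y k - x k))\<bar> \<le> L * (l1_dist d x y)\<^sup>2"
    unfolding l1_dist_def
  proof (rule first_order_expansion[where d = d and f'' = "\<lambda>l k. partial_deriv l (partial_deriv k f)"])
    fix l k x z assume "l \<le> k" "k < d" "x \<in> Rd d"
    then show "((\<lambda>z. partial_deriv k f (x(l := z))) has_real_derivative partial_deriv l (partial_deriv k f) (x(l := z))) (at z)"
      using C_k_partial[OF C2, of k x l] by simp
    show "\<bar>partial_deriv l (partial_deriv k f) x\<bar> \<le> L"
      using \<open>l \<le> k\<close> \<open>k < d\<close> \<open>x \<in> Rd d\<close> by (intro B2) auto
  qed (use C_k_partial[OF C1] x y out in blast)+
  show "\<bar>f y - f x\<bar> \<le> L * l1_dist d x y"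
    unfolding l1_dist_def
  proof (rule abs_diff_le_of_partials[where n = d and d = d and f' = "\<lambda>k. partial_deriv k f"])
    show "\<bar>partial_deriv k f x\<bar> \<le> L" if "k < d" "x \<in> Rd d" for k x
      using that by (intro B1) auto
  qed (use C_k_partial[OF C1] x y out in blast)+
  show "\<bar>partial_deriv i f (x(i := z)) - partial_deriv i f (x(i := z'))\<bar> \<le> L * \<bar>z - z'\<bar>" if i: "i < d"
  proof (rule Lipschitz_of_bounded_derivative[where f = "\<lambda>z. partial_deriv i f (x(i := z))"])
    show "((\<lambda>z. partial_deriv i f (x(i := z))) has_real_derivative partial_deriv i (partial_deriv i f) (x(i := z))) (at z)" for z
      by (rule C_k_partial[OF C2[OF i] x i])
    show "\<bar>partial_deriv i (partial_deriv i f) (x(i := z))\<bar> \<le> L" for z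
      using upd_Rd[OF x i] i by (intro B2) auto
  qed
qed

section \<open>Euler maps of the approximate flow\<close>

text \<open>The l1 norm; not to be confused with the second logarithmic derivative \<open>l1\<close>
  of a Gaussian mixture.\<close>

definition l1 :: "nat \<Rightarrow> (nat \<Rightarrow> real) \<Rightarrow> real" where "l1 d x = (\<Sum>i<d. \<bar>x i\<bar>)"

lemma l1_nonneg [simp]: "0 \<le> l1 d x"
  unfolding l1_def by (intro sum_nonneg) auto

lemma abs_le_l1: "i < d \<Longrightarrow> \<bar>x i\<bar> \<le> l1 d x"
  unfolding l1_def by (rule member_le_sum[of i "{..<d}" "\<lambda>i. \<bar>x i\<bar>"]) auto

lemma l1_dist_0: "l1_dist d (\<lambda>i\<in>{..<d}. 0) x = l1 d x"
  unfolding l1_dist_def l1_def by simp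

lemma abs_set_integral_le:
  fixes f g :: "real \<Rightarrow> real"
  assumes "set_integrable lborel A f" "set_integrable lborel A g" "\<And>r. r \<in> A \<Longrightarrow> \<bar>f r\<bar> \<le> g r"
  shows "\<bar>LINT r:A|lborel. f r\<bar> \<le> (LINT r:A|lborel. g r)"
proof -
  have "\<bar>LINT r:A|lborel. f r\<bar> \<le> (LINT r:A|lborel. \<bar>f r\<bar>)"
    using set_integral_norm_bound[OF assms(1)] by simp
  also have "\<dots> \<le> (LINT r:A|lborel. g r)"
    using assms by (intro set_integral_mono set_integrable_abs) auto
  finally show ?thesis .
qed

lemma set_integral_Ioc_diff:
  fixes f :: "real \<Rightarrow> real"
  assumes "set_integrable lborel {0..S} f" "0 \<le> a" "a \<le> b" "b \<le> S"
  shows "(LINT r:{0..b}|lborel. f r) - (LINT r:{0..a}|lborel. f r) = (LINT r:{a<..b}|lborel. f r)"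
    and "set_integrable lborel {a<..b} f"
proof -
  have sub: "set_integrable lborel {0..a} f" "set_integrable lborel {a<..b} f"
    using assms by (auto intro: set_integrable_subset)
  have "{0..b} = {0..a} \<union> {a<..b}" using assms by auto
  moreover have "{0..a} \<inter> {a<..b} = {}" by auto
  ultimately show "(LINT r:{0..b}|lborel. f r) - (LINT r:{0..a}|lborel. f r) = (LINT r:{a<..b}|lborel. f r)"
    using set_integral_Un[OF _ sub] by simp
  show "set_integrable lborel {a<..b} f" by fact
qed

text \<open>The conditions are imposed at all real times; s and L will be set to 0 outside the time
  interval. The gradient \<open>s'\<close> is specified through the quadratic remainder, the form in
  which it enters the Euler maps. \<open>s_second\<close> concerns the i-th derivative of the i-th
  component along axis i alone, as the integration by parts proceeds axis by axis.\<close>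

locale regular_drift =
  fixes d :: nat and s :: "real \<Rightarrow> (nat \<Rightarrow> real) \<Rightarrow> nat \<Rightarrow> real"
    and s' :: "real \<Rightarrow> (nat \<Rightarrow> real) \<Rightarrow> nat \<Rightarrow> nat \<Rightarrow> real" and L :: "real \<Rightarrow> real"
  assumes d_pos: "1 \<le> d"
    and s_measurable: "\<And>x i. x \<in> Rd d \<Longrightarrow> i < d \<Longrightarrow> (\<lambda>r. s r x i) \<in> borel_measurable borel"
    and L_integrable: "integrable lborel L" and L_nonneg: "\<And>r. 0 \<le> L r"
    and s_Lipschitz: "\<And>r x y i. x \<in> Rd d \<Longrightarrow> y \<in> Rd d \<Longrightarrow> i < d \<Longrightarrow> \<bar>s r y i - s r x i\<bar> \<le> L r * l1_dist d x y"
    and s_0: "\<And>r i. i < d \<Longrightarrow> \<bar>s r (\<lambda>i\<in>{..<d}. 0) i\<bar> \<le> L r"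
    and s_quad: "\<And>r i. i < d \<Longrightarrow> quad_approx d (\<lambda>x. s r x i) (\<lambda>x. s' r x i) (L r) (L r)"
    and s_second: "\<And>r x i z z'. x \<in> Rd d \<Longrightarrow> i < d \<Longrightarrow> \<bar>s' r (x(i := z)) i i - s' r (x(i := z')) i i\<bar> \<le> L r * \<bar>z - z'\<bar>"
begin

lemma s_growth: "x \<in> Rd d \<Longrightarrow> i < d \<Longrightarrow> \<bar>s r x i\<bar> \<le> L r * (1 + l1 d x)"
  using s_Lipschitz[of "\<lambda>i\<in>{..<d}. 0" x i r] s_0[of i r] by (auto simp: l1_dist_0 distrib_left)

lemma s_continuous: "i < d \<Longrightarrow> continuous_on (Rd d) (\<lambda>x. s r x i)"
  using s_quad by (rule quad_approx_continuous)

lemma s_joint_measurable: "i < d \<Longrightarrow> (\<lambda>(r, x). s r x i) \<in> borel_measurable (borel \<Otimes>\<^sub>M leb d)"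
  by (rule measurable_Caratheodory) (auto intro: s_measurable s_continuous)

text \<open>The quadratic remainder makes \<open>s'\<close> a pointwise limit of difference
  quotients with steps 1 / (n + 1), each of which is measurable in time.\<close>

lemma s'_measurable:
  assumes x: "x \<in> Rd d" and i: "i < d" and j: "j < d"
  shows "(\<lambda>r. s' r x i j) \<in> borel_measurable borel"
proof (rule borel_measurable_LIMSEQ_real)
  fix n
  show "(\<lambda>r. (s r (x(j := x j + 1 / real (Suc n))) i - s r x i) * real (Suc n)) \<in> borel_measurable borel"
    using s_measurable[OF x i] s_measurable[OF upd_Rd[OF x j] i] by simp
next
  fix r
  have "\<bar>(s r (x(j := x j + 1 / real (Suc n))) i - s r x i) * real (Suc n) - s' r x i j\<bar> \<le> L r * (1 / real (Suc n))" for n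
  proof -
    define t where "t = 1 / real (Suc n)"
    have t: "0 < t" by (simp add: t_def)
    have "\<bar>s r (x(j := x j + t)) i - s r x i - (\<Sum>k<d. s' r x i k * ((x(j := x j + t)) k - x k))\<bar>
        \<le> L r * (l1_dist d x (x(j := x j + t)))\<^sup>2"
      using quad_approxD(2)[OF s_quad[OF i] x upd_Rd[OF x j]] .
    moreover have "(\<Sum>k<d. s' r x i k * ((x(j := x j + t)) k - x k)) = s' r x i j * t"
      using j by (subst sum.remove[of _ j]) (auto intro!: sum.neutral)
    moreover have "l1_dist d x (x(j := x j + t)) = t"
      using l1_dist_upd[OF j, of x "x j" "x j + t"] t by simp
    ultimately have "\<bar>s r (x(j := x j + t)) i - s r x i - s' r x i j * t\<bar> \<le> L r * t\<^sup>2" by simp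
    then have "\<bar>s r (x(j := x j + t)) i - s r x i - s' r x i j * t\<bar> / t \<le> L r * t\<^sup>2 / t"
      using t by (intro divide_right_mono) auto
    also have "\<bar>s r (x(j := x j + t)) i - s r x i - s' r x i j * t\<bar> / t
        = \<bar>(s r (x(j := x j + t)) i - s r x i - s' r x i j * t) / t\<bar>" using t by simp
    also have "(s r (x(j := x j + t)) i - s r x i - s' r x i j * t) / t
        = (s r (x(j := x j + t)) i - s r x i) * real (Suc n) - s' r x i j"
    proof -
      have "(A - B * c) / c = A * m - B" if "c * m = 1" for A B c m :: real
      proof -
        have c: "c \<noteq> 0" using that by auto
        then have "m = 1 / c" using that by (simp add: nonzero_eq_divide_eq mult.commute)
        with c show ?thesis by (simp add: diff_divide_distrib)
      qed
      moreover have "t * real (Suc n) = 1" by (simp add: t_def)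
      ultimately show ?thesis by blast
    qed
    also have "L r * t\<^sup>2 / t = L r * t" using t by (simp add: power2_eq_square)
    finally show ?thesis unfolding t_def .
  qed
  then have le: "\<forall>n. norm ((s r (x(j := x j + 1 / real (Suc n))) i - s r x i) * real (Suc n) - s' r x i j)
      \<le> L r * (1 / real (Suc n))"
    unfolding real_norm_def by blast
  have lim: "(\<lambda>n. L r * (1 / real (Suc n))) \<longlonglongrightarrow> 0"
    using tendsto_mult_right_zero[OF LIMSEQ_inverse_real_of_nat, of "L r"] by (simp add: inverse_eq_divide)
  show "(\<lambda>n. (s r (x(j := x j + 1 / real (Suc n))) i - s r x i) * real (Suc n)) \<longlonglongrightarrow> s' r x i j"
    by (rule LIM_zero_cancel[OF Lim_null_comparison[OF always_eventually[OF le] lim]])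
qed

text \<open>A clock for the drift x + s: the 1 accounts for the linear part and L for s, in the
  growth bound as well as in the Lipschitz bound. Measured in this clock all rates are bounded,
  although L need not be.\<close>

definition elen :: "real \<Rightarrow> real \<Rightarrow> real" where "elen a b = (LINT r:{a<..b}|lborel. 1 + L r)"

lemma integrable_L: "set_integrable lborel {a<..b} L" "set_integrable lborel {a<..b} (\<lambda>r. 1 + L r)"
  "set_integrable lborel {a<..b} (\<lambda>r. c :: real)"
proof -
  show L: "set_integrable lborel {a<..b} L"
    unfolding set_integrable_def using L_integrable by (intro integrable_mult_indicator) auto
  show c: "set_integrable lborel {a<..b} (\<lambda>r. c :: real)" for c
    unfolding set_integrable_def by (cases "a \<le> b") auto
  show "set_integrable lborel {a<..b} (\<lambda>r. 1 + L r)"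
    by (rule set_integral_add[OF c L])
qed

lemma set_integral_const_Ioc: "a \<le> b \<Longrightarrow> (LINT r:{a<..b}|lborel. c :: real) = c * (b - a)"
  unfolding set_lebesgue_integral_def by simp

lemma elen_eq: "a \<le> b \<Longrightarrow> elen a b = (b - a) + (LINT r:{a<..b}|lborel. L r)"
  unfolding elen_def by (subst set_integral_add) (auto simp: integrable_L set_integral_const_Ioc)

lemma int_L_nonneg: "0 \<le> (LINT r:{a<..b}|lborel. L r)"
  unfolding set_lebesgue_integral_def by (intro Bochner_Integration.integral_nonneg) (simp add: L_nonneg)

lemma elen_nonneg: "0 \<le> elen a b"
  unfolding elen_def set_lebesgue_integral_def
  by (intro Bochner_Integration.integral_nonneg) (simp add: L_nonneg add_nonneg_nonneg)

lemma elen_ge: "a \<le> b \<Longrightarrow> b - a \<le> elen a b" "a \<le> b \<Longrightarrow> (LINT r:{a<..b}|lborel. L r) \<le> elen a b"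
  using elen_eq[of a b] int_L_nonneg[of a b] by auto

lemma elen_mono: "b \<le> c \<Longrightarrow> elen a b \<le> elen a c"
  unfolding elen_def set_lebesgue_integral_def
  using integrable_L[unfolded set_integrable_def] L_nonneg
  by (intro integral_mono) (auto simp: indicator_def add_nonneg_nonneg)

lemma integrable_of_L_bound:
  fixes f :: "real \<Rightarrow> real"
  assumes [measurable]: "f \<in> borel_measurable borel" and f: "\<And>r. \<bar>f r\<bar> \<le> L r * c"
  shows "set_integrable lborel {a<..b} f"
  unfolding set_integrable_def
proof (rule integrable_mult_indicator)
  show "integrable lborel f"
  proof (rule Bochner_Integration.integrable_bound[of lborel "\<lambda>r. L r * c"])
    show "AE r in lborel. norm (f r) \<le> norm (L r * c)"
    proof (rule AE_I2)
      fix r show "norm (f r) \<le> norm (L r * c)" using f[of r] by simp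
    qed
  qed (use L_integrable in auto)
qed auto

lemma integrable_s: "x \<in> Rd d \<Longrightarrow> i < d \<Longrightarrow> set_integrable lborel {a<..b} (\<lambda>r. s r x i)"
  using s_growth by (intro integrable_of_L_bound[where c = "1 + l1 d x"] s_measurable) auto

lemma integrable_s': "x \<in> Rd d \<Longrightarrow> i < d \<Longrightarrow> j < d \<Longrightarrow> set_integrable lborel {a<..b} (\<lambda>r. s' r x i j)"
  using quad_approxD(1)[OF s_quad]
  by (intro integrable_of_L_bound[where c = 1] s'_measurable) auto

definition euler :: "real \<Rightarrow> real \<Rightarrow> (nat \<Rightarrow> real) \<Rightarrow> nat \<Rightarrow> real" where
  "euler a b x = (\<lambda>i\<in>{..<d}. x i + (LINT r:{a<..b}|lborel. x i + s r x i))"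

lemma euler_Rd [simp]: "euler a b x \<in> Rd d"
  by (auto simp: euler_def)

lemma euler_eq:
  assumes "x \<in> Rd d" "i < d" "a \<le> b"
  shows "euler a b x i = (1 + (b - a)) * x i + (LINT r:{a<..b}|lborel. s r x i)"
  using assms integrable_s[OF assms(1,2)] integrable_L(3)
  by (simp add: euler_def set_integral_add set_integral_const_Ioc algebra_simps)

text \<open>At each time r the remainder of s is quadratic with constant L r, so the remainder of
  the Euler map is quadratic with at most \<open>elen a b\<close>; no smoothness in time is
  involved. Its approximate Jacobian is 1 + (b - a) times the identity plus the time integral of
  \<open>s'\<close>. The column sums are at most 1 + (b - a) plus d times the integral of L, and d
  \<ge> 1 absorbs this into 1 + d * elen a b.\<close>

lemma quad_approx_euler:
  fixes \<Lambda> H :: real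
  assumes Q: "quad_approx d u p \<Lambda> H" and ab: "a \<le> b" and nn: "0 \<le> \<Lambda>" "0 \<le> H"
  shows "\<exists>p'. quad_approx d (\<lambda>x. u (euler a b x)) p' (\<Lambda> * (1 + d * elen a b)) (H * (1 + d * elen a b)\<^sup>2 + d * \<Lambda> * elen a b)"
proof (rule exI, rule quad_approx_comp[OF Q _ _ _ _ nn])
  define J where "J x i j = (if i = j then 1 + (b - a) else 0) + (LINT r:{a<..b}|lborel. s' r x i j)" for x i j
  define IL where "IL = (LINT r:{a<..b}|lborel. L r)"
  have IL: "0 \<le> IL" "IL \<le> elen a b" "(b - a) + IL = elen a b"
    using int_L_nonneg elen_ge elen_eq ab by (auto simp: IL_def)
  have kap: "1 + (b - a) + d * IL \<le> 1 + d * elen a b"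
  proof -
    have "1 * (b - a) \<le> real d * (b - a)" using d_pos ab by (intro mult_right_mono) auto
    then show ?thesis using IL(3) by (simp add: distrib_left flip: IL(3))
  qed
  show "euler a b x \<in> Rd d" for x by simp
  show "\<bar>euler a b y i - euler a b x i - (\<Sum>j<d. J x i j * (y j - x j))\<bar> \<le> elen a b * (l1_dist d x y)\<^sup>2"
    if x: "x \<in> Rd d" and y: "y \<in> Rd d" and i: "i < d" for x y i
  proof -
    have "(\<Sum>j<d. J x i j * (y j - x j)) = (\<Sum>j<d. (if i = j then 1 + (b - a) else 0) * (y j - x j))
        + (\<Sum>j<d. (LINT r:{a<..b}|lborel. s' r x i j) * (y j - x j))"
      by (simp add: J_def distrib_right sum.distrib)
    also have "(\<Sum>j<d. (if i = j then 1 + (b - a) else 0) * (y j - x j)) = (1 + (b - a)) * (y i - x i)"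
      using i by (subst sum.remove[of _ i]) (auto intro!: sum.neutral)
    also have "(\<Sum>j<d. (LINT r:{a<..b}|lborel. s' r x i j) * (y j - x j))
        = (LINT r:{a<..b}|lborel. (\<Sum>j<d. s' r x i j * (y j - x j)))"
    proof -
      have "integrable lborel (\<lambda>r. indicator {a<..b} r *\<^sub>R (s' r x i j * (y j - x j)))" if "j < d" for j
        using set_integrable_mult_left[of "y j - x j" lborel "{a<..b}", OF integrable_s'[OF x i that]]
        unfolding set_integrable_def .
      then show ?thesis
        unfolding set_lebesgue_integral_def scaleR_sum_right
        by (subst Bochner_Integration.integral_sum) (auto simp: mult.assoc intro!: sum.cong
          simp flip: integral_mult_left_zero)
    qed
    finally have J_sum: "(\<Sum>j<d. J x i j * (y j - x j)) = (1 + (b - a)) * (y i - x i)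
      + (LINT r:{a<..b}|lborel. (\<Sum>j<d. s' r x i j * (y j - x j)))" .
    have int: "set_integrable lborel {a<..b} (\<lambda>r. \<Sum>j<d. s' r x i j * (y j - x j))"
      unfolding set_integrable_def scaleR_sum_right
      using integrable_s'[OF x i] unfolding set_integrable_def
      by (intro Bochner_Integration.integrable_sum) (auto simp flip: mult.assoc)
    have int2: "set_integrable lborel {a<..b} (\<lambda>r. s r y i - s r x i)"
      by (intro set_integral_diff integrable_s x y i)
    have "euler a b y i - euler a b x i - (\<Sum>j<d. J x i j * (y j - x j))
        = (LINT r:{a<..b}|lborel. s r y i - s r x i - (\<Sum>j<d. s' r x i j * (y j - x j)))"
      unfolding J_sum euler_eq[OF x i ab] euler_eq[OF y i ab]
      using int int2 integrable_s[OF x i] integrable_s[OF y i]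
      by (simp add: set_integral_diff right_diff_distrib)
    then have "\<bar>euler a b y i - euler a b x i - (\<Sum>j<d. J x i j * (y j - x j))\<bar>
        \<le> (LINT r:{a<..b}|lborel. L r * (l1_dist d x y)\<^sup>2)"
      using quad_approxD(2)[OF s_quad[OF i] x y]
      by (simp only:, intro abs_set_integral_le set_integral_diff(1)[OF int2 int]
        set_integrable_mult_left integrable_L(1))
    also have "\<dots> = IL * (l1_dist d x y)\<^sup>2" by (simp add: IL_def)
    also have "\<dots> \<le> elen a b * (l1_dist d x y)\<^sup>2" using IL by (intro mult_right_mono) auto
    finally show ?thesis .
  qed
  show "(\<Sum>i<d. \<bar>J x i j\<bar>) \<le> 1 + d * elen a b" if x: "x \<in> Rd d" and j: "j < d" for x j
  proof -
    have "\<bar>J x i j\<bar> \<le> (if i = j then 1 + (b - a) else 0) + IL" if i: "i < d" for i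
    proof -
      have "\<bar>LINT r:{a<..b}|lborel. s' r x i j\<bar> \<le> IL"
        unfolding IL_def using quad_approxD(1)[OF s_quad[OF i] x j]
        by (intro abs_set_integral_le integrable_s' x i j integrable_L)
      then show ?thesis using ab unfolding J_def by auto
    qed
    then have "(\<Sum>i<d. \<bar>J x i j\<bar>) \<le> (\<Sum>i<d. (if i = j then 1 + (b - a) else 0) + IL)" by (intro sum_mono) auto
    also have "\<dots> = 1 + (b - a) + d * IL" using j by (simp add: sum.distrib)
    finally show ?thesis using kap by linarith
  qed
  show "l1_dist d (euler a b x) (euler a b y) \<le> (1 + d * elen a b) * l1_dist d x y"
    if x: "x \<in> Rd d" and y: "y \<in> Rd d" for x y
  proof -
    have "\<bar>euler a b y i - euler a b x i\<bar> \<le> (1 + (b - a)) * \<bar>y i - x i\<bar> + IL * l1_dist d x y" if i: "i < d" for i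
    proof -
      have "\<bar>LINT r:{a<..b}|lborel. s r y i - s r x i\<bar> \<le> (LINT r:{a<..b}|lborel. L r * l1_dist d x y)"
        using s_Lipschitz[OF x y i] integrable_L(1)
        by (intro abs_set_integral_le set_integral_diff integrable_s x y i) auto
      also have "\<dots> = IL * l1_dist d x y" by (simp add: IL_def)
      finally have "\<bar>LINT r:{a<..b}|lborel. s r y i - s r x i\<bar> \<le> IL * l1_dist d x y" .
      moreover have "euler a b y i - euler a b x i = (1 + (b - a)) * (y i - x i) + (LINT r:{a<..b}|lborel. s r y i - s r x i)"
        unfolding euler_eq[OF x i ab] euler_eq[OF y i ab]
        using integrable_s[OF x i] integrable_s[OF y i] by (simp add: set_integral_diff right_diff_distrib)
      moreover have "\<bar>(1 + (b - a)) * (y i - x i)\<bar> = (1 + (b - a)) * \<bar>y i - x i\<bar>"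
        using ab by (simp add: abs_mult)
      ultimately show ?thesis by linarith
    qed
    then have "l1_dist d (euler a b x) (euler a b y) \<le> (\<Sum>i<d. (1 + (b - a)) * \<bar>y i - x i\<bar> + IL * l1_dist d x y)"
      unfolding l1_dist_def[of d "euler a b x"] by (intro sum_mono) auto
    also have "\<dots> = (1 + (b - a) + d * IL) * l1_dist d x y"
      by (simp add: sum.distrib sum_distrib_left[symmetric] l1_dist_def[symmetric] distrib_right)
    also have "\<dots> \<le> (1 + d * elen a b) * l1_dist d x y" using kap by (intro mult_right_mono) auto
    finally show ?thesis .
  qed
qed

primrec euler_iter :: "(nat \<Rightarrow> real) \<Rightarrow> nat \<Rightarrow> (nat \<Rightarrow> real) \<Rightarrow> nat \<Rightarrow> real" where
  "euler_iter t 0 x = x"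
| "euler_iter t (Suc k) x = euler (t k) (t (Suc k)) (euler_iter t k x)"

lemma euler_iter_Rd: "x \<in> Rd d \<Longrightarrow> euler_iter t k x \<in> Rd d"
  by (cases k) auto

text \<open>Discrete Gronwall. During one step each coordinate of the exact path moves by at most
  \<epsilon> (1 + M), so freezing the position costs (d \<epsilon>)^2 (1 + M) in total, and earlier
  errors are amplified by 1 + d \<epsilon>. The sum over k steps is estimated by k times the largest
  term.\<close>

lemma euler_iter_error:
  fixes Y :: "real \<Rightarrow> nat \<Rightarrow> real" and M \<epsilon> :: real
  assumes x: "x \<in> Rd d" and Y0: "Y 0 = x"
    and Y: "\<And>r. r \<in> {0..S} \<Longrightarrow> Y r \<in> Rd d"
      "\<And>i. i < d \<Longrightarrow> set_integrable lborel {0..S} (\<lambda>r. Y r i + s r (Y r) i)"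
      "\<And>r i. r \<in> {0..S} \<Longrightarrow> i < d \<Longrightarrow> Y r i = x i + (LINT q:{0..r}|lborel. Y q i + s q (Y q) i)"
    and M: "\<And>r. r \<in> {0..S} \<Longrightarrow> l1 d (Y r) \<le> M"
    and t: "t 0 = 0" "\<And>k. k < n \<Longrightarrow> t k \<le> t (Suc k)" "\<And>k. k \<le> n \<Longrightarrow> t k \<in> {0..S}"
    and e: "\<And>k. k < n \<Longrightarrow> elen (t k) (t (Suc k)) \<le> \<epsilon>" "0 \<le> \<epsilon>"
  shows "k \<le> n \<Longrightarrow> l1_dist d (euler_iter t k x) (Y (t k)) \<le> k * ((d * \<epsilon>)\<^sup>2 * (1 + M)) * (1 + d * \<epsilon>) ^ k"
proof (induction k)
  case 0
  then show ?case using t(1) Y0 by (simp add: l1_dist_def)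
next
  case (Suc k)
  define X where "X = euler_iter t k x"
  define c where "c = (d * \<epsilon>)\<^sup>2 * (1 + M)"
  define e' where "e' = l1_dist d X (Y (t k))"
  have X: "X \<in> Rd d" unfolding X_def using x by (rule euler_iter_Rd)
  have M0: "0 \<le> M" using M[of "t k"] l1_nonneg[of d "Y (t k)"] t(3)[of k] Suc.prems by (auto simp del: l1_nonneg)
  have c0: "0 \<le> c" unfolding c_def using M0 by simp
  have tk: "t k \<le> t (Suc k)" "0 \<le> t k" "t (Suc k) \<le> S" "elen (t k) (t (Suc k)) \<le> \<epsilon>"
    using t(2)[of k] t(3)[of k] t(3)[of "Suc k"] e(1)[of k] Suc.prems by auto
  have incr: "Y r i - Y (t k) i = (LINT q:{t k<..r}|lborel. Y q i + s q (Y q) i)"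
      "set_integrable lborel {t k<..r} (\<lambda>q. Y q i + s q (Y q) i)"
    if "r \<in> {t k..t (Suc k)}" "i < d" for r i
    using set_integral_Ioc_diff[OF Y(2)[OF that(2)], of "t k" r] Y(3)[of r i] Y(3)[of "t k" i] that tk by auto
  have near: "\<bar>Y r i - Y (t k) i\<bar> \<le> \<epsilon> * (1 + M)" if r: "r \<in> {t k..t (Suc k)}" and i: "i < d" for r i
  proof -
    have "\<bar>Y r i - Y (t k) i\<bar> \<le> (LINT q:{t k<..r}|lborel. (1 + L q) * (1 + M))"
      unfolding incr[OF r i]
    proof (rule abs_set_integral_le[OF incr(2)[OF r i]])
      show "set_integrable lborel {t k<..r} (\<lambda>q. (1 + L q) * (1 + M))"
        using integrable_L(2) by auto
      fix q assume q: "q \<in> {t k<..r}"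
      then have qS: "q \<in> {0..S}" using r tk by auto
      have "\<bar>s q (Y q) i\<bar> \<le> L q * (1 + M)"
        using s_growth[OF Y(1)[OF qS] i, of q] mult_left_mono[OF add_left_mono[OF M[OF qS], of 1] L_nonneg[of q]]
        by linarith
      moreover have "\<bar>Y q i\<bar> \<le> M" using abs_le_l1[OF i, of "Y q"] M[OF qS] by linarith
      ultimately show "\<bar>Y q i + s q (Y q) i\<bar> \<le> (1 + L q) * (1 + M)"
        using abs_triangle_ineq[of "Y q i" "s q (Y q) i"] by (simp add: distrib_right)
    qed
    also have "\<dots> = elen (t k) r * (1 + M)" by (simp add: elen_def)
    also have "\<dots> \<le> \<epsilon> * (1 + M)"
      using elen_mono[of r "t (Suc k)" "t k"] r tk M0 by (intro mult_right_mono) auto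
    finally show ?thesis .
  qed
  have dist: "l1_dist d X (Y r) \<le> e' + d * \<epsilon> * (1 + M)" if r: "r \<in> {t k..t (Suc k)}" for r
  proof -
    have "l1_dist d (Y (t k)) (Y r) \<le> (\<Sum>i<d. \<epsilon> * (1 + M))"
      unfolding l1_dist_def using near[OF r] by (intro sum_mono) auto
    then show ?thesis using l1_dist_triangle[of d X "Y r" "Y (t k)"] by (simp add: e'_def)
  qed
  have "\<bar>Y (t (Suc k)) i - euler_iter t (Suc k) x i\<bar> \<le> \<bar>Y (t k) i - X i\<bar> + \<epsilon> * (e' + d * \<epsilon> * (1 + M))" if i: "i < d" for i
  proof -
    let ?A = "{t k<..t (Suc k)}"
    have r: "t (Suc k) \<in> {t k..t (Suc k)}" using tk by auto
    have intX: "set_integrable lborel ?A (\<lambda>q. X i + s q X i)"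
      by (intro set_integral_add integrable_L integrable_s X i)
    have "Y (t (Suc k)) i - euler_iter t (Suc k) x i
        = (Y (t k) i - X i) + ((LINT q:?A|lborel. Y q i + s q (Y q) i) - (LINT q:?A|lborel. X i + s q X i))"
      using incr(1)[OF r i] i by (simp add: euler_def X_def)
    also have "(LINT q:?A|lborel. Y q i + s q (Y q) i) - (LINT q:?A|lborel. X i + s q X i)
        = (LINT q:?A|lborel. (Y q i + s q (Y q) i) - (X i + s q X i))"
      by (rule set_integral_diff(2)[OF incr(2)[OF r i] intX, symmetric])
    finally have eq: "Y (t (Suc k)) i - euler_iter t (Suc k) x i
      = (Y (t k) i - X i) + (LINT q:?A|lborel. (Y q i + s q (Y q) i) - (X i + s q X i))" .
    have "\<bar>LINT q:?A|lborel. (Y q i + s q (Y q) i) - (X i + s q X i)\<bar>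
        \<le> (LINT q:?A|lborel. (1 + L q) * (e' + d * \<epsilon> * (1 + M)))"
    proof (rule abs_set_integral_le)
      show "set_integrable lborel ?A (\<lambda>q. (Y q i + s q (Y q) i) - (X i + s q X i))"
        by (rule set_integral_diff(1)[OF incr(2)[OF r i] intX])
      show "set_integrable lborel ?A (\<lambda>q. (1 + L q) * (e' + d * \<epsilon> * (1 + M)))"
        using integrable_L(2) by auto
      fix q assume q: "q \<in> ?A"
      then have qS: "q \<in> {0..S}" using tk by auto
      have D: "l1_dist d X (Y q) \<le> e' + d * \<epsilon> * (1 + M)" using q by (intro dist) auto
      have "\<bar>s q (Y q) i - s q X i\<bar> \<le> L q * (e' + d * \<epsilon> * (1 + M))"
        using s_Lipschitz[OF X Y(1)[OF qS] i, of q] mult_left_mono[OF D L_nonneg[of q]] by linarith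
      moreover have "\<bar>Y q i - X i\<bar> \<le> e' + d * \<epsilon> * (1 + M)"
        using abs_le_l1_dist[OF i, of "Y q" X] D by linarith
      ultimately have "\<bar>(Y q i - X i) + (s q (Y q) i - s q X i)\<bar> \<le> (1 + L q) * (e' + d * \<epsilon> * (1 + M))"
        using abs_triangle_ineq[of "Y q i - X i" "s q (Y q) i - s q X i"] by (simp add: distrib_right)
      then show "\<bar>(Y q i + s q (Y q) i) - (X i + s q X i)\<bar> \<le> (1 + L q) * (e' + d * \<epsilon> * (1 + M))"
        by (simp add: algebra_simps)
    qed
    also have "\<dots> = elen (t k) (t (Suc k)) * (e' + d * \<epsilon> * (1 + M))" by (simp add: elen_def)
    also have "\<dots> \<le> \<epsilon> * (e' + d * \<epsilon> * (1 + M))"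
      using tk M0 e(2) by (intro mult_right_mono) (auto simp: e'_def)
    finally show ?thesis unfolding eq by linarith
  qed
  then have "l1_dist d (euler_iter t (Suc k) x) (Y (t (Suc k))) \<le> (\<Sum>i<d. \<bar>Y (t k) i - X i\<bar> + \<epsilon> * (e' + d * \<epsilon> * (1 + M)))"
    unfolding l1_dist_def[of d "euler_iter t (Suc k) x"] by (intro sum_mono) auto
  also have "\<dots> = (1 + d * \<epsilon>) * e' + c"
    by (simp add: sum.distrib l1_dist_def[symmetric] e'_def[symmetric] c_def power2_eq_square algebra_simps)
  also have "\<dots> \<le> (1 + d * \<epsilon>) * (k * c * (1 + d * \<epsilon>) ^ k) + c * (1 + d * \<epsilon>) ^ Suc k"
  proof (intro add_mono mult_left_mono)
    show "e' \<le> k * c * (1 + d * \<epsilon>) ^ k"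
      using Suc.IH Suc.prems unfolding e'_def X_def c_def by simp
    have "1 \<le> (1 + d * \<epsilon>) ^ Suc k" using e(2) by (intro one_le_power) auto
    then show "c \<le> c * (1 + d * \<epsilon>) ^ Suc k" using c0 mult_left_mono[of 1 _ c] by simp
  qed (use e(2) in auto)
  also have "\<dots> = Suc k * c * (1 + d * \<epsilon>) ^ Suc k" by (simp add: algebra_simps)
  finally show ?case by (simp add: c_def)
qed

end

section \<open>The exact process along the Euler scheme\<close>

lemma sig_mono: "0 \<le> s \<Longrightarrow> s \<le> t \<Longrightarrow> sig s \<le> sig t"
  unfolding sig_def by simp

text \<open>From \<sigma>^2 = 1 - exp (- 2 t) the derivative of the noise coefficient in reverse
  time is - exp (- 2 t) / \<sigma> = \<sigma> - 1 / \<sigma>. This is what brings the velocity into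
  the form position minus w / \<sigma>.\<close>

lemma has_real_derivative_ou:
  assumes "r < T" "i < d"
  shows "((\<lambda>r. ou d (T - r) y w i) has_real_derivative ou d (T - r) y w i - w i / sig (T - r)) (at r)"
proof -
  have pos: "0 < 1 - exp (- 2 * (T - r))" using assms by simp
  have sq: "sqrt (1 - exp (- 2 * (T - r))) * sqrt (1 - exp (- 2 * (T - r))) = 1 - exp (- 2 * (T - r))"
    using pos by simp
  have "((\<lambda>r. exp (- (T - r)) * y i + sqrt (1 - exp (- 2 * (T - r))) * w i) has_real_derivative
    exp (- (T - r)) * y i + (- exp (- 2 * (T - r)) / sqrt (1 - exp (- 2 * (T - r)))) * w i) (at r)"
    using pos by (auto intro!: derivative_eq_intros simp: field_simps)
  moreover have "exp (- (T - r)) * y i + (- exp (- 2 * (T - r)) / sqrt (1 - exp (- 2 * (T - r)))) * w i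
      = (exp (- (T - r)) * y i + sqrt (1 - exp (- 2 * (T - r))) * w i) - w i / sqrt (1 - exp (- 2 * (T - r)))"
  proof -
    have "(- e / q) * v = q * v - v / q" if "0 < q" "q * q = 1 - e" for e q v :: real
    proof -
      have "q * v = (q * q) * (v / q)" using that(1) by simp
      also have "\<dots> = v / q - (e / q) * v" unfolding that(2) by (simp only: left_diff_distrib diff_divide_distrib times_divide_eq_left times_divide_eq_right mult_1)
      finally show ?thesis by simp
    qed
    from this[OF _ sq, of "w i"] pos show ?thesis by simp
  qed
  ultimately have "((\<lambda>r. exp (- (T - r)) * y i + sqrt (1 - exp (- 2 * (T - r))) * w i) has_real_derivative
    (exp (- (T - r)) * y i + sqrt (1 - exp (- 2 * (T - r))) * w i) - w i / sqrt (1 - exp (- 2 * (T - r)))) (at r)"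
    by (simp only:)
  then show ?thesis
    using assms(2) by (simp only: ou_def sig_def restrict_apply' lessThan_iff)
qed

lemma set_integral_Ioc_Icc:
  fixes f :: "real \<Rightarrow> real"
  assumes "f \<in> borel_measurable borel"
  shows "(LINT r:{a<..b}|lborel. f r) = (LINT r:{a..b}|lborel. f r)"
  unfolding set_lebesgue_integral_def
proof (rule integral_cong_AE)
  show "AE r in lborel. indicator {a<..b} r *\<^sub>R f r = indicator {a..b} r *\<^sub>R f r"
    using AE_lborel_singleton[of a] by eventually_elim (auto simp: indicator_def)
qed (use assms in auto)

locale reverse_flow = bounded_data d \<mu> D + regular_drift d s s' L
  for d \<mu> D s s' L +
  fixes T \<tau> :: real
  assumes tau: "0 < \<tau>" "\<tau> < T" and D1: "1 \<le> D"
begin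

abbreviation S where "S \<equiv> T - \<tau>"
abbreviation X where "X r y w \<equiv> ou d (T - r) y w"

text \<open>One random constant for the whole path up to time S: given data bounded by D, it
  dominates 1 plus the l1 norm of the position, the velocity term w / \<sigma>, and the l1 speed.
  The smallest noise level, \<open>sig \<tau>\<close>, occurs at the final time. Its second moment
  is what the expected local error needs.\<close>

definition Gam :: "(nat \<Rightarrow> real) \<Rightarrow> real" where
  "Gam w = (1 + d * D + l1 d w) * (1 + 1 / sig \<tau>)"

lemma sig_tau: "0 < sig \<tau>" using tau by (intro sig_pos)

lemma sig_ge: "r \<le> S \<Longrightarrow> sig \<tau> \<le> sig (T - r)"
  using tau by (intro sig_mono) auto

lemma Gam_ge: "1 + d * D + l1 d w \<le> Gam w" "(1 + d * D + l1 d w) / sig \<tau> \<le> Gam w" "1 \<le> Gam w"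
proof -
  have *: "0 \<le> 1 + d * D + l1 d w" using D1 l1_nonneg[of d w] by (simp add: add_nonneg_nonneg)
  have **: "Gam w = (1 + d * D + l1 d w) + (1 + d * D + l1 d w) / sig \<tau>" by (simp add: Gam_def distrib_left)
  have ***: "0 \<le> (1 + d * D + l1 d w) / sig \<tau>" using * sig_tau by simp
  show "1 + d * D + l1 d w \<le> Gam w" using ** *** by linarith
  moreover show "(1 + d * D + l1 d w) / sig \<tau> \<le> Gam w" using ** * by linarith
  moreover have "0 \<le> d * D" using D1 by simp
  ultimately show "1 \<le> Gam w" using l1_nonneg[of d w] by linarith
qed

section \<open>Pathwise estimates for a fixed data point and fixed noise\<close>

context
  fixes y w :: "nat \<Rightarrow> real"
  assumes y: "\<And>i. i < d \<Longrightarrow> \<bar>y i\<bar> \<le> D"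
begin

lemma w_over_sig: "r \<le> S \<Longrightarrow> \<bar>w i / sig (T - r)\<bar> \<le> \<bar>w i\<bar> / sig \<tau>"
  using sig_ge[of r] sig_tau by (simp add: abs_divide frac_le)

lemma w_over_sig_le: "r \<le> S \<Longrightarrow> i < d \<Longrightarrow> \<bar>w i / sig (T - r)\<bar> \<le> Gam w"
proof -
  assume r: "r \<le> S" and i: "i < d"
  have "\<bar>w i\<bar> \<le> 1 + d * D + l1 d w" using abs_le_l1[OF i, of w] D1 by (simp add: add_increasing)
  then have "\<bar>w i\<bar> / sig \<tau> \<le> (1 + d * D + l1 d w) / sig \<tau>" using sig_tau by (intro divide_right_mono) auto
  then show ?thesis using w_over_sig[OF r, of i] Gam_ge(2)[of w] by linarith
qed

lemma X_l1: "r \<le> S \<Longrightarrow> 1 + l1 d (X r y w) \<le> Gam w"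
proof -
  assume r: "r \<le> S"
  have "\<bar>X r y w i\<bar> \<le> D + \<bar>w i\<bar>" if i: "i < d" for i
  proof -
    have "exp (- (T - r)) * \<bar>y i\<bar> \<le> 1 * D" using r tau y[OF i] by (intro mult_mono) auto
    moreover have "sig (T - r) * \<bar>w i\<bar> \<le> 1 * \<bar>w i\<bar>" using sig_le_1 by (intro mult_right_mono) auto
    moreover have "0 \<le> sig (T - r)" using sig_ge[OF r] sig_tau by linarith
    ultimately show ?thesis
      using i abs_triangle_ineq[of "exp (- (T - r)) * y i" "sig (T - r) * w i"] by (simp add: ou_def abs_mult)
  qed
  then have "l1 d (X r y w) \<le> (\<Sum>i<d. D + \<bar>w i\<bar>)" unfolding l1_def by (intro sum_mono) auto
  also have "\<dots> = d * D + l1 d w" by (simp add: l1_def sum.distrib)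
  finally show ?thesis using Gam_ge(1)[of w] by linarith
qed

lemma X_velocity: "r \<le> S \<Longrightarrow> i < d \<Longrightarrow> \<bar>X r y w i - w i / sig (T - r)\<bar> \<le> D + \<bar>w i\<bar> / sig \<tau>"
proof -
  assume r: "r \<le> S" and i: "i < d"
  have p: "0 < sig (T - r)" using sig_ge[OF r] sig_tau by linarith
  have sq: "sig (T - r) * sig (T - r) = 1 - exp (- 2 * (T - r))"
    using sig_square[of "T - r"] r tau by (simp add: power2_eq_square)
  have "X r y w i - w i / sig (T - r) = exp (- (T - r)) * y i - exp (- 2 * (T - r)) * (w i / sig (T - r))"
  proof -
    have "sig (T - r) * w i = (sig (T - r) * sig (T - r)) * (w i / sig (T - r))" using p by simp
    also have "\<dots> = w i / sig (T - r) - exp (- 2 * (T - r)) * (w i / sig (T - r))"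
      unfolding sq by (simp only: left_diff_distrib mult_1)
    finally have "sig (T - r) * w i = w i / sig (T - r) - exp (- 2 * (T - r)) * (w i / sig (T - r))" .
    moreover have "X r y w i = exp (- (T - r)) * y i + sig (T - r) * w i" using i by (simp add: ou_def)
    ultimately show ?thesis by linarith
  qed
  moreover have "exp (- (T - r)) * \<bar>y i\<bar> \<le> 1 * D" using r tau y[OF i] by (intro mult_mono) auto
  moreover have "exp (- 2 * (T - r)) * \<bar>w i / sig (T - r)\<bar> \<le> 1 * (\<bar>w i\<bar> / sig \<tau>)"
    using r tau w_over_sig[OF r, of i] by (intro mult_mono) auto
  ultimately show ?thesis
    using abs_triangle_ineq4[of "exp (- (T - r)) * y i" "exp (- 2 * (T - r)) * (w i / sig (T - r))"]
    by (simp add: abs_mult)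
qed

lemma X_diff: "a \<le> r \<Longrightarrow> r \<le> S \<Longrightarrow> i < d \<Longrightarrow> \<bar>X r y w i - X a y w i\<bar> \<le> (r - a) * (D + \<bar>w i\<bar> / sig \<tau>)"
proof -
  assume a: "a \<le> r" and r: "r \<le> S" and i: "i < d"
  show ?thesis
  proof (cases "a = r")
    case False
    then have "a < r" using a by simp
    moreover have "((\<lambda>r. X r y w i) has_real_derivative X q y w i - w i / sig (T - q)) (at q)" if "a \<le> q" "q \<le> r" for q
      using that r tau i by (intro has_real_derivative_ou) auto
    ultimately obtain q where q: "a < q" "q < r" "X r y w i - X a y w i = (r - a) * (X q y w i - w i / sig (T - q))"
      using MVT2[of a r "\<lambda>r. X r y w i" "\<lambda>q. X q y w i - w i / sig (T - q)"] by blast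
    show ?thesis
      unfolding q(3) abs_mult using q r i X_velocity[of q i] by (intro mult_mono) auto
  qed simp
qed

lemma X_l1_dist: "a \<le> r \<Longrightarrow> r \<le> S \<Longrightarrow> l1_dist d (X a y w) (X r y w) \<le> (r - a) * Gam w"
proof -
  assume a: "a \<le> r" and r: "r \<le> S"
  have "l1_dist d (X a y w) (X r y w) \<le> (\<Sum>i<d. (r - a) * (D + \<bar>w i\<bar> / sig \<tau>))"
    unfolding l1_dist_def using a r by (intro sum_mono X_diff) auto
  also have "\<dots> = (r - a) * (d * D + l1 d w / sig \<tau>)"
    by (simp add: l1_def sum.distrib sum_distrib_left[symmetric] sum_divide_distrib)
  also have "\<dots> \<le> (r - a) * Gam w"
  proof (rule mult_left_mono)
    have *: "Gam w = (1 + d * D + l1 d w) + (1 + d * D + l1 d w) / sig \<tau>" by (simp add: Gam_def distrib_left)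
    have "l1 d w / sig \<tau> \<le> (1 + d * D + l1 d w) / sig \<tau>"
      using sig_tau D1 by (intro divide_right_mono) auto
    then show "d * D + l1 d w / sig \<tau> \<le> Gam w" using * l1_nonneg[of d w] by linarith
  qed (use a in auto)
  finally show ?thesis .
qed

lemma X_r_measurable: "(\<lambda>r. X r y w) \<in> measurable borel (leb d)"
  unfolding ou_def sig_def by measurable

lemma drift_measurable:
  assumes "i < d" shows "(\<lambda>r. s r (X r y w) i) \<in> borel_measurable borel"
  using measurable_compose[OF measurable_Pair[OF measurable_ident X_r_measurable] s_joint_measurable[OF assms]]
  by simp

lemma X_integral:
  assumes ab: "a \<le> b" "b \<le> S" and i: "i < d"
  shows "set_integrable lborel {a<..b} (\<lambda>r. X r y w i - w i / sig (T - r))"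
    and "(LINT r:{a<..b}|lborel. X r y w i - w i / sig (T - r)) = X b y w i - X a y w i"
proof -
  have [measurable]: "(\<lambda>r. X r y w i - w i / sig (T - r)) \<in> borel_measurable borel"
    using i unfolding ou_def sig_def by simp
  have cont: "continuous_on {a..b} (\<lambda>r. X r y w i - w i / sig (T - r))"
    using i ab tau unfolding ou_def sig_def by (auto intro!: continuous_intros)
  have "set_integrable lborel {a..b} (\<lambda>r. X r y w i - w i / sig (T - r))"
    using cont by (rule borel_integrable_atLeastAtMost')
  then show "set_integrable lborel {a<..b} (\<lambda>r. X r y w i - w i / sig (T - r))"
    by (rule set_integrable_subset) auto
  have "(LBINT r. (X r y w i - w i / sig (T - r)) * indicator {a..b} r) = X b y w i - X a y w i"
  proof (rule integral_FTC_Icc_real[OF ab(1)])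
    fix r assume r: "a \<le> r" "r \<le> b"
    show "((\<lambda>r. X r y w i) has_real_derivative X r y w i - w i / sig (T - r)) (at r)"
      using r ab tau i by (intro has_real_derivative_ou) auto
    have "1 - exp (- (2 * (T - r))) \<noteq> 0" using r ab tau by auto
    then show "isCont (\<lambda>r. X r y w i - w i / sig (T - r)) r"
      using i unfolding ou_def sig_def by (auto intro!: continuous_intros)
  qed
  then show "(LINT r:{a<..b}|lborel. X r y w i - w i / sig (T - r)) = X b y w i - X a y w i"
    by (subst set_integral_Ioc_Icc) (auto simp: set_lebesgue_integral_def mult.commute)
qed

lemma integrand_bound:
  fixes \<Lambda> H :: real
  assumes Q: "quad_approx d u p \<Lambda> H" and r: "r \<le> S"
  shows "i < d \<Longrightarrow> \<bar>p (X r y w) i * (- w i / sig (T - r) - s r (X r y w) i)\<bar> \<le> \<Lambda> * ((1 + L r) * Gam w)"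
    and "\<bar>\<Sum>i<d. p (X r y w) i * (- w i / sig (T - r) - s r (X r y w) i)\<bar> \<le> d * \<Lambda> * ((1 + L r) * Gam w)"
proof -
  show *: "\<bar>p (X r y w) i * (- w i / sig (T - r) - s r (X r y w) i)\<bar> \<le> \<Lambda> * ((1 + L r) * Gam w)" if i: "i < d" for i
    unfolding abs_mult
  proof (rule mult_mono)
    show "\<bar>p (X r y w) i\<bar> \<le> \<Lambda>" using quad_approxD(1)[OF Q] i by simp
    then show "0 \<le> \<Lambda>" by linarith
    have "\<bar>s r (X r y w) i\<bar> \<le> L r * Gam w"
      using s_growth[OF ou_Rd i, of r "T - r" y w] mult_left_mono[OF X_l1[OF r] L_nonneg[of r]] by linarith
    then show "\<bar>- w i / sig (T - r) - s r (X r y w) i\<bar> \<le> (1 + L r) * Gam w"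
      using w_over_sig_le[OF r i] by (simp only: distrib_right mult_1 minus_divide_left[symmetric])
  qed auto
  have "\<bar>\<Sum>i<d. p (X r y w) i * (- w i / sig (T - r) - s r (X r y w) i)\<bar> \<le> (\<Sum>i<d. \<Lambda> * ((1 + L r) * Gam w))"
    using * by (intro order_trans[OF sum_abs] sum_mono) auto
  then show "\<bar>\<Sum>i<d. p (X r y w) i * (- w i / sig (T - r) - s r (X r y w) i)\<bar> \<le> d * \<Lambda> * ((1 + L r) * Gam w)"
    by simp
qed

lemma integrand_measurable:
  fixes \<Lambda> H :: real
  assumes Q: "quad_approx d u p \<Lambda> H" and i: "i < d"
  shows "(\<lambda>r. p (X r y w) i * (- w i / sig (T - r) - s r (X r y w) i)) \<in> borel_measurable borel"
proof -
  have "(\<lambda>r. p (X r y w) i) \<in> borel_measurable borel"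
    using measurable_compose[OF X_r_measurable borel_measurable_continuous_Rd[OF quad_approx_continuous(2)[OF Q i]]] .
  then show ?thesis using drift_measurable[OF i] unfolding sig_def by simp
qed

lemma integrand_integrable:
  fixes \<Lambda> H :: real
  assumes Q: "quad_approx d u p \<Lambda> H" and b: "b \<le> S"
  shows "set_integrable lborel {a<..b} (\<lambda>r. \<Sum>i<d. p (X r y w) i * (- w i / sig (T - r) - s r (X r y w) i))"
proof -
  have meas: "(\<lambda>r. \<Sum>i<d. p (X r y w) i * (- w i / sig (T - r) - s r (X r y w) i)) \<in> borel_measurable borel"
    using integrand_measurable[OF Q] by (intro borel_measurable_sum) auto
  show ?thesis
    unfolding set_integrable_def
  proof (rule Bochner_Integration.integrable_bound)
    show "integrable lborel (\<lambda>r. indicator {a<..b} r *\<^sub>R (d * \<Lambda> * ((1 + L r) * Gam w)))"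
      using set_integrable_mult_right[OF set_integrable_mult_left[OF integrable_L(2)[of a b]], of "Gam w" "d * \<Lambda>"]
      unfolding set_integrable_def by (simp add: mult_ac)
    show "AE r in lborel. norm (indicator {a<..b} r *\<^sub>R (\<Sum>i<d. p (X r y w) i * (- w i / sig (T - r) - s r (X r y w) i)))
      \<le> norm (indicator {a<..b} r *\<^sub>R (d * \<Lambda> * ((1 + L r) * Gam w)))"
    proof (rule AE_I2)
      fix r show "norm (indicator {a<..b} r *\<^sub>R (\<Sum>i<d. p (X r y w) i * (- w i / sig (T - r) - s r (X r y w) i)))
        \<le> norm (indicator {a<..b} r *\<^sub>R (d * \<Lambda> * ((1 + L r) * Gam w)))"
        using integrand_bound(2)[OF Q, of r] b by (cases "r \<in> {a<..b}") auto
    qed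
    show "(\<lambda>r. indicator {a<..b} r *\<^sub>R (\<Sum>i<d. p (X r y w) i * (- w i / sig (T - r) - s r (X r y w) i))) \<in> borel_measurable lborel"
      using meas by simp
  qed
qed

text \<open>Both endpoints are expanded around the common starting point x. Their linear parts
  differ by the integral of p x times the difference of exact velocity and frozen drift. Replacing x
  by the current position X in p and s, and cancelling X, leaves p X times (- w / \<sigma> - s X);
  each replacement costs a factor \<open>elen a b\<close>, so the total error is quadratic in the
  step.\<close>

lemma step_pointwise:
  fixes \<Lambda> H :: real
  assumes Q: "quad_approx d u p \<Lambda> H" and nn: "0 \<le> \<Lambda>" "0 \<le> H" and ab: "a \<le> b" "b \<le> S"
  shows "\<bar>u (X b y w) - u (euler a b (X a y w))
      - (LINT r:{a<..b}|lborel. \<Sum>i<d. p (X r y w) i * (- w i / sig (T - r) - s r (X r y w) i))\<bar>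
    \<le> (H + H * d\<^sup>2 + d * (\<Lambda> + 6 * H)) * (elen a b * Gam w)\<^sup>2"
proof -
  define x where "x = X a y w"
  define e where "e = elen a b"
  define G where "G = Gam w"
  have G: "1 \<le> G" using Gam_ge(3) by (simp add: G_def)
  have e: "0 \<le> e" "b - a \<le> e" using elen_nonneg elen_ge ab by (auto simp: e_def)
  have x: "x \<in> Rd d" by (simp add: x_def)
  have xl1: "1 + l1 d x \<le> G" unfolding x_def G_def using ab by (intro X_l1) auto
  have dist: "l1_dist d x (X r y w) \<le> e * G" if "r \<in> {a<..b}" for r
  proof -
    have "(r - a) * G \<le> e * G" using that e G by (intro mult_right_mono) auto
    then show ?thesis using X_l1_dist[of a r] that ab unfolding x_def G_def by auto
  qed
  define W where "W i = (LINT r:{a<..b}|lborel. x i + s r x i)" for i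
  have Wint: "set_integrable lborel {a<..b} (\<lambda>r. x i + s r x i)" if "i < d" for i
    by (intro set_integral_add integrable_L integrable_s x that)
  have W: "\<bar>W i\<bar> \<le> e * G" if i: "i < d" for i
  proof -
    have "\<bar>W i\<bar> \<le> (LINT r:{a<..b}|lborel. (1 + L r) * G)"
      unfolding W_def
    proof (rule abs_set_integral_le[OF Wint[OF i]])
      show "set_integrable lborel {a<..b} (\<lambda>r. (1 + L r) * G)" using integrable_L(2) by auto
      fix r
      have "\<bar>s r x i\<bar> \<le> L r * G"
        using s_growth[OF x i, of r] mult_left_mono[OF xl1 L_nonneg[of r]] by linarith
      moreover have "\<bar>x i\<bar> \<le> G" using abs_le_l1[OF i, of x] xl1 by linarith
      ultimately show "\<bar>x i + s r x i\<bar> \<le> (1 + L r) * G"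
        using abs_triangle_ineq[of "x i" "s r x i"] by (simp add: distrib_right)
    qed
    then show ?thesis by (simp add: e_def elen_def)
  qed
  have eul: "euler a b x i - x i = W i" if "i < d" for i
    using that by (simp add: euler_def W_def)
  have E1: "\<bar>u (X b y w) - u x - (\<Sum>i<d. p x i * (X b y w i - x i))\<bar> \<le> H * (e * G)\<^sup>2"
  proof -
    have "l1_dist d x (X b y w) \<le> e * G"
    proof (cases "a < b")
      case False
      then have "X b y w = x" using ab by (simp add: x_def)
      then show ?thesis using e G by (simp add: l1_dist_def)
    qed (use dist in auto)
    then have "H * (l1_dist d x (X b y w))\<^sup>2 \<le> H * (e * G)\<^sup>2"
      using nn by (intro mult_left_mono power_mono) auto
    then show ?thesis using quad_approxD(2)[OF Q x, of "X b y w"] by simp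
  qed
  have E2: "\<bar>u (euler a b x) - u x - (\<Sum>i<d. p x i * W i)\<bar> \<le> H * (d * (e * G))\<^sup>2"
  proof -
    have "l1_dist d x (euler a b x) \<le> (\<Sum>i<d. e * G)"
      unfolding l1_dist_def by (intro sum_mono) (auto simp: eul W)
    then have "H * (l1_dist d x (euler a b x))\<^sup>2 \<le> H * (d * (e * G))\<^sup>2"
      using nn by (intro mult_left_mono power_mono) auto
    moreover have "(\<Sum>i<d. p x i * (euler a b x i - x i)) = (\<Sum>i<d. p x i * W i)"
      by (intro sum.cong) (auto simp: eul)
    ultimately show ?thesis using quad_approxD(2)[OF Q x, of "euler a b x"] by simp
  qed
  let ?Z = "\<lambda>r. \<Sum>i<d. p (X r y w) i * (- w i / sig (T - r) - s r (X r y w) i)"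
  let ?V = "\<lambda>r i. (X r y w i - w i / sig (T - r)) - (x i + s r x i)"
  have Vint: "set_integrable lborel {a<..b} (\<lambda>r. ?V r i)" if "i < d" for i
    by (rule set_integral_diff(1)[OF X_integral(1)[OF ab that] Wint[OF that]])
  have V: "X b y w i - x i - W i = (LINT r:{a<..b}|lborel. ?V r i)" if "i < d" for i
    unfolding W_def x_def
    using set_integral_diff(2)[OF X_integral(1)[OF ab that] Wint[OF that]] X_integral(2)[OF ab that]
    by (simp add: x_def)
  have sumint: "set_integrable lborel {a<..b} (\<lambda>r. \<Sum>i<d. p x i * ?V r i)"
    and sumeq: "(\<Sum>i<d. p x i * (X b y w i - x i - W i)) = (LINT r:{a<..b}|lborel. \<Sum>i<d. p x i * ?V r i)"
  proof -
    have *: "integrable lborel (\<lambda>r. indicator {a<..b} r *\<^sub>R (p x i * ?V r i))" if "i < d" for i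
      using set_integrable_mult_right[OF Vint[OF that], of "p x i"] unfolding set_integrable_def .
    show "set_integrable lborel {a<..b} (\<lambda>r. \<Sum>i<d. p x i * ?V r i)"
      unfolding set_integrable_def scaleR_sum_right using * by (intro Bochner_Integration.integrable_sum) auto
    have "(LINT r:{a<..b}|lborel. \<Sum>i<d. p x i * ?V r i) = (\<Sum>i<d. LINT r:{a<..b}|lborel. p x i * ?V r i)"
      unfolding set_lebesgue_integral_def scaleR_sum_right using * by (intro Bochner_Integration.integral_sum) auto
    also have "\<dots> = (\<Sum>i<d. p x i * (X b y w i - x i - W i))"
      by (intro sum.cong refl) (simp only: set_integral_mult_right V lessThan_iff)
    finally show "(\<Sum>i<d. p x i * (X b y w i - x i - W i)) = (LINT r:{a<..b}|lborel. \<Sum>i<d. p x i * ?V r i)" ..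
  qed
  \<comment> \<open>The cost of unfreezing: s and the linear drift are Lipschitz with rate 1 + L r
    in total, and p is Lipschitz with constant 6 H.\<close>
  have E3: "\<bar>(\<Sum>i<d. p x i * (X b y w i - x i - W i)) - (LINT r:{a<..b}|lborel. ?Z r)\<bar> \<le> d * (\<Lambda> + 6 * H) * (e * G)\<^sup>2"
  proof -
    have eq: "(\<Sum>i<d. p x i * (X b y w i - x i - W i)) - (LINT r:{a<..b}|lborel. ?Z r)
      = (LINT r:{a<..b}|lborel. (\<Sum>i<d. p x i * ?V r i) - ?Z r)"
      unfolding sumeq by (rule set_integral_diff(2)[symmetric, OF sumint integrand_integrable[OF Q ab(2)]])
    have "\<bar>(\<Sum>i<d. p x i * (X b y w i - x i - W i)) - (LINT r:{a<..b}|lborel. ?Z r)\<bar>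
        \<le> (LINT r:{a<..b}|lborel. (1 + L r) * (d * (\<Lambda> + 6 * H) * (e * G\<^sup>2)))"
      unfolding eq
    proof (rule abs_set_integral_le)
      show "set_integrable lborel {a<..b} (\<lambda>r. (\<Sum>i<d. p x i * ?V r i) - ?Z r)"
        by (rule set_integral_diff(1)[OF sumint integrand_integrable[OF Q ab(2)]])
      show "set_integrable lborel {a<..b} (\<lambda>r. (1 + L r) * (d * (\<Lambda> + 6 * H) * (e * G\<^sup>2)))"
        using integrable_L(2) by auto
      fix r assume r: "r \<in> {a<..b}"
      then have rS: "r \<le> S" using ab by auto
      let ?x = "X r y w"
      have trm: "\<bar>p x i * ?V r i - p ?x i * (- w i / sig (T - r) - s r ?x i)\<bar> \<le> (1 + L r) * ((\<Lambda> + 6 * H) * (e * G\<^sup>2))"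
        if i: "i < d" for i
      proof -
        have N: "l1_dist d x ?x \<le> e * G" by (rule dist[OF r])
        have "p x i * ?V r i - p ?x i * (- w i / sig (T - r) - s r ?x i)
          = p x i * ((?x i - x i) + (s r ?x i - s r x i)) + (p x i - p ?x i) * (- w i / sig (T - r) - s r ?x i)"
          by (simp add: algebra_simps)
        moreover have "\<bar>p x i * ((?x i - x i) + (s r ?x i - s r x i))\<bar> \<le> \<Lambda> * ((1 + L r) * (e * G))"
          unfolding abs_mult
        proof (rule mult_mono)
          have "\<bar>s r ?x i - s r x i\<bar> \<le> L r * (e * G)"
            using s_Lipschitz[OF x ou_Rd i, of r "T - r" y w] mult_left_mono[OF N L_nonneg[of r]] by linarith
          moreover have "\<bar>?x i - x i\<bar> \<le> e * G" using abs_le_l1_dist[OF i, of ?x x] N by linarith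
          ultimately show "\<bar>(?x i - x i) + (s r ?x i - s r x i)\<bar> \<le> (1 + L r) * (e * G)"
            using abs_triangle_ineq[of "?x i - x i" "s r ?x i - s r x i"] by (simp add: distrib_right)
        qed (use quad_approxD(1)[OF Q x i] nn in auto)
        moreover have "\<bar>(p x i - p ?x i) * (- w i / sig (T - r) - s r ?x i)\<bar> \<le> (6 * H * (e * G)) * ((1 + L r) * G)"
          unfolding abs_mult
        proof (rule mult_mono)
          have "6 * H * l1_dist d x ?x \<le> 6 * H * (e * G)" using N nn by (intro mult_left_mono) auto
          then show "\<bar>p x i - p ?x i\<bar> \<le> 6 * H * (e * G)"
            using quad_approx_gradient_Lipschitz[OF Q x ou_Rd i, of "T - r" y w] by (simp add: abs_minus_commute)
          have "\<bar>s r ?x i\<bar> \<le> L r * G"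
            using s_growth[OF ou_Rd i, of r "T - r" y w] mult_left_mono[OF X_l1[OF rS] L_nonneg[of r]]
            unfolding G_def by linarith
          then show "\<bar>- w i / sig (T - r) - s r ?x i\<bar> \<le> (1 + L r) * G"
            using w_over_sig_le[OF rS i] unfolding G_def by (simp only: distrib_right mult_1 minus_divide_left[symmetric])
        qed (use nn e G in auto)
        moreover have "\<Lambda> * ((1 + L r) * (e * G)) \<le> \<Lambda> * ((1 + L r) * (e * G\<^sup>2))"
          using nn e G L_nonneg[of r] by (intro mult_left_mono) (auto simp: power2_eq_square)
        ultimately have "\<bar>p x i * ?V r i - p ?x i * (- w i / sig (T - r) - s r ?x i)\<bar>
            \<le> \<Lambda> * ((1 + L r) * (e * G\<^sup>2)) + (6 * H * (e * G)) * ((1 + L r) * G)" by linarith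
        then show ?thesis by (simp add: power2_eq_square algebra_simps)
      qed
      have "\<bar>(\<Sum>i<d. p x i * ?V r i) - ?Z r\<bar> \<le> (\<Sum>i<d. (1 + L r) * ((\<Lambda> + 6 * H) * (e * G\<^sup>2)))"
        unfolding sum_subtractf[symmetric] using trm by (intro order_trans[OF sum_abs] sum_mono) auto
      then show "\<bar>(\<Sum>i<d. p x i * ?V r i) - ?Z r\<bar> \<le> (1 + L r) * (d * (\<Lambda> + 6 * H) * (e * G\<^sup>2))"
        by (simp add: mult_ac)
    qed
    also have "\<dots> = e * (d * (\<Lambda> + 6 * H) * (e * G\<^sup>2))" by (simp add: e_def elen_def)
    finally show ?thesis by (simp add: power2_eq_square mult_ac)
  qed
  have "u (X b y w) - u (euler a b x) - (LINT r:{a<..b}|lborel. ?Z r)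
    = (u (X b y w) - u x - (\<Sum>i<d. p x i * (X b y w i - x i))) - (u (euler a b x) - u x - (\<Sum>i<d. p x i * W i))
      + ((\<Sum>i<d. p x i * (X b y w i - x i - W i)) - (LINT r:{a<..b}|lborel. ?Z r))"
    by (simp add: right_diff_distrib sum_subtractf)
  then have "\<bar>u (X b y w) - u (euler a b x) - (LINT r:{a<..b}|lborel. ?Z r)\<bar>
    \<le> H * (e * G)\<^sup>2 + H * (d * (e * G))\<^sup>2 + d * (\<Lambda> + 6 * H) * (e * G)\<^sup>2"
    using E1 E2 E3 by linarith
  then show ?thesis by (simp add: x_def e_def G_def power_mult_distrib algebra_simps)
qed

end
end

section \<open>Moments of the noise and the expected change over one step\<close>

lemma integrable_std_gaussian_component:
  assumes i: "i < d" and f: "integrable (density lborel (\<lambda>u. ennreal (std_normal_density u))) f"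
  shows "integrable (std_gaussian d) (\<lambda>w. f (w i) :: real)"
proof -
  let ?N = "density lborel (\<lambda>u. ennreal (std_normal_density u))"
  have "distr (std_gaussian d) ?N (\<lambda>w. w i) = ?N"
    unfolding std_gaussian_def using i
    by (intro distr_PiM_component prob_space_normal_density) auto
  moreover have "(\<lambda>w. w i) \<in> measurable (std_gaussian d) ?N"
    unfolding std_gaussian_def using i by (intro measurable_component_singleton) simp
  ultimately show ?thesis
    using f integrable_distr[of "\<lambda>w. w i" "std_gaussian d" ?N f] by simp
qed

lemma integrable_std_gaussian_square:
  assumes i: "i < d" shows "integrable (std_gaussian d) (\<lambda>w. (w i)\<^sup>2)"
proof (rule integrable_std_gaussian_component[OF i, of "\<lambda>u. u\<^sup>2"])
  show "integrable (density lborel (\<lambda>u. ennreal (std_normal_density u))) (\<lambda>u. u\<^sup>2)"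
    using integrable_std_normal_moment[of 2] by (subst integrable_density) auto
qed

context bounded_data
begin

lemma AE_P_bounded: "AE v in P. \<forall>i<d. \<bar>fst v i\<bar> \<le> D"
proof -
  have "AE y in \<mu>. \<forall>i\<in>{..<d}. \<bar>y i\<bar> \<le> D"
    using bounded_mu by (subst AE_finite_all) auto
  then have "AE y in distr P \<mu> fst. \<forall>i<d. \<bar>y i\<bar> \<le> D"
    unfolding gam.distr_pair_fst by auto
  then show ?thesis by (rule AE_distrD[OF measurable_fst])
qed

lemma integrable_P_snd:
  fixes g :: "(nat \<Rightarrow> real) \<Rightarrow> real"
  assumes g: "integrable (std_gaussian d) g"
  shows "integrable P (\<lambda>v. g (snd v))" "(\<integral>v. g (snd v) \<partial>P) = (\<integral>w. g w \<partial>std_gaussian d)"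
proof -
  have [measurable]: "g \<in> borel_measurable (std_gaussian d)" using g by auto
  show int: "integrable P (\<lambda>v. g (snd v))"
    by (rule mg.Fubini_integrable) (use g in auto)
  show "(\<integral>v. g (snd v) \<partial>P) = (\<integral>w. g w \<partial>std_gaussian d)"
    using mg.integral_fst'[OF int] by (simp add: mu.prob_space del: space_mu)
qed

end

context reverse_flow
begin

definition EG2 :: real where "EG2 = (\<integral>w. (Gam w)\<^sup>2 \<partial>std_gaussian d)"

lemma Gam_measurable [measurable]: "Gam \<in> borel_measurable (std_gaussian d)"
  unfolding Gam_def [abs_def] l1_def by measurable

lemma integrable_Gam2: "integrable (std_gaussian d) (\<lambda>w. (Gam w)\<^sup>2)"
proof -
  define c k where "c = 1 + d * D" and "k = 1 + 1 / sig \<tau>"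
  define B where "B w = (2 * c\<^sup>2 + 2 * (real d * (\<Sum>i<d. (w i)\<^sup>2))) * k\<^sup>2" for w :: "nat \<Rightarrow> real"
  have bound: "(Gam w)\<^sup>2 \<le> B w" for w
  proof -
    have "(l1 d w)\<^sup>2 \<le> d * (\<Sum>i<d. (w i)\<^sup>2)"
      using sum_squared_le_sum_of_squares[of "\<lambda>i. \<bar>w i\<bar>" "{..<d}"] by (simp add: l1_def mult.commute)
    moreover have "(c + l1 d w)\<^sup>2 \<le> 2 * c\<^sup>2 + 2 * (l1 d w)\<^sup>2"
      using zero_le_power2[of "c - l1 d w"] by (simp add: power2_eq_square algebra_simps)
    ultimately have "(c + l1 d w)\<^sup>2 \<le> 2 * c\<^sup>2 + 2 * (d * (\<Sum>i<d. (w i)\<^sup>2))" by linarith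
    then show ?thesis
      unfolding Gam_def power_mult_distrib c_def[symmetric] k_def[symmetric] B_def
      by (intro mult_right_mono) auto
  qed
  have "integrable (std_gaussian d) B"
    unfolding B_def [abs_def] using integrable_std_gaussian_square by (intro integrable_mult_left
      Bochner_Integration.integrable_add integrable_mult_right Bochner_Integration.integrable_sum) auto
  then show ?thesis
  proof (rule Bochner_Integration.integrable_bound)
    show "AE w in std_gaussian d. norm ((Gam w)\<^sup>2) \<le> norm (B w)"
    proof (rule AE_I2)
      fix w show "norm ((Gam w)\<^sup>2) \<le> norm (B w)"
        using bound[of w] by simp
    qed
  qed measurable
qed

lemma integrable_Gam: "integrable (std_gaussian d) Gam"
proof (rule Bochner_Integration.integrable_bound[OF integrable_Gam2])
  show "AE w in std_gaussian d. norm (Gam w) \<le> norm ((Gam w)\<^sup>2)"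
  proof (rule AE_I2)
    fix w show "norm (Gam w) \<le> norm ((Gam w)\<^sup>2)"
      using Gam_ge(3)[of w] by (simp add: power2_eq_square)
  qed
qed measurable

text \<open>The i-th term of the rate of change along a path v = (y, w). Its conditional mean given
  the position is p i times the i-th score error.\<close>

definition Z :: "((nat \<Rightarrow> real) \<Rightarrow> nat \<Rightarrow> real) \<Rightarrow> nat \<Rightarrow> real \<Rightarrow> (nat \<Rightarrow> real) \<times> (nat \<Rightarrow> real) \<Rightarrow> real" where
  "Z p i r v = p (X r (fst v) (snd v)) i * (- snd v i / sig (T - r) - s r (X r (fst v) (snd v)) i)"

lemma Z_measurable:
  fixes \<Lambda> H :: real
  assumes Q: "quad_approx d u p \<Lambda> H" and i: "i < d"
  shows "(\<lambda>(r, v). Z p i r v) \<in> borel_measurable (borel \<Otimes>\<^sub>M P)"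
proof -
  have X: "(\<lambda>q. X (fst q) (fst (snd q)) (snd (snd q))) \<in> measurable (borel \<Otimes>\<^sub>M P) (leb d)"
    unfolding ou_def sig_def by measurable
  have 1: "(\<lambda>q. p (X (fst q) (fst (snd q)) (snd (snd q))) i) \<in> borel_measurable (borel \<Otimes>\<^sub>M P)"
    by (rule measurable_compose[OF X borel_measurable_continuous_Rd[OF quad_approx_continuous(2)[OF Q i]]])
  have 2: "(\<lambda>q. s (fst q) (X (fst q) (fst (snd q)) (snd (snd q))) i) \<in> borel_measurable (borel \<Otimes>\<^sub>M P)"
    using measurable_compose[OF measurable_Pair[OF measurable_fst X] s_joint_measurable[OF i]] by simp
  have 3: "(\<lambda>q. snd (snd q) i / sig (T - fst q)) \<in> borel_measurable (borel \<Otimes>\<^sub>M P)"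
    using i unfolding sig_def by measurable
  show ?thesis
    unfolding Z_def split_beta' using 1 2 3 by simp
qed

lemma Z_measurable_P:
  fixes \<Lambda> H :: real
  assumes Q: "quad_approx d u p \<Lambda> H" and i: "i < d"
  shows "Z p i r \<in> borel_measurable P"
  using measurable_compose[OF measurable_Pair1' Z_measurable[OF Q i], of r] by simp

lemma Z_integrable:
  fixes \<Lambda> H :: real
  assumes Q: "quad_approx d u p \<Lambda> H" and i: "i < d" and r: "r \<le> S"
  shows "integrable P (Z p i r)" and "(\<integral>v. \<bar>Z p i r v\<bar> \<partial>P) \<le> \<Lambda> * (1 + L r) * (\<integral>w. Gam w \<partial>std_gaussian d)"
proof -
  have bd: "AE v in P. norm (Z p i r v) \<le> norm (\<Lambda> * (1 + L r) * Gam (snd v))"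
    using AE_P_bounded
  proof eventually_elim
    fix v :: "(nat \<Rightarrow> real) \<times> (nat \<Rightarrow> real)"
    assume "\<forall>i<d. \<bar>fst v i\<bar> \<le> D"
    then have "\<bar>Z p i r v\<bar> \<le> \<Lambda> * ((1 + L r) * Gam (snd v))"
      unfolding Z_def using Q r i by (intro integrand_bound(1)) auto
    then show "norm (Z p i r v) \<le> norm (\<Lambda> * (1 + L r) * Gam (snd v))"
      by (simp only: real_norm_def mult.assoc)
  qed
  have G: "integrable P (\<lambda>v. \<Lambda> * (1 + L r) * Gam (snd v))"
    using integrable_P_snd(1)[OF integrable_Gam] by simp
  show int: "integrable P (Z p i r)"
    by (rule Bochner_Integration.integrable_bound[OF G Z_measurable_P[OF Q i] bd])
  have L0: "0 \<le> \<Lambda>"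
    using quad_approxD(1)[OF Q ou_Rd i] by (rule order_trans[OF abs_ge_zero])
  have "(\<integral>v. \<bar>Z p i r v\<bar> \<partial>P) \<le> (\<integral>v. \<Lambda> * (1 + L r) * Gam (snd v) \<partial>P)"
  proof (rule integral_mono_AE)
    show "AE v in P. \<bar>Z p i r v\<bar> \<le> \<Lambda> * (1 + L r) * Gam (snd v)"
      using bd
    proof eventually_elim
      fix v :: "(nat \<Rightarrow> real) \<times> (nat \<Rightarrow> real)"
      assume "norm (Z p i r v) \<le> norm (\<Lambda> * (1 + L r) * Gam (snd v))"
      moreover have "0 \<le> \<Lambda> * (1 + L r) * Gam (snd v)"
        using L0 L_nonneg[of r] Gam_ge(3)[of "snd v"] by (intro mult_nonneg_nonneg) auto
      ultimately show "\<bar>Z p i r v\<bar> \<le> \<Lambda> * (1 + L r) * Gam (snd v)" by simp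
    qed
  qed (use int G in auto)
  then show "(\<integral>v. \<bar>Z p i r v\<bar> \<partial>P) \<le> \<Lambda> * (1 + L r) * (\<integral>w. Gam w \<partial>std_gaussian d)"
    using integrable_P_snd(2)[OF integrable_Gam] by simp
qed

text \<open>The sum over coordinates of the bounds from \<open>velocity_gap_coordinate\<close>. It
  is an extended real because the mean squared score error, bounded only after integration over
  time, may be infinite at single times.\<close>

definition gap_bound :: "real \<Rightarrow> real \<Rightarrow> real \<Rightarrow> ennreal" where
  "gap_bound h \<alpha> r = (\<Sum>i<d. \<integral>\<^sup>+x. ennreal ((4 / h * (\<alpha> + (score (mix (T - r)) x i - s r x i)\<^sup>2 / \<alpha>)
    + 8 * h * (L r + D / sig (T - r) ^ 4)) * mix (T - r) x) \<partial>leb d)"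

text \<open>Neither \<Lambda> nor H occurs on the right. This makes the estimate uniform over test
  functions bounded by 1, however steep they have become under the Euler maps.\<close>

lemma expectation_le_gap_bound:
  fixes \<Lambda> H :: real
  assumes Q: "quad_approx d u p \<Lambda> H" and u: "\<And>x. x \<in> Rd d \<Longrightarrow> \<bar>u x\<bar> \<le> 1"
    and r: "r \<le> S" and h: "0 < h" "h \<le> sig \<tau>" and \<alpha>: "0 < \<alpha>"
  shows "ennreal \<bar>\<integral>v. (\<Sum>i<d. Z p i r v) \<partial>P\<bar> \<le> gap_bound h \<alpha> r"
proof -
  have each: "ennreal \<bar>\<integral>v. Z p i r v \<partial>P\<bar> \<le> (\<integral>\<^sup>+x. ennreal ((4 / h * (\<alpha> + (score (mix (T - r)) x i - s r x i)\<^sup>2 / \<alpha>)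
      + 8 * h * (L r + D / sig (T - r) ^ 4)) * mix (T - r) x) \<partial>leb d)" if i: "i < d" for i
  proof -
    have "ennreal \<bar>\<integral>v. (case v of (y, w) \<Rightarrow> p (ou d (T - r) y w) i * (- w i / sig (T - r) - s r (ou d (T - r) y w) i)) \<partial>P\<bar>
      \<le> (\<integral>\<^sup>+x. ennreal ((4 / h * (\<alpha> + (score (mix (T - r)) x i - s r x i)\<^sup>2 / \<alpha>)
      + 8 * h * (L r + D / sig (T - r) ^ 4)) * mix (T - r) x) \<partial>leb d)"
    proof (rule velocity_gap_coordinate[where u = u and ?s1.0 = "\<lambda>x. s' r x i i"])
      show "continuous_on (Rd d) (\<lambda>x. s r x i)" by (rule s_continuous[OF i])
      show "continuous_on (Rd d) (\<lambda>x. p x i)" by (rule quad_approx_continuous(2)[OF Q i])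
      show "((\<lambda>z. s r (x(i := z)) i) has_real_derivative s' r (x(i := z)) i i) (at z)" if "x \<in> Rd d" for x z
        by (rule quad_approx_partial[OF s_quad[OF i] that i])
      show "((\<lambda>z. u (x(i := z))) has_real_derivative p (x(i := z)) i) (at z)" if "x \<in> Rd d" for x z
        by (rule quad_approx_partial[OF Q that i])
      show "\<bar>s' r x i i\<bar> \<le> L r" if "x \<in> Rd d" for x
        by (rule quad_approxD(1)[OF s_quad[OF i] that i])
      show "\<bar>s' r (x(i := z)) i i - s' r (x(i := z')) i i\<bar> \<le> L r * \<bar>z - z'\<bar>" if "x \<in> Rd d" for x z z'
        by (rule s_second[OF that i])
      show "\<bar>p x i\<bar> \<le> \<Lambda>" if "x \<in> Rd d" for x by (rule quad_approxD(1)[OF Q that i])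
      show "integrable P (\<lambda>(y, w). p (ou d (T - r) y w) i * (- w i / sig (T - r) - s r (ou d (T - r) y w) i))"
        using Z_integrable(1)[OF Q i r] by (simp add: Z_def [abs_def] split_beta')
    qed (use u h \<alpha> i r tau sig_ge[OF r] in auto)
    then show ?thesis by (simp add: Z_def split_beta')
  qed
  have "(\<integral>v. (\<Sum>i<d. Z p i r v) \<partial>P) = (\<Sum>i<d. \<integral>v. Z p i r v \<partial>P)"
    using Z_integrable(1)[OF Q _ r] by (intro Bochner_Integration.integral_sum) auto
  then have "ennreal \<bar>\<integral>v. (\<Sum>i<d. Z p i r v) \<partial>P\<bar> \<le> ennreal (\<Sum>i<d. \<bar>\<integral>v. Z p i r v \<partial>P\<bar>)"
    by (simp add: ennreal_leI)
  also have "\<dots> = (\<Sum>i<d. ennreal \<bar>\<integral>v. Z p i r v \<partial>P\<bar>)" by (subst sum_ennreal) auto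
  also have "\<dots> \<le> gap_bound h \<alpha> r"
    unfolding gap_bound_def using each by (intro sum_mono) auto
  finally show ?thesis .
qed

lemma integrable_P_bounded:
  assumes u: "continuous_on (Rd d) u" "\<And>x. x \<in> Rd d \<Longrightarrow> \<bar>u x\<bar> \<le> 1"
    and f: "f \<in> measurable P (leb d)"
  shows "integrable P (\<lambda>v. u (f v) :: real)"
proof (rule mg.P.integrable_const_bound[where B = 1])
  show "AE v in P. norm (u (f v)) \<le> 1"
    using u(2) measurable_space[OF f] by (intro AE_I2) auto
  show "(\<lambda>v. u (f v)) \<in> borel_measurable P"
    by (rule measurable_compose[OF f borel_measurable_continuous_Rd[OF u(1)]])
qed

lemma X_measurable: "(\<lambda>v. X r (fst v) (snd v)) \<in> measurable P (leb d)"
  using ou_measurable[of "T - r"] by (simp add: split_beta')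

lemma euler_continuous_comp:
  assumes Q: "quad_approx d u p \<Lambda> H" and ab: "a \<le> b" and nn: "0 \<le> \<Lambda>" "0 \<le> H"
  shows "continuous_on (Rd d) (\<lambda>x. u (euler a b x))"
  using quad_approx_euler[OF assms] quad_approx_continuous(1) by blast

text \<open>The expectation of \<open>step_pointwise\<close>. Fubini moves it inside the time
  integral, where the gap bound applies; \<Lambda> and H are left only in the term that is quadratic
  in the step.\<close>

lemma step_expectation:
  fixes \<Lambda> H :: real
  assumes Q: "quad_approx d u p \<Lambda> H" and nn: "0 \<le> \<Lambda>" "0 \<le> H"
    and u: "\<And>x. x \<in> Rd d \<Longrightarrow> \<bar>u x\<bar> \<le> 1"
    and ab: "0 \<le> a" "a \<le> b" "b \<le> S" and h: "0 < h" "h \<le> sig \<tau>" and \<alpha>: "0 < \<alpha>"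
  shows "ennreal \<bar>(\<integral>v. u (X b (fst v) (snd v)) \<partial>P) - (\<integral>v. u (euler a b (X a (fst v) (snd v))) \<partial>P)\<bar>
    \<le> (\<integral>\<^sup>+r\<in>{a<..b}. gap_bound h \<alpha> r \<partial>lborel)
      + ennreal ((H + H * d\<^sup>2 + d * (\<Lambda> + 6 * H)) * (elen a b)\<^sup>2 * EG2)"
proof -
  define F where "F r v = indicator {a<..b} r * (\<Sum>i<d. Z p i r v)" for r v
  define I where "I v = (LINT r:{a<..b}|lborel. \<Sum>i<d. Z p i r v)" for v
  define C where "C = (H + H * d\<^sup>2 + d * (\<Lambda> + 6 * H)) * (elen a b)\<^sup>2"
  have C0: "0 \<le> C" unfolding C_def using nn by simp
  interpret lp: pair_sigma_finite "lborel :: real measure" P ..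
  have Zm: "(\<lambda>(r, v). \<Sum>i<d. Z p i r v) \<in> borel_measurable (lborel \<Otimes>\<^sub>M P)"
    unfolding split_beta' using Z_measurable[OF Q] by (intro borel_measurable_sum) (auto simp: split_beta')
  have Fm: "(\<lambda>(r, v). F r v) \<in> borel_measurable (lborel \<Otimes>\<^sub>M P)"
    unfolding F_def split_beta' using Zm[unfolded split_beta'] by measurable
  have Zint: "integrable P (\<lambda>v. \<Sum>i<d. Z p i r v)" if "r \<le> S" for r
    using Z_integrable(1)[OF Q _ that] by (intro Bochner_Integration.integrable_sum) auto
  have Fint: "integrable (lborel \<Otimes>\<^sub>M P) (\<lambda>(r, v). F r v)"
  proof (rule lp.Fubini_integrable[OF Fm])
    show "AE r in lborel. integrable P (\<lambda>v. case (r, v) of (r, v) \<Rightarrow> F r v)"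
    proof (rule AE_I2)
      fix r show "integrable P (\<lambda>v. case (r, v) of (r, v) \<Rightarrow> F r v)"
        using Zint[of r] ab by (cases "r \<in> {a<..b}") (auto simp: F_def)
    qed
    let ?E = "\<integral>w. Gam w \<partial>std_gaussian d"
    show "integrable lborel (\<lambda>r. \<integral>v. norm (case (r, v) of (r, v) \<Rightarrow> F r v) \<partial>P)"
    proof (rule Bochner_Integration.integrable_bound)
      show "integrable lborel (\<lambda>r. indicator {a<..b} r *\<^sub>R ((1 + L r) * (d * \<Lambda> * ?E)))"
        using set_integrable_mult_left[OF integrable_L(2)[of a b], of "d * \<Lambda> * ?E"]
        unfolding set_integrable_def by simp
      show "(\<lambda>r. \<integral>v. norm (case (r, v) of (r, v) \<Rightarrow> F r v) \<partial>P) \<in> borel_measurable lborel"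
        using Fm by (intro mg.P.borel_measurable_lebesgue_integral) (simp add: split_beta')
      show "AE r in lborel. norm (\<integral>v. norm (case (r, v) of (r, v) \<Rightarrow> F r v) \<partial>P)
          \<le> norm (indicator {a<..b} r *\<^sub>R ((1 + L r) * (d * \<Lambda> * ?E)))"
      proof (rule AE_I2)
        fix r
        show "norm (\<integral>v. norm (case (r, v) of (r, v) \<Rightarrow> F r v) \<partial>P)
          \<le> norm (indicator {a<..b} r *\<^sub>R ((1 + L r) * (d * \<Lambda> * ?E)))"
        proof (cases "r \<in> {a<..b}")
          case True
          then have r: "r \<le> S" using ab by auto
          have Zi: "integrable P (\<lambda>v. \<bar>Z p i r v\<bar>)" if "i < d" for i
            using Z_integrable(1)[OF Q that r] by simp
          have "(\<integral>v. \<bar>\<Sum>i<d. Z p i r v\<bar> \<partial>P) \<le> (\<integral>v. (\<Sum>i<d. \<bar>Z p i r v\<bar>) \<partial>P)"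
            using Zint[OF r] Zi by (intro integral_mono Bochner_Integration.integrable_sum) auto
          also have "\<dots> = (\<Sum>i<d. \<integral>v. \<bar>Z p i r v\<bar> \<partial>P)"
            using Zi by (intro Bochner_Integration.integral_sum) auto
          also have "\<dots> \<le> (\<Sum>i<d. \<Lambda> * (1 + L r) * ?E)"
            using Z_integrable(2)[OF Q _ r] by (intro sum_mono) auto
          finally have "(\<integral>v. \<bar>\<Sum>i<d. Z p i r v\<bar> \<partial>P) \<le> (1 + L r) * (d * \<Lambda> * ?E)" by (simp add: mult_ac)
          moreover have "0 \<le> (\<integral>v. \<bar>\<Sum>i<d. Z p i r v\<bar> \<partial>P)" by simp
          ultimately show ?thesis using True by (simp add: F_def)
        qed (simp add: F_def)
      qed
    qed
  qed
  have IF: "I v = (\<integral>r. F r v \<partial>lborel)" for v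
    by (simp add: I_def F_def set_lebesgue_integral_def)
  have Iint: "integrable P I"
    using lp.integrable_snd[OF Fint] by (simp add: IF [abs_def])
  have "(\<integral>v. I v \<partial>P) = (\<integral>r. (\<integral>v. F r v \<partial>P) \<partial>lborel)"
    using lp.Fubini_integral[OF Fint] by (simp add: IF)
  then have "ennreal \<bar>\<integral>v. I v \<partial>P\<bar> \<le> (\<integral>\<^sup>+r. ennreal \<bar>\<integral>v. F r v \<partial>P\<bar> \<partial>lborel)"
    using integral_norm_bound_ennreal[OF lp.integrable_fst[OF Fint]] by simp
  also have "\<dots> \<le> (\<integral>\<^sup>+r\<in>{a<..b}. gap_bound h \<alpha> r \<partial>lborel)"
  proof (rule nn_integral_mono)
    fix r
    show "ennreal \<bar>\<integral>v. F r v \<partial>P\<bar> \<le> gap_bound h \<alpha> r * indicator {a<..b} r"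
      using expectation_le_gap_bound[OF Q u _ h \<alpha>, of r] ab
      by (cases "r \<in> {a<..b}") (auto simp: F_def)
  qed
  finally have I: "ennreal \<bar>\<integral>v. I v \<partial>P\<bar> \<le> (\<integral>\<^sup>+r\<in>{a<..b}. gap_bound h \<alpha> r \<partial>lborel)" .
  have i1: "integrable P (\<lambda>v. u (X b (fst v) (snd v)))"
    using integrable_P_bounded[OF quad_approx_continuous(1)[OF Q] u X_measurable] .
  have i2: "integrable P (\<lambda>v. u (euler a b (X a (fst v) (snd v))))"
    using integrable_P_bounded[OF euler_continuous_comp[OF Q ab(2) nn] _ X_measurable] u by simp
  have G2: "integrable P (\<lambda>v. C * (Gam (snd v))\<^sup>2)"
    using integrable_P_snd(1)[OF integrable_Gam2] by simp
  have "\<bar>(\<integral>v. u (X b (fst v) (snd v)) - u (euler a b (X a (fst v) (snd v))) - I v \<partial>P)\<bar>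
    \<le> (\<integral>v. C * (Gam (snd v))\<^sup>2 \<partial>P)"
  proof (rule integral_abs_bound[THEN order_trans], rule integral_mono_AE)
    show "AE v in P. \<bar>u (X b (fst v) (snd v)) - u (euler a b (X a (fst v) (snd v))) - I v\<bar> \<le> C * (Gam (snd v))\<^sup>2"
      using AE_P_bounded
    proof eventually_elim
      fix v :: "(nat \<Rightarrow> real) \<times> (nat \<Rightarrow> real)"
    assume "\<forall>i<d. \<bar>fst v i\<bar> \<le> D"
      then show "\<bar>u (X b (fst v) (snd v)) - u (euler a b (X a (fst v) (snd v))) - I v\<bar> \<le> C * (Gam (snd v))\<^sup>2"
        using step_pointwise[of "fst v" u p \<Lambda> H a b "snd v", OF _ Q nn ab(2,3)]
        by (simp add: I_def Z_def C_def power_mult_distrib mult.assoc)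
    qed
  qed (use i1 i2 Iint G2 in auto)
  also have "\<dots> = C * EG2" using integrable_P_snd(2)[OF integrable_Gam2] by (simp add: EG2_def)
  finally have "\<bar>(\<integral>v. u (X b (fst v) (snd v)) \<partial>P) - (\<integral>v. u (euler a b (X a (fst v) (snd v))) \<partial>P) - (\<integral>v. I v \<partial>P)\<bar> \<le> C * EG2"
    using i1 i2 Iint by simp
  then have "\<bar>(\<integral>v. u (X b (fst v) (snd v)) \<partial>P) - (\<integral>v. u (euler a b (X a (fst v) (snd v))) \<partial>P)\<bar> \<le> \<bar>\<integral>v. I v \<partial>P\<bar> + C * EG2"
    by linarith
  then have "ennreal \<bar>(\<integral>v. u (X b (fst v) (snd v)) \<partial>P) - (\<integral>v. u (euler a b (X a (fst v) (snd v))) \<partial>P)\<bar>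
      \<le> ennreal (\<bar>\<integral>v. I v \<partial>P\<bar> + C * EG2)" by (rule ennreal_leI)
  also have "\<dots> = ennreal \<bar>\<integral>v. I v \<partial>P\<bar> + ennreal (C * EG2)"
    using C0 by (intro ennreal_plus) (auto simp: EG2_def)
  also have "\<dots> \<le> (\<integral>\<^sup>+r\<in>{a<..b}. gap_bound h \<alpha> r \<partial>lborel) + ennreal (C * EG2)"
    using I by (rule add_right_mono)
  finally show ?thesis by (simp add: C_def)
qed

end

section \<open>Partitions of the time interval\<close>

context regular_drift
begin

lemma elen_split: "0 \<le> a \<Longrightarrow> a \<le> b \<Longrightarrow> elen 0 b = elen 0 a + elen a b"
proof -
  assume ab: "0 \<le> a" "a \<le> b"
  have "{0<..b} = {0<..a} \<union> {a<..b}" "{0<..a} \<inter> {a<..b} = {}" using ab by auto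
  then show ?thesis
    unfolding elen_def using set_integral_Un[OF _ integrable_L(2)[of 0 a] integrable_L(2)[of a b]] by simp
qed

lemma elen_0_continuous: "continuous_on {0..S} (elen 0)"
proof -
  have Lb: "L \<in> borel_measurable borel" using L_integrable by auto
  have int: "set_integrable lborel {0..S} (\<lambda>r. 1 + L r)" for S
  proof -
    have "integrable lborel (\<lambda>r. indicator {0..S} r *\<^sub>R L r)"
      using L_integrable by (intro integrable_mult_indicator) auto
    moreover have "integrable lborel (\<lambda>r. indicator {0..S} r *\<^sub>R (1::real))" by (cases "0 \<le> S") auto
    ultimately show ?thesis
      unfolding set_integrable_def scaleR_add_right by (intro Bochner_Integration.integrable_add)
  qed
  have "elen 0 x = integral {0..x} (\<lambda>r. 1 + L r)" for x
    unfolding elen_def using set_borel_integral_eq_integral(2)[OF int] Lb by (subst set_integral_Ioc_Icc) auto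
  moreover have "continuous_on {0..S} (\<lambda>x. integral {0..x} (\<lambda>r. 1 + L r))"
    by (rule indefinite_integral_continuous_1) (rule set_borel_integral_eq_integral(1)[OF int])
  ultimately show ?thesis by (simp add: fun_eq_iff [symmetric])
qed

text \<open>As \<open>L\<close> is merely integrable, the steps are equal with respect to \<open>1 + L\<close> and not in time.\<close>

lemma equal_partition:
  assumes S: "0 < S" and n: "0 < n"
  obtains t where "t 0 = 0" "t n = S" "\<And>k. k < n \<Longrightarrow> t k \<le> t (Suc k)"
    "\<And>k. k \<le> n \<Longrightarrow> t k \<in> {0..S}" "\<And>k. k < n \<Longrightarrow> elen (t k) (t (Suc k)) = elen 0 S / n"
proof -
  have e0: "elen 0 0 = 0" by (simp add: elen_def set_lebesgue_integral_def)
  have A0: "0 \<le> elen 0 S" by (rule elen_nonneg)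
  have "\<exists>x\<in>{0..S}. elen 0 x = k * (elen 0 S / n)" if k: "k \<le> n" for k
  proof -
    have "k * (elen 0 S / n) \<le> n * (elen 0 S / n)" using k A0 by (intro mult_right_mono) auto
    then have "k * (elen 0 S / n) \<le> elen 0 S" using n by simp
    then show ?thesis
      using IVT'[of "elen 0" 0 "k * (elen 0 S / n)" S, OF _ _ _ elen_0_continuous] S A0 e0 by auto
  qed
  then obtain t where t: "\<And>k. k \<le> n \<Longrightarrow> t k \<in> {0..S}" "\<And>k. k \<le> n \<Longrightarrow> elen 0 (t k) = k * (elen 0 S / n)"
    by metis
  \<comment> \<open>The summand 1 in 1 + L makes \<open>elen 0\<close> strictly increasing, so the
    points supplied by the intermediate value theorem are determined by their values.\<close>
  have inj: "x = y" if "0 \<le> x" "x \<le> y" "elen 0 x = elen 0 y" for x y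
    using elen_split[OF that(1,2)] elen_ge(1)[OF that(2)] that by simp
  have step: "t k \<le> t (Suc k)" if k: "k < n" for k
  proof (rule ccontr)
    assume *: "\<not> t k \<le> t (Suc k)"
    have "elen 0 (t (Suc k)) \<le> elen 0 (t k)" using * by (intro elen_mono) auto
    moreover have "elen 0 (t k) \<le> elen 0 (t (Suc k))"
    proof -
      have "0 \<le> elen 0 S / n" using A0 by simp
      then have "real k * (elen 0 S / n) \<le> real (Suc k) * (elen 0 S / n)"
        by (intro mult_right_mono) simp_all
      then show ?thesis
        unfolding t(2)[OF less_imp_le_nat[OF k]] t(2)[OF Suc_leI[OF k]] .
    qed
    ultimately have "elen 0 (t (Suc k)) = elen 0 (t k)" by simp
    then have "t (Suc k) = t k" using * t(1)[of "Suc k"] k inj[of "t (Suc k)" "t k"] by simp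
    then show False using * by simp
  qed
  show ?thesis
  proof
    show "t 0 = 0" using t(1)[of 0] t(2)[of 0] e0 inj[of 0 "t 0"] by simp
    show "t n = S" using t(1)[of n] t(2)[of n] n inj[of "t n" S] by simp
    show "elen (t k) (t (Suc k)) = elen 0 S / n" if "k < n" for k
    proof -
      have "elen (t k) (t (Suc k)) = elen 0 (t (Suc k)) - elen 0 (t k)"
        using elen_split[of "t k" "t (Suc k)"] step[OF that] t(1)[of k] that by simp
      also have "\<dots> = (real (Suc k) - real k) * (elen 0 S / n)"
        unfolding t(2)[OF less_imp_le_nat[OF that]] t(2)[OF Suc_leI[OF that]] by (rule left_diff_distrib[symmetric])
      finally show ?thesis by simp
    qed
  qed (use step t in auto)
qed

end

section \<open>Summation over the steps and the limit of fine partitions\<close>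

context reverse_flow
begin

lemma mix_joint_measurable:
  "(\<lambda>q. mix (T - fst q) (snd q)) \<in> borel_measurable (borel \<Otimes>\<^sub>M leb d)"
  "i < d \<Longrightarrow> (\<lambda>q. mix_deriv i (T - fst q) (snd q)) \<in> borel_measurable (borel \<Otimes>\<^sub>M leb d)"
proof -
  have 1: "(\<lambda>v. ou_kernel d (T - fst (fst v)) (snd v) (snd (fst v))) \<in> borel_measurable ((borel \<Otimes>\<^sub>M leb d) \<Otimes>\<^sub>M \<mu>)"
    unfolding ou_kernel_def gauss_kernel_def normal_density_def sig_def
    by (intro borel_measurable_prod) simp
  show "(\<lambda>q. mix (T - fst q) (snd q)) \<in> borel_measurable (borel \<Otimes>\<^sub>M leb d)"
    unfolding mix_def by (rule mu.borel_measurable_lebesgue_integral) (use 1 in \<open>simp add: split_beta'\<close>)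
  show "(\<lambda>q. mix_deriv i (T - fst q) (snd q)) \<in> borel_measurable (borel \<Otimes>\<^sub>M leb d)" if i: "i < d"
  proof -
    have "(\<lambda>v. (exp (- (T - fst (fst v))) * snd v i - snd (fst v) i) / (sig (T - fst (fst v)))\<^sup>2)
        \<in> borel_measurable ((borel \<Otimes>\<^sub>M leb d) \<Otimes>\<^sub>M \<mu>)"
      using i unfolding sig_def by simp
    from borel_measurable_times[OF 1 this] show ?thesis
      unfolding mix_deriv_def
      by (intro mu.borel_measurable_lebesgue_integral) (simp add: split_beta')
  qed
qed

text \<open>The squared score error written through \<open>mix_deriv\<close> and \<open>mix\<close>,
  both jointly measurable in time and space, whereas \<open>score\<close> is defined by a derivative
  at each point. The indicator keeps T - r positive, where the formula agrees with the
  score.\<close>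

definition sq_error :: "nat \<Rightarrow> real \<Rightarrow> (nat \<Rightarrow> real) \<Rightarrow> real" where
  "sq_error i r x = indicator {..S} r * (mix_deriv i (T - r) x / mix (T - r) x - s r x i)\<^sup>2"

lemma sq_error_eq: "r \<le> S \<Longrightarrow> i < d \<Longrightarrow> x \<in> Rd d \<Longrightarrow> sq_error i r x = (score (mix (T - r)) x i - s r x i)\<^sup>2"
  using tau score_mix(1)[of "T - r" i x] by (simp add: sq_error_def)

lemma sq_error_measurable:
  assumes i: "i < d" shows "(\<lambda>q. sq_error i (fst q) (snd q)) \<in> borel_measurable (borel \<Otimes>\<^sub>M leb d)"
  using mix_joint_measurable(1) mix_joint_measurable(2)[OF i] s_joint_measurable[OF i]
  unfolding sq_error_def by (simp add: split_beta')

lemma sq_error_nn_integral_measurable: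
  assumes i: "i < d" shows "(\<lambda>r. \<integral>\<^sup>+x. ennreal (sq_error i r x * mix (T - r) x) \<partial>leb d) \<in> borel_measurable borel"
  using sq_error_measurable[OF i] mix_joint_measurable(1)
  by (intro lebd.borel_measurable_nn_integral) (simp add: split_beta')

lemma nn_integral_mix: "0 < t \<Longrightarrow> (\<integral>\<^sup>+x. ennreal (mix t x) \<partial>leb d) = 1"
proof -
  assume t: "0 < t"
  have "prob_space (distr P (leb d) (\<lambda>(y, w). ou d t y w))"
    by (rule mg.P.prob_space_distr[OF ou_measurable])
  then have "emeasure (density (leb d) (\<lambda>x. ennreal (mix t x))) (Rd d) = 1"
    unfolding ou_law[OF t] using prob_space.emeasure_space_1 by fastforce
  moreover have "emeasure (density (leb d) (\<lambda>x. ennreal (mix t x))) (Rd d) = (\<integral>\<^sup>+x. ennreal (mix t x) \<partial>leb d)"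
    using sets.top[of "leb d"] by (subst emeasure_density) (auto intro!: nn_integral_cong)
  ultimately show ?thesis by simp
qed

text \<open>As \<open>mix\<close> has integral 1, everything except the score error is a
  deterministic function of time. This isolates the only term that needs the assumption on the
  learned score.\<close>

lemma gap_bound_eq:
  assumes r: "r \<le> S" and h: "0 < h" and \<alpha>: "0 < \<alpha>"
  shows "gap_bound h \<alpha> r = ennreal (d * (4 / h * \<alpha> + 8 * h * (L r + D / sig (T - r) ^ 4)))
    + ennreal (4 / h / \<alpha>) * (\<Sum>i<d. \<integral>\<^sup>+x. ennreal (sq_error i r x * mix (T - r) x) \<partial>leb d)"
proof -
  define c where "c = 4 / h * \<alpha> + 8 * h * (L r + D / sig (T - r) ^ 4)"
  have Tr: "0 < T - r" using r tau by auto
  have c: "0 \<le> c" using h \<alpha> L_nonneg[of r] D1 unfolding c_def by (intro add_nonneg_nonneg mult_nonneg_nonneg) auto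
  have "(\<integral>\<^sup>+x. ennreal ((4 / h * (\<alpha> + (score (mix (T - r)) x i - s r x i)\<^sup>2 / \<alpha>)
      + 8 * h * (L r + D / sig (T - r) ^ 4)) * mix (T - r) x) \<partial>leb d)
    = ennreal c + ennreal (4 / h / \<alpha>) * (\<integral>\<^sup>+x. ennreal (sq_error i r x * mix (T - r) x) \<partial>leb d)" if i: "i < d" for i
  proof -
    have [measurable]: "(\<lambda>x. sq_error i r x) \<in> borel_measurable (leb d)"
      using measurable_compose[OF measurable_Pair1' sq_error_measurable[OF i], of r] by simp
    have "(\<integral>\<^sup>+x. ennreal ((4 / h * (\<alpha> + (score (mix (T - r)) x i - s r x i)\<^sup>2 / \<alpha>)
      + 8 * h * (L r + D / sig (T - r) ^ 4)) * mix (T - r) x) \<partial>leb d)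
      = (\<integral>\<^sup>+x. ennreal c * ennreal (mix (T - r) x) + ennreal (4 / h / \<alpha>) * ennreal (sq_error i r x * mix (T - r) x) \<partial>leb d)"
    proof (rule nn_integral_cong)
      fix x assume "x \<in> space (leb d)"
      then have "(4 / h * (\<alpha> + (score (mix (T - r)) x i - s r x i)\<^sup>2 / \<alpha>)
        + 8 * h * (L r + D / sig (T - r) ^ 4)) * mix (T - r) x
        = c * mix (T - r) x + 4 / h / \<alpha> * (sq_error i r x * mix (T - r) x)"
        using sq_error_eq[OF r i, of x] by (simp add: c_def distrib_left distrib_right)
      moreover have "0 \<le> sq_error i r x" by (simp add: sq_error_def)
      ultimately show "ennreal ((4 / h * (\<alpha> + (score (mix (T - r)) x i - s r x i)\<^sup>2 / \<alpha>)
        + 8 * h * (L r + D / sig (T - r) ^ 4)) * mix (T - r) x)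
        = ennreal c * ennreal (mix (T - r) x) + ennreal (4 / h / \<alpha>) * ennreal (sq_error i r x * mix (T - r) x)"
        using c h \<alpha> mix_nonneg[of "T - r" x]
        by (simp only: ennreal_plus mult_nonneg_nonneg ennreal_mult divide_nonneg_pos zero_le_numeral)
    qed
    also have "\<dots> = ennreal c + ennreal (4 / h / \<alpha>) * (\<integral>\<^sup>+x. ennreal (sq_error i r x * mix (T - r) x) \<partial>leb d)"
      by (subst nn_integral_add) (auto simp: nn_integral_cmult nn_integral_mix[OF Tr])
    finally show ?thesis .
  qed
  then have "gap_bound h \<alpha> r = (\<Sum>i<d. ennreal c + ennreal (4 / h / \<alpha>) * (\<integral>\<^sup>+x. ennreal (sq_error i r x * mix (T - r) x) \<partial>leb d))"
    unfolding gap_bound_def by (intro sum.cong) auto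
  also have "\<dots> = ennreal (d * c) + ennreal (4 / h / \<alpha>) * (\<Sum>i<d. \<integral>\<^sup>+x. ennreal (sq_error i r x * mix (T - r) x) \<partial>leb d)"
    using c by (simp add: sum.distrib sum_distrib_left ennreal_mult ennreal_of_nat_eq_real_of_nat)
  finally show ?thesis by (simp add: c_def)
qed

lemma gap_bound_indicator_measurable:
  assumes h: "0 < h" and \<alpha>: "0 < \<alpha>"
  shows "(\<lambda>r. gap_bound h \<alpha> r * indicator {..S} r) \<in> borel_measurable borel"
proof -
  have [measurable]: "L \<in> borel_measurable borel" using L_integrable by auto
  have [measurable]: "sig \<in> borel_measurable borel" unfolding sig_def [abs_def] by measurable
  have [measurable]: "(\<lambda>r. \<Sum>i<d. \<integral>\<^sup>+x. ennreal (sq_error i r x * mix (T - r) x) \<partial>leb d) \<in> borel_measurable borel"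
    using sq_error_nn_integral_measurable by (intro borel_measurable_sum) auto
  have "(\<lambda>r. (ennreal (d * (4 / h * \<alpha> + 8 * h * (L r + D / sig (T - r) ^ 4)))
    + ennreal (4 / h / \<alpha>) * (\<Sum>i<d. \<integral>\<^sup>+x. ennreal (sq_error i r x * mix (T - r) x) \<partial>leb d)) * indicator {..S} r)
    \<in> borel_measurable borel"
    by measurable
  also have "(\<lambda>r. (ennreal (d * (4 / h * \<alpha> + 8 * h * (L r + D / sig (T - r) ^ 4)))
    + ennreal (4 / h / \<alpha>) * (\<Sum>i<d. \<integral>\<^sup>+x. ennreal (sq_error i r x * mix (T - r) x) \<partial>leb d)) * indicator {..S} r)
    = (\<lambda>r. gap_bound h \<alpha> r * indicator {..S} r)"
    using gap_bound_eq[OF _ h \<alpha>] by (auto simp: fun_eq_iff indicator_def)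
  finally show ?thesis .
qed

lemma gap_integral_split:
  assumes h: "0 < h" and \<alpha>: "0 < \<alpha>" and ab: "a \<le> b" "b \<le> S"
  shows "(\<integral>\<^sup>+r\<in>{a<..b}. gap_bound h \<alpha> r \<partial>lborel) + (\<integral>\<^sup>+r\<in>{b<..S}. gap_bound h \<alpha> r \<partial>lborel)
    = (\<integral>\<^sup>+r\<in>{a<..S}. gap_bound h \<alpha> r \<partial>lborel)"
proof -
  have m: "(\<lambda>r. gap_bound h \<alpha> r * indicator {x<..y} r) \<in> borel_measurable lborel" if "y \<le> S" for x y
  proof -
    have "(\<lambda>r. gap_bound h \<alpha> r * indicator {x<..y} r) = (\<lambda>r. (gap_bound h \<alpha> r * indicator {..S} r) * indicator {x<..y} r)"
      using that by (auto simp: indicator_def fun_eq_iff)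
    then show ?thesis using gap_bound_indicator_measurable[OF h \<alpha>] by simp
  qed
  have "(\<integral>\<^sup>+r\<in>{a<..S}. gap_bound h \<alpha> r \<partial>lborel)
    = (\<integral>\<^sup>+r. gap_bound h \<alpha> r * indicator {a<..b} r + gap_bound h \<alpha> r * indicator {b<..S} r \<partial>lborel)"
    using ab by (intro nn_integral_cong) (auto simp: indicator_def)
  also have "\<dots> = (\<integral>\<^sup>+r\<in>{a<..b}. gap_bound h \<alpha> r \<partial>lborel) + (\<integral>\<^sup>+r\<in>{b<..S}. gap_bound h \<alpha> r \<partial>lborel)"
    using ab by (intro nn_integral_add m) auto
  finally show ?thesis ..
qed

text \<open>Induction backwards in time: u is \<phi> composed with the last j Euler maps and is
  evaluated at the exact position at time \<open>t (n - j)\<close>. Each further map multiplies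
  \<Lambda> by 1 + d \<epsilon>, multiplies H by its square and adds d \<Lambda> \<epsilon> times
  the power accumulated in \<Lambda>, which explains the constants. \<open>K\<Lambda>\<close> and
  \<open>KH\<close> bound them for all j at once, so that all local errors have the same
  bound.\<close>

lemma Euler_telescope:
  fixes \<Lambda> H \<epsilon> K\<Lambda> KH :: real
  assumes Q: "quad_approx d \<phi> p \<Lambda> H" and nn: "0 \<le> \<Lambda>" "0 \<le> H"
    and \<phi>: "\<And>x. x \<in> Rd d \<Longrightarrow> \<bar>\<phi> x\<bar> \<le> 1"
    and h: "0 < h" "h \<le> sig \<tau>" and \<alpha>: "0 < \<alpha>"
    and t: "t n = S" "\<And>k. k < n \<Longrightarrow> t k \<le> t (Suc k)" "\<And>k. k \<le> n \<Longrightarrow> t k \<in> {0..S}"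
    and e: "\<And>k. k < n \<Longrightarrow> elen (t k) (t (Suc k)) = \<epsilon>" "0 \<le> \<epsilon>"
    and K: "\<Lambda> * (1 + d * \<epsilon>) ^ n \<le> K\<Lambda>" "(H + n * d * \<Lambda> * \<epsilon>) * (1 + d * \<epsilon>) ^ (2 * n) \<le> KH"
  shows "j \<le> n \<Longrightarrow> \<exists>u p'. quad_approx d u p' (\<Lambda> * (1 + d * \<epsilon>) ^ j) ((H + j * d * \<Lambda> * \<epsilon>) * (1 + d * \<epsilon>) ^ (2 * j))
    \<and> (\<forall>x\<in>Rd d. \<bar>u x\<bar> \<le> 1) \<and> (\<forall>x\<in>Rd d. u (euler_iter t (n - j) x) = \<phi> (euler_iter t n x))
    \<and> ennreal \<bar>(\<integral>v. \<phi> (X S (fst v) (snd v)) \<partial>P) - (\<integral>v. u (X (t (n - j)) (fst v) (snd v)) \<partial>P)\<bar>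
      \<le> (\<integral>\<^sup>+r\<in>{t (n - j)<..S}. gap_bound h \<alpha> r \<partial>lborel) + ennreal (j * ((KH + KH * d\<^sup>2 + d * (K\<Lambda> + 6 * KH)) * \<epsilon>\<^sup>2 * EG2))"
proof (induction j)
  case 0
  show ?case
    by (rule exI[of _ \<phi>], rule exI[of _ p]) (use Q \<phi> t(1) in auto)
next
  case (Suc j)
  define k where "k = n - Suc j"
  have k: "k < n" "n - j = Suc k" using Suc.prems by (auto simp: k_def)
  define \<kappa> where "\<kappa> = 1 + d * \<epsilon>"
  have \<kappa>: "1 \<le> \<kappa>" using e(2) by (simp add: \<kappa>_def)
  define \<Lambda>j Hj where "\<Lambda>j = \<Lambda> * \<kappa> ^ j" and "Hj = (H + j * d * \<Lambda> * \<epsilon>) * \<kappa> ^ (2 * j)"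
  have nnj: "0 \<le> \<Lambda>j" "0 \<le> Hj" using nn \<kappa> e(2) by (auto simp: \<Lambda>j_def Hj_def)
  define Kc where "Kc = (KH + KH * d\<^sup>2 + d * (K\<Lambda> + 6 * KH)) * \<epsilon>\<^sup>2 * EG2"
  have le\<Lambda>: "\<Lambda>j \<le> K\<Lambda>"
  proof -
    have "\<Lambda>j \<le> \<Lambda> * \<kappa> ^ n" unfolding \<Lambda>j_def using nn \<kappa> Suc.prems by (intro mult_left_mono power_increasing) auto
    then show ?thesis using K(1) unfolding \<kappa>_def by simp
  qed
  have leH: "Hj \<le> KH"
  proof -
    have "real (j * d) * \<Lambda> * \<epsilon> \<le> real (n * d) * \<Lambda> * \<epsilon>"
      using nn e(2) Suc.prems by (intro mult_right_mono of_nat_mono mult_le_mono1) auto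
    then have "Hj \<le> (H + n * d * \<Lambda> * \<epsilon>) * \<kappa> ^ (2 * n)"
      unfolding Hj_def
      by (rule mult_mono[OF add_left_mono]) (use nn \<kappa> e(2) Suc.prems in \<open>auto intro: power_increasing\<close>)
    then show ?thesis using K(2) unfolding \<kappa>_def by simp
  qed
  have EG0: "0 \<le> EG2" by (simp add: EG2_def)
  have Kc0: "0 \<le> Kc" unfolding Kc_def using nnj le\<Lambda> leH EG0 by (intro mult_nonneg_nonneg add_nonneg_nonneg) auto
  obtain u p' where u: "quad_approx d u p' \<Lambda>j Hj" "\<forall>x\<in>Rd d. \<bar>u x\<bar> \<le> 1"
      "\<forall>x\<in>Rd d. u (euler_iter t (Suc k) x) = \<phi> (euler_iter t n x)"
      "ennreal \<bar>(\<integral>v. \<phi> (X S (fst v) (snd v)) \<partial>P) - (\<integral>v. u (X (t (Suc k)) (fst v) (snd v)) \<partial>P)\<bar>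
        \<le> (\<integral>\<^sup>+r\<in>{t (Suc k)<..S}. gap_bound h \<alpha> r \<partial>lborel) + ennreal (j * Kc)"
    using Suc.IH Suc.prems unfolding \<kappa>_def[symmetric] \<Lambda>j_def[symmetric] Hj_def[symmetric] Kc_def[symmetric] k(2)
    by auto
  define a b where "a = t k" and "b = t (Suc k)"
  have ab: "0 \<le> a" "a \<le> b" "b \<le> S" "elen a b = \<epsilon>"
    using t(2)[OF k(1)] t(3)[of k] t(3)[of "Suc k"] e(1)[OF k(1)] k by (auto simp: a_def b_def)
  define u' where "u' x = u (euler a b x)" for x
  obtain p'' where Q': "quad_approx d u' p'' (\<Lambda>j * \<kappa>) (Hj * \<kappa>\<^sup>2 + d * \<Lambda>j * \<epsilon>)"
    using quad_approx_euler[OF u(1) ab(2) nnj] unfolding ab(4) \<kappa>_def u'_def by auto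
  have Q'': "quad_approx d u' p'' (\<Lambda> * \<kappa> ^ Suc j) ((H + Suc j * d * \<Lambda> * \<epsilon>) * \<kappa> ^ (2 * Suc j))"
  proof (rule quad_approx_mono[OF Q'])
    show "\<Lambda>j * \<kappa> \<le> \<Lambda> * \<kappa> ^ Suc j" by (simp add: \<Lambda>j_def)
    have "\<kappa> ^ j \<le> \<kappa> ^ (2 * Suc j)" using \<kappa> by (intro power_increasing) auto
    then have "d * \<Lambda> * \<epsilon> * \<kappa> ^ j \<le> d * \<Lambda> * \<epsilon> * \<kappa> ^ (2 * Suc j)"
      using nn e(2) by (intro mult_left_mono) auto
    then show "Hj * \<kappa>\<^sup>2 + d * \<Lambda>j * \<epsilon> \<le> (H + Suc j * d * \<Lambda> * \<epsilon>) * \<kappa> ^ (2 * Suc j)"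
      by (simp add: Hj_def \<Lambda>j_def algebra_simps power2_eq_square)
  qed
  have bound: "\<forall>x\<in>Rd d. \<bar>u' x\<bar> \<le> 1" using u(2) by (simp add: u'_def)
  have iter: "\<forall>x\<in>Rd d. u' (euler_iter t k x) = \<phi> (euler_iter t n x)"
    using u(3) by (simp add: u'_def a_def b_def)
  have step: "ennreal \<bar>(\<integral>v. u (X b (fst v) (snd v)) \<partial>P) - (\<integral>v. u' (X a (fst v) (snd v)) \<partial>P)\<bar>
    \<le> (\<integral>\<^sup>+r\<in>{a<..b}. gap_bound h \<alpha> r \<partial>lborel) + ennreal Kc"
  proof -
    have "(Hj + Hj * d\<^sup>2 + d * (\<Lambda>j + 6 * Hj)) * \<epsilon>\<^sup>2 * EG2 \<le> Kc"
      unfolding Kc_def using le\<Lambda> leH EG0 nnj by (intro mult_right_mono add_mono mult_left_mono) auto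
    then have "ennreal ((Hj + Hj * d\<^sup>2 + d * (\<Lambda>j + 6 * Hj)) * (elen a b)\<^sup>2 * EG2) \<le> ennreal Kc"
      unfolding ab(4) by (rule ennreal_leI)
    then show ?thesis
      using step_expectation[OF u(1) nnj _ ab(1,2,3) h \<alpha>] u(2) unfolding u'_def
      by (meson add_left_mono order_trans)
  qed
  let ?I = "\<integral>v. \<phi> (X S (fst v) (snd v)) \<partial>P" and ?J = "\<integral>v. u (X b (fst v) (snd v)) \<partial>P"
    and ?K = "\<integral>v. u' (X a (fst v) (snd v)) \<partial>P"
  have "ennreal \<bar>?I - ?K\<bar> \<le> ennreal (\<bar>?I - ?J\<bar> + \<bar>?J - ?K\<bar>)" by (intro ennreal_leI) linarith
  also have "\<dots> = ennreal \<bar>?I - ?J\<bar> + ennreal \<bar>?J - ?K\<bar>" by simp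
  also have "\<dots> \<le> ((\<integral>\<^sup>+r\<in>{b<..S}. gap_bound h \<alpha> r \<partial>lborel) + ennreal (j * Kc)) + ((\<integral>\<^sup>+r\<in>{a<..b}. gap_bound h \<alpha> r \<partial>lborel) + ennreal Kc)"
    using u(4) step unfolding b_def[symmetric] by (rule add_mono)
  also have "\<dots> = ((\<integral>\<^sup>+r\<in>{a<..b}. gap_bound h \<alpha> r \<partial>lborel) + (\<integral>\<^sup>+r\<in>{b<..S}. gap_bound h \<alpha> r \<partial>lborel)) + ennreal (Suc j * Kc)"
  proof -
    have "ennreal (Suc j * Kc) = ennreal (j * Kc) + ennreal Kc"
      using Kc0 by (subst ennreal_plus[symmetric]) (auto simp: algebra_simps)
    then show ?thesis by (simp add: add_ac)
  qed
  also have "(\<integral>\<^sup>+r\<in>{a<..b}. gap_bound h \<alpha> r \<partial>lborel) + (\<integral>\<^sup>+r\<in>{b<..S}. gap_bound h \<alpha> r \<partial>lborel) = (\<integral>\<^sup>+r\<in>{a<..S}. gap_bound h \<alpha> r \<partial>lborel)"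
    by (rule gap_integral_split[OF h(1) \<alpha> ab(2,3)])
  finally have "ennreal \<bar>?I - ?K\<bar> \<le> (\<integral>\<^sup>+r\<in>{a<..S}. gap_bound h \<alpha> r \<partial>lborel) + ennreal (Suc j * Kc)"
    by (simp add: add_right_mono)
  then show ?case
    using Q'' bound iter unfolding Kc_def \<kappa>_def a_def k_def by blast
qed

text \<open>Refine the partition. The growth factors stay below exp (d A), each of the n local
  errors is of order 1 / n^2, and their sum C / n vanishes; the gap integral does not depend on n.
  Meanwhile the Euler iterates converge to the flow at each starting point, and \<phi> is bounded
  and continuous, so the expectations converge.\<close>

theorem transport_error:
  fixes \<Lambda> H :: real and Y :: "real \<Rightarrow> (nat \<Rightarrow> real) \<Rightarrow> nat \<Rightarrow> real"
  assumes Q: "quad_approx d \<phi> p \<Lambda> H"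
    and \<phi>: "\<And>x. x \<in> Rd d \<Longrightarrow> \<bar>\<phi> x\<bar> \<le> 1"
    and h: "0 < h" "h \<le> sig \<tau>" and \<alpha>: "0 < \<alpha>"
    and Y: "ode_flow d S s Y" and YS: "Y S \<in> measurable (leb d) (leb d)"
  shows "ennreal \<bar>(\<integral>v. \<phi> (X S (fst v) (snd v)) \<partial>P) - (\<integral>v. \<phi> (Y S (X 0 (fst v) (snd v))) \<partial>P)\<bar>
    \<le> (\<integral>\<^sup>+r\<in>{0<..S}. gap_bound h \<alpha> r \<partial>lborel)"
proof -
  have S: "0 < S" using tau by simp
  have z: "(\<lambda>i\<in>{..<d}. 0 :: real) \<in> Rd d" by auto
  have nn: "0 \<le> \<Lambda>" "0 \<le> H"
  proof -
    show "0 \<le> \<Lambda>" using quad_approxD(1)[OF Q z, of 0] d_pos by (intro order_trans[OF abs_ge_zero]) auto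
    \<comment> \<open>A point at distance 1 from the origin, which exists since d \<ge> 1, forces H
      to be nonnegative.\<close>
    let ?y = "(\<lambda>i\<in>{..<d}. 0 :: real)(0 := 1)"
    have y: "?y \<in> Rd d" using upd_Rd[OF z, of 0 1] d_pos by simp
    have "(\<lambda>i\<in>{..<d}. 0 :: real)(0 := 0) = (\<lambda>i\<in>{..<d}. 0)" using d_pos by (intro ext) auto
    then have "l1_dist d (\<lambda>i\<in>{..<d}. 0) ?y = 1"
      using l1_dist_upd[of 0 d "\<lambda>i\<in>{..<d}. 0" 0 1] d_pos by simp
    then show "0 \<le> H" using quad_approxD(2)[OF Q z y] by (simp add: order_trans[OF abs_ge_zero])
  qed
  define A where "A = elen 0 S"
  have A: "0 \<le> A" unfolding A_def by (rule elen_nonneg)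
  define K\<Lambda> KH where "K\<Lambda> = \<Lambda> * exp (d * A)" and "KH = (H + d * \<Lambda> * A) * (exp (d * A))\<^sup>2"
  define C where "C = (KH + KH * d\<^sup>2 + d * (K\<Lambda> + 6 * KH)) * A\<^sup>2 * EG2"
  have powle: "(1 + d * (A / n)) ^ n \<le> exp (d * A)" if "0 < n" for n :: nat
  proof -
    have "(1 + d * (A / n)) ^ n \<le> exp (d * (A / n)) ^ n"
      using A by (intro power_mono) auto
    also have "\<dots> = exp (d * A)" using that by (simp flip: exp_of_nat_mult)
    finally show ?thesis .
  qed
  have part: "\<exists>t. t 0 = 0 \<and> t n = S \<and> (\<forall>k<n. t k \<le> t (Suc k)) \<and> (\<forall>k\<le>n. t k \<in> {0..S}) \<and>
      (\<forall>k<n. elen (t k) (t (Suc k)) = A / n)" if "0 < n" for n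
    using equal_partition[OF S that] unfolding A_def by metis
  define t where "t n = (SOME t. t 0 = 0 \<and> t n = S \<and> (\<forall>k<n. t k \<le> t (Suc k)) \<and> (\<forall>k\<le>n. t k \<in> {0..S}) \<and>
      (\<forall>k<n. elen (t k) (t (Suc k)) = A / n))" for n
  have t: "t n 0 = 0" "t n n = S" "\<And>k. k < n \<Longrightarrow> t n k \<le> t n (Suc k)" "\<And>k. k \<le> n \<Longrightarrow> t n k \<in> {0..S}"
    "\<And>k. k < n \<Longrightarrow> elen (t n k) (t n (Suc k)) = A / n" if "0 < n" for n
    using someI_ex[OF part[OF that]] unfolding t_def[symmetric] by auto
  let ?E = "\<lambda>n v. euler_iter (t n) n (X 0 (fst v) (snd v))"
  have tele: "continuous_on (Rd d) (\<lambda>x. \<phi> (euler_iter (t n) n x))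
    \<and> ennreal \<bar>(\<integral>v. \<phi> (X S (fst v) (snd v)) \<partial>P) - (\<integral>v. \<phi> (?E n v) \<partial>P)\<bar>
      \<le> (\<integral>\<^sup>+r\<in>{0<..S}. gap_bound h \<alpha> r \<partial>lborel) + ennreal (C / n)" if n: "0 < n" for n
  proof -
    have K1: "\<Lambda> * (1 + d * (A / n)) ^ n \<le> K\<Lambda>"
      unfolding K\<Lambda>_def using powle[OF n] nn by (intro mult_left_mono) auto
    have "(1 + d * (A / n)) ^ (2 * n) = ((1 + d * (A / n)) ^ n)\<^sup>2" by (simp add: power_mult mult.commute flip: power_mult)
    also have "\<dots> \<le> (exp (d * A))\<^sup>2" using powle[OF n] A by (intro power_mono) auto
    finally have K2: "(H + n * d * \<Lambda> * (A / n)) * (1 + d * (A / n)) ^ (2 * n) \<le> KH"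
      unfolding KH_def using nn A n by (intro mult_mono) auto
    have e0: "0 \<le> A / n" using A by simp
    from Euler_telescope[OF Q nn \<phi> h \<alpha> t(2-5)[OF n] e0 K1 K2, of n]
    obtain u p' \<Lambda>' H' where u: "quad_approx d u p' \<Lambda>' H'" "\<forall>x\<in>Rd d. u x = \<phi> (euler_iter (t n) n x)"
      "ennreal \<bar>(\<integral>v. \<phi> (X S (fst v) (snd v)) \<partial>P) - (\<integral>v. u (X 0 (fst v) (snd v)) \<partial>P)\<bar>
        \<le> (\<integral>\<^sup>+r\<in>{0<..S}. gap_bound h \<alpha> r \<partial>lborel) + ennreal (n * ((KH + KH * d\<^sup>2 + d * (K\<Lambda> + 6 * KH)) * (A / n)\<^sup>2 * EG2))"
      using t(1)[OF n] by auto
    have "n * ((KH + KH * d\<^sup>2 + d * (K\<Lambda> + 6 * KH)) * (A / n)\<^sup>2 * EG2) = C / n"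
      using n by (simp add: C_def field_simps power2_eq_square)
    moreover have "continuous_on (Rd d) (\<lambda>x. \<phi> (euler_iter (t n) n x))"
      using quad_approx_continuous(1)[OF u(1)] u(2) by (simp cong: continuous_on_cong_simp)
    moreover have "(\<integral>v. u (X 0 (fst v) (snd v)) \<partial>P) = (\<integral>v. \<phi> (?E n v) \<partial>P)"
      using u(2) by simp
    ultimately show ?thesis using u(3) by simp
  qed
  have conv: "(\<lambda>n. \<phi> (euler_iter (t (Suc n)) (Suc n) x)) \<longlonglongrightarrow> \<phi> (Y S x)" if x: "x \<in> Rd d" for x
  proof -
    have Yx: "Y 0 x = x" "\<And>r. r \<in> {0..S} \<Longrightarrow> Y r x \<in> Rd d"
      "\<And>i. i < d \<Longrightarrow> set_integrable lborel {0..S} (\<lambda>r. Y r x i + s r (Y r x) i)"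
      "\<And>r i. r \<in> {0..S} \<Longrightarrow> i < d \<Longrightarrow> Y r x i = x i + (LINT q:{0..r}|lborel. Y q x i + s q (Y q x) i)"
      using Y x unfolding ode_flow_def by blast+
    \<comment> \<open>The path is bounded because \<open>ode_flow\<close> includes integrability of
      its velocity. The bound may depend on x, as convergence is needed only pointwise.\<close>
    define M where "M = (\<Sum>i<d. \<bar>x i\<bar> + (LINT q:{0..S}|lborel. \<bar>Y q x i + s q (Y q x) i\<bar>))"
    have M: "l1 d (Y r x) \<le> M" if r: "r \<in> {0..S}" for r
      unfolding l1_def M_def
    proof (rule sum_mono)
      fix i assume "i \<in> {..<d}"
      then have i: "i < d" by simp
      have sub: "set_integrable lborel {0..r} (\<lambda>r. Y r x i + s r (Y r x) i)"
        using r by (intro set_integrable_subset[OF Yx(3)[OF i]]) auto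
      have "\<bar>LINT q:{0..r}|lborel. Y q x i + s q (Y q x) i\<bar> \<le> (LINT q:{0..r}|lborel. \<bar>Y q x i + s q (Y q x) i\<bar>)"
        using set_integral_norm_bound[OF sub] by simp
      also have "\<dots> \<le> (LINT q:{0..S}|lborel. \<bar>Y q x i + s q (Y q x) i\<bar>)"
        using set_integrable_abs[OF sub] set_integrable_abs[OF Yx(3)[OF i]] r
        unfolding set_lebesgue_integral_def set_integrable_def
        by (intro integral_mono) (auto simp: indicator_def)
      finally show "\<bar>Y r x i\<bar> \<le> \<bar>x i\<bar> + (LINT q:{0..S}|lborel. \<bar>Y q x i + s q (Y q x) i\<bar>)"
        using Yx(4)[OF r i] by linarith
    qed
    have M0: "0 \<le> M" using M[of 0] l1_nonneg[of d "Y 0 x"] S by (auto simp del: l1_nonneg intro: order_trans)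
    define c where "c = (d * A)\<^sup>2 * (1 + M) * exp (d * A)"
    define N where "N n = l1_dist d (euler_iter (t n) n x) (Y S x)" for n
    have N: "N n \<le> c / n" if n: "0 < n" for n
    proof -
      have "N n \<le> n * ((d * (A / n))\<^sup>2 * (1 + M)) * (1 + d * (A / n)) ^ n"
        unfolding N_def using t(2)[OF n] euler_iter_error[where Y = "\<lambda>r. Y r x" and \<epsilon> = "A / real n" and k = n, OF x Yx M t(1)[OF n] t(3)[OF n] t(4)[OF n]]
          t(5)[OF n] A by simp
      also have "\<dots> \<le> n * ((d * (A / n))\<^sup>2 * (1 + M)) * exp (d * A)"
        using powle[OF n] M0 by (intro mult_left_mono) auto
      also have "\<dots> = c / n" using n by (simp add: c_def field_simps power2_eq_square)
      finally show ?thesis .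
    qed
    have N0: "(\<lambda>n. N (Suc n)) \<longlonglongrightarrow> 0"
    proof (rule Lim_null_comparison[OF always_eventually])
      show "\<forall>n. norm (N (Suc n)) \<le> c * inverse (real (Suc n))"
      proof
        fix n
        have "0 \<le> N (Suc n)" unfolding N_def by (rule l1_dist_nonneg)
        then show "norm (N (Suc n)) \<le> c * inverse (real (Suc n))"
          using N[of "Suc n"] by (simp add: divide_inverse)
      qed
      show "(\<lambda>n. c * inverse (real (Suc n))) \<longlonglongrightarrow> 0"
        by (rule tendsto_mult_right_zero[OF LIMSEQ_inverse_real_of_nat])
    qed
    have "(\<lambda>n. \<Lambda> * N (Suc n) + H * (N (Suc n))\<^sup>2) \<longlonglongrightarrow> \<Lambda> * 0 + H * 0\<^sup>2"
      by (intro tendsto_intros N0)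
    then have lim: "(\<lambda>n. \<Lambda> * N (Suc n) + H * (N (Suc n))\<^sup>2) \<longlonglongrightarrow> 0" by simp
    have YSx: "Y S x \<in> Rd d" using Yx(2)[of S] S by auto
    have "\<forall>n. norm (\<phi> (euler_iter (t (Suc n)) (Suc n) x) - \<phi> (Y S x)) \<le> \<Lambda> * N (Suc n) + H * (N (Suc n))\<^sup>2"
    proof
      fix n
      let ?e = "euler_iter (t (Suc n)) (Suc n) x"
      have e: "?e \<in> Rd d" by (rule euler_iter_Rd[OF x])
      have "\<bar>\<phi> (Y S x) - \<phi> ?e\<bar> \<le> \<Lambda> * l1_dist d ?e (Y S x) + H * (l1_dist d ?e (Y S x))\<^sup>2"
        using quad_approxD(2)[OF Q e YSx] sum_mult_abs_le[of d "p ?e" \<Lambda> "Y S x" ?e, OF quad_approxD(1)[OF Q e]]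
        by linarith
      then show "norm (\<phi> ?e - \<phi> (Y S x)) \<le> \<Lambda> * N (Suc n) + H * (N (Suc n))\<^sup>2"
        by (simp add: N_def abs_minus_commute)
    qed
    then show ?thesis
      by (rule LIM_zero_cancel[OF Lim_null_comparison[OF always_eventually lim]])
  qed
  have \<phi>c: "continuous_on (Rd d) \<phi>" by (rule quad_approx_continuous(1)[OF Q])
  have "(\<lambda>n. \<integral>v. \<phi> (?E (Suc n) v) \<partial>P) \<longlonglongrightarrow> (\<integral>v. \<phi> (Y S (X 0 (fst v) (snd v))) \<partial>P)"
  proof (rule integral_dominated_convergence[where w = "\<lambda>_. 1"])
    show "(\<lambda>v. \<phi> (Y S (X 0 (fst v) (snd v)))) \<in> borel_measurable P"
      by (rule measurable_compose[OF measurable_compose[OF X_measurable YS] borel_measurable_continuous_Rd[OF \<phi>c]])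
    show "(\<lambda>v. \<phi> (?E (Suc n) v)) \<in> borel_measurable P" for n
      using tele[of "Suc n"]
      by (intro measurable_compose[OF X_measurable[of 0] borel_measurable_continuous_Rd, of "\<lambda>x. \<phi> (euler_iter (t (Suc n)) (Suc n) x)"]) simp
    show "AE v in P. (\<lambda>n. \<phi> (?E (Suc n) v)) \<longlonglongrightarrow> \<phi> (Y S (X 0 (fst v) (snd v)))"
      using conv by simp
    show "AE v in P. norm (\<phi> (?E (Suc n) v)) \<le> 1" for n
      using \<phi> euler_iter_Rd by (intro AE_I2) simp
  qed (simp add: mg.P.integrable_const)
  then have lim1: "(\<lambda>n. ennreal \<bar>(\<integral>v. \<phi> (X S (fst v) (snd v)) \<partial>P) - (\<integral>v. \<phi> (?E (Suc n) v) \<partial>P)\<bar>)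
    \<longlonglongrightarrow> ennreal \<bar>(\<integral>v. \<phi> (X S (fst v) (snd v)) \<partial>P) - (\<integral>v. \<phi> (Y S (X 0 (fst v) (snd v))) \<partial>P)\<bar>"
    by (intro tendsto_ennrealI tendsto_intros)
  have "(\<lambda>n. ennreal (C / Suc n)) \<longlonglongrightarrow> ennreal 0"
    using tendsto_mult_right_zero[OF LIMSEQ_inverse_real_of_nat, of C]
    by (intro tendsto_ennrealI) (simp add: divide_inverse)
  then have lim2: "(\<lambda>n. (\<integral>\<^sup>+r\<in>{0<..S}. gap_bound h \<alpha> r \<partial>lborel) + ennreal (C / Suc n))
      \<longlonglongrightarrow> (\<integral>\<^sup>+r\<in>{0<..S}. gap_bound h \<alpha> r \<partial>lborel) + ennreal 0"
    by (intro tendsto_add tendsto_const)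
  have le: "\<forall>n\<ge>0. ennreal \<bar>(\<integral>v. \<phi> (X S (fst v) (snd v)) \<partial>P) - (\<integral>v. \<phi> (?E (Suc n) v) \<partial>P)\<bar>
      \<le> (\<integral>\<^sup>+r\<in>{0<..S}. gap_bound h \<alpha> r \<partial>lborel) + ennreal (C / Suc n)"
    using tele[of "Suc _"] by blast
  show ?thesis
    by (rule LIMSEQ_le[OF lim1 lim2, unfolded ennreal_0 add_0_right], rule exI, rule le)
qed

end

section \<open>Duality for the total variation\<close>

text \<open>Values in [0, 1] let these functions imitate indicators: complements correspond to 1 -
  \<phi> and intersections to products, and both remain in the class.\<close>

definition test_fun :: "nat \<Rightarrow> ((nat \<Rightarrow> real) \<Rightarrow> real) \<Rightarrow> bool" where
  "test_fun d \<phi> \<longleftrightarrow> (\<exists>p \<Lambda> H. quad_approx d \<phi> p \<Lambda> H) \<and> (\<forall>x\<in>Rd d. 0 \<le> \<phi> x \<and> \<phi> x \<le> 1)"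

lemma test_fun_measurable:
  assumes "test_fun d \<phi>" shows "\<phi> \<in> borel_measurable (leb d)"
proof -
  obtain p and \<Lambda> H :: real where "quad_approx d \<phi> p \<Lambda> H" using assms unfolding test_fun_def by auto
  then show ?thesis by (intro borel_measurable_continuous_Rd quad_approx_continuous(1))
qed

lemma quad_approx_affine:
  assumes "quad_approx d u p \<Lambda> H"
  shows "quad_approx d (\<lambda>x. a + c * u x) (\<lambda>x i. c * p x i) (\<bar>c\<bar> * \<Lambda>) (\<bar>c\<bar> * H)"
  unfolding quad_approx_def
proof (intro ballI conjI allI impI)
  fix x i assume "x \<in> Rd d" "i < d"
  then show "\<bar>c * p x i\<bar> \<le> \<bar>c\<bar> * \<Lambda>"
    using quad_approxD(1)[OF assms] by (simp add: abs_mult mult_left_mono)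
next
  fix x y assume xy: "x \<in> Rd d" "y \<in> Rd d"
  have "(a + c * u y) - (a + c * u x) - (\<Sum>i<d. c * p x i * (y i - x i))
    = c * (u y - u x - (\<Sum>i<d. p x i * (y i - x i)))"
    by (simp add: right_diff_distrib sum_distrib_left mult.assoc)
  then show "\<bar>(a + c * u y) - (a + c * u x) - (\<Sum>i<d. c * p x i * (y i - x i))\<bar> \<le> \<bar>c\<bar> * H * (l1_dist d x y)\<^sup>2"
    using mult_left_mono[OF quad_approxD(2)[OF assms xy], of "\<bar>c\<bar>"] by (simp add: abs_mult mult.assoc)
qed

lemma test_fun_compl: "test_fun d \<phi> \<Longrightarrow> test_fun d (\<lambda>x. 1 - \<phi> x)"
  unfolding test_fun_def using quad_approx_affine[of d \<phi> _ _ _ 1 "-1"] by fastforce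

text \<open>Apart from the two remainders, the error of the product rule is (f y - f x) * (g y - g
  x). At distance N \<le> 1 it is quadratic since both factors are Lipschitz there; at larger
  distance it is at most 1, hence at most N^2.\<close>

lemma test_fun_mult:
  assumes f: "test_fun d f" and g: "test_fun d g"
  shows "test_fun d (\<lambda>x. f x * g x)"
proof -
  obtain p \<Lambda> H where p: "quad_approx d f p \<Lambda> H" using f unfolding test_fun_def by auto
  obtain q \<Lambda>' H' where q: "quad_approx d g q \<Lambda>' H'" using g unfolding test_fun_def by auto
  have bd: "0 \<le> f x" "f x \<le> 1" "0 \<le> g x" "g x \<le> 1" if "x \<in> Rd d" for x
    using f g that unfolding test_fun_def by auto
  have p': "quad_approx d f p \<bar>\<Lambda>\<bar> \<bar>H\<bar>" and q': "quad_approx d g q \<bar>\<Lambda>'\<bar> \<bar>H'\<bar>"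
    by (rule quad_approx_mono[OF p], simp, simp, rule quad_approx_mono[OF q], simp, simp)
  have mod: "\<bar>u y - u x\<bar> \<le> (\<bar>\<Lambda>\<bar> + \<bar>H\<bar>) * l1_dist d x y"
    if Q: "quad_approx d u p \<bar>\<Lambda>\<bar> \<bar>H\<bar>" and xy: "x \<in> Rd d" "y \<in> Rd d" and N: "l1_dist d x y \<le> 1" for u p \<Lambda> H x y
  proof -
    have "\<bar>u y - u x\<bar> \<le> \<bar>\<Lambda>\<bar> * l1_dist d x y + \<bar>H\<bar> * (l1_dist d x y)\<^sup>2"
      using quad_approxD(2)[OF Q xy] sum_mult_abs_le[of d "p x" "\<bar>\<Lambda>\<bar>" y x, OF quad_approxD(1)[OF Q xy(1)]] by linarith
    moreover have "(l1_dist d x y)\<^sup>2 \<le> l1_dist d x y"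
      using mult_left_mono[OF N, of "l1_dist d x y"] by (simp add: power2_eq_square)
    ultimately show ?thesis using mult_left_mono[of "(l1_dist d x y)\<^sup>2" "l1_dist d x y" "\<bar>H\<bar>"] by (simp add: distrib_right)
  qed
  define K where "K = 1 + (\<bar>\<Lambda>\<bar> + \<bar>H\<bar>) * (\<bar>\<Lambda>'\<bar> + \<bar>H'\<bar>)"
  have "quad_approx d (\<lambda>x. f x * g x) (\<lambda>x i. g x * p x i + f x * q x i) (\<bar>\<Lambda>\<bar> + \<bar>\<Lambda>'\<bar>) (\<bar>H\<bar> + \<bar>H'\<bar> + K)"
    unfolding quad_approx_def
  proof (intro ballI conjI allI impI)
    fix x i assume x: "x \<in> Rd d" and i: "i < d"
    have "\<bar>g x * p x i\<bar> \<le> 1 * \<bar>\<Lambda>\<bar>" "\<bar>f x * q x i\<bar> \<le> 1 * \<bar>\<Lambda>'\<bar>"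
      unfolding abs_mult using bd[OF x] quad_approxD(1)[OF p' x i] quad_approxD(1)[OF q' x i]
      by (intro mult_mono; simp)+
    then show "\<bar>g x * p x i + f x * q x i\<bar> \<le> \<bar>\<Lambda>\<bar> + \<bar>\<Lambda>'\<bar>" by linarith
  next
    fix x y assume x: "x \<in> Rd d" and y: "y \<in> Rd d"
    define N where "N = l1_dist d x y"
    have N0: "0 \<le> N" by (simp add: N_def)
    define rf rg where "rf = f y - f x - (\<Sum>i<d. p x i * (y i - x i))" and "rg = g y - g x - (\<Sum>i<d. q x i * (y i - x i))"
    have r: "\<bar>rf\<bar> \<le> \<bar>H\<bar> * N\<^sup>2" "\<bar>rg\<bar> \<le> \<bar>H'\<bar> * N\<^sup>2"
      using quad_approxD(2)[OF p' x y] quad_approxD(2)[OF q' x y] by (auto simp: rf_def rg_def N_def)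
    have prod: "\<bar>(f y - f x) * (g y - g x)\<bar> \<le> K * N\<^sup>2"
    proof (cases "N \<le> 1")
      case True
      have "\<bar>(f y - f x) * (g y - g x)\<bar> \<le> ((\<bar>\<Lambda>\<bar> + \<bar>H\<bar>) * N) * ((\<bar>\<Lambda>'\<bar> + \<bar>H'\<bar>) * N)"
        unfolding abs_mult using mod[OF p' x y] mod[OF q' x y] True N0 by (intro mult_mono) (auto simp: N_def)
      also have "\<dots> \<le> K * N\<^sup>2" by (simp add: K_def power2_eq_square algebra_simps)
      finally show ?thesis .
    next
      case False
      have "\<bar>(f y - f x) * (g y - g x)\<bar> \<le> 1 * 1"
        unfolding abs_mult using bd[OF x] bd[OF y] by (intro mult_mono) (auto simp: abs_le_iff)
      also have "\<dots> \<le> 1 * N\<^sup>2" using False by (simp add: one_le_power)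
      also have "\<dots> \<le> K * N\<^sup>2" by (intro mult_right_mono) (auto simp: K_def)
      finally show ?thesis by simp
    qed
    have fg: "\<bar>g x * rf\<bar> \<le> 1 * (\<bar>H\<bar> * N\<^sup>2)" "\<bar>f x * rg\<bar> \<le> 1 * (\<bar>H'\<bar> * N\<^sup>2)"
      unfolding abs_mult using bd[OF x] r by (intro mult_mono; simp)+
    have "f y * g y - f x * g x - (\<Sum>i<d. (g x * p x i + f x * q x i) * (y i - x i))
      = g x * rf + f x * rg + (f y - f x) * (g y - g x)"
      unfolding rf_def rg_def by (simp add: algebra_simps sum.distrib sum_distrib_left sum_subtractf)
    then show "\<bar>f y * g y - f x * g x - (\<Sum>i<d. (g x * p x i + f x * q x i) * (y i - x i))\<bar>
        \<le> (\<bar>H\<bar> + \<bar>H'\<bar> + K) * (l1_dist d x y)\<^sup>2"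
      using fg prod unfolding N_def[symmetric] distrib_right by linarith
  qed
  moreover have "0 \<le> f x * g x \<and> f x * g x \<le> 1" if "x \<in> Rd d" for x
    using bd[OF that] by (simp add: mult_le_one)
  ultimately show ?thesis unfolding test_fun_def by blast
qed

text \<open>Smooth steps in one coordinate. The derivatives of tanh are polynomials in tanh, so the
  first and second derivatives are bounded explicitly in terms of c.\<close>

lemma test_fun_coordinate:
  assumes i: "i < d"
  shows "test_fun d (\<lambda>x. (1 + tanh (c * x i + b)) / 2)"
proof -
  define u where "u z = (1 + tanh (c * z + b)) / 2" for z :: real
  define u' where "u' z = c * (1 - (tanh (c * z + b))\<^sup>2) / 2" for z :: real
  have T: "\<bar>tanh z\<bar> \<le> 1" for z :: real using tanh_real_bounds[of z] by auto
  have T2: "0 \<le> 1 - (tanh z)\<^sup>2" "1 - (tanh z)\<^sup>2 \<le> 1" for z :: real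
    using T[of z] by (auto simp: abs_square_le_1)
  have D: "(u has_real_derivative u' z) (at z)" for z
    unfolding u_def [abs_def] u'_def by (auto intro!: derivative_eq_intros)
  have D2: "(u' has_real_derivative - (c\<^sup>2 * tanh (c * z + b) * (1 - (tanh (c * z + b))\<^sup>2))) (at z)" for z
    unfolding u'_def [abs_def] by (auto intro!: derivative_eq_intros simp: power2_eq_square field_simps)
  have u'_bd: "\<bar>u' z\<bar> \<le> \<bar>c\<bar>" for z
  proof -
    have "\<bar>u' z\<bar> = \<bar>c\<bar> * (1 - (tanh (c * z + b))\<^sup>2) / 2"
      unfolding u'_def using T2(1)[of "c * z + b"] by (simp add: abs_mult)
    also have "\<dots> \<le> \<bar>c\<bar> * 1 / 2" using T2 by (intro divide_right_mono mult_left_mono) auto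
    finally show ?thesis by simp
  qed
  have "\<bar>u' x - u' y\<bar> \<le> c\<^sup>2 * \<bar>x - y\<bar>" for x y
  proof (rule Lipschitz_of_bounded_derivative[OF D2])
    fix z
    have "\<bar>tanh (c * z + b)\<bar> * (1 - (tanh (c * z + b))\<^sup>2) \<le> 1 * 1"
      using T T2 by (intro mult_mono) auto
    then have "c\<^sup>2 * (\<bar>tanh (c * z + b)\<bar> * (1 - (tanh (c * z + b))\<^sup>2)) \<le> c\<^sup>2 * 1"
      by (intro mult_left_mono) auto
    then show "\<bar>- (c\<^sup>2 * tanh (c * z + b) * (1 - (tanh (c * z + b))\<^sup>2))\<bar> \<le> c\<^sup>2"
      using T2(1)[of "c * z + b"] by (simp add: abs_mult mult.assoc)
  qed
  then have E: "\<bar>u (z + t) - u z - t * u' z\<bar> \<le> c\<^sup>2 * t\<^sup>2" for z t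
    by (rule quadratic_error_of_Lipschitz_derivative[OF D])
  have "quad_approx d (\<lambda>x. u (x i)) (\<lambda>x j. if j = i then u' (x i) else 0) \<bar>c\<bar> (c\<^sup>2)"
    unfolding quad_approx_def
  proof (intro ballI conjI allI impI)
    fix x y assume "x \<in> Rd d" "y \<in> Rd d"
    have "(\<Sum>j<d. (if j = i then u' (x i) else 0) * (y j - x j)) = (y i - x i) * u' (x i)"
      using i by (subst sum.remove[of _ i]) (auto intro!: sum.neutral)
    moreover have "c\<^sup>2 * (y i - x i)\<^sup>2 \<le> c\<^sup>2 * (l1_dist d x y)\<^sup>2"
      using abs_le_l1_dist[OF i, of y x] by (intro mult_left_mono) (auto simp: abs_le_square_iff[symmetric])
    ultimately show "\<bar>u (y i) - u (x i) - (\<Sum>j<d. (if j = i then u' (x i) else 0) * (y j - x j))\<bar> \<le> c\<^sup>2 * (l1_dist d x y)\<^sup>2"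
      using E[of "x i" "y i - x i"] by simp
  qed (use u'_bd in auto)
  moreover have "0 \<le> u z \<and> u z \<le> 1" for z using T[of "c * z + b"] by (auto simp: u_def abs_le_iff)
  ultimately show ?thesis unfolding test_fun_def u_def by blast
qed

text \<open>Approximation of the indicator in L^1 of m. The sets with this property form a
  sigma-algebra if m is finite, which reduces density of test functions to half-spaces.\<close>

definition approximable :: "nat \<Rightarrow> (nat \<Rightarrow> real) measure \<Rightarrow> (nat \<Rightarrow> real) set \<Rightarrow> bool" where
  "approximable d m A \<longleftrightarrow> A \<in> sets m \<and>
    (\<forall>\<epsilon>>0. \<exists>\<phi>. test_fun d \<phi> \<and> (\<integral>x. \<bar>\<phi> x - indicator A x\<bar> \<partial>m) < \<epsilon>)"

context
  fixes d :: nat and m :: "(nat \<Rightarrow> real) measure"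
  assumes fin: "finite_measure m" and sets_m [measurable_cong]: "sets m = sets (leb d)"
begin

interpretation finite_measure m by (rule fin)

lemma space_m: "space m = Rd d"
  using sets_eq_imp_space_eq[OF sets_m] by simp

lemma integrable_test:
  assumes "test_fun d \<phi>" "A \<in> sets m"
  shows "integrable m (\<lambda>x. \<bar>\<phi> x - indicator A x\<bar>)"
proof (rule integrable_const_bound[where B = 1])
  have [measurable]: "\<phi> \<in> borel_measurable m"
    using test_fun_measurable[OF assms(1)] by (simp cong: measurable_cong_sets add: sets_m)
  show "(\<lambda>x. \<bar>\<phi> x - indicator A x\<bar>) \<in> borel_measurable m" using assms(2) by measurable
  show "AE x in m. norm \<bar>\<phi> x - indicator A x\<bar> \<le> 1"
    using assms(1) by (intro AE_I2) (auto simp: test_fun_def space_m indicator_def abs_le_iff)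
qed

lemma approximable_compl:
  assumes "approximable d m A" shows "approximable d m (space m - A)"
  unfolding approximable_def
proof (intro conjI allI impI)
  show "space m - A \<in> sets m" using assms by (auto simp: approximable_def)
  fix \<epsilon> :: real assume "0 < \<epsilon>"
  then obtain \<phi> where p: "test_fun d \<phi>" "(\<integral>x. \<bar>\<phi> x - indicator A x\<bar> \<partial>m) < \<epsilon>"
    using assms unfolding approximable_def by auto
  have "(\<integral>x. \<bar>(1 - \<phi> x) - indicator (space m - A) x\<bar> \<partial>m) = (\<integral>x. \<bar>\<phi> x - indicator A x\<bar> \<partial>m)"
    by (intro Bochner_Integration.integral_cong) (auto simp: indicator_def)
  then show "\<exists>\<phi>. test_fun d \<phi> \<and> (\<integral>x. \<bar>\<phi> x - indicator (space m - A) x\<bar> \<partial>m) < \<epsilon>"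
    using p test_fun_compl by (intro exI[of _ "\<lambda>x. 1 - \<phi> x"]) auto
qed

lemma approximable_Int:
  assumes A: "approximable d m A" and B: "approximable d m B" shows "approximable d m (A \<inter> B)"
  unfolding approximable_def
proof (intro conjI allI impI)
  have s: "A \<in> sets m" "B \<in> sets m" using A B by (auto simp: approximable_def)
  then show AB: "A \<inter> B \<in> sets m" by auto
  fix \<epsilon> :: real assume "0 < \<epsilon>"
  then have e: "0 < \<epsilon> / 2" by simp
  obtain f where f: "test_fun d f" "(\<integral>x. \<bar>f x - indicator A x\<bar> \<partial>m) < \<epsilon> / 2"
    using A e unfolding approximable_def by blast
  obtain g where g: "test_fun d g" "(\<integral>x. \<bar>g x - indicator B x\<bar> \<partial>m) < \<epsilon> / 2"
    using B e unfolding approximable_def by blast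
  have fg: "test_fun d (\<lambda>x. f x * g x)" by (rule test_fun_mult[OF f(1) g(1)])
  have "(\<integral>x. \<bar>f x * g x - indicator (A \<inter> B) x\<bar> \<partial>m)
    \<le> (\<integral>x. \<bar>f x - indicator A x\<bar> + \<bar>g x - indicator B x\<bar> \<partial>m)"
  proof (rule integral_mono)
    fix x assume "x \<in> space m"
    then have bd: "0 \<le> f x" "f x \<le> 1" "0 \<le> g x" "g x \<le> 1"
      using f(1) g(1) unfolding test_fun_def space_m by auto
    have eq: "f x * g x - indicator (A \<inter> B) x = f x * (g x - indicator B x) + indicator B x * (f x - indicator A x)"
      by (simp add: indicator_def algebra_simps)
    have 1: "\<bar>f x * (g x - indicator B x)\<bar> \<le> 1 * \<bar>g x - indicator B x\<bar>"
      unfolding abs_mult using bd by (intro mult_right_mono) auto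
    have 2: "\<bar>indicator B x * (f x - indicator A x)\<bar> \<le> 1 * \<bar>f x - indicator A x\<bar>"
      unfolding abs_mult by (intro mult_right_mono) (auto simp: indicator_def)
    show "\<bar>f x * g x - indicator (A \<inter> B) x\<bar> \<le> \<bar>f x - indicator A x\<bar> + \<bar>g x - indicator B x\<bar>"
      unfolding eq using order_trans[OF abs_triangle_ineq add_mono[OF 1 2]] by (simp add: add.commute)
  qed (use integrable_test[OF fg AB] integrable_test[OF f(1) s(1)] integrable_test[OF g(1) s(2)] in auto)
  also have "\<dots> < \<epsilon>"
    using f(2) g(2) integrable_test[OF f(1) s(1)] integrable_test[OF g(1) s(2)] by simp
  finally show "\<exists>\<phi>. test_fun d \<phi> \<and> (\<integral>x. \<bar>\<phi> x - indicator (A \<inter> B) x\<bar> \<partial>m) < \<epsilon>"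
    using fg by blast
qed

lemma approximable_empty: "approximable d m {}"
  unfolding approximable_def
proof (intro conjI allI impI)
  have "quad_approx d (\<lambda>x. 0) (\<lambda>x i. 0) 0 0" by (simp add: quad_approx_def)
  then have "test_fun d (\<lambda>x. 0)" unfolding test_fun_def by auto
  then show "\<exists>\<phi>. test_fun d \<phi> \<and> (\<integral>x. \<bar>\<phi> x - indicator {} x\<bar> \<partial>m) < \<epsilon>" if "0 < \<epsilon>" for \<epsilon>
    using that by (intro exI[of _ "\<lambda>x. 0"]) simp
qed auto

lemma approximable_UN:
  assumes A: "\<And>i::nat. approximable d m (A i)" shows "approximable d m (\<Union>i. A i)"
  unfolding approximable_def
proof (intro conjI allI impI)
  have s: "A i \<in> sets m" for i using A by (auto simp: approximable_def)
  then show U: "(\<Union>i. A i) \<in> sets m" by auto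
  define B where "B n = (\<Union>i<n. A i)" for n
  have Bs: "B n \<in> sets m" for n using s by (auto simp: B_def)
  have B: "approximable d m (B n)" for n
  proof (induction n)
    case 0 then show ?case by (simp add: B_def approximable_empty)
  next
    case (Suc n)
    have "B (Suc n) = space m - ((space m - B n) \<inter> (space m - A n))"
      using sets.sets_into_space[OF s] sets.sets_into_space[OF Bs[of n]] by (auto simp: B_def less_Suc_eq)
    then show ?case using Suc A by (simp only:) (intro approximable_compl approximable_Int)
  qed
  fix \<epsilon> :: real assume e: "0 < \<epsilon>"
  \<comment> \<open>Continuity of the finite measure from below reduces the countable union to a
    finite one, at a cost of \<epsilon> / 2.\<close>
  have "incseq B" unfolding incseq_def B_def by (intro allI impI UN_mono) auto
  then have "(\<lambda>n. measure m (B n)) \<longlonglongrightarrow> measure m (\<Union>n. B n)"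
    using Bs by (intro finite_Lim_measure_incseq) auto
  also have "(\<Union>n. B n) = (\<Union>i. A i)" by (auto simp: B_def)
  finally obtain n where n: "\<bar>measure m (B n) - measure m (\<Union>i. A i)\<bar> < \<epsilon> / 2"
    using e LIMSEQ_D[of "\<lambda>n. measure m (B n)" _ "\<epsilon> / 2"] by fastforce
  obtain \<phi> where p: "test_fun d \<phi>" "(\<integral>x. \<bar>\<phi> x - indicator (B n) x\<bar> \<partial>m) < \<epsilon> / 2"
    using B[of n] e unfolding approximable_def by (meson half_gt_zero)
  have sub: "B n \<subseteq> (\<Union>i. A i)" by (auto simp: B_def)
  have D: "(\<Union>i. A i) - B n \<in> sets m" using U Bs by auto
  have "(\<integral>x. \<bar>\<phi> x - indicator (\<Union>i. A i) x\<bar> \<partial>m) \<le> (\<integral>x. \<bar>\<phi> x - indicator (B n) x\<bar> + indicator ((\<Union>i. A i) - B n) x \<partial>m)"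
  proof (rule integral_mono)
    show "\<bar>\<phi> x - indicator (\<Union>i. A i) x\<bar> \<le> \<bar>\<phi> x - indicator (B n) x\<bar> + indicator ((\<Union>i. A i) - B n) x" for x
      using sub by (auto simp: indicator_def)
  qed (use integrable_test[OF p(1) U] integrable_test[OF p(1) Bs] D in \<open>auto simp: emeasure_eq_measure\<close>)
  also have "\<dots> = (\<integral>x. \<bar>\<phi> x - indicator (B n) x\<bar> \<partial>m) + measure m ((\<Union>i. A i) - B n)"
    using integrable_test[OF p(1) Bs] D by (subst Bochner_Integration.integral_add) (auto simp: emeasure_eq_measure)
  also have "measure m ((\<Union>i. A i) - B n) = measure m (\<Union>i. A i) - measure m (B n)"
    using U Bs sub by (rule finite_measure_Diff)
  finally have "(\<integral>x. \<bar>\<phi> x - indicator (\<Union>i. A i) x\<bar> \<partial>m) < \<epsilon>" using p(2) n by linarith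
  then show "\<exists>\<phi>. test_fun d \<phi> \<and> (\<integral>x. \<bar>\<phi> x - indicator (\<Union>i. A i) x\<bar> \<partial>m) < \<epsilon>" using p(1) by blast
qed

lemma approximable_halfspace:
  assumes i: "i < d" shows "approximable d m {x \<in> Rd d. x i \<le> a}"
  unfolding approximable_def
proof (intro conjI allI impI)
  let ?A = "{x \<in> Rd d. x i \<le> a}"
  have [measurable]: "(\<lambda>x. x i) \<in> borel_measurable (leb d)" using i by simp
  have "{x \<in> space (leb d). x i \<le> a} \<in> sets (leb d)" by measurable
  then show A: "?A \<in> sets m" by (simp add: sets_m)
  \<comment> \<open>The slope n is combined with a shift by sqrt n, so that the argument tends to
    infinity also on the boundary x i = a. For x i > a the slope wins, and the limit is the
    indicator of the closed half-space at every point.\<close>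
  define \<phi> where "\<phi> n x = (1 + tanh ((- real n) * x i + (real n * a + sqrt n))) / 2" for n and x :: "nat \<Rightarrow> real"
  have t: "test_fun d (\<phi> n)" for n unfolding \<phi>_def by (rule test_fun_coordinate[OF i])
  have "(\<lambda>n. \<integral>x. \<bar>\<phi> n x - indicator ?A x\<bar> \<partial>m) \<longlonglongrightarrow> (\<integral>x. 0 \<partial>m)"
  proof (rule integral_dominated_convergence[where w = "\<lambda>_. 1"])
    show "(\<lambda>x. \<bar>\<phi> n x - indicator ?A x\<bar>) \<in> borel_measurable m" for n
      using integrable_test[OF t A] by auto
    show "AE x in m. norm \<bar>\<phi> n x - indicator ?A x\<bar> \<le> 1" for n
      using t[of n] by (intro AE_I2) (auto simp: test_fun_def space_m indicator_def abs_le_iff)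
    show "AE x in m. (\<lambda>n. \<bar>\<phi> n x - indicator ?A x\<bar>) \<longlonglongrightarrow> 0"
    proof (rule AE_I2)
      fix x assume x: "x \<in> space m"
      have arg: "(- real n) * x i + (real n * a + sqrt n) = sqrt n * (sqrt n * (a - x i) + 1)" for n :: nat
      proof -
        have "real n = sqrt n * sqrt n" by simp
        then show ?thesis by (simp only: algebra_simps) (simp add: algebra_simps)
      qed
      have sq: "filterlim (\<lambda>n. sqrt (real n)) at_top sequentially"
        by (rule filterlim_compose[OF sqrt_at_top filterlim_real_sequentially])
      show "(\<lambda>n. \<bar>\<phi> n x - indicator ?A x\<bar>) \<longlonglongrightarrow> 0"
      proof (cases "x i \<le> a")
        case True
        have "filterlim (\<lambda>n. (- real n) * x i + (real n * a + sqrt n)) at_top sequentially"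
        proof (rule filterlim_at_top_mono[OF sq], rule always_eventually, rule allI)
          fix n :: nat
          have "real n * x i \<le> real n * a" using True by (intro mult_left_mono) auto
          then show "sqrt n \<le> (- real n) * x i + (real n * a + sqrt n)" by simp
        qed
        then have "(\<lambda>n. tanh ((- real n) * x i + (real n * a + sqrt n))) \<longlonglongrightarrow> 1"
          by (rule filterlim_compose[OF tanh_real_at_top])
        then have "(\<lambda>n. \<bar>\<phi> n x - 1\<bar>) \<longlonglongrightarrow> \<bar>(1 + 1) / 2 - 1\<bar>"
          unfolding \<phi>_def by (intro tendsto_intros) auto
        then show ?thesis using True x by (simp add: space_m)
      next
        case False
        have "filterlim (\<lambda>n. sqrt (real n) * (x i - a)) at_top sequentially"
          using False by (intro filterlim_at_top_mult_tendsto_pos[OF tendsto_const _ sq]) simp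
        then have "filterlim (\<lambda>n. - 1 + sqrt (real n) * (x i - a)) at_top sequentially"
          by (rule filterlim_tendsto_add_at_top[OF tendsto_const])
        then have "filterlim (\<lambda>n. sqrt (real n) * (- 1 + sqrt (real n) * (x i - a))) at_top sequentially"
          by (rule filterlim_at_top_mult_at_top[OF sq])
        then have "filterlim (\<lambda>n. - (sqrt (real n) * (- 1 + sqrt (real n) * (x i - a)))) at_bot sequentially"
          by (simp add: filterlim_uminus_at_top)
        then have "filterlim (\<lambda>n. sqrt n * (sqrt n * (a - x i) + 1)) at_bot sequentially"
          by (simp add: algebra_simps)
        then have "(\<lambda>n. tanh ((- real n) * x i + (real n * a + sqrt n))) \<longlonglongrightarrow> - 1"
          unfolding arg by (rule filterlim_compose[OF tanh_real_at_bot])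
        then have "(\<lambda>n. \<bar>\<phi> n x - 0\<bar>) \<longlonglongrightarrow> \<bar>(1 + - 1) / 2 - 0\<bar>"
          unfolding \<phi>_def by (intro tendsto_intros) auto
        then show ?thesis using False by simp
      qed
    qed
  qed auto
  then have L: "(\<lambda>n. \<integral>x. \<bar>\<phi> n x - indicator ?A x\<bar> \<partial>m) \<longlonglongrightarrow> 0" by simp
  fix \<epsilon> :: real assume "0 < \<epsilon>"
  from LIMSEQ_D[OF L this] obtain n where "norm ((\<integral>x. \<bar>\<phi> n x - indicator ?A x\<bar> \<partial>m) - 0) < \<epsilon>" by blast
  then show "\<exists>\<phi>. test_fun d \<phi> \<and> (\<integral>x. \<bar>\<phi> x - indicator ?A x\<bar> \<partial>m) < \<epsilon>"
    using t[of n] by (intro exI[of _ "\<phi> n"]) auto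
qed

text \<open>Two generation steps: half-lines generate the Borel sets of one coordinate, and
  cylinders over these generate the product algebra.\<close>

lemma approximable_sets:
  assumes "A \<in> sets (leb d)" shows "approximable d m A"
proof -
  have cyl: "approximable d m {x \<in> Rd d. x i \<in> B}" if i: "i < d" and B: "B \<in> sets (borel :: real measure)" for i B
  proof -
    have "B \<in> sigma_sets UNIV (range (\<lambda>a::real. {..a}))"
      using B unfolding borel_eq_atMost by simp
    then show ?thesis
    proof (induction rule: sigma_sets.induct)
      case (Basic B)
      then show ?case using approximable_halfspace[OF i] by auto
    next
      case Empty
      then show ?case using approximable_empty by simp
    next
      case (Compl B)
      have "{x \<in> Rd d. x i \<in> UNIV - B} = space m - {x \<in> Rd d. x i \<in> B}" by (auto simp: space_m)
      then show ?case using approximable_compl[OF Compl.IH] by simp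
    next
      case (Union B)
      have "{x \<in> Rd d. x i \<in> (\<Union>k. B k)} = (\<Union>k. {x \<in> Rd d. x i \<in> B k})" by auto
      then show ?case using approximable_UN[OF Union.IH] by simp
    qed
  qed
  have "A \<in> sigma_sets (Rd d) {{f \<in> Rd d. f i \<in> B} | i B. i \<in> {..<d} \<and> B \<in> sets (lborel :: real measure)}"
    using assms sets_PiM_single[of "{..<d}" "\<lambda>_. lborel :: real measure"] by simp
  then show ?thesis
  proof (induction rule: sigma_sets.induct)
    case (Basic A)
    then show ?case using cyl by auto
  next
    case Empty
    then show ?case by (rule approximable_empty)
  next
    case (Compl A)
    then show ?case using approximable_compl[of A] by (simp add: space_m)
  next
    case (Union A)
    then show ?case by (intro approximable_UN)
  qed
qed

end

text \<open>With respect to the finite measure of density |f|, the indicator of {f > 0} is close to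
  some \<phi> with values in [0, 1]. Then 2 \<phi> - 1 is admissible and close to the sign of f; the
  loss at each point is 2 |f| times the distance of \<phi> from the indicator.\<close>

lemma L1_norm_le_of_test_functions:
  fixes f :: "(nat \<Rightarrow> real) \<Rightarrow> real"
  assumes f: "integrable (leb d) f"
    and B: "\<And>\<phi> p \<Lambda> H. quad_approx d \<phi> p \<Lambda> H \<Longrightarrow> (\<And>x. x \<in> Rd d \<Longrightarrow> \<bar>\<phi> x\<bar> \<le> 1) \<Longrightarrow> \<bar>\<integral>x. \<phi> x * f x \<partial>leb d\<bar> \<le> B"
  shows "(\<integral>x. \<bar>f x\<bar> \<partial>leb d) \<le> B"
proof (rule field_le_epsilon)
  fix e :: real assume e: "0 < e"
  have [measurable]: "f \<in> borel_measurable (leb d)" using f by auto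
  define m where "m = density (leb d) (\<lambda>x. ennreal \<bar>f x\<bar>)"
  have fin: "finite_measure m"
  proof
    have "emeasure m (space m) = (\<integral>\<^sup>+x. ennreal \<bar>f x\<bar> \<partial>leb d)"
      unfolding m_def using sets.top[of "leb d"] by (subst emeasure_density) (auto intro!: nn_integral_cong)
    also have "\<dots> < \<infinity>" using f by (simp add: integrable_iff_bounded)
    finally show "emeasure m (space m) \<noteq> \<infinity>" by simp
  qed
  have sets_m: "sets m = sets (leb d)" by (simp add: m_def)
  define A where "A = {x \<in> space (leb d). 0 < f x}"
  have A: "A \<in> sets (leb d)" unfolding A_def by measurable
  obtain \<phi> where \<phi>: "test_fun d \<phi>" "(\<integral>x. \<bar>\<phi> x - indicator A x\<bar> \<partial>m) < e / 2"
    using approximable_sets[OF fin sets_m A] e unfolding approximable_def by (meson half_gt_zero)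
  obtain p \<Lambda> H where Q: "quad_approx d \<phi> p \<Lambda> H" using \<phi>(1) unfolding test_fun_def by auto
  have bd: "0 \<le> \<phi> x" "\<phi> x \<le> 1" if "x \<in> Rd d" for x using \<phi>(1) that unfolding test_fun_def by auto
  have [measurable]: "\<phi> \<in> borel_measurable (leb d)" by (rule test_fun_measurable[OF \<phi>(1)])
  have dist: "(\<integral>x. \<bar>\<phi> x - indicator A x\<bar> \<partial>m) = (\<integral>x. \<bar>f x\<bar> * \<bar>\<phi> x - indicator A x\<bar> \<partial>leb d)"
    unfolding m_def using A by (subst integral_density) auto
  have int1: "integrable (leb d) (\<lambda>x. \<bar>f x\<bar> * \<bar>\<phi> x - indicator A x\<bar>)"
    using f A bd by (intro Bochner_Integration.integrable_bound[OF f])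
      (auto simp: abs_mult indicator_def abs_le_iff intro!: mult_left_le)
  define \<psi> where "\<psi> x = - 1 + 2 * \<phi> x" for x
  have \<psi>bd: "\<bar>\<psi> x\<bar> \<le> 1" if "x \<in> Rd d" for x using bd[OF that] by (auto simp: \<psi>_def)
  have int2: "integrable (leb d) (\<lambda>x. \<psi> x * f x)"
    using f \<psi>bd by (intro Bochner_Integration.integrable_bound[OF f])
      (auto simp: abs_mult \<psi>_def intro!: mult_left_le_one_le)
  have "(\<integral>x. \<bar>f x\<bar> \<partial>leb d) \<le> (\<integral>x. \<psi> x * f x + 2 * (\<bar>f x\<bar> * \<bar>\<phi> x - indicator A x\<bar>) \<partial>leb d)"
  proof (rule integral_mono)
    fix x assume x: "x \<in> space (leb d)"
    show "\<bar>f x\<bar> \<le> \<psi> x * f x + 2 * (\<bar>f x\<bar> * \<bar>\<phi> x - indicator A x\<bar>)"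
    proof (cases "0 < f x")
      case True
      then have eq: "\<bar>\<phi> x - indicator A x\<bar> = 1 - \<phi> x" using x bd[of x] by (simp add: A_def)
      show ?thesis unfolding eq using True by (simp add: \<psi>_def algebra_simps)
    next
      case False
      then have eq: "\<bar>\<phi> x - indicator A x\<bar> = \<phi> x" "\<bar>f x\<bar> = - f x" using x bd[of x] by (auto simp: A_def)
      show ?thesis unfolding eq by (simp add: \<psi>_def algebra_simps)
    qed
  qed (use f int1 int2 in auto)
  also have "\<dots> = (\<integral>x. \<psi> x * f x \<partial>leb d) + 2 * (\<integral>x. \<bar>\<phi> x - indicator A x\<bar> \<partial>m)"
    unfolding dist using int1 int2 by simp
  also have "\<dots> \<le> B + e"
    using B[of \<psi>, OF quad_approx_affine[OF Q, of "- 1" 2, folded \<psi>_def] \<psi>bd] \<phi>(2) by simp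
  finally show "(\<integral>x. \<bar>f x\<bar> \<partial>leb d) \<le> B + e" .
qed

section \<open>Distance of the forward density to the Gaussian\<close>

lemma std_gaussian_eq_density:
  "std_gaussian d = density (leb d) (\<lambda>x. ennreal (gauss_kernel d 1 (\<lambda>_. 0) x))"
  by (simp add: std_gaussian_def density_gauss_kernel)

lemma std_gaussian_component_moments:
  assumes i: "i < d"
  shows "integrable (std_gaussian d) (\<lambda>w. w i)" "(\<integral>w. w i \<partial>std_gaussian d) = 0"
    "(\<integral>w. (w i)\<^sup>2 \<partial>std_gaussian d) = 1"
proof -
  let ?N = "density lborel (\<lambda>u. ennreal (std_normal_density u))"
  have d: "distr (std_gaussian d) ?N (\<lambda>w. w i) = ?N"
    unfolding std_gaussian_def using i
    by (intro distr_PiM_component prob_space_normal_density) auto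
  have m: "(\<lambda>w. w i) \<in> measurable (std_gaussian d) ?N"
    unfolding std_gaussian_def using i by (intro measurable_component_singleton) simp
  have "has_bochner_integral lborel (\<lambda>u. std_normal_density u * u) 0"
    using std_normal_moment_odd[of 0] by simp
  then have 1: "integrable ?N (\<lambda>u. u)" "(\<integral>u. u \<partial>?N) = 0"
    by (auto simp: has_bochner_integral_iff integrable_density integral_density)
  show "integrable (std_gaussian d) (\<lambda>w. w i)" by (rule integrable_std_gaussian_component[OF i 1(1)])
  have e: "(\<integral>w. f (w i) \<partial>std_gaussian d) = (\<integral>u. f u \<partial>?N)" if "f \<in> borel_measurable borel" for f :: "real \<Rightarrow> real"
  proof -
    have "(\<integral>u. f u \<partial>?N) = (\<integral>u. f u \<partial>distr (std_gaussian d) ?N (\<lambda>w. w i))" by (simp only: d)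
    also have "\<dots> = (\<integral>w. f (w i) \<partial>std_gaussian d)" using that by (intro integral_distr[OF m]) simp
    finally show ?thesis by (rule sym)
  qed
  show "(\<integral>w. w i \<partial>std_gaussian d) = 0" by (rule e[of "\<lambda>u. u", unfolded 1(2)]) simp
  have "has_bochner_integral lborel (\<lambda>u. std_normal_density u * u\<^sup>2) 1"
    using std_normal_moment_even[of 1] by simp
  then have "(\<integral>u. u\<^sup>2 \<partial>?N) = 1"
    by (auto simp: has_bochner_integral_iff integral_density)
  then show "(\<integral>w. (w i)\<^sup>2 \<partial>std_gaussian d) = 1" by (subst e[of "\<lambda>u. u\<^sup>2"]) simp_all
qed

text \<open>From \<open>(sqrt f - sqrt g)\<^sup>2 \<le> g - f + f ln (f / g)\<close> and AM-GM; integrated over two probability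
  densities and optimised over \<open>c\<close>, this is Pinsker's inequality up to a constant.\<close>

lemma abs_diff_le_entropy:
  fixes f g c :: real
  assumes f: "0 < f" and g: "0 < g" and c: "0 < c"
  shows "\<bar>f - g\<bar> \<le> c * (f + g) + 1 / (2 * c) * (g - f + f * ln (f / g))"
proof -
  define a b where "a = sqrt f" and "b = sqrt g"
  have ab: "0 < a" "0 < b" "f = a\<^sup>2" "g = b\<^sup>2" using f g by (auto simp: a_def b_def)
  have "ln (b / a) \<le> b / a - 1" using ab by (intro ln_le_minus_one) simp
  then have "- ln (f / g) \<le> 2 * (b / a - 1)"
    using ab by (simp add: ln_div ln_realpow)
  then have "f * (- ln (f / g)) \<le> f * (2 * (b / a - 1))" using f by (intro mult_left_mono) auto
  also have "f * (2 * (b / a - 1)) = 2 * a * b - 2 * f"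
    using ab by (simp add: power2_eq_square field_simps)
  finally have "(a - b)\<^sup>2 \<le> g - f + f * ln (f / g)"
    using ab by (simp add: power2_eq_square algebra_simps)
  then have E: "1 / (2 * c) * (a - b)\<^sup>2 \<le> 1 / (2 * c) * (g - f + f * ln (f / g))"
    using c by (intro mult_left_mono) auto
  have "\<bar>f - g\<bar> = \<bar>a - b\<bar> * (a + b)"
    using ab by (simp add: power2_eq_square square_diff_square_factored abs_mult)
  also have "\<dots> \<le> 1 / (2 * c) * (a - b)\<^sup>2 + c / 2 * (a + b)\<^sup>2"
  proof -
    have "0 \<le> (\<bar>a - b\<bar> - c * (a + b))\<^sup>2 / (2 * c)" using c by simp
    also have "\<dots> = 1 / (2 * c) * (a - b)\<^sup>2 + c / 2 * (a + b)\<^sup>2 - \<bar>a - b\<bar> * (a + b)"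
      using c by (simp add: power2_diff power_mult_distrib field_simps power2_eq_square)
    finally show ?thesis by simp
  qed
  also have "c / 2 * (a + b)\<^sup>2 \<le> c / 2 * (2 * (f + g))"
    using c ab zero_le_power2[of "a - b"] by (intro mult_left_mono) (auto simp: power2_eq_square algebra_simps)
  also have "c / 2 * (2 * (f + g)) = c * (f + g)" by simp
  finally have "\<bar>f - g\<bar> \<le> 1 / (2 * c) * (a - b)\<^sup>2 + c * (f + g)" by simp
  then show ?thesis using E by linarith
qed

lemma ln_gauss_kernel_ratio:
  assumes "0 < \<sigma>"
  shows "ln (gauss_kernel d \<sigma> c x / gauss_kernel d 1 (\<lambda>_. 0) x)
    = (\<Sum>i<d. - ln \<sigma> - (x i - c i)\<^sup>2 / (2 * \<sigma>\<^sup>2) + (x i)\<^sup>2 / 2)"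
proof -
  have one: "ln (normal_density (c i) \<sigma> (x i) / normal_density 0 1 (x i))
      = - ln \<sigma> - (x i - c i)\<^sup>2 / (2 * \<sigma>\<^sup>2) + (x i)\<^sup>2 / 2" for i
  proof -
    have "normal_density (c i) \<sigma> (x i) / normal_density 0 1 (x i)
      = exp (- (x i - c i)\<^sup>2 / (2 * \<sigma>\<^sup>2)) / (\<sigma> * exp (- (x i)\<^sup>2 / 2))"
      using assms by (simp add: normal_density_def real_sqrt_mult)
    also have "ln \<dots> = - (x i - c i)\<^sup>2 / (2 * \<sigma>\<^sup>2) - (ln \<sigma> + - (x i)\<^sup>2 / 2)"
      using assms by (simp add: ln_div ln_mult)
    finally show ?thesis by simp
  qed
  have "gauss_kernel d \<sigma> c x / gauss_kernel d 1 (\<lambda>_. 0) x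
    = (\<Prod>i<d. normal_density (c i) \<sigma> (x i) / normal_density 0 1 (x i))"
    by (simp add: gauss_kernel_def prod_dividef)
  also have "ln \<dots> = (\<Sum>i<d. ln (normal_density (c i) \<sigma> (x i) / normal_density 0 1 (x i)))"
    using assms by (intro ln_prod) (auto simp: less_imp_neq[OF normal_density_pos, symmetric])
  finally show ?thesis by (simp add: one)
qed

context bounded_data
begin

text \<open>The relative entropy of the kernel with respect to the Gaussian is the sum over i of -
  ln \<sigma> + (c i)^2 / 2 + (\<sigma>^2 - 1) / 2. For t \<ge> 1 the quantity x = exp (- 2 t) is at
  most 1/2, whence - ln (1 - x) \<le> 2 x and the entropy is at most \<kappa>^2. The entropy
  inequality with parameter \<kappa> / 2 then gives \<kappa> + \<kappa>.\<close>

lemma kernel_TV: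
  assumes t: "1 \<le> t" and y: "\<And>i. i < d \<Longrightarrow> \<bar>y i\<bar> \<le> D" and D1: "1 \<le> D" and d: "1 \<le> d"
  shows "(\<integral>\<^sup>+x. ennreal \<bar>ou_kernel d t y x - gauss_kernel d 1 (\<lambda>_. 0) x\<bar> \<partial>leb d) \<le> ennreal (2 * (sqrt d * exp (- t) * D))"
proof -
  define \<sigma> where "\<sigma> = sig t"
  define c where "c i = exp (- t) * y i" for i
  define f g where "f = gauss_kernel d \<sigma> c" and "g = gauss_kernel d 1 (\<lambda>_. 0)"
  define R where "R x = (\<Sum>i<d. - ln \<sigma> - (x i - c i)\<^sup>2 / (2 * \<sigma>\<^sup>2) + (x i)\<^sup>2 / 2)" for x :: "nat \<Rightarrow> real"
  define \<kappa> where "\<kappa> = sqrt d * exp (- t) * D"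
  have \<kappa>: "0 < \<kappa>" using d D1 by (simp add: \<kappa>_def)
  have \<sigma>: "0 < \<sigma>" using t by (simp add: \<sigma>_def sig_pos)
  have fg: "0 < f x" "0 < g x" for x using \<sigma> by (auto simp: f_def g_def gauss_kernel_pos)
  have R: "ln (f x / g x) = R x" for x unfolding f_def g_def R_def by (rule ln_gauss_kernel_ratio[OF \<sigma>])
  have [measurable]: "f \<in> borel_measurable (leb d)" "g \<in> borel_measurable (leb d)" unfolding f_def g_def by measurable
  have [measurable]: "R \<in> borel_measurable (leb d)" unfolding R_def [abs_def] by measurable
  have dens: "integrable (leb d) (gauss_kernel d s a)" "(\<integral>x. gauss_kernel d s a x \<partial>leb d) = 1" if "0 < s" for s a
  proof -
    have "prob_space (density (leb d) (\<lambda>x. ennreal (gauss_kernel d s a x)))"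
      unfolding density_gauss_kernel[OF that] using that by (intro prob_space_PiM prob_space_normal_density)
    from prob_space.emeasure_space_1[OF this]
    have "emeasure (density (leb d) (\<lambda>x. ennreal (gauss_kernel d s a x))) (space (leb d)) = 1"
      by (simp only: space_density)
    moreover have "emeasure (density (leb d) (\<lambda>x. ennreal (gauss_kernel d s a x))) (space (leb d))
        = (\<integral>\<^sup>+x. ennreal (gauss_kernel d s a x) \<partial>leb d)"
      by (subst emeasure_density) (measurable, rule nn_integral_cong, simp)
    ultimately have 1: "(\<integral>\<^sup>+x. ennreal (gauss_kernel d s a x) \<partial>leb d) = 1" by simp
    then show "integrable (leb d) (gauss_kernel d s a)"
      by (intro integrableI_nonneg) (auto simp: gauss_kernel_nonneg)
    show "(\<integral>x. gauss_kernel d s a x \<partial>leb d) = 1"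
      using 1 by (subst integral_eq_nn_integral) (auto simp: gauss_kernel_nonneg)
  qed
  let ?A = "\<lambda>w. \<lambda>i\<in>{..<d}. c i + \<sigma> * w i"
  have Am: "?A \<in> measurable (std_gaussian d) (leb d)" by measurable
  \<comment> \<open>In terms of the noise, x = c + \<sigma> w, the logarithmic ratio is a quadratic
    polynomial; its expectation needs only the first two moments of w.\<close>
  have RA: "R (?A w) = (\<Sum>i<d. (- ln \<sigma> + (c i)\<^sup>2 / 2) + c i * \<sigma> * w i + (\<sigma>\<^sup>2 / 2 - 1 / 2) * (w i)\<^sup>2)" for w
    unfolding R_def using \<sigma> by (intro sum.cong) (auto simp: power2_eq_square field_simps)
  have intRA: "integrable (std_gaussian d) (\<lambda>w. R (?A w))"
    unfolding RA using std_gaussian_component_moments(1) integrable_std_gaussian_square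
    by (intro Bochner_Integration.integrable_sum Bochner_Integration.integrable_add integrable_mult_right) auto
  have "(\<integral>w. R (?A w) \<partial>std_gaussian d) = (\<Sum>i<d. (- ln \<sigma> + (c i)\<^sup>2 / 2) + (\<sigma>\<^sup>2 / 2 - 1 / 2))"
    unfolding RA using std_gaussian_component_moments integrable_std_gaussian_square
    by (subst Bochner_Integration.integral_sum) (auto intro!: sum.cong simp: gam.prob_space[simplified])
  also have "\<dots> \<le> (\<Sum>i<d. (exp (- t))\<^sup>2 * D\<^sup>2)"
  proof (rule sum_mono)
    fix i assume "i \<in> {..<d}"
    then have "(y i)\<^sup>2 \<le> D\<^sup>2" using y[of i] D1 by (metis abs_le_square_iff abs_of_nonneg lessThan_iff order_trans zero_le_one)
    then have c: "(c i)\<^sup>2 \<le> (exp (- t))\<^sup>2 * D\<^sup>2" by (simp add: c_def power_mult_distrib)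
    define x where "x = (exp (- t))\<^sup>2"
    have x: "0 < x" "x \<le> 1 / 2" "\<sigma>\<^sup>2 = 1 - x"
    proof -
      have "2 \<le> exp t" using exp_ge_add_one_self[of t] t by linarith
      then have "exp (- t) \<le> 1 / 2" by (simp add: exp_minus field_simps)
      then have "x \<le> (1 / 2)\<^sup>2" unfolding x_def by (intro power_mono) auto
      then show "x \<le> 1 / 2" by (simp add: power2_eq_square)
      show "\<sigma>\<^sup>2 = 1 - x" using t sig_square[of t] by (simp add: \<sigma>_def x_def flip: exp_double)
    qed (simp add: x_def)
    have "ln (1 / (1 - x)) \<le> 1 / (1 - x) - 1" using x by (intro ln_le_minus_one) simp
    then have "- ln (1 - x) \<le> x / (1 - x)" using x by (simp add: ln_div field_simps)
    also have "\<dots> \<le> 2 * x" using x by (simp add: field_simps)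
    finally have "- ln (\<sigma>\<^sup>2) \<le> 2 * x" by (simp add: x)
    then have "- ln \<sigma> \<le> x" using \<sigma> by (simp add: ln_realpow)
    moreover have "x * 1 \<le> x * D\<^sup>2" using x D1 by (intro mult_left_mono) (auto simp: one_le_power)
    ultimately have "- ln \<sigma> + (\<sigma>\<^sup>2 / 2 - 1 / 2) \<le> x * D\<^sup>2 / 2"
      unfolding x(3) by (simp add: field_simps)
    then show "(- ln \<sigma> + (c i)\<^sup>2 / 2) + (\<sigma>\<^sup>2 / 2 - 1 / 2) \<le> (exp (- t))\<^sup>2 * D\<^sup>2"
      using c unfolding x_def by simp
  qed
  also have "\<dots> = \<kappa>\<^sup>2" by (simp add: \<kappa>_def power_mult_distrib)
  finally have KL: "(\<integral>w. R (?A w) \<partial>std_gaussian d) \<le> \<kappa>\<^sup>2" .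
  have law: "distr (std_gaussian d) (leb d) ?A = density (leb d) (\<lambda>x. ennreal (f x))"
    unfolding f_def by (rule distr_std_gaussian_affine[OF \<sigma>])
  have fR: "integrable (leb d) (\<lambda>x. f x * R x)" "(\<integral>x. f x * R x \<partial>leb d) \<le> \<kappa>\<^sup>2"
  proof -
    have "integrable (density (leb d) (\<lambda>x. ennreal (f x))) R"
      unfolding law[symmetric] using intRA by (subst integrable_distr_eq[OF Am]) auto
    then show "integrable (leb d) (\<lambda>x. f x * R x)"
      using fg by (subst (asm) integrable_density) (auto simp: less_imp_le)
    have "(\<integral>x. f x * R x \<partial>leb d) = (\<integral>x. R x \<partial>density (leb d) (\<lambda>x. ennreal (f x)))"
      using fg by (subst integral_density) (auto simp: less_imp_le)
    also have "\<dots> = (\<integral>w. R (?A w) \<partial>std_gaussian d)"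
      unfolding law[symmetric] by (subst integral_distr[OF Am]) auto
    finally show "(\<integral>x. f x * R x \<partial>leb d) \<le> \<kappa>\<^sup>2" using KL by simp
  qed
  have f1: "integrable (leb d) f" "(\<integral>x. f x \<partial>leb d) = 1" and g1: "integrable (leb d) g" "(\<integral>x. g x \<partial>leb d) = 1"
    unfolding f_def g_def using \<sigma> by (auto intro: dens)
  have k2: "0 < \<kappa> / 2" using \<kappa> by simp
  have int: "integrable (leb d) (\<lambda>x. \<bar>f x - g x\<bar>)" using f1 g1 by auto
  have "(\<integral>x. \<bar>f x - g x\<bar> \<partial>leb d) \<le> (\<integral>x. \<kappa> / 2 * (f x + g x) + 1 / (2 * (\<kappa> / 2)) * (g x - f x + f x * R x) \<partial>leb d)"
  proof (rule integral_mono)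
    show "\<bar>f x - g x\<bar> \<le> \<kappa> / 2 * (f x + g x) + 1 / (2 * (\<kappa> / 2)) * (g x - f x + f x * R x)" for x
      using abs_diff_le_entropy[OF fg(1)[of x] fg(2)[of x] k2] unfolding R .
  qed (use f1 g1 fR int in auto)
  also have "\<dots> = \<kappa> / 2 * (1 + 1) + 1 / (2 * (\<kappa> / 2)) * (1 - 1 + (\<integral>x. f x * R x \<partial>leb d))"
    using f1 g1 fR by simp
  also have "\<dots> \<le> \<kappa> + 1 / \<kappa> * \<kappa>\<^sup>2" using fR(2) \<kappa> by (simp add: divide_right_mono)
  also have "\<dots> = 2 * \<kappa>" using \<kappa> by (simp add: power2_eq_square)
  finally have "(\<integral>x. \<bar>f x - g x\<bar> \<partial>leb d) \<le> 2 * \<kappa>" .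
  moreover have "(\<integral>\<^sup>+x. ennreal \<bar>f x - g x\<bar> \<partial>leb d) = ennreal (\<integral>x. \<bar>f x - g x\<bar> \<partial>leb d)"
    using int by (intro nn_integral_eq_integral) auto
  ultimately show ?thesis
    unfolding \<kappa>_def[symmetric] by (simp add: ou_kernel_def f_def g_def \<sigma>_def c_def [abs_def] ennreal_leI)
qed

text \<open>Convexity: the distance of a mixture is at most the mean of the distances of its
  components, and these are bounded uniformly in the data point.\<close>

lemma mix_TV:
  assumes t: "1 \<le> t" and D1: "1 \<le> D" and d: "1 \<le> d"
  shows "(\<integral>x. \<bar>mix t x - gauss_kernel d 1 (\<lambda>_. 0) x\<bar> \<partial>leb d) \<le> 2 * (sqrt d * exp (- t) * D)"
proof -
  let ?g = "gauss_kernel d 1 (\<lambda>_. 0)"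
  have t0: "0 < t" using t by simp
  have km: "(\<lambda>(y, x). ennreal \<bar>ou_kernel d t y x - ?g x\<bar>) \<in> borel_measurable (\<mu> \<Otimes>\<^sub>M leb d)"
    unfolding split_beta' using ou_kernel_measurable(1)[of t] by (simp add: split_beta')
  have "(\<integral>\<^sup>+x. ennreal \<bar>mix t x - ?g x\<bar> \<partial>leb d) \<le> (\<integral>\<^sup>+x. \<integral>\<^sup>+y. ennreal \<bar>ou_kernel d t y x - ?g x\<bar> \<partial>\<mu> \<partial>leb d)"
  proof (rule nn_integral_mono)
    fix x assume x: "x \<in> space (leb d)"
    then have i: "integrable \<mu> (\<lambda>y. ou_kernel d t y x)" using t0 by (intro integrable_ou_kernel) auto
    have "mix t x - ?g x = (\<integral>y. ou_kernel d t y x - ?g x \<partial>\<mu>)"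
      using i by (simp add: mix_def mu.prob_space[simplified])
    then show "ennreal \<bar>mix t x - ?g x\<bar> \<le> (\<integral>\<^sup>+y. ennreal \<bar>ou_kernel d t y x - ?g x\<bar> \<partial>\<mu>)"
      using integral_norm_bound_ennreal[of \<mu> "\<lambda>y. ou_kernel d t y x - ?g x"] i by simp
  qed
  also have "\<dots> = (\<integral>\<^sup>+y. \<integral>\<^sup>+x. ennreal \<bar>ou_kernel d t y x - ?g x\<bar> \<partial>leb d \<partial>\<mu>)"
    by (rule ml.Fubini'[OF km])
  also have "\<dots> \<le> (\<integral>\<^sup>+y. ennreal (2 * (sqrt d * exp (- t) * D)) \<partial>\<mu>)"
  proof (rule nn_integral_mono_AE)
    have "AE y in \<mu>. \<forall>i\<in>{..<d}. \<bar>y i\<bar> \<le> D"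
      using bounded_mu by (subst AE_finite_all) auto
    then show "AE y in \<mu>. (\<integral>\<^sup>+x. ennreal \<bar>ou_kernel d t y x - ?g x\<bar> \<partial>leb d) \<le> ennreal (2 * (sqrt d * exp (- t) * D))"
      by (rule eventually_mono) (intro kernel_TV t D1 d, simp)
  qed
  also have "\<dots> = ennreal (2 * (sqrt d * exp (- t) * D))" using mu.emeasure_space_1 by simp
  finally have le: "(\<integral>\<^sup>+x. ennreal \<bar>mix t x - ?g x\<bar> \<partial>leb d) \<le> ennreal (2 * (sqrt d * exp (- t) * D))" .
  have "(\<integral>x. \<bar>mix t x - ?g x\<bar> \<partial>leb d) = enn2real (\<integral>\<^sup>+x. ennreal \<bar>mix t x - ?g x\<bar> \<partial>leb d)"
    by (rule integral_eq_nn_integral) auto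
  also have "\<dots> \<le> 2 * (sqrt d * exp (- t) * D)"
    using le D1 by (intro enn2real_leI) auto
  finally show ?thesis .
qed

end

section \<open>The total variation estimate\<close>

lemma abs_le_sup_norm: "i < d \<Longrightarrow> \<bar>x i\<bar> \<le> sup_norm d x"
  unfolding sup_norm_def by (rule Max_ge) auto

lemma bdd_above_sup_norm:
  assumes K: "compact K" and d: "1 \<le> d"
  shows "bdd_above (sup_norm d ` K)"
proof -
  have "\<exists>b. \<forall>x\<in>K. \<bar>x i\<bar> \<le> b" for i :: nat
  proof -
    have "continuous_on K (\<lambda>x. x i)"
      by (rule continuous_on_subset[OF continuous_on_product_coordinates]) simp
    then have "bounded ((\<lambda>x. x i) ` K)" using K compact_continuous_image compact_imp_bounded by blast
    then show ?thesis by (auto simp: bounded_iff)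
  qed
  then obtain b where b: "\<And>i x. x \<in> K \<Longrightarrow> \<bar>x i\<bar> \<le> b i" by metis
  have "sup_norm d x \<le> (\<Sum>i<d. \<bar>b i\<bar>)" if x: "x \<in> K" for x
    unfolding sup_norm_def
  proof (rule Max.boundedI)
    show "(\<lambda>i. \<bar>x i\<bar>) ` {..<d} \<noteq> {}" using d by (auto simp: lessThan_empty_iff)
    fix a assume "a \<in> (\<lambda>i. \<bar>x i\<bar>) ` {..<d}"
    then obtain i where i: "i < d" "a = \<bar>x i\<bar>" by auto
    have "\<bar>b i\<bar> \<le> (\<Sum>i<d. \<bar>b i\<bar>)" using i by (intro member_le_sum) auto
    then show "a \<le> (\<Sum>i<d. \<bar>b i\<bar>)" using b[OF x, of i] i by linarith
  qed simp
  then show ?thesis by (auto intro!: bdd_aboveI2)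
qed

lemma data_distribution_bounded:
  assumes \<mu>: "data_distribution d K \<mu>" and d: "1 \<le> d"
  shows "bounded_data d \<mu> (radius d K)" and "1 \<le> radius d K"
proof -
  interpret prob_space \<mu> using \<mu> by (simp add: data_distribution_def)
  have K: "compact K" "AE x in \<mu>. x \<in> K" "sets \<mu> = sets (leb d)"
    using \<mu> by (auto simp: data_distribution_def)
  have le: "sup_norm d x \<le> radius d K - 1" if "x \<in> K" for x
    unfolding radius_def using cSUP_upper[OF that bdd_above_sup_norm[OF K(1) d]] by simp
  \<comment> \<open>A probability measure cannot be concentrated on the empty set. A point of K
    gives the supremum in \<open>radius\<close> its meaning and its sign.\<close>
  have "K \<noteq> {}"
  proof
    assume "K = {}"
    then have "AE x in \<mu>. False" using K(2) by simp
    then show False by simp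
  qed
  then obtain x where x: "x \<in> K" by auto
  have "0 \<le> sup_norm d x" using abs_le_sup_norm[of 0 d x] d by simp
  then show "1 \<le> radius d K" using le[OF x] by linarith
  show "bounded_data d \<mu> (radius d K)"
  proof
    fix i assume i: "i < d"
    show "AE y in \<mu>. \<bar>y i\<bar> \<le> radius d K"
      using K(2)
    proof (rule eventually_mono)
      fix y assume "y \<in> K"
      then show "\<bar>y i\<bar> \<le> radius d K" using le[of y] abs_le_sup_norm[OF i, of y] by linarith
    qed
  qed (rule K(3))
qed

text \<open>Multiplication by the indicator extends s and L to all times as
  \<open>regular_drift\<close> requires, without changing anything on the time interval.\<close>

lemma regular_score_drift:
  assumes s: "regular_score d S s L" and d: "1 \<le> d"
  shows "regular_drift d (\<lambda>r x i. indicator {0..S} r * s r x i)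
    (\<lambda>r x i k. indicator {0..S} r * partial_deriv k (\<lambda>x. s r x i) x) (\<lambda>r. indicator {0..S} r * L r)"
proof
  have C: "C_k d 2 (\<lambda>x. s r x i)" "\<bar>s r (\<lambda>i\<in>{..<d}. 0) i\<bar> \<le> L r" "0 \<le> L r"
      "\<And>\<alpha> x. (\<Sum>i<d. \<alpha> i) \<in> {1..2} \<Longrightarrow> x \<in> Rd d \<Longrightarrow> \<bar>multi_deriv \<alpha> d (\<lambda>x. s r x i) x\<bar> \<le> L r"
    if "r \<in> {0..S}" "i < d" for r i
    using s that unfolding regular_score_def by (auto intro: less_imp_le)
  have L0: "0 \<le> L r" if "r \<in> {0..S}" for r using C(3)[OF that, of 0] d by simp
  note exp = first_order_expansion_C2[OF C(1) C(4)]
  show "(\<lambda>r. indicator {0..S} r * s r x i) \<in> borel_measurable borel" if "x \<in> Rd d" "i < d" for x i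
    using s that unfolding regular_score_def set_borel_measurable_def by simp
  show "integrable lborel (\<lambda>r. indicator {0..S} r * L r)"
    using s unfolding regular_score_def set_integrable_def by simp
  show "0 \<le> indicator {0..S} r * L r" for r :: real using L0 by (auto simp: indicator_def)
  show "\<bar>indicator {0..S} r * s r y i - indicator {0..S} r * s r x i\<bar> \<le> indicator {0..S} r * L r * l1_dist d x y"
    if "x \<in> Rd d" "y \<in> Rd d" "i < d" for r x y i
    using exp(2)[of r i x y] that by (auto simp: indicator_def)
  show "\<bar>indicator {0..S} r * s r (\<lambda>i\<in>{..<d}. 0) i\<bar> \<le> indicator {0..S} r * L r" if "i < d" for r i
    using C(2)[of r i] that by (auto simp: indicator_def)
  show "quad_approx d (\<lambda>x. indicator {0..S} r * s r x i) (\<lambda>x k. indicator {0..S} r * partial_deriv k (\<lambda>x. s r x i) x)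
    (indicator {0..S} r * L r) (indicator {0..S} r * L r)" if "i < d" for r i
  proof (cases "r \<in> {0..S}")
    case True
    then show ?thesis
      using exp(1)[OF True that True that] partial_deriv_bounds(1)[of d "\<lambda>x. s r x i", OF C(4)[OF True that]]
      unfolding quad_approx_def by simp
  qed (simp add: quad_approx_def)
  show "\<bar>indicator {0..S} r * partial_deriv i (\<lambda>x. s r x i) (x(i := z)) - indicator {0..S} r * partial_deriv i (\<lambda>x. s r x i) (x(i := z'))\<bar>
    \<le> indicator {0..S} r * L r * \<bar>z - z'\<bar>" if "x \<in> Rd d" "i < d" for r x i z z'
    using exp(3)[of r i x x i z z'] that by (auto simp: indicator_def)
qed (rule d)

text \<open>The noise level saturates at 1, so a lower bound linear in t needs t to be bounded. It
  follows from exp (2 t) \<ge> 1 + 2 t and 1 + 2 t \<le> 3.\<close>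

lemma sig_square_ge:
  assumes "0 < t" "t \<le> 1" shows "2 * t / 3 \<le> (sig t)\<^sup>2"
proof -
  have "1 + 2 * t \<le> exp (2 * t)" by (rule exp_ge_add_one_self)
  then have "exp (- 2 * t) \<le> 1 / (1 + 2 * t)" using assms by (simp add: exp_minus field_simps)
  also have "\<dots> \<le> 1 - 2 * t / 3"
  proof -
    have "t * t \<le> t * 1" using assms by (intro mult_left_mono) auto
    then show ?thesis using assms by (simp add: field_simps)
  qed
  finally show ?thesis using assms by (simp add: sig_square)
qed

lemma integral_density_Rd:
  fixes f g :: "(nat \<Rightarrow> real) \<Rightarrow> real"
  assumes "f \<in> borel_measurable (leb d)" "g \<in> borel_measurable (leb d)" "\<And>x. x \<in> Rd d \<Longrightarrow> 0 \<le> f x"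
  shows "(\<integral>x. g x \<partial>density (leb d) (\<lambda>x. ennreal (f x))) = (\<integral>x. g x * f x \<partial>leb d)"
  using assms by (subst integral_density) (auto simp: mult.commute intro!: AE_I2)

lemma prob_density_Rd:
  fixes f :: "(nat \<Rightarrow> real) \<Rightarrow> real"
  assumes f: "f \<in> borel_measurable (leb d)" "\<And>x. x \<in> Rd d \<Longrightarrow> 0 \<le> f x"
    and p: "prob_space (density (leb d) (\<lambda>x. ennreal (f x)))"
  shows "integrable (leb d) f" "(\<integral>x. f x \<partial>leb d) = 1"
proof -
  note [measurable] = f(1)
  have "(\<integral>\<^sup>+x. ennreal (f x) \<partial>leb d) = emeasure (density (leb d) (\<lambda>x. ennreal (f x))) (space (leb d))"
    by (subst emeasure_density) (measurable, rule nn_integral_cong, simp)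
  also have "\<dots> = 1" using prob_space.emeasure_space_1[OF p] by (simp only: space_density)
  finally have 1: "(\<integral>\<^sup>+x. ennreal (f x) \<partial>leb d) = 1" .
  show "integrable (leb d) f" using f 1 by (intro integrableI_nonneg) (auto intro!: AE_I2)
  show "(\<integral>x. f x \<partial>leb d) = 1" using f 1 by (subst integral_eq_nn_integral) (auto intro!: AE_I2)
qed

lemma TV_le_2:
  assumes f: "integrable (leb d) f" "(\<integral>x. f x \<partial>leb d) = 1" "\<And>x. x \<in> Rd d \<Longrightarrow> 0 \<le> f x"
    and g: "integrable (leb d) g" "(\<integral>x. g x \<partial>leb d) = 1" "\<And>x. x \<in> Rd d \<Longrightarrow> 0 \<le> g x"
  shows "TV d f g \<le> 2"
proof -
  have "TV d f g \<le> (\<integral>x. f x + g x \<partial>leb d)"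
    unfolding TV_def
  proof (rule integral_mono)
    show "\<bar>f x - g x\<bar> \<le> f x + g x" if "x \<in> space (leb d)" for x
      using f(3)[of x] g(3)[of x] that by (simp add: abs_le_iff)
  qed (use f g in auto)
  also have "\<dots> = 2" using f g by simp
  finally show ?thesis .
qed

lemma TV_cong: "(\<And>x. x \<in> Rd d \<Longrightarrow> f x = f' x) \<Longrightarrow> TV d f g = TV d f' g"
  unfolding TV_def by (intro Bochner_Integration.integral_cong) auto

section \<open>Comparison of the final laws and choice of the parameters\<close>

context bounded_data
begin

lemma mix_prob:
  assumes t: "0 < t"
  shows "prob_space (density (leb d) (\<lambda>x. ennreal (mix t x)))"
  unfolding ou_law[OF t, symmetric] by (rule mg.P.prob_space_distr[OF ou_measurable])

lemmas mix_density = prob_density_Rd[OF mix_measurable mix_nonneg mix_prob]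

lemma integral_mix:
  assumes t: "0 < t" and [measurable]: "g \<in> borel_measurable (leb d)"
  shows "(\<integral>v. g (ou d t (fst v) (snd v)) \<partial>P) = (\<integral>x. g x * mix t x \<partial>leb d)"
proof -
  have "(\<integral>x. g x * mix t x \<partial>leb d) = (\<integral>x. g x \<partial>distr P (leb d) (\<lambda>(y, w). ou d t y w))"
    unfolding ou_law[OF t] by (rule integral_density_Rd[symmetric]) (auto intro: mix_nonneg)
  also have "\<dots> = (\<integral>v. g (ou d t (fst v) (snd v)) \<partial>P)"
    by (subst integral_distr[OF ou_measurable]) (auto simp: split_beta')
  finally show ?thesis by simp
qed

end

context reverse_flow
begin

lemma score_error_eq:
  assumes \<rho>: "\<And>t x. t \<in> {0..S} \<Longrightarrow> x \<in> Rd d \<Longrightarrow> \<rho> t x = mix (T - t) x"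
  shows "score_error d S \<rho> s = (\<integral>\<^sup>+r\<in>{0..S}. (\<Sum>i<d. \<integral>\<^sup>+x. ennreal (sq_error i r x * mix (T - r) x) \<partial>leb d) \<partial>lborel)"
  unfolding score_error_def
proof (intro nn_integral_cong)
  fix r :: real
  have "(\<integral>\<^sup>+x. ennreal (\<Sum>j<d. (score (\<rho> r) x j - s r x j)\<^sup>2) \<partial>density (leb d) (\<lambda>x. ennreal (\<rho> r x)))
    = (\<Sum>i<d. \<integral>\<^sup>+x. ennreal (sq_error i r x * mix (T - r) x) \<partial>leb d)" if r: "r \<in> {0..S}"
  proof -
    have [measurable]: "(\<lambda>x. sq_error i r x) \<in> borel_measurable (leb d)" if "i < d" for i
      using measurable_compose[OF measurable_Pair1' sq_error_measurable[OF that], of r] by simp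
    have sc: "score (\<rho> r) x j = score (mix (T - r)) x j" if "x \<in> Rd d" "j < d" for x j
      unfolding score_def partial_deriv_def using \<rho>[OF r upd_Rd[OF that]] by simp
    have eq: "(\<Sum>j<d. (score (\<rho> r) x j - s r x j)\<^sup>2) = (\<Sum>j<d. sq_error j r x)" if "x \<in> Rd d" for x
      using r sc[OF that] sq_error_eq[of r _ x] that by (intro sum.cong) auto
    have "density (leb d) (\<lambda>x. ennreal (\<rho> r x)) = density (leb d) (\<lambda>x. ennreal (mix (T - r) x))"
    proof (rule density_cong)
      have "\<rho> r \<in> borel_measurable (leb d) \<longleftrightarrow> mix (T - r) \<in> borel_measurable (leb d)"
        using \<rho>[OF r] by (intro measurable_cong) simp
      then show "(\<lambda>x. ennreal (\<rho> r x)) \<in> borel_measurable (leb d)" by simp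
    qed (use \<rho>[OF r] in \<open>auto intro!: AE_I2\<close>)
    then have "(\<integral>\<^sup>+x. ennreal (\<Sum>j<d. (score (\<rho> r) x j - s r x j)\<^sup>2) \<partial>density (leb d) (\<lambda>x. ennreal (\<rho> r x)))
      = (\<integral>\<^sup>+x. ennreal (\<Sum>j<d. sq_error j r x) \<partial>density (leb d) (\<lambda>x. ennreal (mix (T - r) x)))"
      using eq by (simp only:) (intro nn_integral_cong, simp)
    also have "\<dots> = (\<integral>\<^sup>+x. ennreal (mix (T - r) x) * ennreal (\<Sum>j<d. sq_error j r x) \<partial>leb d)"
      by (rule nn_integral_density) auto
    also have "\<dots> = (\<integral>\<^sup>+x. (\<Sum>j<d. ennreal (sq_error j r x * mix (T - r) x)) \<partial>leb d)"
    proof (rule nn_integral_cong)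
      fix x
      have "ennreal (mix (T - r) x) * ennreal (\<Sum>j<d. sq_error j r x) = ennreal (\<Sum>j<d. sq_error j r x * mix (T - r) x)"
        by (simp add: sum_distrib_left[symmetric] ennreal_mult'[OF mix_nonneg] mult.commute[of _ "mix (T - r) x"])
      then show "ennreal (mix (T - r) x) * ennreal (\<Sum>j<d. sq_error j r x) = (\<Sum>j<d. ennreal (sq_error j r x * mix (T - r) x))"
        by (simp add: sum_ennreal sq_error_def mix_nonneg)
    qed
    also have "\<dots> = (\<Sum>i<d. \<integral>\<^sup>+x. ennreal (sq_error i r x * mix (T - r) x) \<partial>leb d)"
      by (rule nn_integral_sum) auto
    finally show ?thesis .
  qed
  then show "(\<integral>\<^sup>+x. ennreal (\<Sum>j<d. (score (\<rho> r) x j - s r x j)\<^sup>2) \<partial>density (leb d) (\<lambda>x. ennreal (\<rho> r x))) * indicator {0..S} r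
    = (\<Sum>i<d. \<integral>\<^sup>+x. ennreal (sq_error i r x * mix (T - r) x) \<partial>leb d) * indicator {0..S} r"
    by (simp add: indicator_def)
qed

text \<open>At all times up to S the squared noise level is at least 2 \<tau> / 3, so D / \<sigma>^4
  is at most 9/4 D / \<tau>^2; this is the origin of \<tau>^-2. The time integral of the score error
  is bounded by hypothesis.\<close>

lemma gap_integral_le:
  assumes h: "0 < h" and \<alpha>: "0 < \<alpha>" and \<tau>: "\<tau> \<le> 1"
    and E: "(\<integral>\<^sup>+r\<in>{0..S}. (\<Sum>i<d. \<integral>\<^sup>+x. ennreal (sq_error i r x * mix (T - r) x) \<partial>leb d) \<partial>lborel) \<le> ennreal (\<delta>\<^sup>2)"
  shows "(\<integral>\<^sup>+r\<in>{0<..S}. gap_bound h \<alpha> r \<partial>lborel)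
    \<le> ennreal (d * (4 / h * \<alpha> * S + 8 * h * ((\<integral>r. L r \<partial>lborel) + 9 / 4 * D / \<tau>\<^sup>2 * S)) + 4 / h / \<alpha> * \<delta>\<^sup>2)"
proof -
  define Q where "Q r = (\<Sum>i<d. \<integral>\<^sup>+x. ennreal (sq_error i r x * mix (T - r) x) \<partial>leb d)" for r
  define c where "c = d * (4 / h * \<alpha> + 8 * h * (9 / 4 * D / \<tau>\<^sup>2))"
  define b where "b = 8 * d * h"
  define k where "k = 4 / h / \<alpha>"
  have nn: "0 \<le> c" "0 \<le> b" "0 \<le> k" "0 \<le> S" using h \<alpha> D1 tau by (auto simp: c_def b_def k_def)
  have [measurable]: "L \<in> borel_measurable borel" using L_integrable by auto
  have [measurable]: "Q \<in> borel_measurable borel"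
    unfolding Q_def [abs_def] using sq_error_nn_integral_measurable by (intro borel_measurable_sum) auto
  have "(\<integral>\<^sup>+r\<in>{0<..S}. gap_bound h \<alpha> r \<partial>lborel)
    \<le> (\<integral>\<^sup>+r. (ennreal c * indicator {0<..S} r + ennreal b * ennreal (L r)) + ennreal k * (Q r * indicator {0..S} r) \<partial>lborel)"
  proof (rule nn_integral_mono)
    fix r :: real
    show "gap_bound h \<alpha> r * indicator {0<..S} r
      \<le> (ennreal c * indicator {0<..S} r + ennreal b * ennreal (L r)) + ennreal k * (Q r * indicator {0..S} r)"
    proof (cases "r \<in> {0<..S}")
      case True
      then have r: "r \<le> S" by simp
      have pos: "0 < sig (T - r)" using r tau by (intro sig_pos) simp
      have "2 * \<tau> / 3 \<le> (sig \<tau>)\<^sup>2" using tau \<tau> by (intro sig_square_ge) auto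
      also have "\<dots> \<le> (sig (T - r))\<^sup>2" using sig_ge[OF r] sig_tau by (intro power_mono) auto
      finally have "(2 * \<tau> / 3)\<^sup>2 \<le> ((sig (T - r))\<^sup>2)\<^sup>2" using tau by (intro power_mono) auto
      then have "D / sig (T - r) ^ 4 \<le> D / (2 * \<tau> / 3)\<^sup>2" using D1 tau pos by (intro divide_left_mono) (auto simp flip: power_mult)
      also have "\<dots> = 9 / 4 * D / \<tau>\<^sup>2" by (simp add: power2_eq_square)
      finally have "8 * h * (L r + D / sig (T - r) ^ 4) \<le> 8 * h * (L r + 9 / 4 * D / \<tau>\<^sup>2)"
        using h by (intro mult_left_mono) auto
      then have "d * (4 / h * \<alpha> + 8 * h * (L r + D / sig (T - r) ^ 4))
        \<le> d * (4 / h * \<alpha> + 8 * h * (L r + 9 / 4 * D / \<tau>\<^sup>2))"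
        by (intro mult_left_mono) auto
      also have "\<dots> = c + b * L r" by (simp add: c_def b_def distrib_left)
      finally have "ennreal (d * (4 / h * \<alpha> + 8 * h * (L r + D / sig (T - r) ^ 4))) \<le> ennreal (c + b * L r)"
        by (rule ennreal_leI)
      also have "\<dots> = ennreal c + ennreal b * ennreal (L r)"
        using nn L_nonneg[of r] by (simp add: ennreal_mult)
      finally have "gap_bound h \<alpha> r \<le> (ennreal c + ennreal b * ennreal (L r)) + ennreal k * Q r"
        unfolding gap_bound_eq[OF r h \<alpha>] Q_def[symmetric] k_def[symmetric] by (rule add_right_mono)
      then show ?thesis using True by simp
    qed simp
  qed
  also have "\<dots> = (ennreal c * ennreal S + ennreal b * ennreal (\<integral>r. L r \<partial>lborel))
      + ennreal k * (\<integral>\<^sup>+r\<in>{0..S}. Q r \<partial>lborel)"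
    using nn L_nonneg
    by (simp add: nn_integral_add nn_integral_cmult nn_integral_eq_integral[OF L_integrable] emeasure_lborel_Ioc)
  also have "\<dots> \<le> (ennreal c * ennreal S + ennreal b * ennreal (\<integral>r. L r \<partial>lborel)) + ennreal k * ennreal (\<delta>\<^sup>2)"
    using E unfolding Q_def by (intro add_left_mono mult_left_mono) auto
  also have "\<dots> = ennreal (c * S + b * (\<integral>r. L r \<partial>lborel) + k * \<delta>\<^sup>2)"
    using nn L_nonneg by (simp add: ennreal_mult)
  also have "c * S + b * (\<integral>r. L r \<partial>lborel) + k * \<delta>\<^sup>2
      = d * (4 / h * \<alpha> * S + 8 * h * ((\<integral>r. L r \<partial>lborel) + 9 / 4 * D / \<tau>\<^sup>2 * S)) + 4 / h / \<alpha> * \<delta>\<^sup>2"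
    by (simp add: c_def b_def k_def distrib_left distrib_right)
  finally show ?thesis .
qed

text \<open>The exact initial law, pushed forward by the approximate flow, serves as intermediate
  law. Its distance to the exact final law is the transport error, bounded by B. Its distance to the
  approximate final law is at most the initial distance, because testing with \<phi> after the flow
  is testing with a function still bounded by 1.\<close>

lemma TV_le_gap_integral:
  assumes h: "0 < h" "h \<le> sig \<tau>" and \<alpha>: "0 < \<alpha>"
    and Y: "ode_flow d S s Y" and YS [measurable]: "Y S \<in> measurable (leb d) (leb d)"
    and f: "f \<in> borel_measurable (leb d)" "\<And>x. x \<in> Rd d \<Longrightarrow> 0 \<le> f x"
    and g: "g \<in> borel_measurable (leb d)" "\<And>x. x \<in> Rd d \<Longrightarrow> 0 \<le> g x"
    and fp: "prob_space (density (leb d) (\<lambda>x. ennreal (f x)))"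
    and fg: "distr (density (leb d) (\<lambda>x. ennreal (f x))) (leb d) (Y S) = density (leb d) (\<lambda>x. ennreal (g x))"
    and B: "(\<integral>\<^sup>+r\<in>{0<..S}. gap_bound h \<alpha> r \<partial>lborel) \<le> ennreal B" "0 \<le> B"
  shows "TV d (mix \<tau>) g \<le> B + TV d (mix T) f"
proof -
  have T: "0 < T" using tau by simp
  have YS': "Y S \<in> measurable (density (leb d) (\<lambda>x. ennreal (f x))) (leb d)" using YS by simp
  have gp: "prob_space (density (leb d) (\<lambda>x. ennreal (g x)))"
    unfolding fg[symmetric] by (rule prob_space.prob_space_distr[OF fp YS'])
  note fi = prob_density_Rd[OF f fp] and gi = prob_density_Rd[OF g gp]
  show ?thesis
    unfolding TV_def
  proof (rule L1_norm_le_of_test_functions)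
    show "integrable (leb d) (\<lambda>x. mix \<tau> x - g x)" using mix_density[OF tau(1)] gi by auto
    fix \<phi> p and \<Lambda> H :: real
    assume Q: "quad_approx d \<phi> p \<Lambda> H" and \<phi>1: "\<And>x. x \<in> Rd d \<Longrightarrow> \<bar>\<phi> x\<bar> \<le> 1"
    have \<phi> [measurable]: "\<phi> \<in> borel_measurable (leb d)"
      by (rule borel_measurable_continuous_Rd[OF quad_approx_continuous(1)[OF Q]])
    have \<phi>Y: "\<bar>\<phi> (Y S x)\<bar> \<le> 1" if "x \<in> Rd d" for x
      using measurable_space[OF YS, of x] that by (intro \<phi>1) simp
    have int: "integrable (leb d) (\<lambda>x. u x * v x)"
      if u: "u \<in> borel_measurable (leb d)" "\<And>x. x \<in> Rd d \<Longrightarrow> \<bar>u x\<bar> \<le> 1" and v: "integrable (leb d) v" for u v :: "(nat \<Rightarrow> real) \<Rightarrow> real"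
    proof (rule Bochner_Integration.integrable_bound[OF v])
      show "AE x in leb d. norm (u x * v x) \<le> norm (v x)"
        using u(2) by (auto intro!: AE_I2 mult_left_le_one_le simp: abs_mult)
    qed (use u(1) v in measurable)
    have \<phi>Ym: "(\<lambda>x. \<phi> (Y S x)) \<in> borel_measurable (leb d)" by measurable
    note i = int[OF \<phi> \<phi>1 mix_density(1)[OF tau(1)]] int[OF \<phi> \<phi>1 gi(1)]
      int[OF \<phi>Ym \<phi>Y mix_density(1)[OF T]] int[OF \<phi>Ym \<phi>Y fi(1)]
    have e1: "(\<integral>v. \<phi> (X S (fst v) (snd v)) \<partial>P) = (\<integral>x. \<phi> x * mix \<tau> x \<partial>leb d)"
      using integral_mix[OF tau(1) \<phi>] by simp
    have e2: "(\<integral>v. \<phi> (Y S (X 0 (fst v) (snd v))) \<partial>P) = (\<integral>x. \<phi> (Y S x) * mix T x \<partial>leb d)"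
      using integral_mix[OF T \<phi>Ym] by simp
    have e3: "(\<integral>x. \<phi> x * g x \<partial>leb d) = (\<integral>x. \<phi> (Y S x) * f x \<partial>leb d)"
    proof -
      have "(\<integral>x. \<phi> x * g x \<partial>leb d) = (\<integral>x. \<phi> x \<partial>distr (density (leb d) (\<lambda>x. ennreal (f x))) (leb d) (Y S))"
        unfolding fg by (rule integral_density_Rd[OF g(1) \<phi> g(2), symmetric])
      also have "\<dots> = (\<integral>x. \<phi> (Y S x) \<partial>density (leb d) (\<lambda>x. ennreal (f x)))"
        by (rule integral_distr[OF YS' \<phi>])
      also have "\<dots> = (\<integral>x. \<phi> (Y S x) * f x \<partial>leb d)"
        by (rule integral_density_Rd[OF f(1) \<phi>Ym f(2)])
      finally show ?thesis .
    qed
    have "ennreal \<bar>(\<integral>x. \<phi> x * mix \<tau> x \<partial>leb d) - (\<integral>x. \<phi> (Y S x) * mix T x \<partial>leb d)\<bar> \<le> ennreal B"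
      using transport_error[OF Q \<phi>1 h \<alpha> Y YS] B(1) unfolding e1 e2 by (rule order_trans)
    then have A: "\<bar>(\<integral>x. \<phi> x * mix \<tau> x \<partial>leb d) - (\<integral>x. \<phi> (Y S x) * mix T x \<partial>leb d)\<bar> \<le> B"
      using B(2) by simp
    have "\<bar>\<integral>x. \<phi> (Y S x) * (mix T x - f x) \<partial>leb d\<bar> \<le> (\<integral>x. \<bar>\<phi> (Y S x) * (mix T x - f x)\<bar> \<partial>leb d)"
      by (rule integral_abs_bound)
    also have "\<dots> \<le> (\<integral>x. \<bar>mix T x - f x\<bar> \<partial>leb d)"
    proof (rule integral_mono)
      have d: "integrable (leb d) (\<lambda>x. mix T x - f x)" using mix_density[OF T] fi by auto
      show "integrable (leb d) (\<lambda>x. \<bar>\<phi> (Y S x) * (mix T x - f x)\<bar>)" "integrable (leb d) (\<lambda>x. \<bar>mix T x - f x\<bar>)"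
        using int[OF \<phi>Ym \<phi>Y d] d by auto
      show "\<bar>\<phi> (Y S x) * (mix T x - f x)\<bar> \<le> \<bar>mix T x - f x\<bar>" if "x \<in> space (leb d)" for x
        using mult_right_mono[OF \<phi>Y[of x], of "\<bar>mix T x - f x\<bar>"] that by (simp add: abs_mult)
    qed
    finally have C: "\<bar>\<integral>x. \<phi> (Y S x) * (mix T x - f x) \<partial>leb d\<bar> \<le> (\<integral>x. \<bar>mix T x - f x\<bar> \<partial>leb d)" .
    have "(\<integral>x. \<phi> (Y S x) * (mix T x - f x) \<partial>leb d)
        = (\<integral>x. \<phi> (Y S x) * mix T x \<partial>leb d) - (\<integral>x. \<phi> (Y S x) * f x \<partial>leb d)"
      unfolding right_diff_distrib using i by (intro Bochner_Integration.integral_diff)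
    moreover have "(\<integral>x. \<phi> x * (mix \<tau> x - g x) \<partial>leb d)
        = (\<integral>x. \<phi> x * mix \<tau> x \<partial>leb d) - (\<integral>x. \<phi> x * g x \<partial>leb d)"
      unfolding right_diff_distrib using i by (intro Bochner_Integration.integral_diff)
    ultimately show "\<bar>\<integral>x. \<phi> x * (mix \<tau> x - g x) \<partial>leb d\<bar> \<le> B + (\<integral>x. \<bar>mix T x - f x\<bar> \<partial>leb d)"
      using A C unfolding e3 by linarith
  qed
qed

end

text \<open>Here \<open>d = a\<^sup>4\<close>, \<open>T = b\<^sup>4\<close>, \<open>\<delta> = e\<^sup>2\<close> and \<open>z\<^sup>2\<close> is the factor \<open>\<L> + T \<tau>\<^sup>-\<^sup>2 D\<^sup>3\<close> of the theorem.\<close>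

lemma window_choice:
  fixes a b e z I D \<tau> S :: real
  assumes a: "1 \<le> a" and b: "0 < b" and e: "0 < e" and z: "0 < z" and \<tau>: "0 < \<tau>" "\<tau> \<le> 1" "\<tau> < b ^ 4"
    and D: "1 \<le> D" and I: "0 \<le> I" and Z: "z\<^sup>2 = I + b ^ 4 / \<tau>\<^sup>2 * D ^ 3" and S: "0 \<le> S" "S \<le> b ^ 4"
  defines "\<alpha> \<equiv> e\<^sup>2 / (a\<^sup>2 * b\<^sup>2)" and "h \<equiv> b * e / (a * z)"
  shows "a ^ 4 * (4 / h * \<alpha> * S + 8 * h * (I + 9 / 4 * D / \<tau>\<^sup>2 * S)) + 4 / h / \<alpha> * (e\<^sup>2)\<^sup>2 \<le> 26 * (a ^ 3 * b * z * e)"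
    and "e\<^sup>2 \<le> 2 / 3 \<Longrightarrow> h\<^sup>2 \<le> 2 * \<tau> / 3"
    and "2 / 3 \<le> e\<^sup>2 \<Longrightarrow> 2 / 3 \<le> a ^ 3 * b * z * e"
proof -
  have a0: "0 < a" using a by simp
  \<comment> \<open>With S \<le> b^4 the terms become 4 a^4 b^4 \<alpha> / h, 18 a^4 z^2 h and 4 e^4
    / (h \<alpha>), where 18 = 8 * 9/4. Equating the first and third gives \<alpha>; equating them,
    up to constants, with the second gives h. Each term is then a multiple of a^3 b z e, and 4 + 18
    + 4 = 26. The factor D^3 of z^2 majorises the D of the second term.\<close>
  have h: "0 < h" and \<alpha>: "0 < \<alpha>" using a0 b e z by (auto simp: h_def \<alpha>_def)
  have D3: "D \<le> D ^ 3" "1 \<le> D ^ 3" using D power_increasing[of 1 3 D] by auto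
  have zb: "b ^ 4 / \<tau>\<^sup>2 \<le> z\<^sup>2"
  proof -
    have "b ^ 4 / \<tau>\<^sup>2 * 1 \<le> b ^ 4 / \<tau>\<^sup>2 * D ^ 3" using D3 by (intro mult_left_mono) auto
    then show ?thesis using Z I by simp
  qed
  have "9 / 4 * D / \<tau>\<^sup>2 * S \<le> 9 / 4 * D ^ 3 / \<tau>\<^sup>2 * b ^ 4"
    using S D D3 by (intro mult_mono divide_right_mono mult_left_mono) auto
  then have "I + 9 / 4 * D / \<tau>\<^sup>2 * S \<le> 9 / 4 * z\<^sup>2" using I unfolding Z by (simp add: algebra_simps)
  then have "8 * h * (I + 9 / 4 * D / \<tau>\<^sup>2 * S) \<le> 8 * h * (9 / 4 * z\<^sup>2)" using h by (intro mult_left_mono) auto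
  moreover have "4 / h * \<alpha> * S \<le> 4 / h * \<alpha> * b ^ 4" using S h \<alpha> by (intro mult_left_mono) auto
  ultimately have "4 / h * \<alpha> * S + 8 * h * (I + 9 / 4 * D / \<tau>\<^sup>2 * S) \<le> 4 / h * \<alpha> * b ^ 4 + 8 * h * (9 / 4 * z\<^sup>2)"
    by (rule add_mono[rotated])
  then have "a ^ 4 * (4 / h * \<alpha> * S + 8 * h * (I + 9 / 4 * D / \<tau>\<^sup>2 * S)) + 4 / h / \<alpha> * (e\<^sup>2)\<^sup>2
    \<le> a ^ 4 * (4 / h * \<alpha> * b ^ 4 + 8 * h * (9 / 4 * z\<^sup>2)) + 4 / h / \<alpha> * (e\<^sup>2)\<^sup>2"
    by (intro add_right_mono mult_left_mono) auto
  also have "\<dots> = a ^ 4 * (4 / h * \<alpha> * b ^ 4) + 18 * (a ^ 4 * h * z\<^sup>2) + 4 / h / \<alpha> * (e\<^sup>2)\<^sup>2"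
    by (simp add: distrib_left)
  finally have "a ^ 4 * (4 / h * \<alpha> * S + 8 * h * (I + 9 / 4 * D / \<tau>\<^sup>2 * S)) + 4 / h / \<alpha> * (e\<^sup>2)\<^sup>2
    \<le> a ^ 4 * (4 / h * \<alpha> * b ^ 4) + 18 * (a ^ 4 * h * z\<^sup>2) + 4 / h / \<alpha> * (e\<^sup>2)\<^sup>2" .
  moreover have "a ^ 4 * (4 / h * \<alpha> * b ^ 4) = 4 * (a ^ 3 * b * z * e)"
    using a0 b e z by (simp add: h_def \<alpha>_def field_simps power2_eq_square power3_eq_cube power4_eq_xxxx)
  moreover have "a ^ 4 * h * z\<^sup>2 = a ^ 3 * b * z * e"
    using a0 b e z by (simp add: h_def field_simps power2_eq_square power3_eq_cube power4_eq_xxxx)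
  moreover have "4 / h / \<alpha> * (e\<^sup>2)\<^sup>2 = 4 * (a ^ 3 * b * z * e)"
    using a0 b e z by (simp add: h_def \<alpha>_def field_simps power2_eq_square power3_eq_cube power4_eq_xxxx)
  ultimately show "a ^ 4 * (4 / h * \<alpha> * S + 8 * h * (I + 9 / 4 * D / \<tau>\<^sup>2 * S)) + 4 / h / \<alpha> * (e\<^sup>2)\<^sup>2 \<le> 26 * (a ^ 3 * b * z * e)"
    by linarith
  have "b\<^sup>2 / \<tau> \<le> z"
  proof (rule power2_le_imp_le)
    show "(b\<^sup>2 / \<tau>)\<^sup>2 \<le> z\<^sup>2" using zb by (simp add: power_divide flip: power_mult)
  qed (use z in simp)
  then have zb': "b\<^sup>2 \<le> z * \<tau>" using \<tau> by (simp add: field_simps)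
  \<comment> \<open>The right-hand side is the lower bound for the squared noise level at \<tau>, so
    h is an admissible window. The key is b^2 / z^2 \<le> \<tau>, which follows from z \<ge> b^2 /
    \<tau> and \<tau> \<le> b^2.\<close>
  show "h\<^sup>2 \<le> 2 * \<tau> / 3" if e2: "e\<^sup>2 \<le> 2 / 3"
  proof -
    have bt: "\<tau> \<le> b\<^sup>2"
    proof (rule power2_le_imp_le)
      have "\<tau>\<^sup>2 \<le> \<tau>" using \<tau> by (simp add: power2_eq_square mult_left_le)
      then show "\<tau>\<^sup>2 \<le> (b\<^sup>2)\<^sup>2" using \<tau> by (simp flip: power_mult)
    qed simp
    have "b\<^sup>2 * b\<^sup>2 \<le> (z * \<tau>) * (z * \<tau>)" using zb' z \<tau> by (intro mult_mono) auto
    also have "\<dots> = z\<^sup>2 * (\<tau> * \<tau>)" by (simp add: power2_eq_square)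
    also have "\<dots> \<le> z\<^sup>2 * (\<tau> * b\<^sup>2)" using bt \<tau> by (intro mult_left_mono) auto
    finally have "b\<^sup>2 * b\<^sup>2 \<le> (z\<^sup>2 * \<tau>) * b\<^sup>2" by (simp only: mult.assoc)
    then have "b\<^sup>2 \<le> z\<^sup>2 * \<tau>" by (rule mult_right_le_imp_le) (use b in simp)
    then have bz: "b\<^sup>2 / z\<^sup>2 \<le> \<tau>" using z by (simp add: field_simps)
    have "e\<^sup>2 / a\<^sup>2 \<le> e\<^sup>2 / 1" using a by (intro divide_left_mono) (auto simp: one_le_power)
    then have "e\<^sup>2 / a\<^sup>2 \<le> e\<^sup>2" by simp
    from this e2 have "e\<^sup>2 / a\<^sup>2 \<le> 2 / 3" by (rule order_trans)
    from mult_mono[OF bz this] have "(b\<^sup>2 / z\<^sup>2) * (e\<^sup>2 / a\<^sup>2) \<le> \<tau> * (2 / 3)"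
      using \<tau> by simp
    then show ?thesis by (simp add: h_def power_divide power_mult_distrib mult.commute)
  qed
  \<comment> \<open>Multiplied by 26 this exceeds the trivial bound 2. It rests on b z \<ge> 1, from
    z \<ge> b^2 / \<tau> and b^3 \<ge> \<tau>.\<close>
  show "2 / 3 \<le> a ^ 3 * b * z * e" if e2: "2 / 3 \<le> e\<^sup>2"
  proof -
    have "2 / 3 \<le> e"
    proof (rule power2_le_imp_le)
      show "(2 / 3)\<^sup>2 \<le> e\<^sup>2" using e2 by (simp add: power2_eq_square)
    qed (use e in simp)
    have b3: "\<tau> \<le> b ^ 3"
    proof (cases "1 \<le> b")
      case True
      then show ?thesis using \<tau> one_le_power[of b 3] by linarith
    next
      case False
      then have "b ^ 4 \<le> b ^ 3" using b by (intro power_decreasing) auto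
      then show ?thesis using \<tau> by linarith
    qed
    have "b * b\<^sup>2 \<le> b * (z * \<tau>)" using zb' b by (intro mult_left_mono) auto
    then have "1 * \<tau> \<le> (b * z) * \<tau>" using b3 by (simp add: power3_eq_cube power2_eq_square algebra_simps)
    then have "1 \<le> b * z" using \<tau> by (simp only: mult_le_cancel_right_pos)
    moreover have "1 \<le> a ^ 3" using a by (rule one_le_power)
    ultimately have "1 * 1 \<le> a ^ 3 * (b * z)" using a0 by (intro mult_mono) auto
    from mult_mono[OF this \<open>2 / 3 \<le> e\<close>] have "1 * (2 / 3) \<le> (a ^ 3 * (b * z)) * e"
      using a0 b z by simp
    then show ?thesis by (simp add: mult.assoc)
  qed
qed

lemma ode_flow_indicator:
  assumes Y: "ode_flow d S s Y"
  shows "ode_flow d S (\<lambda>r x i. indicator {0..S} r * s r x i) Y"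
proof -
  have 1: "set_integrable lborel {0..S} (\<lambda>r. Y r x i + indicator {0..S} r * s r (Y r x) i)
      \<longleftrightarrow> set_integrable lborel {0..S} (\<lambda>r. Y r x i + s r (Y r x) i)" for x i
    by (intro set_integrable_cong) auto
  have 2: "(LINT r:{0..t}|lborel. Y r x i + indicator {0..S} r * s r (Y r x) i)
      = (LINT r:{0..t}|lborel. Y r x i + s r (Y r x) i)" if "t \<in> {0..S}" for t x i
    using that by (intro set_lebesgue_integral_cong) auto
  show ?thesis using Y unfolding ode_flow_def by (simp add: 1 2)
qed

text \<open>Both claims have a regime in which the right-hand side is below 2 or of that order and
  the estimates do the work, and one in which it exceeds 2 and nothing remains to be shown: \<delta>
  > 2/3 for the first, T < 1 for the second.\<close>

lemma TV_reverse_densities: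
  assumes d: "1 \<le> d" and \<tau>: "0 < \<tau>" "\<tau> \<le> 1" "\<tau> < T" and \<delta>: "0 < \<delta>"
    and \<mu>: "data_distribution d K \<mu>" and q: "forward_density d \<mu> q"
    and se: "score_error d (T - \<tau>) (\<lambda>t. q (T - t)) s \<le> ennreal (\<delta>\<^sup>2)"
    and s: "regular_score d (T - \<tau>) s L" and \<rho>': "approx_reverse_density d (T - \<tau>) s \<rho>'"
  shows "TV d (q \<tau>) (\<rho>' (T - \<tau>))
      \<le> 26 * real d powr (3/4) * T powr (1/4) *
          ((LINT t:{0..T - \<tau>}|lborel. L t) + T * \<tau> powi (-2) * (radius d K) ^ 3) powr (1/2) * \<delta> powr (1/2)
        + TV d (q T) (\<rho>' 0)" (is "_ \<le> ?R + _")
    and "density (leb d) (\<lambda>x. ennreal (\<rho>' 0 x)) = std_gaussian d \<Longrightarrow>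
      TV d (q T) (\<rho>' 0) \<le> 26 * exp (- T) * sqrt (real d) * radius d K"
proof -
  define s0 where "s0 r x i = indicator {0..T - \<tau>} r * s r x i" for r x i
  define s0' where "s0' r x i k = indicator {0..T - \<tau>} r * partial_deriv k (\<lambda>x. s r x i) x" for r x i k
  define L0 where "L0 r = indicator {0..T - \<tau>} r * L r" for r
  note D = data_distribution_bounded[OF \<mu> d]
  interpret bounded_data d \<mu> "radius d K" by (rule D(1))
  interpret reverse_flow d \<mu> "radius d K" s0 s0' L0 T \<tau>
    using regular_score_drift[OF s d] \<tau> D(2)
    unfolding s0_def [abs_def] s0'_def [abs_def] L0_def [abs_def]
    by (intro reverse_flow.intro bounded_data_axioms reverse_flow_axioms.intro)
  have T: "0 < T" using \<tau> by simp
  have q_mix: "q t x = mix t x" if "0 < t" "x \<in> Rd d" for t x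
    by (rule forward_density_eq_mix[OF q that])
  obtain Y where Y: "ode_flow d S s Y"
    and \<rho>0: "\<And>t x. t \<in> {0..S} \<Longrightarrow> x \<in> Rd d \<Longrightarrow> 0 \<le> \<rho>' t x"
    and dist: "\<And>t. t \<in> {0..S} \<Longrightarrow>
      distributed (density (leb d) (\<lambda>x. ennreal (\<rho>' 0 x))) (leb d) (Y t) (\<lambda>x. ennreal (\<rho>' t x))"
    and p0: "prob_space (density (leb d) (\<lambda>x. ennreal (\<rho>' 0 x)))"
    using \<rho>' unfolding approx_reverse_density_def by blast
  have S: "0 \<in> {0..S}" "S \<in> {0..S}" using \<tau> by auto
  \<comment> \<open>The notion of a distributed variable only provides measurability of the density
    as an extended real; nonnegativity on \<open>Rd d\<close> transfers it back.\<close>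
  have meas: "\<rho>' t \<in> borel_measurable (leb d)" if t: "t \<in> {0..S}" for t
  proof -
    have "(\<lambda>x. enn2real (ennreal (\<rho>' t x))) \<in> borel_measurable (leb d)"
      using dist[OF t] by (auto simp: distributed_def)
    also have "(\<lambda>x. enn2real (ennreal (\<rho>' t x))) \<in> borel_measurable (leb d) \<longleftrightarrow> \<rho>' t \<in> borel_measurable (leb d)"
      using \<rho>0[OF t] by (intro measurable_cong) simp
    finally show ?thesis .
  qed
  have YS: "Y S \<in> measurable (leb d) (leb d)"
    using dist[OF S(2)] by (simp add: distributed_def)
  have law: "distr (density (leb d) (\<lambda>x. ennreal (\<rho>' 0 x))) (leb d) (Y S) = density (leb d) (\<lambda>x. ennreal (\<rho>' S x))"
    using dist[OF S(2)] by (simp add: distributed_def)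
  have pS: "prob_space (density (leb d) (\<lambda>x. ennreal (\<rho>' S x)))"
    unfolding law[symmetric] by (rule prob_space.prob_space_distr[OF p0]) (use YS in simp)
  note i0 = prob_density_Rd[OF meas[OF S(1)] \<rho>0[OF S(1)] p0]
    and iS = prob_density_Rd[OF meas[OF S(2)] \<rho>0[OF S(2)] pS]
  have TVq: "TV d (q t) f = TV d (mix t) f" if "0 < t" for t f
    using q_mix[OF that] by (rule TV_cong)
  have TV2: "TV d (mix t) (\<rho>' r) \<le> 2" if "0 < t" "r \<in> {0..S}" "prob_space (density (leb d) (\<lambda>x. ennreal (\<rho>' r x)))" for t r
    using mix_density[OF that(1)] mix_nonneg prob_density_Rd[OF meas[OF that(2)] \<rho>0[OF that(2)] that(3)] \<rho>0[OF that(2)]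
    by (intro TV_le_2) auto
  have E: "(\<integral>\<^sup>+r\<in>{0..S}. (\<Sum>i<d. \<integral>\<^sup>+x. ennreal (sq_error i r x * mix (T - r) x) \<partial>leb d) \<partial>lborel) \<le> ennreal (\<delta>\<^sup>2)"
  proof -
    have "score_error d S (\<lambda>t. q (T - t)) s0 = score_error d S (\<lambda>t. q (T - t)) s"
      unfolding score_error_def s0_def by (intro nn_integral_cong) (auto simp: indicator_def)
    moreover have "score_error d S (\<lambda>t. q (T - t)) s0
        = (\<integral>\<^sup>+r\<in>{0..S}. (\<Sum>i<d. \<integral>\<^sup>+x. ennreal (sq_error i r x * mix (T - r) x) \<partial>leb d) \<partial>lborel)"
      using \<tau> by (intro score_error_eq q_mix) auto
    ultimately show ?thesis using se by simp
  qed
  define I where "I = (LINT t:{0..S}|lborel. L t)"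
  have I: "(\<integral>r. L0 r \<partial>lborel) = I" unfolding L0_def I_def set_lebesgue_integral_def by simp
  have I0: "0 \<le> I" unfolding I[symmetric] by (rule Bochner_Integration.integral_nonneg) (rule L_nonneg)
  define Z where "Z = I + T * \<tau> powi (-2) * (radius d K) ^ 3"
  have Z: "Z = I + T / \<tau>\<^sup>2 * (radius d K) ^ 3" by (simp add: Z_def power_int_minus divide_inverse)
  have Z0: "0 < Z" unfolding Z using I0 T \<tau> D1 by (intro add_nonneg_pos mult_pos_pos divide_pos_pos) auto
  \<comment> \<open>Naming the fractional powers turns the optimisation into identities between
    rational functions.\<close>
  define a b e z where "a = real d powr (1/4)" and "b = T powr (1/4)" and "e = \<delta> powr (1/2)" and "z = Z powr (1/2)"
  have root: "(x powr (1/4)) ^ 4 = x" "(x powr (1/2))\<^sup>2 = x" "(x powr (1/4)) ^ 3 = x powr (3/4)" if "0 < x" for x :: real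
    using that by (simp_all add: powr_powr flip: powr_numeral)
  have a4: "a ^ 4 = d" "a ^ 3 = d powr (3/4)" and b4: "b ^ 4 = T" and e2: "e\<^sup>2 = \<delta>" and z2: "z\<^sup>2 = Z"
    using d T \<delta> Z0 unfolding a_def b_def e_def z_def by (auto simp: root)
  have pos: "1 \<le> a" "0 < b" "0 < e" "0 < z"
    using d T \<delta> Z0 unfolding a_def b_def e_def z_def by (auto simp: ge_one_powr_ge_zero)
  have R: "?R = 26 * (a ^ 3 * b * z * e)"
    unfolding a4 b_def e_def z_def Z_def I_def by (simp add: mult.assoc)
  have S0: "0 \<le> S" "S \<le> b ^ 4" and \<tau>b: "\<tau> < b ^ 4" and Zz: "z\<^sup>2 = I + b ^ 4 / \<tau>\<^sup>2 * (radius d K) ^ 3"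
    using \<tau> Z by (auto simp: b4 z2)
  note wc = window_choice[OF pos \<tau>(1,2) \<tau>b D1 I0 Zz S0]
  show "TV d (q \<tau>) (\<rho>' (T - \<tau>)) \<le> ?R + TV d (q T) (\<rho>' 0)"
  proof (cases "e\<^sup>2 \<le> 2 / 3")
    case True
    define \<alpha> h where "\<alpha> = e\<^sup>2 / (a\<^sup>2 * b\<^sup>2)" and "h = b * e / (a * z)"
    have h: "0 < h" and \<alpha>: "0 < \<alpha>" using pos by (auto simp: h_def \<alpha>_def)
    have "h\<^sup>2 \<le> 2 * \<tau> / 3" using wc(2)[OF True] by (simp add: h_def)
    also have "\<dots> \<le> (sig \<tau>)\<^sup>2" using \<tau> by (intro sig_square_ge) auto
    finally have hs: "h \<le> sig \<tau>" by (rule power2_le_imp_le) (use sig_tau in simp)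
    have "(\<integral>\<^sup>+r\<in>{0<..S}. gap_bound h \<alpha> r \<partial>lborel)
      \<le> ennreal (a ^ 4 * (4 / h * \<alpha> * S + 8 * h * (I + 9 / 4 * radius d K / \<tau>\<^sup>2 * S)) + 4 / h / \<alpha> * (e\<^sup>2)\<^sup>2)"
      using gap_integral_le[OF h \<alpha> \<tau>(2) E] unfolding I a4 e2 .
    also have "\<dots> \<le> ennreal (26 * (a ^ 3 * b * z * e))"
      using wc(1) unfolding \<alpha>_def[symmetric] h_def[symmetric] by (rule ennreal_leI)
    finally have B: "(\<integral>\<^sup>+r\<in>{0<..S}. gap_bound h \<alpha> r \<partial>lborel) \<le> ennreal (26 * (a ^ 3 * b * z * e))" .
    have Y0: "ode_flow d S s0 Y" unfolding s0_def [abs_def] by (rule ode_flow_indicator[OF Y])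
    have "TV d (mix \<tau>) (\<rho>' S) \<le> 26 * (a ^ 3 * b * z * e) + TV d (mix T) (\<rho>' 0)"
      using pos
      by (intro TV_le_gap_integral[OF h hs \<alpha> Y0 YS meas[OF S(1)] \<rho>0[OF S(1)] meas[OF S(2)] \<rho>0[OF S(2)] p0 law B]) auto
    then show ?thesis unfolding R TVq[OF \<tau>(1)] TVq[OF T] .
  next
    \<comment> \<open>\<delta> > 2/3: the bound exceeds 2, whatever window would be chosen.\<close>
    case False
    then have "2 / 3 \<le> a ^ 3 * b * z * e" using wc(3) by simp
    then have "2 \<le> 26 * (a ^ 3 * b * z * e)" by linarith
    moreover have "0 \<le> TV d (mix T) (\<rho>' 0)"
      unfolding TV_def by (rule Bochner_Integration.integral_nonneg) simp
    ultimately show ?thesis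
      using TV2[OF \<tau>(1) S(2) pS] unfolding R TVq[OF \<tau>(1)] TVq[OF T] by linarith
  qed
  show "TV d (q T) (\<rho>' 0) \<le> 26 * exp (- T) * sqrt (real d) * radius d K"
    if g: "density (leb d) (\<lambda>x. ennreal (\<rho>' 0 x)) = std_gaussian d"
  proof (cases "1 \<le> T")
    case True
    have "AE x in leb d. ennreal (\<rho>' 0 x) = ennreal (gauss_kernel d 1 (\<lambda>_. 0) x)"
      using g meas[OF S(1)] unfolding std_gaussian_eq_density by (intro lebd.density_unique) auto
    with AE_space[of "leb d"] have "AE x in leb d. \<rho>' 0 x = gauss_kernel d 1 (\<lambda>_. 0) x"
      by eventually_elim (auto simp: \<rho>0[OF S(1)] gauss_kernel_nonneg)
    then have "TV d (mix T) (\<rho>' 0) = (\<integral>x. \<bar>mix T x - gauss_kernel d 1 (\<lambda>_. 0) x\<bar> \<partial>leb d)"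
      unfolding TV_def using meas[OF S(1)] by (intro integral_cong_AE) auto
    also have "\<dots> \<le> 2 * (sqrt d * exp (- T) * radius d K)" by (rule mix_TV[OF True D1 d])
    also have "\<dots> \<le> 26 * (sqrt d * exp (- T) * radius d K)" using D1 by (intro mult_right_mono) auto
    finally show ?thesis unfolding TVq[OF T] by (simp add: mult_ac)
  next
    \<comment> \<open>T < 1: exp (- T) is at least 1/3, so the right-hand side is at least
      26/3.\<close>
    case False
    have "exp (- 1) \<le> exp (- T)" using False by simp
    moreover have "1 / 3 \<le> exp (- 1 :: real)" using exp_le by (simp add: exp_minus field_simps)
    ultimately have "1 / 3 \<le> exp (- T)" by linarith
    moreover have "1 \<le> sqrt (real d)" using d by simp
    ultimately have m: "1 / 3 * 1 \<le> exp (- T) * sqrt (real d)" by (intro mult_mono) auto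
    have "1 / 3 * 1 * 1 \<le> exp (- T) * sqrt (real d) * radius d K" by (rule mult_mono[OF m D1]) simp_all
    then show ?thesis using TV2[OF T S(1) p0] unfolding TVq[OF T] by linarith
  qed
qed

theorem theorem3p5:
  "\<exists>C::real. C > 0 \<and>
     (\<forall>(d::nat) (T::real) (\<tau>::real) (\<delta>::real) (K::(nat \<Rightarrow> real) set) (\<mu>::(nat \<Rightarrow> real) measure)
       (q::real \<Rightarrow> (nat \<Rightarrow> real) \<Rightarrow> real) (\<rho>::real \<Rightarrow> (nat \<Rightarrow> real) \<Rightarrow> real)
       (\<rho>'::real \<Rightarrow> (nat \<Rightarrow> real) \<Rightarrow> real)
       (s::real \<Rightarrow> (nat \<Rightarrow> real) \<Rightarrow> nat \<Rightarrow> real) (L::real \<Rightarrow> real).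
       1 \<le> d \<longrightarrow> 0 < \<tau> \<longrightarrow> \<tau> \<le> 1 \<longrightarrow> \<tau> < T \<longrightarrow> 0 < \<delta> \<longrightarrow>
       data_distribution d K \<mu> \<longrightarrow>
       forward_density d \<mu> q \<longrightarrow>
       \<rho> = (\<lambda>t. q (T - t)) \<longrightarrow>
       score_error d (T - \<tau>) \<rho> s \<le> ennreal (\<delta>\<^sup>2) \<longrightarrow>
       regular_score d (T - \<tau>) s L \<longrightarrow>
       approx_reverse_density d (T - \<tau>) s \<rho>' \<longrightarrow>
       TV d (\<rho> (T - \<tau>)) (\<rho>' (T - \<tau>))
         \<le> C * real d powr (3/4) * T powr (1/4) *
             ((LINT t:{0..T - \<tau>}|lborel. L t) + T * \<tau> powi (-2) * (radius d K) ^ 3) powr (1/2) *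
             \<delta> powr (1/2)
           + TV d (\<rho> 0) (\<rho>' 0) \<and>
       (density (leb d) (\<lambda>x. ennreal (\<rho>' 0 x)) = std_gaussian d \<longrightarrow>
         TV d (\<rho> 0) (\<rho>' 0) \<le> C * exp (- T) * sqrt (real d) * radius d K))"
\<comment> \<open>26 is dictated by the balance of window and AM-GM weight. For the Gaussian
  initialisation 2 is enough if T \<ge> 1 and 6 if T < 1.\<close>
proof (intro exI[of _ 26] conjI allI impI)
  fix d T \<tau> \<delta> K \<mu> q \<rho> \<rho>' s L
  assume "1 \<le> d" "0 < \<tau>" "\<tau> \<le> 1" "\<tau> < T" "0 < \<delta>" "data_distribution d K \<mu>" "forward_density d \<mu> q"
    and \<rho>: "\<rho> = (\<lambda>t. q (T - t))"
    and "score_error d (T - \<tau>) \<rho> s \<le> ennreal (\<delta>\<^sup>2)" "regular_score d (T - \<tau>) s L"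
      "approx_reverse_density d (T - \<tau>) s \<rho>'"
  note TV_reverse_densities[OF this(1-7) this(9)[unfolded \<rho>] this(10,11)]
  then show "TV d (\<rho> (T - \<tau>)) (\<rho>' (T - \<tau>))
         \<le> 26 * real d powr (3/4) * T powr (1/4) *
             ((LINT t:{0..T - \<tau>}|lborel. L t) + T * \<tau> powi (-2) * (radius d K) ^ 3) powr (1/2) *
             \<delta> powr (1/2)
           + TV d (\<rho> 0) (\<rho>' 0)"
    "density (leb d) (\<lambda>x. ennreal (\<rho>' 0 x)) = std_gaussian d \<Longrightarrow>
         TV d (\<rho> 0) (\<rho>' 0) \<le> 26 * exp (- T) * sqrt (real d) * radius d K"
    unfolding \<rho> by simp_all
qed simp

end
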